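(* Let $L$ be an invertible 1-dimensional $\mathbb{K}$-rational lattice and let $x\in\mathbf{C}_\infty^*$ with $|x|_\infty>q$. Then the functional $$\varphi_{x,L}:\mathcal{A}(\mathcal{L}_{\mathbb{K},1})\to\mathbf{C}_\infty,\qquad \varphi_{x,L}(f)=Z(x)^{-1}\sum_{J\subset\mathbf{A}}f(J^{-1}L,J^{-1}L)\,J^{-x}$$ (sum over nonzero ideals $J$ of $\mathbf{A}$, with $Z(x)=\sum_{J\subset\mathbf{A}}J^{-x}$) is a KMS$_x$-functional for the time evolution $\sigma$.
   Context: $\mathbb{K}$ is the function field of a smooth projective geometrically connected curve over $\mathbb{F}_q$, $\infty$ a fixed place of degree $d_\infty$ with valuation $v_\infty$ and $|x|_\infty=q^{-d_\infty v_\infty(x)}$ (extended to $\mathbf{C}_\infty$), $\mathbf{A}\subset\mathbb{K}$ the ring of functions regular outside $\infty$, $\mathbf{C}_\infty$ the completion of an algebraic closure of $\mathbb{K}_\infty$, $\mathbb{A}_{\mathbb{K},f}$ the finite adeles, $R=\prod_{v\ne\infty}\mathbf{A}_v$. Exponentiation. $S_\infty=\mathbf{C}_\infty^*\times\mathbb{Z}_p$. Fix a uniformizer $u_\infty$ at $\infty$; every $\lambda\in\mathbb{K}_\infty^*$ is uniquely $\mathrm{sign}(\lambda)u_\infty^{v_\infty(\lambda)}\langle\lambda\rangle$ with $\mathrm{sign}(\lambda)\in\mathbb{F}_{q^{d_\infty}}^*$ and $\langle\lambda\rangle$ a 1-unit; $\lambda$ is positive if $\mathrm{sign}(\lambda)=1$.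 For a fractional ideal $I$ of $\mathbf{A}$ and $s=(x,y)\in S_\infty$, $I^s=x^{\deg I}\langle I\rangle^y$, where $\deg I=\log_q\#(\mathbf{A}/I)$ for integral $I$ (extended multiplicatively), $\langle\cdot\rangle$ is the unique extension to fractional ideals (with values in 1-units of $\mathbf{C}_\infty$) of $(a)\mapsto\langle a\rangle$ for $a$ positive, and $w^y=\sum_j\binom{y}{j}(w-1)^j$. In particular $I^x:=I^{(x,0)}=x^{\deg I}$ and $I^{-x}=(I^x)^{-1}$. Lattices. A 1-dimensional $\mathbb{K}$-rational lattice is $L=(\Lambda,\phi)$ with $\Lambda\subset\mathbb{K}$ a nonzero finitely generated $\mathbf{A}$-submodule (a fractional ideal) and $\phi:\mathbb{K}/\mathbf{A}\to\mathbb{K}/\Lambda$ an $\mathbf{A}$-homomorphism; it is invertible if $\phi$ is an isomorphism. Adelically $\Lambda=Rs^{-1}\cap\mathbb{K}$ and $\phi=\rho s^{-1}:\mathbb{K}/\mathbf{A}\cong\mathbb{A}_{\mathbb{K},f}/R\to\mathbb{A}_{\mathbb{K},f}/Rs^{-1}\cong\mathbb{K}/\Lambda$ with $s\in\mathbb{A}_{\mathbb{K},f}^*$, $\rho\in R$, $(s,\rho)$ unique up to $(sr,\rho r)$, $r\in R^*$. Isomorphism is scaling $kL=(k\Lambda,k\phi)$, $k\in\mathbb{K}^*$. $L\sim L'$ (commensurable) if $\rho s^{-1}=\rho's'^{-1}$ in $\mathbb{A}_{\mathbb{K},f}$ (for classes: up to $\mathbb{K}^*$). For a nonzero ideal $J=Ru\cap\mathbb{K}$,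 $u\in R\cap\mathbb{A}_{\mathbb{K},f}^*$, $J^{-1}L$ is the lattice with data $(su,\rho u)$; its underlying lattice is $J^{-1}\Lambda$. For $L$ invertible, $c(L)=\{L':L'\sim L\}=\{J^{-1}L\}_J$. Algebra. $\mathcal{A}(\mathcal{L}_{\mathbb{K},1})$ is the algebra of continuous compactly supported $\mathbf{C}_\infty$-valued functions $f(L,L')$ of pairs of commensurable lattices, with $f(kL,kL')=f(L,L')$ for $k\in\mathbb{K}^*$ (the set of such pairs modulo $\mathbb{K}^*$ carrying the quotient topology from the parameters $(s,\rho,u)$, $L\leftrightarrow(s,\rho)$, $L'\leftrightarrow(su,\rho u)$, $u\in\mathbb{A}_{\mathbb{K},f}^*$, $\rho,\rho u\in R$), with product $(f_1*f_2)(L,L')=\sum_{L''\sim L}f_1(L,L'')f_2(L'',L')$. It acts on functions on $c(L)$ by $(\pi_L(f)\xi)(L')=\sum_{L''\in c(L)}f(L',L'')\xi(L'')$, and is topologized by the operator norm $\|f\|_{\pi_L}=\sup_{\xi\ne0}\|\pi_L(f)\xi\|/\|\xi\|$, with $\|\xi\|=\sup_{L'\in c(L)}|\xi(L')|$. The time evolution (extended to $S_\infty$) is $(\sigma_sf)(L,L')=\frac{I^s}{J^s}f(L,L')$, where $I=\Lambda$, $J=\Lambda'$ are the fractional ideals underlying $L$, $L'$. A KMS functional at inverse temperature $x\in\mathbf{C}_\infty^*$ (KMS$_x$-functional) is a continuous linear functional $\varphi$ with $\varphi(f_1*\sigma_x(f_2))=\varphi(f_2*f_1)$ for all $f_1,f_2$,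 where $\sigma_x=\sigma_{(x,0)}$, normalized by $\varphi(1)=1$ (unital algebra; in the non-unital case $\|\varphi\|=1$). *)

theory Defs
  imports
    "HOL-Analysis.Analysis"
    "HOL-Algebra.QuotRing"
    "HOL-Computational_Algebra.Polynomial"
    "HOL-Library.Set_Algebras"
begin

section \<open>Places and completions of a field\<close>

type_synonym 'k place = "'k \<Rightarrow> int"
type_synonym 'k adele = "'k place \<Rightarrow> (nat \<Rightarrow> 'k) set"
type_synonym 'k rlattice = "'k set \<times> ('k set \<Rightarrow> 'k set)"

definition cosets :: "'a::plus set \<Rightarrow> 'a set \<Rightarrow> 'a set set" where
  "cosets G H = (\<lambda>g. g +o H) ` G"

text \<open>\<open>v(a) \<ge> n\<close>, where \<open>v(0) = \<infinity>\<close>. A valuation is an integer-valued function whose value at \<open>0\<close>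
  is the dummy \<open>0\<close>; the value at \<open>0\<close> is never used otherwise.\<close>
definition val_ge :: "'k::field place \<Rightarrow> int \<Rightarrow> 'k \<Rightarrow> bool" where
  "val_ge v n a \<longleftrightarrow> a = 0 \<or> n \<le> v a"

definition cauchy_ring :: "'k::field place \<Rightarrow> (nat \<Rightarrow> 'k) ring" where
  "cauchy_ring v =
    \<lparr>carrier = {f. \<forall>n. \<exists>N. \<forall>i\<ge>N. \<forall>j\<ge>N. val_ge v n (f i - f j)},
     mult = (\<lambda>f g i. f i * g i), one = (\<lambda>_. 1),
     zero = (\<lambda>_. 0), add = (\<lambda>f g i. f i + g i)\<rparr>"

definition null_seqs :: "'k::field place \<Rightarrow> (nat \<Rightarrow> 'k) set" where
  "null_seqs v = {f. \<forall>n. \<exists>N. \<forall>i\<ge>N. val_ge v n (f i)}"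

definition completion :: "'k::field place \<Rightarrow> (nat \<Rightarrow> 'k) set ring" where
  "completion v = cauchy_ring v Quot null_seqs v"

text \<open>\<open>{x \<in> K\<^sub>v. v(x) \<ge> n}\<close>; for \<open>n = 0\<close> this is the valuation ring of the completion.\<close>
definition completion_ball :: "'k::field place \<Rightarrow> int \<Rightarrow> (nat \<Rightarrow> 'k) set set" where
  "completion_ball v n = {X \<in> carrier (completion v). \<exists>f\<in>X. \<forall>i. val_ge v n (f i)}"

section \<open>Global function fields with a fixed place at infinity\<close>

text \<open>\<open>Fq\<close> is the field of constants; it is algebraically closed in \<open>K\<close> because the curve is
  geometrically connected. The closed points of the curve are the normalized discrete
  valuations of \<open>K\<close> that are trivial on \<open>Fq\<close>.\<close>

definition is_place :: "'k::field set \<Rightarrow> 'k place \<Rightarrow> bool" where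
  "is_place Fq v \<longleftrightarrow>
     v 0 = 0 \<and>
     (\<forall>a b. a \<noteq> 0 \<longrightarrow> b \<noteq> 0 \<longrightarrow> v (a * b) = v a + v b) \<and>
     (\<forall>a b. a \<noteq> 0 \<longrightarrow> b \<noteq> 0 \<longrightarrow> a + b \<noteq> 0 \<longrightarrow> min (v a) (v b) \<le> v (a + b)) \<and>
     v ` (- {0}) = UNIV \<and>
     (\<forall>c\<in>Fq. v c = 0)"

definition polys_over :: "'a::comm_semiring_0 set \<Rightarrow> 'a poly set" where
  "polys_over F = {P. \<forall>i. coeff P i \<in> F}"

definition algebraic_over :: "'a::comm_semiring_0 set \<Rightarrow> 'a \<Rightarrow> bool" where
  "algebraic_over F a \<longleftrightarrow> (\<exists>P\<in>polys_over F. P \<noteq> 0 \<and> poly P a = 0)"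

definition simple_ext :: "'k::field set \<Rightarrow> 'k \<Rightarrow> 'k set" where
  "simple_ext F t = {poly P t / poly Q t | P Q. P \<in> polys_over F \<and> Q \<in> polys_over F \<and> poly Q t \<noteq> 0}"

locale global_function_field =
  fixes Fq :: "'k::field set"
    and vinf :: "'k place"
  assumes Fq_finite: "finite Fq"
    and Fq_subfield: "0 \<in> Fq" "1 \<in> Fq"
      "\<And>a b. a \<in> Fq \<Longrightarrow> b \<in> Fq \<Longrightarrow> a - b \<in> Fq"
      "\<And>a b. a \<in> Fq \<Longrightarrow> b \<in> Fq \<Longrightarrow> a * b \<in> Fq"
      "\<And>a. a \<in> Fq \<Longrightarrow> inverse a \<in> Fq"
    and Fq_alg_closed: "\<And>a. algebraic_over Fq a \<Longrightarrow> a \<in> Fq"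
    and function_field: "\<exists>t B. \<not> algebraic_over Fq t \<and> finite B \<and>
      (\<forall>a. \<exists>c. (\<forall>b\<in>B. c b \<in> simple_ext Fq t) \<and> a = (\<Sum>b\<in>B. c b * b))"
    and vinf_place: "is_place Fq vinf"
begin

definition q :: nat where "q = card Fq"

definition fin_places :: "'k place set" where
  "fin_places = {v. is_place Fq v \<and> v \<noteq> vinf}"

definition A :: "'k set" where
  "A = {a. \<forall>v\<in>fin_places. val_ge v 0 a}"

text \<open>The logarithm of the cardinality of a finite \<open>Fq\<close>-vector space; the floor is exact there.\<close>
definition logq :: "nat \<Rightarrow> nat" where
  "logq N = nat \<lfloor>log (real q) (real N)\<rfloor>"

definition d_inf :: nat where
  "d_inf = logq (card (cosets {a. val_ge vinf 0 a} {a. val_ge vinf 1 a}))"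

definition nonzero_ideals :: "'k set set" where
  "nonzero_ideals = {J. J \<subseteq> A \<and> J \<noteq> {0} \<and> 0 \<in> J \<and>
     (\<forall>a\<in>J. \<forall>b\<in>J. a + b \<in> J) \<and> (\<forall>c\<in>A. \<forall>a\<in>J. c * a \<in> J)}"

definition frac_ideals :: "'k set set" where
  "frac_ideals = {M. M \<noteq> {0} \<and>
     (\<exists>S. finite S \<and> M = {\<Sum>s\<in>S. c s * s | c. \<forall>s\<in>S. c s \<in> A})}"

definition ideal_mult :: "'k set \<Rightarrow> 'k set \<Rightarrow> 'k set" where
  "ideal_mult M N = {\<Sum>i<n. a i * b i | (n::nat) a b. \<forall>i<n. a i \<in> M \<and> b i \<in> N}"

definition deg_integral :: "'k set \<Rightarrow> nat" where
  "deg_integral J = logq (card (cosets A J))"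

definition deg :: "'k set \<Rightarrow> int" where
  "deg M = (THE d. \<forall>I\<in>nonzero_ideals. \<forall>J\<in>nonzero_ideals.
     ideal_mult M J = I \<longrightarrow> d = int (deg_integral I) - int (deg_integral J))"

definition adeles :: "'k adele ring" where
  "adeles =
    \<lparr>carrier = {a \<in> (\<Pi>\<^sub>E v\<in>fin_places. carrier (completion v)).
        finite {v \<in> fin_places. a v \<notin> completion_ball v 0}},
     mult = (\<lambda>a b. \<lambda>v\<in>fin_places. a v \<otimes>\<^bsub>completion v\<^esub> b v),
     one = (\<lambda>v\<in>fin_places. \<one>\<^bsub>completion v\<^esub>),
     zero = (\<lambda>v\<in>fin_places. \<zero>\<^bsub>completion v\<^esub>),
     add = (\<lambda>a b. \<lambda>v\<in>fin_places. a v \<oplus>\<^bsub>completion v\<^esub> b v)\<rparr>"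

definition R :: "'k adele set" where
  "R = {a \<in> carrier adeles. \<forall>v\<in>fin_places. a v \<in> completion_ball v 0}"

abbreviation ideles :: "'k adele set" where
  "ideles \<equiv> Units adeles"

definition diag :: "'k \<Rightarrow> 'k adele" where
  "diag a = (\<lambda>v\<in>fin_places. null_seqs v +>\<^bsub>cauchy_ring v\<^esub> (\<lambda>_. a))"

definition adele_top :: "'k adele topology" where
  "adele_top = topology (\<lambda>U. U \<subseteq> carrier adeles \<and>
     (\<forall>a\<in>U. \<exists>N :: 'k place \<Rightarrow> nat. finite {v \<in> fin_places. N v \<noteq> 0} \<and>
        {b \<in> carrier adeles. \<forall>v\<in>fin_places.
           b v \<ominus>\<^bsub>completion v\<^esub> a v \<in> completion_ball v (int (N v))} \<subseteq> U))"

text \<open>The topology on the unit group is induced by \<open>u \<mapsto> (u, u\<^sup>-\<^sup>1)\<close>.\<close>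
definition idele_top :: "'k adele topology" where
  "idele_top = pullback_topology ideles (\<lambda>u. (u, inv\<^bsub>adeles\<^esub> u)) (prod_topology adele_top adele_top)"

text \<open>A lattice is a pair \<open>(\<Lambda>, \<phi>)\<close>; elements of \<open>K/A\<close> and \<open>K/\<Lambda>\<close> are cosets in \<open>K\<close>. In \<open>K/\<Lambda>\<close>,
  \<open>c *o X + \<Lambda>\<close> is the product of the scalar \<open>c \<in> A\<close> with the coset \<open>X\<close>.\<close>

definition rational_lattice :: "'k rlattice \<Rightarrow> bool" where
  "rational_lattice L \<longleftrightarrow> (case L of (\<Lambda>, \<phi>) \<Rightarrow>
     \<Lambda> \<in> frac_ideals \<and>
     \<phi> \<in> cosets UNIV A \<rightarrow>\<^sub>E cosets UNIV \<Lambda> \<and>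
     (\<forall>a b. \<phi> ((a + b) +o A) = \<phi> (a +o A) + \<phi> (b +o A)) \<and>
     (\<forall>c\<in>A. \<forall>a. \<phi> ((c * a) +o A) = c *o \<phi> (a +o A) + \<Lambda>))"

definition invertible_lattice :: "'k rlattice \<Rightarrow> bool" where
  "invertible_lattice L \<longleftrightarrow> rational_lattice L \<and>
     bij_betw (snd L) (cosets UNIV A) (cosets UNIV (fst L))"

definition scale :: "'k \<Rightarrow> 'k rlattice \<Rightarrow> 'k rlattice" where
  "scale k L = (k *o fst L, \<lambda>X\<in>cosets UNIV A. k *o snd L X)"

definition R_over :: "'k adele \<Rightarrow> 'k adele set" where
  "R_over s = (\<lambda>r. r \<otimes>\<^bsub>adeles\<^esub> inv\<^bsub>adeles\<^esub> s) ` R"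

text \<open>The lattice with adelic data \<open>(s, \<rho>)\<close>: the diagonal embedding induces the identifications of
  \<open>K/A\<close> with the quotient of the adeles by \<open>R\<close> and of \<open>K/\<Lambda>\<close> with their quotient by \<open>R s\<^sup>-\<^sup>1\<close>,
  and \<open>\<phi>\<close> is multiplication by \<open>\<rho> s\<^sup>-\<^sup>1\<close>.\<close>
definition adelic_lattice :: "'k adele \<Rightarrow> 'k adele \<Rightarrow> 'k rlattice" where
  "adelic_lattice s \<rho> =
    ({a. diag a \<in> R_over s},
     \<lambda>X\<in>cosets UNIV A. {b. \<exists>a\<in>X.
        diag b \<ominus>\<^bsub>adeles\<^esub> (\<rho> \<otimes>\<^bsub>adeles\<^esub> inv\<^bsub>adeles\<^esub> s \<otimes>\<^bsub>adeles\<^esub> diag a) \<in> R_over s})"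

definition commensurable :: "'k rlattice \<Rightarrow> 'k rlattice \<Rightarrow> bool" where
  "commensurable L L' \<longleftrightarrow> rational_lattice L \<and> rational_lattice L' \<and>
     (\<exists>s\<in>ideles. \<exists>s'\<in>ideles. \<exists>\<rho>\<in>R. \<exists>\<rho>'\<in>R.
        L = adelic_lattice s \<rho> \<and> L' = adelic_lattice s' \<rho>' \<and>
        \<rho> \<otimes>\<^bsub>adeles\<^esub> inv\<^bsub>adeles\<^esub> s = \<rho>' \<otimes>\<^bsub>adeles\<^esub> inv\<^bsub>adeles\<^esub> s')"

definition comm_class :: "'k rlattice \<Rightarrow> 'k rlattice set" where
  "comm_class L = {L'. commensurable L' L}"

definition ideal_inv_act :: "'k set \<Rightarrow> 'k rlattice \<Rightarrow> 'k rlattice" where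
  "ideal_inv_act J L = (THE M. \<exists>s\<in>ideles. \<exists>\<rho>\<in>R. \<exists>u\<in>R \<inter> ideles.
     L = adelic_lattice s \<rho> \<and>
     J = {a. diag a \<in> (\<lambda>r. r \<otimes>\<^bsub>adeles\<^esub> u) ` R} \<and>
     M = adelic_lattice (s \<otimes>\<^bsub>adeles\<^esub> u) (\<rho> \<otimes>\<^bsub>adeles\<^esub> u))"

definition pair_class :: "'k rlattice \<Rightarrow> 'k rlattice \<Rightarrow> ('k rlattice \<times> 'k rlattice) set" where
  "pair_class L L' = {(scale k L, scale k L') | k. k \<noteq> 0}"

definition param_top :: "('k adele \<times> 'k adele \<times> 'k adele) topology" where
  "param_top = subtopology (prod_topology idele_top (prod_topology adele_top idele_top))
     {(s, \<rho>, u). s \<in> ideles \<and> \<rho> \<in> R \<and> u \<in> ideles \<and> \<rho> \<otimes>\<^bsub>adeles\<^esub> u \<in> R}"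

definition param_class :: "'k adele \<times> 'k adele \<times> 'k adele \<Rightarrow> ('k rlattice \<times> 'k rlattice) set" where
  "param_class = (\<lambda>(s, \<rho>, u). pair_class (adelic_lattice s \<rho>)
     (adelic_lattice (s \<otimes>\<^bsub>adeles\<^esub> u) (\<rho> \<otimes>\<^bsub>adeles\<^esub> u)))"

definition pair_space :: "('k rlattice \<times> 'k rlattice) set topology" where
  "pair_space = topology (\<lambda>U. U \<subseteq> param_class ` topspace param_top \<and>
     openin param_top {p \<in> topspace param_top. param_class p \<in> U})"

end

section \<open>The field \<open>C\<^sub>\<infinity>\<close>, exponentiation and the dynamical system\<close>

text \<open>The absolute value on \<open>C\<^sub>\<infinity>\<close> is the distance to \<open>0\<close>.\<close>
definition absC :: "'c::{zero, metric_space} \<Rightarrow> real" where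
  "absC z = dist z 0"

text \<open>The type \<open>'c\<close> is the completion of an algebraic closure of the completion of \<open>K\<close> at infinity.
  The topological sort constraints besides \<open>complete_space\<close> hold automatically for a field with an
  absolute value; they only make the library of infinite sums applicable.
  \<open>\<iota>\<close> is the embedding of \<open>K\<close>, and \<open>uinf\<close> the fixed uniformizer.\<close>
locale drinfeld_setting = global_function_field Fq vinf
  for Fq :: "'k::field set" and vinf :: "'k place" +
  fixes \<iota> :: "'k \<Rightarrow> 'c::{field, complete_space, topological_ab_group_add,
      uniform_topological_group_add, topological_semigroup_mult}"
    and uinf :: 'c
  assumes dist_absC: "\<And>a b :: 'c. dist a b = absC (a - b)"
    and absC_mult: "\<And>a b :: 'c. absC (a * b) = absC a * absC b"
    and absC_add: "\<And>a b :: 'c. absC (a + b) \<le> max (absC a) (absC b)"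
    and \<iota>_hom: "\<iota> 1 = 1" "\<And>a b. \<iota> (a + b) = \<iota> a + \<iota> b" "\<And>a b. \<iota> (a * b) = \<iota> a * \<iota> b"
    and absC_\<iota>: "\<And>a. a \<noteq> 0 \<Longrightarrow> absC (\<iota> a) = real q powi (- (int d_inf * vinf a))"
    and alg_closure: "\<And>P. P \<in> polys_over {z. algebraic_over (closure (range \<iota>)) z} \<Longrightarrow> degree P > 0
        \<Longrightarrow> \<exists>z. algebraic_over (closure (range \<iota>)) z \<and> poly P z = 0"
    and alg_closure_dense: "closure {z. algebraic_over (closure (range \<iota>)) z} = UNIV"
    and uinf: "uinf \<in> closure (range \<iota>)" "absC uinf = real q powi (- int d_inf)"
begin

definition Kinf :: "'c set" where "Kinf = closure (range \<iota>)"

definition v_Kinf :: "'c \<Rightarrow> int" where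
  "v_Kinf z = (THE n. absC z = real q powi (- (int d_inf * n)))"

definition one_units :: "'c set" where
  "one_units = {z. absC (z - 1) < 1}"

text \<open>The nonzero elements of the residue field at infinity are the roots of unity \<open>\<zeta>\<close> with
  \<open>\<zeta>\<^bsup>N\<^esup> = 1\<close>, where \<open>N + 1\<close> is the cardinality of the residue field.\<close>
definition sign :: "'c \<Rightarrow> 'c" where
  "sign z = (THE \<zeta>. \<zeta> \<in> Kinf \<and> \<zeta> ^ (q ^ d_inf - 1) = 1 \<and>
     z / (\<zeta> * uinf powi v_Kinf z) \<in> one_units)"

definition one_unit_part :: "'c \<Rightarrow> 'c" where
  "one_unit_part z = z / (sign z * uinf powi v_Kinf z)"

definition ideal_one_unit :: "'k set \<Rightarrow> 'c" where
  "ideal_one_unit = (THE g. g \<in> frac_ideals \<rightarrow>\<^sub>E one_units \<and>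
     (\<forall>M\<in>frac_ideals. \<forall>N\<in>frac_ideals. g (ideal_mult M N) = g M * g N) \<and>
     (\<forall>a. a \<noteq> 0 \<longrightarrow> sign (\<iota> a) = 1 \<longrightarrow> g (a *o A) = one_unit_part (\<iota> a)))"

text \<open>A \<open>p\<close>-adic integer \<open>y\<close> is the sequence of its residues \<open>y mod p\<^sup>n \<in> {0..<p\<^sup>n}\<close>.\<close>
definition Zp :: "(nat \<Rightarrow> nat) set" where
  "Zp = {y. \<forall>n. y n < CHAR('k) ^ n \<and> y (Suc n) mod CHAR('k) ^ n = y n}"

definition S_inf :: "('c \<times> (nat \<Rightarrow> nat)) set" where
  "S_inf = (- {0}) \<times> Zp"

text \<open>As \<open>j < p\<^sup>j\<close>, the class of the binomial coefficient of \<open>y\<close> and \<open>j\<close> modulo \<open>p\<close> depends only on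
  \<open>y mod p\<^sup>j\<close>.\<close>
definition one_unit_pow :: "'c \<Rightarrow> (nat \<Rightarrow> nat) \<Rightarrow> 'c" where
  "one_unit_pow w y = (\<Sum>j. of_nat (y j choose j) * (w - 1) ^ j)"

definition ideal_pow :: "'k set \<Rightarrow> 'c \<times> (nat \<Rightarrow> nat) \<Rightarrow> 'c" where
  "ideal_pow I s = fst s powi deg I * one_unit_pow (ideal_one_unit I) (snd s)"

definition exponent :: "'c \<Rightarrow> 'c \<times> (nat \<Rightarrow> nat)" where
  "exponent x = (x, \<lambda>_. 0)"

text \<open>\<open>on_classes f\<close> is the function induced by \<open>f\<close> on pairs modulo scaling; it is well defined for
  scaling-invariant \<open>f\<close>. Functions on commensurable pairs are extended by \<open>0\<close> to all pairs.\<close>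

definition on_classes :: "('k rlattice \<Rightarrow> 'k rlattice \<Rightarrow> 'c) \<Rightarrow> ('k rlattice \<times> 'k rlattice) set \<Rightarrow> 'c" where
  "on_classes f P = (let (L, L') = (SOME p. p \<in> P) in f L L')"

definition alg :: "('k rlattice \<Rightarrow> 'k rlattice \<Rightarrow> 'c) set" where
  "alg = {f.
     (\<forall>L L'. \<not> commensurable L L' \<longrightarrow> f L L' = 0) \<and>
     (\<forall>L L' k. commensurable L L' \<longrightarrow> k \<noteq> 0 \<longrightarrow> f (scale k L) (scale k L') = f L L') \<and>
     continuous_map pair_space euclidean (on_classes f) \<and>
     compactin pair_space (pair_space closure_of {P \<in> topspace pair_space. on_classes f P \<noteq> 0})}"

definition conv :: "('k rlattice \<Rightarrow> 'k rlattice \<Rightarrow> 'c) \<Rightarrow> ('k rlattice \<Rightarrow> 'k rlattice \<Rightarrow> 'c)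
    \<Rightarrow> 'k rlattice \<Rightarrow> 'k rlattice \<Rightarrow> 'c" where
  "conv f1 f2 = (\<lambda>L L'. \<Sum>\<^sub>\<infinity>L''\<in>comm_class L. f1 L L'' * f2 L'' L')"

definition sigma :: "'c \<times> (nat \<Rightarrow> nat) \<Rightarrow> ('k rlattice \<Rightarrow> 'k rlattice \<Rightarrow> 'c)
    \<Rightarrow> 'k rlattice \<Rightarrow> 'k rlattice \<Rightarrow> 'c" where
  "sigma s f = (\<lambda>L L'. ideal_pow (fst L) s / ideal_pow (fst L') s * f L L')"

definition rep :: "('k rlattice \<Rightarrow> 'k rlattice \<Rightarrow> 'c) \<Rightarrow> 'k rlattice \<Rightarrow> ('k rlattice \<Rightarrow> 'c)
    \<Rightarrow> 'k rlattice \<Rightarrow> 'c" where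
  "rep f L \<xi> = (\<lambda>L'. \<Sum>\<^sub>\<infinity>L''\<in>comm_class L. f L' L'' * \<xi> L'')"

definition sup_norm :: "'k rlattice \<Rightarrow> ('k rlattice \<Rightarrow> 'c) \<Rightarrow> real" where
  "sup_norm L \<xi> = (SUP L'\<in>comm_class L. absC (\<xi> L'))"

definition op_norm :: "'k rlattice \<Rightarrow> ('k rlattice \<Rightarrow> 'k rlattice \<Rightarrow> 'c) \<Rightarrow> real" where
  "op_norm L f = (SUP \<xi>\<in>{\<xi>. bdd_above ((\<lambda>L'. absC (\<xi> L')) ` comm_class L) \<and>
       (\<exists>L'\<in>comm_class L. \<xi> L' \<noteq> 0)}. sup_norm L (rep f L \<xi>) / sup_norm L \<xi>)"

definition alg_unit :: "('k rlattice \<Rightarrow> 'k rlattice \<Rightarrow> 'c) \<Rightarrow> bool" where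
  "alg_unit e \<longleftrightarrow> e \<in> alg \<and> (\<forall>f\<in>alg. conv e f = f \<and> conv f e = f)"

text \<open>Continuity refers to the norm \<open>op_norm L\<close>. The last conjunct is the normalization: the value at
  the unit is \<open>1\<close> if the algebra is unital, and the functional has norm \<open>1\<close> otherwise.\<close>
definition KMS_functional ::
  "'k rlattice \<Rightarrow> 'c \<Rightarrow> (('k rlattice \<Rightarrow> 'k rlattice \<Rightarrow> 'c) \<Rightarrow> 'c) \<Rightarrow> bool" where
  "KMS_functional L x \<phi> \<longleftrightarrow>
     (\<forall>f\<in>alg. \<forall>g\<in>alg. \<phi> (\<lambda>M M'. f M M' + g M M') = \<phi> f + \<phi> g) \<and>
     (\<forall>f\<in>alg. \<forall>c. \<phi> (\<lambda>M M'. c * f M M') = c * \<phi> f) \<and>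
     (\<forall>f\<in>alg. \<forall>\<epsilon>>0. \<exists>\<delta>>0. \<forall>g\<in>alg.
        op_norm L (\<lambda>M M'. g M M' - f M M') < \<delta> \<longrightarrow> absC (\<phi> g - \<phi> f) < \<epsilon>) \<and>
     (\<forall>f1\<in>alg. \<forall>f2\<in>alg. \<phi> (conv f1 (sigma (exponent x) f2)) = \<phi> (conv f2 f1)) \<and>
     (if \<exists>e. alg_unit e then \<forall>e. alg_unit e \<longrightarrow> \<phi> e = 1
      else (SUP f\<in>alg - {\<lambda>_ _. 0}. absC (\<phi> f) / op_norm L f) = 1)"

definition zeta :: "'c \<Rightarrow> 'c" where
  "zeta x = (\<Sum>\<^sub>\<infinity>J\<in>nonzero_ideals. inverse (ideal_pow J (exponent x)))"

definition phi_functional :: "'c \<Rightarrow> 'k rlattice \<Rightarrow> ('k rlattice \<Rightarrow> 'k rlattice \<Rightarrow> 'c) \<Rightarrow> 'c" where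
  "phi_functional x L f = inverse (zeta x) *
     (\<Sum>\<^sub>\<infinity>J\<in>nonzero_ideals.
        f (ideal_inv_act J L) (ideal_inv_act J L) * inverse (ideal_pow J (exponent x)))"

end

end

theory Submission
  imports Defs
begin

text \<open>A rational lattice is given by a divisor \<open>D\<close>, for which \<open>\<Lambda> = {a. ord a \<ge> D}\<close>, and an adele
  \<open>y\<close> with \<open>ord y \<ge> D\<close>, by which \<open>\<phi>\<close> multiplies. The pair \<open>(D, y)\<close> is unique, and commensurable
  lattices have the same \<open>y\<close>. For an invertible lattice \<open>ord y = D\<close>, hence the lattices commensurable
  to \<open>L\<close> are the \<open>J\<^sup>-\<^sup>1L\<close>, without repetition. Only finitely many ideals have a given degree,
  so \<open>J\<^sup>-\<^sup>x\<close> tends to \<open>0\<close>, and sums of bounded multiples of \<open>J\<^sup>-\<^sup>x\<close> converge in the complete non-archimedean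
  field. The term of \<open>J = A\<close> is \<open>1\<close> and dominates the others, so \<open>Z(x)\<close> has absolute value \<open>1\<close>.
  An element \<open>f\<close> of the algebra has compact support modulo scaling; hence it is bounded, and for
  given \<open>J\<close> there are only finitely many \<open>J'\<close> with \<open>f(J\<^sup>-\<^sup>1L, J'\<^sup>-\<^sup>1L) \<noteq> 0\<close>. The time evolution replaces
  the weight \<open>J\<^sup>-\<^sup>x\<close> by \<open>J'\<^sup>-\<^sup>x\<close>, so the KMS condition is the interchange of two sums. The functional is
  bounded by the operator norm because that norm bounds the diagonal matrix coefficients, and the
  indicator function of diagonal pairs shows that its norm is \<open>1\<close>.

  The adelic description rests on strong approximation and on the finiteness of residue fields. Both
  come from counting expansions \<open>\<Sum>i<N. x\<^sup>i y\<^sub>i\<close>: they are pairwise distinct if the digits \<open>y\<^sub>i\<close> represent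
  different classes modulo \<open>x\<close>, but they lie in a finite set whose size is exponential in \<open>N\<close>.\<close>

section \<open>Indices of additive subgroups\<close>

text \<open>The function field is given only by a finite generating set over \<open>Fq(t)\<close>,
  and places are bare integer-valued maps; degrees, product formula and factorization of ideals are
  all extracted from indices. Upper bounds are cheap, since a unit step of a divisor embeds into one
  residue field. Lower bounds hold up to a constant factor, which disappears when the exponent
  \<open>N\<close> grows. Strong approximation is then a squeeze: along a chain from
  \<open>A\<close> to a principal ideal the local upper bounds multiply to exactly the index of that
  ideal, so each of them is attained. The valuation rings found by Zorn's lemma are discrete by an
  index count as well. Whether the algebra has a unit is left open, and both normalizations are
  proved. The test element is the indicator of the diagonal pairs whose underlying ideals lie in one
  fixed ideal class: after scaling, these pairs share a single \<open>s\<close>, with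
  \<open>u = 1\<close> and \<open>\<rho>\<close> in the compact ring \<open>R\<close>, so the
  support is compact.\<close>

definition add_subgroup :: "'a::ab_group_add set \<Rightarrow> bool" where
  "add_subgroup G \<longleftrightarrow> 0 \<in> G \<and> (\<forall>a\<in>G. \<forall>b\<in>G. a - b \<in> G)"

lemma add_subgroupD:
  assumes "add_subgroup G"
  shows "0 \<in> G" "a \<in> G \<Longrightarrow> b \<in> G \<Longrightarrow> a - b \<in> G" "a \<in> G \<Longrightarrow> - a \<in> G" "a \<in> G \<Longrightarrow> b \<in> G \<Longrightarrow> a + b \<in> G"
proof -
  show z: "0 \<in> G" and d: "\<And>a b. a \<in> G \<Longrightarrow> b \<in> G \<Longrightarrow> a - b \<in> G"
    using assms by (auto simp: add_subgroup_def)
  show m: "- a \<in> G" if "a \<in> G" for a using d[OF z that] by simp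
  show "a + b \<in> G" if "a \<in> G" "b \<in> G" for a b using d[OF that(1) m[OF that(2)]] by simp
qed

lemma add_subgroup_sum:
  assumes "add_subgroup G" "\<And>i. i \<in> S \<Longrightarrow> f i \<in> G"
  shows "sum f S \<in> G"
  using assms(2) by (induction S rule: infinite_finite_induct) (auto intro: add_subgroupD[OF assms(1)])

lemma add_subgroup_Int: "add_subgroup G \<Longrightarrow> add_subgroup H \<Longrightarrow> add_subgroup (G \<inter> H)"
  by (auto simp: add_subgroup_def)

lemma coset_eq_iff:
  assumes "add_subgroup H"
  shows "a +o H = b +o H \<longleftrightarrow> a - b \<in> H"
proof
  assume "a +o H = b +o H"
  moreover have "a \<in> a +o H" using add_subgroupD(1)[OF assms] by (force simp: elt_set_plus_def)
  ultimately obtain h where "h \<in> H" "a = b + h" by (auto simp: elt_set_plus_def)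
  then show "a - b \<in> H" by simp
next
  have *: "a +o H \<subseteq> b +o H" if "a - b \<in> H" for a b :: 'a
  proof
    fix x assume "x \<in> a +o H"
    then obtain h where "h \<in> H" "x = a + h" by (auto simp: elt_set_plus_def)
    then have "x = b + ((a - b) + h)" "(a - b) + h \<in> H"
      using that add_subgroupD(4)[OF assms] by auto
    then show "x \<in> b +o H" unfolding elt_set_plus_def by blast
  qed
  assume h: "a - b \<in> H"
  then have "b - a \<in> H" using add_subgroupD(3)[OF assms h] by simp
  then show "a +o H = b +o H" using *[OF h] *[of b a] by blast
qed

lemma coset_self: "add_subgroup H \<Longrightarrow> a \<in> a +o H"
  using add_subgroupD(1) by (force simp: elt_set_plus_def)

lemma mem_coset_iff: "x \<in> a +o H \<longleftrightarrow> x - (a::'a::ab_group_add) \<in> H"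
  by (force simp: elt_set_plus_def)

section \<open>Systems of representatives and multiplicativity of the index\<close>

definition transversal :: "'a::ab_group_add set \<Rightarrow> 'a set \<Rightarrow> 'a set \<Rightarrow> bool" where
  "transversal G H T \<longleftrightarrow> T \<subseteq> G \<and> (\<forall>a\<in>G. \<exists>!t. t \<in> T \<and> a - t \<in> H)"

lemma transversal_bij:
  assumes "add_subgroup H" "transversal G H T"
  shows "bij_betw (\<lambda>t. t +o H) T (cosets G H)"
proof (rule bij_betw_imageI)
  show "inj_on (\<lambda>t. t +o H) T"
  proof (rule inj_onI)
    fix s t assume st: "s \<in> T" "t \<in> T" "s +o H = t +o H"
    then have "s - t \<in> H" "s - s \<in> H" "s \<in> G" using assms coset_eq_iff[of H s t] add_subgroupD(1)[of H]
      by (auto simp: transversal_def)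
    then show "s = t" using assms(2) st unfolding transversal_def by blast
  qed
  show "(\<lambda>t. t +o H) ` T = cosets G H"
  proof
    show "(\<lambda>t. t +o H) ` T \<subseteq> cosets G H" using assms(2) by (auto simp: cosets_def transversal_def)
    show "cosets G H \<subseteq> (\<lambda>t. t +o H) ` T"
    proof
      fix X assume "X \<in> cosets G H"
      then obtain a where a: "a \<in> G" "X = a +o H" by (auto simp: cosets_def)
      then obtain t where "t \<in> T" "a - t \<in> H" using assms(2) by (auto simp: transversal_def)
      then show "X \<in> (\<lambda>t. t +o H) ` T" using a coset_eq_iff[OF assms(1), of a t] by blast
    qed
  qed
qed

lemma transversal_card:
  assumes "add_subgroup H" "transversal G H T"
  shows "card (cosets G H) = card T" "finite (cosets G H) \<longleftrightarrow> finite T"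
  using transversal_bij[OF assms] bij_betw_same_card bij_betw_finite by metis+

lemma transversal_exists:
  assumes "add_subgroup H"
  shows "\<exists>T. transversal G H T"
proof -
  define g where "g X = (SOME a. a \<in> G \<and> X = a +o H)" for X
  have g: "g X \<in> G \<and> X = g X +o H" if "X \<in> cosets G H" for X
    unfolding g_def by (rule someI_ex) (use that in \<open>auto simp: cosets_def\<close>)
  have "transversal G H (g ` cosets G H)" unfolding transversal_def
  proof (intro conjI ballI)
    show "g ` cosets G H \<subseteq> G" using g by blast
    fix a assume a: "a \<in> G"
    then have c: "a +o H \<in> cosets G H" by (auto simp: cosets_def)
    show "\<exists>!t. t \<in> g ` cosets G H \<and> a - t \<in> H"
    proof (rule ex1I[of _ "g (a +o H)"])
      show "g (a +o H) \<in> g ` cosets G H \<and> a - g (a +o H) \<in> H"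
        using g[OF c] c coset_eq_iff[OF assms] by blast
      fix t assume t: "t \<in> g ` cosets G H \<and> a - t \<in> H"
      then obtain X where X: "X \<in> cosets G H" "t = g X" by blast
      then have "X = a +o H" using g[OF X(1)] t coset_eq_iff[OF assms, of a t] by auto
      then show "t = g (a +o H)" using X by simp
    qed
  qed
  then show ?thesis by blast
qed

lemma transversal_tower:
  assumes G: "add_subgroup G" and H: "add_subgroup H" and M: "add_subgroup M"
    and sub: "M \<subseteq> H" "H \<subseteq> G"
    and T: "transversal G H T" and U: "transversal H M U"
  shows "transversal G M ((\<lambda>(t, u). t + u) ` (T \<times> U))" "inj_on (\<lambda>(t, u). t + u) (T \<times> U)"
proof -
  have TU: "T \<subseteq> G" "U \<subseteq> H" using T U by (auto simp: transversal_def)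
  have uniq: "t = t' \<and> u = u'"
    if "t \<in> T" "t' \<in> T" "u \<in> U" "u' \<in> U" "a - (t + u) \<in> M" "a - (t' + u') \<in> M" "a \<in> G" for t t' u u' a
  proof -
    have "a - t = (a - (t + u)) + u" "a - t' = (a - (t' + u')) + u'" by auto
    then have h: "a - t \<in> H" "a - t' \<in> H" using that sub TU add_subgroupD(4)[OF H] by (metis subsetD)+
    then have tt: "t = t'" using T that unfolding transversal_def by blast
    have "(a - t) - u \<in> M" "(a - t) - u' \<in> M" using that tt by (simp_all add: algebra_simps)
    then have "u = u'" using U h that unfolding transversal_def by blast
    then show ?thesis using tt by simp
  qed
  show "inj_on (\<lambda>(t, u). t + u) (T \<times> U)"
  proof (rule inj_onI, clarify)
    fix t u t' u' assume a: "t \<in> T" "u \<in> U" "t' \<in> T" "u' \<in> U" "t + u = t' + u'"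
    have "t + u \<in> G" using a TU sub add_subgroupD(4)[OF G] by blast
    then show "t = t' \<and> u = u'" using uniq[of t t' u u' "t + u"] a add_subgroupD(1)[OF M] by auto
  qed
  show "transversal G M ((\<lambda>(t, u). t + u) ` (T \<times> U))" unfolding transversal_def
  proof (intro conjI ballI)
    show "(\<lambda>(t, u). t + u) ` (T \<times> U) \<subseteq> G" using TU sub by (auto intro!: add_subgroupD(4)[OF G])
    fix a assume a: "a \<in> G"
    then obtain t where t: "t \<in> T" "a - t \<in> H" using T by (auto simp: transversal_def)
    then obtain u where u: "u \<in> U" "(a - t) - u \<in> M" using U by (auto simp: transversal_def)
    show "\<exists>!z. z \<in> (\<lambda>(t, u). t + u) ` (T \<times> U) \<and> a - z \<in> M"
    proof (rule ex1I[of _ "t + u"])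
      show "t + u \<in> (\<lambda>(t, u). t + u) ` (T \<times> U) \<and> a - (t + u) \<in> M"
        using t u by (auto simp: algebra_simps)
      fix z assume z: "z \<in> (\<lambda>(t, u). t + u) ` (T \<times> U) \<and> a - z \<in> M"
      then obtain t' u' where z': "t' \<in> T" "u' \<in> U" "z = t' + u'" by auto
      have "a - (t + u) \<in> M" using u by (simp add: algebra_simps)
      then show "z = t + u" using uniq[of t t' u u' a] z' z t u a by auto
    qed
  qed
qed

text \<open>Sums of representatives represent the composite quotient. The product formula also
  covers infinite quotients, because \<open>card\<close> is 0 on infinite sets; finiteness is
  therefore transported by separate conclusions.\<close>

lemma index_tower:
  assumes G: "add_subgroup G" and H: "add_subgroup H" and M: "add_subgroup M"
    and sub: "M \<subseteq> H" "H \<subseteq> G"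
  shows "card (cosets G M) = card (cosets G H) * card (cosets H M)"
    and "finite (cosets G H) \<Longrightarrow> finite (cosets H M) \<Longrightarrow> finite (cosets G M)"
    and "finite (cosets G M) \<Longrightarrow> finite (cosets H M)"
    and "finite (cosets G M) \<Longrightarrow> finite (cosets G H)"
proof -
  obtain T U where T: "transversal G H T" and U: "transversal H M U"
    using transversal_exists[OF H] transversal_exists[OF M] by blast
  note tr = transversal_tower[OF assms T U]
  note c = transversal_card[OF H T] transversal_card[OF M U] transversal_card[OF M tr(1)]
  have ne: "T \<noteq> {}" "U \<noteq> {}" using T U add_subgroupD(1)[OF G] add_subgroupD(1)[OF H]
    by (auto simp: transversal_def)
  show "card (cosets G M) = card (cosets G H) * card (cosets H M)"
    using c tr(2) by (simp add: card_image card_cartesian_product)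
  have fin: "finite (cosets G M) \<longleftrightarrow> finite (T \<times> U)"
    using c(6) finite_image_iff[OF tr(2)] by simp
  show "finite (cosets G H) \<Longrightarrow> finite (cosets H M) \<Longrightarrow> finite (cosets G M)"
    "finite (cosets G M) \<Longrightarrow> finite (cosets H M)" "finite (cosets G M) \<Longrightarrow> finite (cosets G H)"
    using fin c ne by (auto simp: finite_cartesian_product_iff)
qed

lemma index_pos:
  assumes "add_subgroup G" "finite (cosets G H)"
  shows "card (cosets G H) > 0"
proof -
  have "0 +o H \<in> cosets G H" unfolding cosets_def by (rule imageI) (rule add_subgroupD(1)[OF assms(1)])
  then show ?thesis using assms(2) card_gt_0_iff by blast
qed

text \<open>Second isomorphism theorem: \<open>G'/H'\<close> embeds in \<open>G/H\<close>.\<close>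
lemma index_le:
  assumes "add_subgroup G'" "add_subgroup H" "G' \<subseteq> G" "H' = G' \<inter> H" "finite (cosets G H)"
  shows "finite (cosets G' H')" "card (cosets G' H') \<le> card (cosets G H)"
proof -
  have H': "add_subgroup H'" using assms add_subgroup_Int by metis
  obtain T where T: "transversal G' H' T" using transversal_exists[OF H'] by blast
  have inj: "inj_on (\<lambda>t. t +o H) T"
  proof (rule inj_onI)
    fix s t assume st: "s \<in> T" "t \<in> T" "s +o H = t +o H"
    have g: "s \<in> G'" "t \<in> G'" using T st by (auto simp: transversal_def)
    then have "s - t \<in> H'" "s - s \<in> H'" using st assms coset_eq_iff[OF assms(2)] add_subgroupD[OF assms(1)]
        add_subgroupD(1)[OF H'] by auto
    then show "s = t" using T st g by (auto simp: transversal_def)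
  qed
  have sub: "(\<lambda>t. t +o H) ` T \<subseteq> cosets G H" using T assms(3) by (auto simp: cosets_def transversal_def)
  have "finite T" using inj sub assms(5) by (meson finite_imageD finite_subset)
  then show "finite (cosets G' H')" "card (cosets G' H') \<le> card (cosets G H)"
    using transversal_card[OF H' T] card_inj_on_le[OF inj sub assms(5)] by simp_all
qed

text \<open>The embedding of \<open>G'/H'\<close> into \<open>G/H\<close> is onto as soon as the
  finite target is not larger. This turns an equality of indices into solvability of congruences,
  which is how strong approximation is read off from counting.\<close>

lemma index_surj:
  assumes "add_subgroup G'" "add_subgroup H" "G' \<subseteq> G" "H' = G' \<inter> H" "finite (cosets G H)"
    "card (cosets G H) \<le> card (cosets G' H')" "a \<in> G"
  shows "\<exists>b\<in>G'. a - b \<in> H"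
proof -
  have H': "add_subgroup H'" using assms add_subgroup_Int by metis
  have "cosets G' H \<subseteq> cosets G H" using assms(3) by (auto simp: cosets_def)
  moreover have "card (cosets G' H) = card (cosets G' H')"
  proof -
    obtain T where T: "transversal G' H' T" using transversal_exists[OF H'] by blast
    have "a - t \<in> H' \<longleftrightarrow> a - t \<in> H" if "a \<in> G'" "t \<in> T" for a t
      using T assms(4) add_subgroupD(2)[OF assms(1)] that unfolding transversal_def by blast
    then have "transversal G' H T" using T unfolding transversal_def by (metis (no_types, lifting))
    then show ?thesis using T transversal_card(1) assms(2) H' by metis
  qed
  ultimately have "cosets G' H = cosets G H" using assms(5,6) card_seteq[OF assms(5), of "cosets G' H"] by simp
  moreover have "a +o H \<in> cosets G H" using assms(7) by (auto simp: cosets_def)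
  ultimately have "a +o H \<in> cosets G' H" by simp
  then obtain b where "b \<in> G'" "a +o H = b +o H" unfolding cosets_def by blast
  then show ?thesis using coset_eq_iff[OF assms(2)] by blast
qed

lemma add_subgroup_scale:
  assumes "add_subgroup G"
  shows "add_subgroup ((x::'a::ring) *o G)"
  unfolding add_subgroup_def
proof (intro conjI ballI)
  show "0 \<in> x *o G" unfolding elt_set_times_def using add_subgroupD(1)[OF assms] by force
  fix a b assume "a \<in> x *o G" "b \<in> x *o G"
  then obtain g h where "a = x * g" "b = x * h" "g \<in> G" "h \<in> G" unfolding elt_set_times_def by blast
  then have "a - b = x * (g - h)" "g - h \<in> G"
    using add_subgroupD(2)[OF assms] by (auto simp: right_diff_distrib)
  then show "a - b \<in> x *o G" unfolding elt_set_times_def by blast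
qed

lemma mem_scale_iff:
  assumes "(x::'a::field) \<noteq> 0"
  shows "a \<in> x *o G \<longleftrightarrow> a / x \<in> G"
proof
  show "a \<in> x *o G \<Longrightarrow> a / x \<in> G" using assms by (auto simp: elt_set_times_def)
  assume "a / x \<in> G"
  moreover have "a = x * (a / x)" using assms by simp
  ultimately show "a \<in> x *o G" unfolding elt_set_times_def by blast
qed

lemma mem_scale_diff_iff:
  assumes "(x::'a::field) \<noteq> 0"
  shows "a - x * t \<in> x *o G \<longleftrightarrow> a / x - t \<in> G"
proof -
  have "(a - x * t) / x = a / x - t" using assms by (simp add: diff_divide_distrib)
  then show ?thesis using mem_scale_iff[OF assms] by simp
qed

lemma index_scale:
  assumes "(x::'a::field) \<noteq> 0" "add_subgroup H"
  shows "card (cosets (x *o G) (x *o H)) = card (cosets G H)"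
    "finite (cosets (x *o G) (x *o H)) = finite (cosets G H)"
proof -
  obtain T where T: "transversal G H T" using transversal_exists[OF assms(2)] by blast
  have inj: "inj_on ((*) x) T" using assms(1) by (auto simp: inj_on_def)
  have "transversal (x *o G) (x *o H) ((*) x ` T)" unfolding transversal_def
  proof (intro conjI ballI)
    show "(*) x ` T \<subseteq> x *o G" using T by (auto simp: transversal_def elt_set_times_def)
    fix a assume "a \<in> x *o G"
    then have "a / x \<in> G" using assms mem_scale_iff by blast
    then obtain t where t: "t \<in> T" "a / x - t \<in> H" "\<And>s. s \<in> T \<Longrightarrow> a / x - s \<in> H \<Longrightarrow> s = t"
      using T unfolding transversal_def by metis
    show "\<exists>!s. s \<in> (*) x ` T \<and> a - s \<in> x *o H"
    proof (rule ex1I[of _ "x * t"])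
      show "x * t \<in> (*) x ` T \<and> a - x * t \<in> x *o H"
        using t(1) t(2)[folded mem_scale_diff_iff[OF assms(1)]] by blast
      fix s assume s: "s \<in> (*) x ` T \<and> a - s \<in> x *o H"
      then obtain s' where s': "s' \<in> T" "s = x * s'" by blast
      then have "a / x - s' \<in> H" using s mem_scale_diff_iff[OF assms(1)] by metis
      with s' have "s' \<in> T" "s = x * s'" "a / x - s' \<in> H" by blast+
      then show "s = x * t" using t by simp
    qed
  qed
  note c = transversal_card[OF add_subgroup_scale[OF assms(2), of x] this] transversal_card[OF assms(2) T]
  show "card (cosets (x *o G) (x *o H)) = card (cosets G H)"
    using c inj by (simp add: card_image)
  show "finite (cosets (x *o G) (x *o H)) = finite (cosets G H)"
    using c inj by (simp add: finite_image_iff)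
qed

text \<open>Cardinalities become indices of the zero subgroup, so that \<open>index_tower\<close>
  also counts elements.\<close>

lemma cosets_zero:
  shows "card (cosets G {0::'a::ab_group_add}) = card G" "finite (cosets G {0::'a}) = finite G"
proof -
  have "cosets G {0} = (\<lambda>a. {a}) ` G" by (simp add: cosets_def elt_set_plus_def)
  then show "card (cosets G {0::'a}) = card G" "finite (cosets G {0::'a}) = finite G"
    by (simp_all add: card_image finite_image_iff)
qed

section \<open>Pairwise incongruent families and bounds for indices\<close>

definition incongruent :: "'a::ab_group_add set \<Rightarrow> 'a set \<Rightarrow> bool" where
  "incongruent H Y \<longleftrightarrow> (\<forall>a\<in>Y. \<forall>b\<in>Y. a - b \<in> H \<longrightarrow> a = b)"

lemma transversal_incongruent:
  assumes "add_subgroup H" "transversal G H T"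
  shows "incongruent H T"
  unfolding incongruent_def
proof (intro ballI impI)
  fix a b assume ab: "a \<in> T" "b \<in> T" "a - b \<in> H"
  have "a - a \<in> H" "a \<in> G" using add_subgroupD(1)[OF assms(1)] ab assms(2) by (auto simp: transversal_def)
  then show "a = b" using ab assms(2) unfolding transversal_def by blast
qed

text \<open>A system of representatives is itself incongruent, so a bound for all finite incongruent
  families bounds its finite subsets, and finiteness of the quotient comes out together with the
  bound.\<close>

lemma index_bound:
  assumes "add_subgroup H"
    and "\<And>Y. finite Y \<Longrightarrow> Y \<subseteq> G \<Longrightarrow> incongruent H Y \<Longrightarrow> card Y \<le> M"
  shows "finite (cosets G H)" "card (cosets G H) \<le> M"
proof -
  obtain T where T: "transversal G H T" using transversal_exists[OF assms(1)] by blast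
  have TG: "T \<subseteq> G" using T by (simp add: transversal_def)
  have "card Y \<le> M" if "finite Y" "Y \<subseteq> T" for Y
  proof -
    have "incongruent H Y"
      using transversal_incongruent[OF assms(1) T] that by (auto simp: incongruent_def)
    then show ?thesis using assms(2)[of Y] that TG by auto
  qed
  then have "finite T \<and> card T \<le> M"
    using finite_if_finite_subsets_card_bdd[of T M] by auto
  then show "finite (cosets G H)" "card (cosets G H) \<le> M"
    using transversal_card[OF assms(1) T] by auto
qed

lemma incongruent_card_le:
  assumes "add_subgroup H" "incongruent H Y" "Y \<subseteq> G" "finite (cosets G H)"
  shows "finite Y" "card Y \<le> card (cosets G H)"
proof -
  have inj: "inj_on (\<lambda>t. t +o H) Y"
    using assms(2) coset_eq_iff[OF assms(1)] by (auto simp: inj_on_def incongruent_def)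
  have sub: "(\<lambda>t. t +o H) ` Y \<subseteq> cosets G H" using assms(3) by (auto simp: cosets_def)
  show "finite Y" using inj sub assms(4) by (meson finite_imageD finite_subset)
  show "card Y \<le> card (cosets G H)" using card_inj_on_le[OF inj sub assms(4)] .
qed

text \<open>The quotient is a finite vector space over the field \<open>F\<close>. Induction on the
  index: enlarging \<open>H\<close> by a line \<open>F a\<close> gives a subspace in which
  \<open>H\<close> has index exactly \<open>card F\<close>.\<close>

lemma index_power:
  fixes F :: "'a::field set"
  assumes F: "finite F" "0 \<in> F" "1 \<in> F" "\<And>a b. a \<in> F \<Longrightarrow> b \<in> F \<Longrightarrow> a - b \<in> F"
      "\<And>a b. a \<in> F \<Longrightarrow> b \<in> F \<Longrightarrow> a * b \<in> F" "\<And>a. a \<in> F \<Longrightarrow> inverse a \<in> F"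
    and G: "add_subgroup G" "\<And>c a. c \<in> F \<Longrightarrow> a \<in> G \<Longrightarrow> c * a \<in> G"
    and H: "add_subgroup H" "\<And>c a. c \<in> F \<Longrightarrow> a \<in> H \<Longrightarrow> c * a \<in> H"
    and "H \<subseteq> G" "finite (cosets G H)"
  shows "\<exists>k. card (cosets G H) = card F ^ k"
  using H \<open>H \<subseteq> G\<close> \<open>finite (cosets G H)\<close>
proof (induction "card (cosets G H)" arbitrary: H rule: less_induct)
  case less
  show ?case
  proof (cases "H = G")
    case True
    have "a +o G = 0 +o G" if "a \<in> G" for a
      by (simp only: coset_eq_iff[OF G(1)] diff_zero that)
    then have "cosets G G = {0 +o G}"
      using add_subgroupD(1)[OF G(1)] unfolding cosets_def by auto
    then have "card (cosets G H) = card F ^ 0" using True by simp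
    then show ?thesis by blast
  next
    case False
    then obtain a where a: "a \<in> G" "a \<notin> H" using less.prems by blast
    define H' where "H' = {c * a + h | c h. c \<in> F \<and> h \<in> H}"
    have sub: "H \<subseteq> H'" using F(2) unfolding H'_def by force
    have H'G: "H' \<subseteq> G" unfolding H'_def using a G less.prems(3) add_subgroupD(4)[OF G(1)] by blast
    have H'1: "add_subgroup H'" unfolding add_subgroup_def
    proof (intro conjI ballI)
      show "0 \<in> H'" using sub add_subgroupD(1)[OF less.prems(1)] by blast
      fix x y assume "x \<in> H'" "y \<in> H'"
      then obtain c h d k where "x = c * a + h" "y = d * a + k" "c \<in> F" "d \<in> F" "h \<in> H" "k \<in> H"
        unfolding H'_def by blast
      then have "x - y = (c - d) * a + (h - k)" "c - d \<in> F" "h - k \<in> H"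
        using F(4) add_subgroupD(2)[OF less.prems(1)] by (auto simp: algebra_simps)
      then show "x - y \<in> H'" unfolding H'_def by blast
    qed
    have H'2: "c * x \<in> H'" if cx: "c \<in> F" "x \<in> H'" for c x
    proof -
      obtain d h where "x = d * a + h" "d \<in> F" "h \<in> H" using cx unfolding H'_def by blast
      then have "c * x = (c * d) * a + c * h" "c * d \<in> F" "c * h \<in> H"
        using cx F(5) less.prems(2) by (auto simp: algebra_simps)
      then show ?thesis unfolding H'_def by blast
    qed
    \<comment> \<open>Distinct multiples of \<open>a\<close> are incongruent modulo
      \<open>H\<close>: otherwise dividing by a nonzero scalar would put \<open>a\<close> into
      \<open>H\<close>.\<close>
    have T: "transversal H' H ((\<lambda>c. c * a) ` F)" unfolding transversal_def
    proof (intro conjI ballI)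
      show "(\<lambda>c. c * a) ` F \<subseteq> H'" using add_subgroupD(1)[OF less.prems(1)] unfolding H'_def by force
      fix x assume "x \<in> H'"
      then obtain d h where d: "x = d * a + h" "d \<in> F" "h \<in> H" unfolding H'_def by blast
      show "\<exists>!t. t \<in> (\<lambda>c. c * a) ` F \<and> x - t \<in> H"
      proof (rule ex1I[of _ "d * a"])
        show "d * a \<in> (\<lambda>c. c * a) ` F \<and> x - d * a \<in> H" using d by auto
        fix t assume t: "t \<in> (\<lambda>c. c * a) ` F \<and> x - t \<in> H"
        then obtain c where c: "c \<in> F" "t = c * a" by blast
        have "(x - t) - h \<in> H" using t d add_subgroupD(2)[OF less.prems(1)] by blast
        then have e: "(d - c) * a \<in> H" using c d by (simp add: algebra_simps)
        have "d = c"
        proof (rule ccontr)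
          assume ne: "d \<noteq> c"
          have "inverse (d - c) * ((d - c) * a) \<in> H"
            by (intro less.prems(2) F(6) F(4) e c d)
          then have "a \<in> H" using ne by (simp add: mult.assoc[symmetric])
          then show False using a by blast
        qed
        then show "t = d * a" using c by simp
      qed
    qed
    have c1: "card (cosets H' H) = card F" "finite (cosets H' H)"
    proof -
      have "inj_on (\<lambda>c. c * a) F" using a add_subgroupD(1)[OF less.prems(1)] by (auto simp: inj_on_def)
      then show "card (cosets H' H) = card F" "finite (cosets H' H)"
        using transversal_card[OF less.prems(1) T] F(1) by (auto simp: card_image)
    qed
    note tw = index_tower[OF G(1) H'1 less.prems(1) sub H'G]
    have fin: "finite (cosets G H')" using tw(4) less.prems(4) by blast
    have "card {0, 1 :: 'a} \<le> card F" using F by (intro card_mono) auto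
    then have "card F > 1" by simp
    then have "card (cosets G H') < card (cosets G H)"
      using tw(1) c1 index_pos[OF G(1) fin] by simp
    from less.hyps[OF this H'1 H'2 H'G fin] obtain k where "card (cosets G H') = card F ^ k" by blast
    then have "card (cosets G H) = card F ^ Suc k" using tw(1) c1 by simp
    then show ?thesis by blast
  qed
qed

section \<open>Places and weak approximation\<close>

text \<open>The counting arguments yield estimates with an uncontrolled factor \<open>C\<close>;
  comparing \<open>N\<close>-th powers for all \<open>N\<close> removes it and leaves a sharp
  inequality.\<close>

lemma power_growth:
  fixes a b C :: nat
  assumes "\<And>N. a ^ N \<le> C * b ^ N"
  shows "a \<le> b"
proof (rule ccontr)
  assume "\<not> a \<le> b"
  then have ab: "b < a" by simp
  show False
  proof (cases "b = 0")
    case True then show False using assms[of 1] ab by simp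
  next
    case False
    then have b: "0 < real b" by simp
    have "1 < real a / real b" using ab b by simp
    then obtain N where N: "real C < (real a / real b) ^ N" using real_arch_pow by blast
    have "real (a ^ N) \<le> real (C * b ^ N)" using assms[of N] of_nat_mono by blast
    then have "(real a / real b) ^ N \<le> real C" using b by (simp add: power_divide divide_le_eq)
    then show False using N by simp
  qed
qed

text \<open>Reduction modulo \<open>x\<close> recovers the lowest digit, because the digits are
  incongruent; then \<open>x\<close> is cancelled and the argument repeats.\<close>

lemma digit_sums_inj:
  assumes x: "(x::'a::field) \<noteq> 0" and G: "add_subgroup G" "\<And>a. a \<in> G \<Longrightarrow> x * a \<in> G"
    and Y: "Y \<subseteq> G" "incongruent (x *o G) Y"
  shows "inj_on (\<lambda>y. \<Sum>i<N. x ^ i * y i) ({..<N} \<rightarrow>\<^sub>E Y)"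
proof -
  have pw: "x ^ i * a \<in> G" if "a \<in> G" for i a
    by (induction i) (auto simp: that mult.assoc intro: G(2))
  have *: "\<forall>i<N. y i = z i"
    if "\<forall>i<N. y i \<in> Y" "\<forall>i<N. z i \<in> Y" "(\<Sum>i<N. x ^ i * y i) = (\<Sum>i<N. x ^ i * z i)" for y z
    using that
  proof (induction N arbitrary: y z)
    case 0 then show ?case by simp
  next
    case (Suc N)
    define sy where "sy = (\<Sum>i<N. x ^ i * y (Suc i))"
    define sz where "sz = (\<Sum>i<N. x ^ i * z (Suc i))"
    have e: "y 0 + x * sy = z 0 + x * sz"
      using Suc.prems(3) by (simp del: sum.lessThan_Suc add: sum.lessThan_Suc_shift sy_def sz_def sum_distrib_left mult.assoc)
    have "sy \<in> G" "sz \<in> G" unfolding sy_def sz_def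
      using Suc.prems(1,2) Y(1) by (auto intro!: add_subgroup_sum[OF G(1)] pw)
    then have "sz - sy \<in> G" using add_subgroupD(2)[OF G(1)] by blast
    moreover have "y 0 - z 0 = x * (sz - sy)" using e by (simp add: algebra_simps)
    ultimately have "y 0 - z 0 \<in> x *o G" unfolding elt_set_times_def by blast
    then have 0: "y 0 = z 0" using Y(2) Suc.prems(1,2) by (auto simp: incongruent_def)
    then have "sy = sz" using e x by simp
    then have e': "(\<Sum>i<N. x ^ i * y (Suc i)) = (\<Sum>i<N. x ^ i * z (Suc i))"
      unfolding sy_def sz_def .
    have "\<forall>i<N. y (Suc i) \<in> Y" "\<forall>i<N. z (Suc i) \<in> Y" using Suc.prems(1,2) Suc_less_eq by blast+
    from Suc.IH[OF this e'] have s: "\<forall>i<N. y (Suc i) = z (Suc i)" .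
    show ?case
    proof (intro allI impI)
      fix i assume "i < Suc N" then show "y i = z i" using 0 s by (cases i) auto
    qed
  qed
  show ?thesis
  proof (rule inj_onI)
    fix y z assume a: "y \<in> {..<N} \<rightarrow>\<^sub>E Y" "z \<in> {..<N} \<rightarrow>\<^sub>E Y" "(\<Sum>i<N. x ^ i * y i) = (\<Sum>i<N. x ^ i * z i)"
    then have "\<forall>i<N. y i = z i" using * by (auto simp: PiE_iff)
    then show "y = z" using a by (intro PiE_ext[OF a(1,2)]) auto
  qed
qed

lemma polys_over_iff: "P \<in> polys_over F \<longleftrightarrow> (\<forall>i. coeff P i \<in> F)"
  by (simp add: polys_over_def)

locale subring_set =
  fixes F :: "'a::comm_ring_1 set"
  assumes F01: "0 \<in> F" "1 \<in> F" and Fdiff: "\<And>a b. a \<in> F \<Longrightarrow> b \<in> F \<Longrightarrow> a - b \<in> F"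
    and Fmult: "\<And>a b. a \<in> F \<Longrightarrow> b \<in> F \<Longrightarrow> a * b \<in> F"
begin

lemma add_subgroup: "add_subgroup F"
  unfolding add_subgroup_def using F01 Fdiff by blast

lemmas Fminus = add_subgroupD(3)[OF add_subgroup]
lemmas Fadd = add_subgroupD(4)[OF add_subgroup]
lemmas Fsum = add_subgroup_sum[OF add_subgroup]

lemma Fpower: "a \<in> F \<Longrightarrow> a ^ n \<in> F"
  by (induction n) (auto intro: F01 Fmult)

lemma polys_over_ring:
  shows "0 \<in> polys_over F" "1 \<in> polys_over F"
    "P \<in> polys_over F \<Longrightarrow> Q \<in> polys_over F \<Longrightarrow> P + Q \<in> polys_over F"
    "P \<in> polys_over F \<Longrightarrow> Q \<in> polys_over F \<Longrightarrow> P - Q \<in> polys_over F"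
    "P \<in> polys_over F \<Longrightarrow> Q \<in> polys_over F \<Longrightarrow> P * Q \<in> polys_over F"
    "c \<in> F \<Longrightarrow> monom c n \<in> polys_over F"
  by (auto simp: polys_over_iff F01 Fadd Fdiff coeff_mult coeff_1 intro!: Fsum Fmult)

lemma polys_over_power: "P \<in> polys_over F \<Longrightarrow> P ^ n \<in> polys_over F"
  by (induction n) (auto intro: polys_over_ring)

lemma polys_over_prod: "(\<And>i. i \<in> S \<Longrightarrow> P i \<in> polys_over F) \<Longrightarrow> prod P S \<in> polys_over F"
  by (induction S rule: infinite_finite_induct) (auto intro: polys_over_ring)

end

context global_function_field
begin

lemma Fq_subring: "subring_set Fq"
  by unfold_locales (use Fq_subfield in auto)

interpretation Fq: subring_set Fq by (rule Fq_subring)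

lemma q_ge_2: "q \<ge> 2"
proof -
  have "card {0, 1 :: 'k} \<le> card Fq" using Fq_subfield Fq_finite by (intro card_mono) auto
  then show ?thesis by (simp add: q_def)
qed

lemma finite_polys:
  "finite {P \<in> polys_over Fq. degree P \<le> d}" "card {P \<in> polys_over Fq. degree P \<le> d} \<le> q ^ (d + 1)"
proof -
  let ?f = "\<lambda>P. \<lambda>i\<in>{..d}. coeff P i"
  have inj: "inj_on ?f {P \<in> polys_over Fq. degree P \<le> d}"
  proof (rule inj_onI)
    fix P Q assume a: "P \<in> {P \<in> polys_over Fq. degree P \<le> d}" "Q \<in> {P \<in> polys_over Fq. degree P \<le> d}"
      and e: "?f P = ?f Q"
    have "coeff P i = coeff Q i" for i
    proof (cases "i \<le> d")
      case True then show ?thesis using fun_cong[OF e, of i] by simp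
    next
      case False then show ?thesis using a by (simp add: coeff_eq_0)
    qed
    then show "P = Q" by (simp add: poly_eq_iff)
  qed
  have sub: "?f ` {P \<in> polys_over Fq. degree P \<le> d} \<subseteq> {..d} \<rightarrow>\<^sub>E Fq"
    by (auto simp: polys_over_iff PiE_iff extensional_def split: if_splits)
  have fin: "finite ({..d} \<rightarrow>\<^sub>E Fq)" using Fq_finite by (simp add: finite_PiE)
  show "finite {P \<in> polys_over Fq. degree P \<le> d}" using inj sub fin by (meson finite_imageD finite_subset)
  show "card {P \<in> polys_over Fq. degree P \<le> d} \<le> q ^ (d + 1)"
    using card_inj_on_le[OF inj sub fin] by (simp add: card_PiE q_def)
qed

text \<open>Finite containers for the digit sums: the \<open>Fq[t]\<close>-module generated by
  \<open>B\<close>, filtered by the degree of the coefficients. Several coefficient families may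
  give the same element, which only makes the set smaller.\<close>

definition span_deg :: "'k \<Rightarrow> 'k set \<Rightarrow> nat \<Rightarrow> 'k set" where
  "span_deg t B d = {\<Sum>b\<in>B. poly (p b) t * b | p. \<forall>b\<in>B. p b \<in> polys_over Fq \<and> degree (p b) \<le> d}"

lemma span_deg_finite:
  assumes "finite B"
  shows "finite (span_deg t B d)" "card (span_deg t B d) \<le> q ^ ((d + 1) * card B)"
proof -
  let ?P = "{P \<in> polys_over Fq. degree P \<le> d}"
  have sub: "span_deg t B d \<subseteq> (\<lambda>p. \<Sum>b\<in>B. poly (p b) t * b) ` (B \<rightarrow>\<^sub>E ?P)"
  proof
    fix z assume "z \<in> span_deg t B d"
    then obtain p where p: "z = (\<Sum>b\<in>B. poly (p b) t * b)" "\<forall>b\<in>B. p b \<in> ?P"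
      unfolding span_deg_def by blast
    then have "z = (\<Sum>b\<in>B. poly (restrict p B b) t * b)" by simp
    moreover have "restrict p B \<in> B \<rightarrow>\<^sub>E ?P" using p(2) by auto
    ultimately show "z \<in> (\<lambda>p. \<Sum>b\<in>B. poly (p b) t * b) ` (B \<rightarrow>\<^sub>E ?P)" by blast
  qed
  have fin: "finite (B \<rightarrow>\<^sub>E ?P)" using assms finite_polys by (simp add: finite_PiE)
  show "finite (span_deg t B d)" using sub fin finite_surj by blast
  have "card (span_deg t B d) \<le> card (B \<rightarrow>\<^sub>E ?P)" using sub fin by (meson surj_card_le)
  also have "\<dots> = card ?P ^ card B" using assms by (simp add: card_PiE)
  also have "\<dots> \<le> (q ^ (d + 1)) ^ card B" using finite_polys(2) by (intro power_mono) auto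
  finally show "card (span_deg t B d) \<le> q ^ ((d + 1) * card B)" by (simp only: power_mult)
qed

lemma span_deg_mono: "d \<le> e \<Longrightarrow> span_deg t B d \<subseteq> span_deg t B e"
  unfolding span_deg_def using order_trans by blast

lemma span_deg_add:
  assumes "z \<in> span_deg t B d" "w \<in> span_deg t B d"
  shows "z + w \<in> span_deg t B d"
proof -
  obtain p r where p: "z = (\<Sum>b\<in>B. poly (p b) t * b)" "\<forall>b\<in>B. p b \<in> polys_over Fq \<and> degree (p b) \<le> d"
    and r: "w = (\<Sum>b\<in>B. poly (r b) t * b)" "\<forall>b\<in>B. r b \<in> polys_over Fq \<and> degree (r b) \<le> d"
    using assms unfolding span_deg_def by blast
  have "z + w = (\<Sum>b\<in>B. poly (p b + r b) t * b)"
    using p(1) r(1) by (simp add: sum.distrib algebra_simps)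
  moreover have "\<forall>b\<in>B. p b + r b \<in> polys_over Fq \<and> degree (p b + r b) \<le> d"
    using p(2) r(2) Fq.polys_over_ring(3) degree_add_le by blast
  ultimately show ?thesis unfolding span_deg_def
    by (intro CollectI exI[of _ "\<lambda>b. p b + r b"]) auto
qed

lemma span_deg_zero: "0 \<in> span_deg t B d"
  unfolding span_deg_def using Fq.polys_over_ring(1)
  by (intro CollectI exI[of _ "\<lambda>b. 0"]) auto

lemma span_deg_sum:
  assumes "\<And>i. i \<in> I \<Longrightarrow> f i \<in> span_deg t B d"
  shows "sum f I \<in> span_deg t B d"
  using assms by (induction I rule: infinite_finite_induct) (auto intro: span_deg_zero span_deg_add)

lemma span_deg_mult:
  assumes "z \<in> span_deg t B d" "Q \<in> polys_over Fq" "degree Q \<le> e"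
  shows "poly Q t * z \<in> span_deg t B (d + e)"
proof -
  obtain p where p: "z = (\<Sum>b\<in>B. poly (p b) t * b)" "\<forall>b\<in>B. p b \<in> polys_over Fq \<and> degree (p b) \<le> d"
    using assms unfolding span_deg_def by blast
  have "poly Q t * z = (\<Sum>b\<in>B. poly (p b * Q) t * b)"
    using p(1) by (simp add: sum_distrib_left algebra_simps)
  moreover have "degree (p b * Q) \<le> d + e" if "b \<in> B" for b
    using degree_mult_le[of "p b" Q] p(2) that assms(3) by (meson add_mono le_trans)
  moreover have "\<forall>b\<in>B. p b * Q \<in> polys_over Fq" using p(2) assms(2) Fq.polys_over_ring(5) by blast
  ultimately show ?thesis unfolding span_deg_def
    by (intro CollectI exI[of _ "\<lambda>b. p b * Q"]) auto
qed

text \<open>The coefficients are fractions in \<open>t\<close>, so finitely many elements are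
  brought into one \<open>span_deg\<close> by multiplying with all denominators.\<close>

lemma common_denominator:
  assumes B: "finite B" "\<And>a. \<exists>c. (\<forall>b\<in>B. c b \<in> simple_ext Fq t) \<and> a = (\<Sum>b\<in>B. c b * b)"
    and "finite Y"
  shows "\<exists>D d. D \<in> polys_over Fq \<and> poly D t \<noteq> 0 \<and> (\<forall>y\<in>Y. poly D t * y \<in> span_deg t B d)"
  using \<open>finite Y\<close>
proof (induction Y)
  case empty
  show ?case by (intro exI[of _ 1] exI[of _ 0]) (auto intro: Fq.polys_over_ring)
next
  case (insert y Y)
  obtain D d where D: "D \<in> polys_over Fq" "poly D t \<noteq> 0" "\<forall>y\<in>Y. poly D t * y \<in> span_deg t B d"
    using insert.IH by blast
  obtain c where c: "\<forall>b\<in>B. c b \<in> simple_ext Fq t" "y = (\<Sum>b\<in>B. c b * b)" using B(2) by blast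
  have "\<forall>b. \<exists>P Q. b \<in> B \<longrightarrow> P \<in> polys_over Fq \<and> Q \<in> polys_over Fq \<and> poly Q t \<noteq> 0 \<and> c b = poly P t / poly Q t"
    using c(1) unfolding simple_ext_def by fast
  then obtain P Q where PQ: "\<And>b. b \<in> B \<Longrightarrow> P b \<in> polys_over Fq" "\<And>b. b \<in> B \<Longrightarrow> Q b \<in> polys_over Fq"
      "\<And>b. b \<in> B \<Longrightarrow> poly (Q b) t \<noteq> 0" "\<And>b. b \<in> B \<Longrightarrow> c b = poly (P b) t / poly (Q b) t"
    by metis
  define E where "E = (\<Prod>b\<in>B. Q b)"
  \<comment> \<open>The numerator of \<open>c b\<close> over the common denominator
    \<open>E\<close>.\<close>
  define p where "p b = P b * (\<Prod>b'\<in>B - {b}. Q b')" for b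
  define e where "e = Max (insert 0 ((\<lambda>b. degree (p b)) ` B))"
  have E: "E \<in> polys_over Fq" "poly E t \<noteq> 0"
    using PQ B(1) by (auto simp: E_def poly_prod intro: Fq.polys_over_prod)
  have pm: "p b \<in> polys_over Fq \<and> degree (p b) \<le> e" if "b \<in> B" for b
    using that B(1) PQ by (auto simp: e_def p_def intro!: Fq.polys_over_ring Fq.polys_over_prod Max_ge)
  have "poly E t * (c b * b) = poly (p b) t * b" if "b \<in> B" for b
  proof -
    have "E = Q b * (\<Prod>b'\<in>B - {b}. Q b')" using that B(1) by (simp add: E_def prod.remove)
    then show ?thesis using PQ(3,4)[OF that] by (simp add: p_def)
  qed
  then have "poly E t * y = (\<Sum>b\<in>B. poly (p b) t * b)" using c(2) by (simp only: sum_distrib_left cong: sum.cong)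
  then have y: "poly E t * y \<in> span_deg t B e" unfolding span_deg_def using pm by blast
  let ?d = "max (d + degree E) (e + degree D)"
  have "poly (D * E) t * z \<in> span_deg t B ?d" if "z \<in> insert y Y" for z
  proof (cases "z = y")
    case True
    have "poly D t * (poly E t * y) \<in> span_deg t B (e + degree D)" using span_deg_mult[OF y D(1)] by blast
    then show ?thesis using True span_deg_mono[of "e + degree D" ?d] by (auto simp: mult.assoc)
  next
    case False
    then have "poly E t * (poly D t * z) \<in> span_deg t B (d + degree E)" using that D(3) span_deg_mult[OF _ E(1)] by blast
    then show ?thesis using span_deg_mono[of "d + degree E" ?d] by (auto simp: ac_simps)
  qed
  moreover have "D * E \<in> polys_over Fq" "poly (D * E) t \<noteq> 0" using D E Fq.polys_over_ring(5) by auto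
  ultimately show ?case by blast
qed

text \<open>Sums of \<open>N\<close> digits in base \<open>x\<close> are, up to a common denominator,
  polynomials in a transcendental element of degree linear in \<open>N\<close>; as they are all distinct, there are
  at most \<open>O(M\<^sup>N)\<close> of them.\<close>
lemma finite_index_scale:
  fixes x :: 'k
  assumes "x \<noteq> 0"
  shows "\<exists>M. \<forall>G. add_subgroup G \<longrightarrow> (\<forall>a\<in>G. x * a \<in> G) \<longrightarrow>
    finite (cosets G (x *o G)) \<and> card (cosets G (x *o G)) \<le> M"
proof -
  obtain t B where B: "finite B" "\<And>a. \<exists>c. (\<forall>b\<in>B. c b \<in> simple_ext Fq t) \<and> a = (\<Sum>b\<in>B. c b * b)"
    using function_field by blast
  obtain D e' where D: "D \<in> polys_over Fq" "poly D t \<noteq> 0" "\<And>b. b \<in> B \<Longrightarrow> poly D t * (x * b) \<in> span_deg t B e'"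
    using common_denominator[OF B, of "(\<lambda>b. x * b) ` B"] B(1) by blast
  \<comment> \<open>Multiplication by \<open>D(t) x\<close> raises the degree by at most
    \<open>e\<close>; the maximum with \<open>degree D\<close> lets additional factors
    \<open>D(t)\<close> be absorbed at the same rate.\<close>
  define e where "e = max e' (degree D)"
  have Db: "poly D t * (x * b) \<in> span_deg t B e" if "b \<in> B" for b
    using D(3)[OF that] span_deg_mono[of e' e] by (auto simp: e_def)
  have step: "(poly D t * x) * z \<in> span_deg t B (d + e)" if z: "z \<in> span_deg t B d" for z d
  proof -
    obtain p where p: "z = (\<Sum>b\<in>B. poly (p b) t * b)" "\<forall>b\<in>B. p b \<in> polys_over Fq \<and> degree (p b) \<le> d"
      using z unfolding span_deg_def by blast
    have "(poly D t * x) * z = (\<Sum>b\<in>B. poly (p b) t * (poly D t * (x * b)))"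
      using p(1) by (simp add: sum_distrib_left algebra_simps)
    moreover have "poly (p b) t * (poly D t * (x * b)) \<in> span_deg t B (d + e)" if "b \<in> B" for b
      using span_deg_mult[OF Db[OF that], of "p b" d] p(2) that by (simp add: add.commute)
    ultimately show ?thesis using span_deg_sum[of B _ t B] by simp
  qed
  have stepi: "(poly D t * x) ^ i * z \<in> span_deg t B (d + i * e)" if "z \<in> span_deg t B d" for z d i
  proof (induction i)
    case 0 then show ?case using that by simp
  next
    case (Suc i)
    then show ?case using step[OF Suc] by (simp add: algebra_simps)
  qed
  \<comment> \<open>The growth of the containers per digit: each digit adds \<open>e\<close> to the
    degree of \<open>card B\<close> coefficients. This bound is fixed before \<open>G\<close> is
    chosen.\<close>
  define M where "M = q ^ (e * card B)"
  have main: "card Y \<le> M" if G: "add_subgroup G" "\<forall>a\<in>G. x * a \<in> G"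
    and Y: "finite Y" "Y \<subseteq> G" "incongruent (x *o G) Y" for G Y
  proof -
    obtain E d where E: "E \<in> polys_over Fq" "poly E t \<noteq> 0" "\<And>y. y \<in> Y \<Longrightarrow> poly E t * y \<in> span_deg t B d"
      using common_denominator[OF B Y(1)] by blast
    have "card Y ^ N \<le> q ^ ((d + 1) * card B) * M ^ N" for N
    proof -
      let ?s = "\<lambda>y. \<Sum>i<N. x ^ i * y i"
      let ?m = "poly D t ^ N * poly E t"
      have in_span: "?m * ?s y \<in> span_deg t B (d + N * e)" if y: "y \<in> {..<N} \<rightarrow>\<^sub>E Y" for y
      proof -
        have "poly D t ^ N * poly E t * (x ^ i * y i) \<in> span_deg t B (d + N * e)" if i: "i < N" for i
        proof -
          have "y i \<in> Y" using y i by auto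
          then have 1: "(poly D t * x) ^ i * (poly E t * y i) \<in> span_deg t B (d + i * e)"
            using stepi E(3) by blast
          \<comment> \<open>The summand with \<open>x ^ i\<close> uses only \<open>i\<close> of the
            factors \<open>D(t)\<close>; it is padded with \<open>N - i\<close> further ones, so
            that one multiplier clears all summands.\<close>
          have "degree (D ^ (N - i)) \<le> degree D * (N - i)" by (rule degree_power_le)
          also have "\<dots> \<le> (N - i) * e" by (simp add: e_def)
          finally have "degree (D ^ (N - i)) \<le> (N - i) * e" .
          then have "poly (D ^ (N - i)) t * ((poly D t * x) ^ i * (poly E t * y i))
              \<in> span_deg t B (d + i * e + (N - i) * e)"
            using span_deg_mult[OF 1 Fq.polys_over_power[OF D(1)]] by blast
          moreover have e1: "d + i * e + (N - i) * e = d + N * e" using i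
            by (simp add: add_mult_distrib[symmetric])
          moreover have e2: "poly (D ^ (N - i)) t * ((poly D t * x) ^ i * (poly E t * y i))
             = (poly D t ^ (N - i) * poly D t ^ i) * poly E t * (x ^ i * y i)"
            by (simp only: power_mult_distrib poly_power mult.assoc mult.left_commute mult.commute)
          moreover have e3: "poly D t ^ (N - i) * poly D t ^ i = poly D t ^ N" using i
            by (simp add: power_add[symmetric])
          ultimately show ?thesis by (simp only: e1 e2 e3)
        qed
        then show ?thesis by (auto simp: sum_distrib_left intro!: span_deg_sum)
      qed
      have "inj_on ?s ({..<N} \<rightarrow>\<^sub>E Y)" using digit_sums_inj[OF assms G(1) _ Y(2,3)] G(2) by blast
      moreover have "?m \<noteq> 0" using D E by simp
      ultimately have "inj_on (\<lambda>y. ?m * ?s y) ({..<N} \<rightarrow>\<^sub>E Y)" by (simp add: inj_on_def)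
      then have "card ({..<N} \<rightarrow>\<^sub>E Y) \<le> card (span_deg t B (d + N * e))"
        using in_span span_deg_finite(1)[OF B(1)] by (intro card_inj_on_le) auto
      also have "\<dots> \<le> q ^ ((d + N * e + 1) * card B)" by (rule span_deg_finite(2)[OF B(1)])
      also have "\<dots> = q ^ ((d + 1) * card B) * M ^ N"
        by (simp add: M_def power_add[symmetric] power_mult[symmetric] algebra_simps)
      finally show ?thesis by (simp add: card_PiE)
    qed
    then show ?thesis by (rule power_growth)
  qed
  show ?thesis
  proof (intro exI allI impI)
    fix G assume G: "add_subgroup G" "\<forall>a\<in>G. x * a \<in> G"
    show "finite (cosets G (x *o G)) \<and> card (cosets G (x *o G)) \<le> M"
      using index_bound[OF add_subgroup_scale[OF G(1)], of G x M] main[OF G] by blast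
  qed
qed

end

context global_function_field
begin

interpretation Fq: subring_set Fq by (rule Fq_subring)

section \<open>Arithmetic of normalized discrete valuations\<close>

abbreviation place :: "'k place \<Rightarrow> bool" where "place \<equiv> is_place Fq"

abbreviation places :: "'k place set" where "places \<equiv> {v. place v}"

lemma
  assumes "place v"
  shows place_mult: "a \<noteq> 0 \<Longrightarrow> b \<noteq> 0 \<Longrightarrow> v (a * b) = v a + v b"
    and place_add: "a \<noteq> 0 \<Longrightarrow> b \<noteq> 0 \<Longrightarrow> a + b \<noteq> 0 \<Longrightarrow> min (v a) (v b) \<le> v (a + b)"
    and place_Fq: "c \<in> Fq \<Longrightarrow> v c = 0"
    and place_0: "v 0 = 0"
  using assms by (auto simp: is_place_def)

lemma place_surj:
  assumes "place v"
  obtains a where "a \<noteq> 0" "v a = n"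
proof -
  have "v ` (- {0}) = UNIV" using assms by (simp add: is_place_def)
  then have "n \<in> v ` (- {0})" by simp
  then show thesis using that by auto
qed

lemma place_one: "place v \<Longrightarrow> v 1 = 0"
  using place_Fq Fq_subfield by blast

lemma place_inverse:
  assumes "place v" "a \<noteq> 0"
  shows "v (inverse a) = - v a"
  using place_mult[OF assms(1) assms(2), of "inverse a"] assms place_one[OF assms(1)] by simp

lemma place_divide: "place v \<Longrightarrow> a \<noteq> 0 \<Longrightarrow> b \<noteq> 0 \<Longrightarrow> v (a / b) = v a - v b"
  using place_mult[of v a "inverse b"] place_inverse[of v b] by (simp add: divide_inverse)

lemma place_power: "place v \<Longrightarrow> a \<noteq> 0 \<Longrightarrow> v (a ^ n) = int n * v a"
  by (induction n) (auto simp: place_one place_mult algebra_simps)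

lemma place_minus:
  assumes "place v"
  shows "v (- a) = v a"
proof (cases "a = 0")
  case False
  have "- 1 \<in> Fq" using Fq.Fminus Fq_subfield by blast
  then have "v (- 1) = 0" using place_Fq assms by blast
  then show ?thesis using place_mult[OF assms, of "- 1" a] False by simp
qed simp

lemma val_ge_0 [simp]: "val_ge v n 0"
  by (simp add: val_ge_def)

lemma val_ge_mono: "val_ge v n a \<Longrightarrow> m \<le> n \<Longrightarrow> val_ge v m a"
  by (auto simp: val_ge_def)

lemma val_ge_add:
  assumes "place v" "val_ge v n a" "val_ge v n b"
  shows "val_ge v n (a + b)"
  using assms place_add[OF assms(1), of a b] unfolding val_ge_def
  by (cases "a = 0"; cases "b = 0"; cases "a + b = 0") auto

lemma val_ge_minus_iff: "place v \<Longrightarrow> val_ge v n (- a) \<longleftrightarrow> val_ge v n a"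
  using place_minus[of v a] by (auto simp: val_ge_def)

lemma val_ge_diff:
  assumes "place v" "val_ge v n a" "val_ge v n b"
  shows "val_ge v n (a - b)"
  using val_ge_add[OF assms(1,2), of "- b"] assms val_ge_minus_iff by simp

lemma val_ge_mult:
  assumes "place v" "val_ge v n a" "val_ge v m b"
  shows "val_ge v (n + m) (a * b)"
  using assms place_mult[OF assms(1), of a b] unfolding val_ge_def by (cases "a = 0"; cases "b = 0") auto

lemma val_ge_mult_iff:
  assumes "place v" "a \<noteq> 0"
  shows "val_ge v n (a * b) \<longleftrightarrow> val_ge v (n - v a) b"
  using assms place_mult[OF assms, of b] unfolding val_ge_def by (cases "b = 0") auto

lemma val_ge_Fq: "place v \<Longrightarrow> c \<in> Fq \<Longrightarrow> val_ge v 0 c"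
  using place_Fq[of v c] by (simp add: val_ge_def)

lemma val_ge_one: "place v \<Longrightarrow> val_ge v 0 1"
  using val_ge_Fq Fq_subfield by blast

lemma val_ge_power: "place v \<Longrightarrow> val_ge v 0 a \<Longrightarrow> val_ge v 0 (a ^ n)"
  by (induction n) (auto simp: val_ge_one dest: val_ge_mult[of v 0 a 0])

lemma val_ge_sum:
  assumes "place v" "\<And>i. i \<in> S \<Longrightarrow> val_ge v n (f i)"
  shows "val_ge v n (sum f S)"
  using assms(2) by (induction S rule: infinite_finite_induct) (auto intro: val_ge_add[OF assms(1)])

lemma val_ge_self: "val_ge v (v a) a"
  by (simp add: val_ge_def)

lemma place_add_eq:
  assumes "place v" "a \<noteq> 0" "val_ge v (v a + 1) b"
  shows "a + b \<noteq> 0" "v (a + b) = v a"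
proof -
  show n: "a + b \<noteq> 0"
  proof
    assume "a + b = 0"
    then have "b = - a" by (simp add: add_eq_0_iff)
    then show False using assms place_minus[OF assms(1), of a] by (auto simp: val_ge_def)
  qed
  show "v (a + b) = v a"
  proof (rule antisym)
    have "val_ge v (v a) (a + b)" using val_ge_add[OF assms(1) val_ge_self] val_ge_mono[OF assms(3)] by simp
    then show "v a \<le> v (a + b)" using n by (simp add: val_ge_def)
    show "v (a + b) \<le> v a"
    proof (rule ccontr)
      assume "\<not> v (a + b) \<le> v a"
      then have "val_ge v (v a + 1) (a + b)" by (simp add: val_ge_def)
      then have "val_ge v (v a + 1) ((a + b) - b)" using val_ge_diff assms by blast
      then show False using assms(2) by (simp add: val_ge_def)
    qed
  qed
qed

text \<open>Units for \<open>v\<close> are units for \<open>w\<close>, hence \<open>w\<close> is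
  \<open>v\<close> times the value of \<open>w\<close> at a uniformizer of \<open>v\<close>;
  surjectivity of \<open>w\<close> and the sign force this factor to be 1. Distinct places therefore
  have incomparable valuation rings, which is what separates them.\<close>

lemma place_eqI:
  assumes "place v" "place w" "\<And>a. val_ge v 0 a \<Longrightarrow> val_ge w 0 a"
  shows "v = w"
proof -
  obtain p where p: "p \<noteq> 0" "v p = 1" using place_surj[OF assms(1)] by blast
  have unit: "w a = 0" if "a \<noteq> 0" "v a = 0" for a
  proof -
    have "val_ge v 0 a" "val_ge v 0 (inverse a)"
      using that place_inverse[OF assms(1) that(1)] by (auto simp: val_ge_def)
    then have "val_ge w 0 a" "val_ge w 0 (inverse a)" using assms(3) by blast+
    then show ?thesis using that place_inverse[OF assms(2) that(1)] by (auto simp: val_ge_def)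
  qed
  have wn: "w a = v a * w p" if "a \<noteq> 0" for a
  proof -
    have pw: "p powi (v a) \<noteq> 0" using p by simp
    have "v (p powi n) = n" "w (p powi n) = n * w p" for n
      using p assms by (auto simp: power_int_def place_power place_inverse)
    note pv = this
    have "w (a / p powi (v a)) = 0" using unit[of "a / p powi (v a)"] that pw place_divide[OF assms(1) that pw] pv by simp
    then show ?thesis using place_divide[OF assms(2) that pw] pv by simp
  qed
  obtain b where "b \<noteq> 0" "w b = 1" using place_surj[OF assms(2)] by blast
  then have "v b * w p = 1" using wn by simp
  moreover have "w p \<ge> 0" using assms(3)[of p] p by (simp add: val_ge_def)
  ultimately have "w p = 1" by (metis abs_of_nonneg zmult_eq_1_iff one_neq_neg_one not_one_le_zero neg_0_le_iff_le)
  then show ?thesis using wn place_0 assms by (intro ext) (metis mult.right_neutral)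
qed

text \<open>One notion for several objects: the powers of the maximal ideal of a valuation ring for
  \<open>S = {v}\<close>, the fractional ideals of \<open>A\<close> for
  \<open>S = fin_places\<close>, and Riemann-Roch spaces for \<open>S = places\<close>. Since
  \<open>E\<close> is a lower bound for the valuations, the Riemann-Roch space is that of the
  divisor \<open>- E\<close>.\<close>

definition vbox :: "'k place set \<Rightarrow> ('k place \<Rightarrow> int) \<Rightarrow> 'k set" where
  "vbox S E = {a. \<forall>v\<in>S. val_ge v (E v) a}"

lemma box_subgroup: "S \<subseteq> places \<Longrightarrow> add_subgroup (vbox S E)"
  unfolding add_subgroup_def vbox_def using val_ge_diff by auto

lemma box_mono: "(\<And>v. v \<in> S \<Longrightarrow> E v \<le> F v) \<Longrightarrow> vbox S F \<subseteq> vbox S E"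
  unfolding vbox_def using val_ge_mono by blast

lemma box_cong: "(\<And>v. v \<in> S \<Longrightarrow> E v = F v) \<Longrightarrow> vbox S E = vbox S F"
  unfolding vbox_def by simp

lemma box_Fq: "S \<subseteq> places \<Longrightarrow> c \<in> Fq \<Longrightarrow> a \<in> vbox S E \<Longrightarrow> c * a \<in> vbox S E"
  unfolding vbox_def using val_ge_mult[of _ 0 c] val_ge_Fq by fastforce

lemma box_scale:
  assumes "S \<subseteq> places" "x \<noteq> 0"
  shows "x *o vbox S E = vbox S (\<lambda>v. E v + v x)"
proof (rule Set.set_eqI)
  fix a
  have "val_ge v (E v) (a / x) \<longleftrightarrow> val_ge v (E v + v x) a" if "v \<in> S" for v
    using val_ge_mult_iff[of v x "E v + v x" "a / x"] that assms by auto
  then show "a \<in> x *o vbox S E \<longleftrightarrow> a \<in> vbox S (\<lambda>v. E v + v x)"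
    by (simp add: mem_scale_iff[OF assms(2)] vbox_def)
qed

lemma place_separate:
  assumes "place v" "place w" "v \<noteq> w"
  obtains c where "c \<noteq> 0" "v c > 0" "w c < 0"
proof -
  obtain a where a: "val_ge v 0 a" "\<not> val_ge w 0 a" using place_eqI assms by blast
  obtain b where b: "val_ge w 0 b" "\<not> val_ge v 0 b" using place_eqI[of w v] assms by metis
  have nz: "a \<noteq> 0" "b \<noteq> 0" using a b by auto
  then have "v (a / b) > 0" "w (a / b) < 0" "a / b \<noteq> 0" using a b nz assms
    by (auto simp: place_divide val_ge_def)
  then show thesis using that by blast
qed

text \<open>Induction on \<open>S\<close>: if \<open>c\<close> has no pole at the new place
  \<open>u\<close>, a high power of an element \<open>d\<close> with a zero at \<open>v\<close> and
  a pole at \<open>u\<close> is added to it.\<close>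

lemma place_separate_finite:
  assumes "place v" "finite S" "S \<subseteq> places" "v \<notin> S"
  shows "\<exists>c. c \<noteq> 0 \<and> v c > 0 \<and> (\<forall>w\<in>S. w c < 0)"
  using assms(2-)
proof (induction S)
  case empty
  then show ?case using place_surj[OF assms(1), of 1] by (metis empty_iff zero_less_one)
next
  case (insert u S)
  then obtain c where c: "c \<noteq> 0" "v c > 0" "\<forall>w\<in>S. w c < 0" by auto
  obtain d where d: "d \<noteq> 0" "v d > 0" "u d < 0"
    using place_separate[of v u] insert.prems assms(1) by auto
  show ?case
  proof (cases "u c < 0")
    case True then show ?thesis using c by auto
  next
    case False
    \<comment> \<open>Large enough that at each \<open>w\<close> in \<open>S\<close> where
      \<open>d\<close> has a pole, \<open>d ^ r\<close> has a worse one than \<open>c\<close>; thus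
      at every place where a pole is wanted the two terms have different valuations and cannot
      cancel. The summand 1 keeps \<open>r\<close> positive.\<close>
    define r where "r = nat (1 + (\<Sum>w\<in>S. \<bar>w c\<bar>))"
    have r1: "int r \<ge> 1" by (simp add: r_def sum_nonneg)
    have rw: "int r > \<bar>w c\<bar>" if "w \<in> S" for w
      using member_le_sum[OF that, of "\<lambda>w. \<bar>w c\<bar>"] insert.hyps(1) by (simp add: r_def sum_nonneg)
    have pu: "place u" and pw: "\<And>w. w \<in> S \<Longrightarrow> place w" using insert.prems by auto
    have dr: "d ^ r \<noteq> 0" using d by simp
    have "u (d ^ r) < 0" using place_power[OF pu d(1)] d(3) r1 by (simp add: mult_pos_neg)
    then have u: "d ^ r + c \<noteq> 0" "u (d ^ r + c) < 0"
      using place_add_eq[OF pu dr, of c] False by (auto simp: val_ge_def)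
    have "int r * v d \<ge> 1 * 1" using r1 d(2) by (intro mult_mono) auto
    then have "val_ge v 1 (d ^ r)" "val_ge v 1 c"
      using c(2) place_power[OF assms(1) d(1), of r] unfolding val_ge_def by simp_all
    then have "val_ge v 1 (d ^ r + c)" using val_ge_add assms(1) by blast
    then have v: "v (d ^ r + c) > 0" using u by (simp add: val_ge_def)
    have "w (d ^ r + c) < 0" if w: "w \<in> S" for w
    proof (cases "w d < 0")
      case True
      have "int r * w d \<le> int r * (- 1)" using True by (intro mult_left_mono) auto
      then have "w (d ^ r) < w c" using place_power[OF pw[OF w] d(1), of r] rw[OF w] by simp
      then have "w (d ^ r + c) = w (d ^ r)"
        using place_add_eq[OF pw[OF w] dr, of c] by (auto simp: val_ge_def)
      then show ?thesis using \<open>w (d ^ r) < w c\<close> c w by force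
    next
      case False
      then have "w (d ^ r) \<ge> 0" using place_power[OF pw[OF w] d(1), of r] by simp
      then have "w (c + d ^ r) = w c" using place_add_eq[OF pw[OF w] c(1), of "d ^ r"] c(3) w
        by (auto simp: val_ge_def)
      then show ?thesis using c w by (simp add: add.commute)
    qed
    then show ?thesis using u v by (intro exI[of _ "d ^ r + c"]) auto
  qed
qed

text \<open>The element \<open>1 / (1 + c ^ r)\<close> is close to 1 where \<open>c\<close> has a
  zero and close to 0 where \<open>c\<close> has a pole.\<close>

lemma place_idempotent:
  assumes "place v" "finite S" "S \<subseteq> places" "v \<notin> S"
  shows "\<exists>e. val_ge v (int r) (e - 1) \<and> (\<forall>w\<in>S. val_ge w (int r) e)"
proof (cases "r = 0")
  case True
  then show ?thesis using val_ge_one assms by (intro exI[of _ 1]) auto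
next
  case False
  obtain c where c: "c \<noteq> 0" "v c > 0" "\<forall>w\<in>S. w c < 0" using place_separate_finite[OF assms] by blast
  have cr: "c ^ r \<noteq> 0" using c by simp
  have vr: "v (c ^ r) \<ge> int r" using place_power[OF assms(1) c(1), of r] c(2)
    by (simp add: mult_le_cancel_left1)
  have v1: "val_ge v (v 1 + 1) (c ^ r)" using vr False place_one[OF assms(1)] by (simp add: val_ge_def)
  have n: "1 + c ^ r \<noteq> 0" "v (1 + c ^ r) = 0"
    using place_add_eq[OF assms(1) _ v1] place_one[OF assms(1)] by auto
  define e where "e = 1 / (1 + c ^ r)"
  have "e - 1 = - (c ^ r / (1 + c ^ r))" using n by (simp add: e_def field_simps)
  moreover have "val_ge v (int r) (c ^ r / (1 + c ^ r))"
    using place_divide[OF assms(1) cr n(1)] n(2) vr by (simp add: val_ge_def)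
  ultimately have "val_ge v (int r) (e - 1)" using val_ge_minus_iff[OF assms(1)] by simp
  moreover have "val_ge w (int r) e" if "w \<in> S" for w
  proof -
    have pw: "place w" using that assms by auto
    have "w c \<le> - 1" using c that by force
    then have "int r * w c \<le> int r * (- 1)" by (intro mult_left_mono) auto
    then have wr: "w (c ^ r) \<le> - int r" using place_power[OF pw c(1)] by simp
    then have "val_ge w (w (c ^ r) + 1) 1" using False place_one[OF pw] by (simp add: val_ge_def)
    then have "w (c ^ r + 1) = w (c ^ r)" using place_add_eq[OF pw cr] by blast
    then show ?thesis using n place_divide[OF pw _ n(1), of 1] place_one[OF pw] wr
      by (simp add: e_def val_ge_def add.commute)
  qed
  ultimately show ?thesis by blast
qed

text \<open>Interpolation with the approximate idempotents; their precision \<open>r\<close>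
  compensates the poles of each \<open>f v\<close> at all places of \<open>S\<close>.\<close>

lemma weak_approximation:
  assumes "finite S" "S \<subseteq> places"
  shows "\<exists>a. \<forall>v\<in>S. val_ge v n (a - f v)"
proof -
  define r where "r = nat (\<bar>n\<bar> + (\<Sum>v\<in>S. \<Sum>w\<in>S. \<bar>w (f v)\<bar>))"
  have r: "int r \<ge> n - w (f v)" if "w \<in> S" "v \<in> S" for w v
  proof -
    have "\<bar>w (f v)\<bar> \<le> (\<Sum>w\<in>S. \<bar>w (f v)\<bar>)" using that assms by (intro member_le_sum) auto
    also have "\<dots> \<le> (\<Sum>v\<in>S. \<Sum>w\<in>S. \<bar>w (f v)\<bar>)"
      using that assms by (intro member_le_sum[of v S "\<lambda>v. \<Sum>w\<in>S. \<bar>w (f v)\<bar>"]) (auto intro: sum_nonneg)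
    finally show ?thesis by (simp add: r_def)
  qed
  have "\<forall>v\<in>S. \<exists>e. val_ge v (int r) (e - 1) \<and> (\<forall>w\<in>S - {v}. val_ge w (int r) e)"
    using place_idempotent[of _ "S - {_}" r] assms by blast
  then obtain e where e: "\<And>v. v \<in> S \<Longrightarrow> val_ge v (int r) (e v - 1)"
      "\<And>v w. v \<in> S \<Longrightarrow> w \<in> S \<Longrightarrow> w \<noteq> v \<Longrightarrow> val_ge w (int r) (e v)"
    by (metis DiffI singletonD)
  have "val_ge w n ((\<Sum>v\<in>S. e v * f v) - f w)" if w: "w \<in> S" for w
  proof -
    have pw: "place w" using w assms by blast
    have "(\<Sum>v\<in>S. e v * f v) - f w = (e w - 1) * f w + (\<Sum>v\<in>S - {w}. e v * f v)"
      using w assms(1) by (simp add: sum.remove algebra_simps)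
    moreover have v1: "val_ge w n ((e w - 1) * f w)"
      by (rule val_ge_mono[OF val_ge_mult[OF pw e(1)[OF w] val_ge_self]]) (use r[OF w w] in simp)
    moreover have v2: "val_ge w n (e v * f v)" if "v \<in> S - {w}" for v
      by (rule val_ge_mono[OF val_ge_mult[OF pw e(2) val_ge_self]]) (use r[OF w, of v] that w in auto)
    moreover have "val_ge w n ((e w - 1) * f w + (\<Sum>v\<in>S - {w}. e v * f v))"
      by (intro val_ge_add[OF pw v1] val_ge_sum[OF pw] v2)
    ultimately show ?thesis by simp
  qed
  then show ?thesis by blast
qed

section \<open>Residue fields and indices of boxes\<close>

definition resid_card :: "'k place \<Rightarrow> nat" where
  "resid_card v = card (cosets (vbox {v} (\<lambda>_. 0)) (vbox {v} (\<lambda>_. 1)))"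

text \<open>A uniformizer maps the valuation ring into itself, so finiteness of the residue field is
  an instance of \<open>finite_index_scale\<close>; the quotients at the other levels are scaled
  copies.\<close>

lemma resid_index:
  assumes "place v"
  shows "finite (cosets (vbox {v} (\<lambda>_. n)) (vbox {v} (\<lambda>_. n + 1)))"
    "card (cosets (vbox {v} (\<lambda>_. n)) (vbox {v} (\<lambda>_. n + 1))) = resid_card v"
proof -
  have s: "{v} \<subseteq> places" using assms by simp
  obtain p where p: "p \<noteq> 0" "v p = 1" using place_surj[OF assms] by blast
  obtain x where x: "x \<noteq> 0" "v x = n" using place_surj[OF assms] by blast
  have "p *o vbox {v} (\<lambda>_. 0) = vbox {v} (\<lambda>_. 1)"
    unfolding box_scale[OF s p(1)] using p by (intro box_cong) auto
  moreover have "p * a \<in> vbox {v} (\<lambda>_. 0)" if "a \<in> vbox {v} (\<lambda>_. 0)" for a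
    using that val_ge_mult[OF assms, of 1 p 0 a] p val_ge_mono[of v 1 _ 0] by (auto simp: vbox_def val_ge_def)
  ultimately have fin: "finite (cosets (vbox {v} (\<lambda>_. 0)) (vbox {v} (\<lambda>_. 1)))"
    using finite_index_scale[OF p(1)] box_subgroup[OF s] by metis
  have "x *o vbox {v} (\<lambda>_. 0) = vbox {v} (\<lambda>_. n)" "x *o vbox {v} (\<lambda>_. 1) = vbox {v} (\<lambda>_. n + 1)"
    unfolding box_scale[OF s x(1)] by (rule box_cong, use x in simp)+
  then show "finite (cosets (vbox {v} (\<lambda>_. n)) (vbox {v} (\<lambda>_. n + 1)))"
    "card (cosets (vbox {v} (\<lambda>_. n)) (vbox {v} (\<lambda>_. n + 1))) = resid_card v"
    using index_scale[OF x(1) box_subgroup[OF s], of "vbox {v} (\<lambda>_. 0)" "\<lambda>_. 1"] fin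
    by (simp_all add: resid_card_def)
qed

lemma resid_card_ge_2:
  assumes "place v"
  shows "resid_card v \<ge> 2"
proof -
  have s: "add_subgroup (vbox {v} (\<lambda>_. 1))" using box_subgroup assms by simp
  have "incongruent (vbox {v} (\<lambda>_. 1)) {0, 1}" unfolding incongruent_def vbox_def
    using place_one[OF assms] place_minus[OF assms, of 1] by (auto simp: val_ge_def)
  then have "card {0, 1 :: 'k} \<le> resid_card v" unfolding resid_card_def
    using resid_index(1)[OF assms, of 0] val_ge_one[OF assms]
    by (intro incongruent_card_le(2)[OF s]) (auto simp: vbox_def)
  then show ?thesis by simp
qed

lemma resid_card_power:
  assumes "place v"
  shows "\<exists>k. resid_card v = q ^ k"
proof -
  have s: "{v} \<subseteq> places" using assms by simp
  have "vbox {v} (\<lambda>_. 1) \<subseteq> vbox {v} (\<lambda>_. 0)" by (rule box_mono) simp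
  from index_power[OF Fq_finite Fq_subfield box_subgroup[OF s] box_Fq[OF s] box_subgroup[OF s] box_Fq[OF s] this]
  show ?thesis unfolding resid_card_def q_def using resid_index(1)[OF assms, of 0] by simp
qed

text \<open>The quotient of a unit step embeds into the residue field at \<open>u\<close>. For
  finite \<open>S\<close> weak approximation lifts every residue class; for all finite places the
  corresponding equality is \<open>fin_box_step\<close>, whose proof uses the upper bound given
  here.\<close>

lemma box_step:
  fixes E :: "'k place \<Rightarrow> int"
  assumes S: "S \<subseteq> places" and u: "u \<in> S"
  defines "E' \<equiv> E(u := E u + 1)"
  shows "vbox S E' = vbox S E \<inter> vbox {u} (\<lambda>_. E u + 1)" "vbox S E \<subseteq> vbox {u} (\<lambda>_. E u)"
    "finite (cosets (vbox S E) (vbox S E'))" "card (cosets (vbox S E) (vbox S E')) \<le> resid_card u"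
    "finite S \<Longrightarrow> card (cosets (vbox S E) (vbox S E')) = resid_card u"
proof -
  have pu: "place u" using S u by blast
  show 1: "vbox S E' = vbox S E \<inter> vbox {u} (\<lambda>_. E u + 1)" unfolding E'_def vbox_def
    using u val_ge_mono[of u "E u + 1" _ "E u"] by auto
  show 2: "vbox S E \<subseteq> vbox {u} (\<lambda>_. E u)" using u by (auto simp: vbox_def)
  note r = resid_index[OF pu, of "E u"]
  have g: "add_subgroup (vbox S E)" "add_subgroup (vbox {u} (\<lambda>_. E u + 1))" using S u box_subgroup by auto
  show 3: "finite (cosets (vbox S E) (vbox S E'))" "card (cosets (vbox S E) (vbox S E')) \<le> resid_card u"
    using index_le[OF g 2 1 r(1)] r(2) by simp_all
  assume fin: "finite S"
  obtain T where T: "transversal (vbox {u} (\<lambda>_. E u)) (vbox {u} (\<lambda>_. E u + 1)) T"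
    using transversal_exists[OF g(2)] by blast
  have Tu: "T \<subseteq> vbox {u} (\<lambda>_. E u)" using T by (simp add: transversal_def)
  \<comment> \<open>A precision that exceeds all bounds on \<open>S\<close>, and
    \<open>E u + 1\<close> as well: the approximations keep the residue class at \<open>u\<close>
    and lie in the box elsewhere.\<close>
  define n where "n = \<bar>E u\<bar> + 1 + (\<Sum>v\<in>S. \<bar>E v\<bar>)"
  have n: "n \<ge> E v" if "v \<in> S" for v
    using member_le_sum[OF that, of "\<lambda>v. \<bar>E v\<bar>"] fin by (simp add: n_def)
  have "(\<Sum>v\<in>S. \<bar>E v\<bar>) \<ge> 0" by (simp add: sum_nonneg)
  then have n': "n \<ge> E u + 1" unfolding n_def by linarith
  have "\<forall>t. \<exists>b. \<forall>v\<in>S. val_ge v n (b - (if v = u then t else 0))"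
    by (intro allI weak_approximation[OF fin S])
  then obtain b where b: "\<And>t v. v \<in> S \<Longrightarrow> val_ge v n (b t - (if v = u then t else 0))" by metis
  have bu: "b t - t \<in> vbox {u} (\<lambda>_. E u + 1)" for t
    using b[OF u, of t] n' val_ge_mono by (auto simp: vbox_def)
  have bS: "b t \<in> vbox S E" if "t \<in> T" for t unfolding vbox_def
  proof (intro CollectI ballI)
    fix v assume v: "v \<in> S"
    show "val_ge v (E v) (b t)"
    proof (cases "v = u")
      case True
      have "val_ge u (E u) (b t - t)" "val_ge u (E u) t"
        using bu[of t] Tu that by (auto simp: vbox_def intro: val_ge_mono)
      then have "val_ge u (E u) ((b t - t) + t)" by (rule val_ge_add[OF pu])
      then show ?thesis using True by simp
    next
      case False then show ?thesis using b[OF v, of t] n[OF v] val_ge_mono by auto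
    qed
  qed
  have TT: "t = t'" if t: "t \<in> T" "t' \<in> T" "b t - b t' \<in> vbox {u} (\<lambda>_. E u + 1)" for t t'
  proof -
    have "(b t - b t') - (b t - t) + (b t' - t') \<in> vbox {u} (\<lambda>_. E u + 1)"
      by (rule add_subgroupD(4)[OF g(2) add_subgroupD(2)[OF g(2) t(3) bu] bu])
    then have "t - t' \<in> vbox {u} (\<lambda>_. E u + 1)" by (simp add: algebra_simps)
    then show ?thesis using transversal_incongruent[OF g(2) T] t by (auto simp: incongruent_def)
  qed
  have "inj_on b T" using TT add_subgroupD(1)[OF g(2)] by (auto simp: inj_on_def)
  moreover have "incongruent (vbox S E') (b ` T)" unfolding incongruent_def using TT 1 by blast
  moreover have "add_subgroup (vbox S E')" using S box_subgroup by blast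
  ultimately have "card T \<le> card (cosets (vbox S E) (vbox S E'))"
    using incongruent_card_le(2)[of "vbox S E'" "b ` T" "vbox S E"] bS 3 by (auto simp: card_image)
  moreover have "card T = resid_card u" using transversal_card[OF g(2) T] r by simp
  ultimately show "card (cosets (vbox S E) (vbox S E')) = resid_card u" using 3 by simp
qed

text \<open>Unit steps, one place at a time. Equality is conditional on full index of every
  intermediate step, so that one induction serves both for finite \<open>S\<close>, where weak
  approximation supplies this, and for all finite places, where it has to wait for strong
  approximation.\<close>

lemma box_index:
  assumes S: "S \<subseteq> places" and T: "finite T" "T \<subseteq> S"
    and E: "\<And>v. v \<in> S \<Longrightarrow> E v \<le> E' v" "\<And>v. v \<in> S \<Longrightarrow> v \<notin> T \<Longrightarrow> E v = E' v"
  shows "finite (cosets (vbox S E) (vbox S E'))"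
    "card (cosets (vbox S E) (vbox S E')) \<le> (\<Prod>v\<in>T. resid_card v ^ nat (E' v - E v))"
    "(\<And>F u. u \<in> T \<Longrightarrow> (\<And>v. v \<in> S \<Longrightarrow> E v \<le> F v) \<Longrightarrow> (\<And>v. v \<in> S \<Longrightarrow> F v \<le> E' v) \<Longrightarrow> F u < E' u \<Longrightarrow>
        card (cosets (vbox S F) (vbox S (F(u := F u + 1)))) = resid_card u)
      \<Longrightarrow> card (cosets (vbox S E) (vbox S E')) = (\<Prod>v\<in>T. resid_card v ^ nat (E' v - E v))"
proof -
  \<comment> \<open>The condition passes from \<open>E\<close> to any larger lower bound, as needed
    when the induction replaces \<open>E\<close> by \<open>F\<close>.\<close>
  define step where "step E = (\<forall>F. \<forall>u\<in>T. (\<forall>v\<in>S. E v \<le> F v) \<longrightarrow> (\<forall>v\<in>S. F v \<le> E' v) \<longrightarrow> F u < E' u \<longrightarrow>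
    card (cosets (vbox S F) (vbox S (F(u := F u + 1)))) = resid_card u)" for E
  have "finite (cosets (vbox S E) (vbox S E')) \<and>
    card (cosets (vbox S E) (vbox S E')) \<le> (\<Prod>v\<in>T. resid_card v ^ nat (E' v - E v)) \<and>
    (step E \<longrightarrow> card (cosets (vbox S E) (vbox S E')) = (\<Prod>v\<in>T. resid_card v ^ nat (E' v - E v)))"
    using E
  proof (induction "\<Sum>v\<in>T. nat (E' v - E v)" arbitrary: E)
    case 0
    then have "\<forall>v\<in>T. nat (E' v - E v) = 0" using T(1) by simp
    then have eq: "\<forall>v\<in>S. E v = E' v" using 0 T by (metis diff_gt_0_iff_gt nat_0_iff not_less antisym subsetD)
    then have b: "vbox S E = vbox S E'" by (intro box_cong) simp
    have g: "add_subgroup (vbox S E')" using S box_subgroup by blast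
    have "a +o vbox S E' = 0 +o vbox S E'" if "a \<in> vbox S E'" for a
      by (simp only: coset_eq_iff[OF g] diff_zero that)
    then have "cosets (vbox S E') (vbox S E') = {0 +o vbox S E'}"
      using add_subgroupD(1)[OF g] unfolding cosets_def by auto
    then show ?case using b eq T by (auto simp: subset_iff)
  next
    case (Suc n)
    have "(\<Sum>v\<in>T. nat (E' v - E v)) \<noteq> 0" using Suc.hyps(2) by simp
    from sum.not_neutral_contains_not_neutral[OF this]
    obtain u where u: "u \<in> T" "nat (E' u - E u) \<noteq> 0" by blast
    define F where "F = E(u := E u + 1)"
    have uS: "u \<in> S" using u T by blast
    have Fu: "E' u - F u = E' u - E u - 1" by (simp add: F_def)
    have r: "(\<Sum>v\<in>T. nat (E' v - E v)) = nat (E' u - E u) + (\<Sum>v\<in>T - {u}. nat (E' v - E v))"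
      "(\<Sum>v\<in>T. nat (E' v - F v)) = nat (E' u - F u) + (\<Sum>v\<in>T - {u}. nat (E' v - F v))"
      "(\<Prod>v\<in>T. resid_card v ^ nat (E' v - E v)) =
         resid_card u ^ nat (E' u - E u) * (\<Prod>v\<in>T - {u}. resid_card v ^ nat (E' v - E v))"
      "(\<Prod>v\<in>T. resid_card v ^ nat (E' v - F v)) =
         resid_card u ^ nat (E' u - F u) * (\<Prod>v\<in>T - {u}. resid_card v ^ nat (E' v - F v))"
      using u T(1) by (simp_all add: sum.remove prod.remove)
    have s: "nat (E' u - E u) = Suc (nat (E' u - F u))" using u Fu by auto
    have rest: "(\<Sum>v\<in>T - {u}. nat (E' v - F v)) = (\<Sum>v\<in>T - {u}. nat (E' v - E v))"
      "(\<Prod>v\<in>T - {u}. resid_card v ^ nat (E' v - F v)) = (\<Prod>v\<in>T - {u}. resid_card v ^ nat (E' v - E v))"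
      by (auto simp: F_def intro!: sum.cong prod.cong)
    have n: "n = (\<Sum>v\<in>T. nat (E' v - F v))" using Suc.hyps(2) r(1,2) s rest(1) by simp
    have F: "F v \<le> E' v" if "v \<in> S" for v using Suc.prems(1)[OF that] u by (auto simp: F_def)
    have F': "F v = E' v" if "v \<in> S" "v \<notin> T" for v using Suc.prems(2)[OF that] u that by (auto simp: F_def)
    have EF: "E v \<le> F v" for v by (simp add: F_def)
    have g: "add_subgroup (vbox S E)" "add_subgroup (vbox S F)" "add_subgroup (vbox S E')"
      using S box_subgroup by auto
    have sub: "vbox S E' \<subseteq> vbox S F" "vbox S F \<subseteq> vbox S E"
      using F EF box_mono by meson+
    note IH = Suc.hyps(1)[OF n F F']
    note st = box_step(3,4)[OF S uS, of E, folded F_def]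
    note tw = index_tower[OF g sub]
    have P: "(\<Prod>v\<in>T. resid_card v ^ nat (E' v - E v)) = resid_card u * (\<Prod>v\<in>T. resid_card v ^ nat (E' v - F v))"
      unfolding r(3,4) s rest(2) by simp
    have "finite (cosets (vbox S E) (vbox S E'))" by (rule tw(2)[OF st(1) IH[THEN conjunct1]])
    moreover have "card (cosets (vbox S E) (vbox S E')) \<le> (\<Prod>v\<in>T. resid_card v ^ nat (E' v - E v))"
      unfolding tw(1) P by (intro mult_le_mono st(2) IH[THEN conjunct2, THEN conjunct1])
    moreover have "card (cosets (vbox S E) (vbox S E')) = (\<Prod>v\<in>T. resid_card v ^ nat (E' v - E v))" if st: "step E"
    proof -
      have "step F" unfolding step_def
      proof (intro allI ballI impI)
        fix G w assume "w \<in> T" "\<forall>v\<in>S. F v \<le> G v" "\<forall>v\<in>S. G v \<le> E' v" "G w < E' w"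
        moreover then have "\<forall>v\<in>S. E v \<le> G v" using EF order_trans by blast
        ultimately show "card (cosets (vbox S G) (vbox S (G(w := G w + 1)))) = resid_card w"
          using st unfolding step_def by blast
      qed
      then have IHc: "card (cosets (vbox S F) (vbox S E')) = (\<Prod>v\<in>T. resid_card v ^ nat (E' v - F v))"
        using IH by blast
      have "card (cosets (vbox S E) (vbox S F)) = resid_card u"
        using st u uS Suc.prems(1) unfolding step_def F_def by auto
      then show ?thesis unfolding tw(1) P IHc by simp
    qed
    ultimately show ?case by blast
  qed
  then show "finite (cosets (vbox S E) (vbox S E'))"
    "card (cosets (vbox S E) (vbox S E')) \<le> (\<Prod>v\<in>T. resid_card v ^ nat (E' v - E v))"
    "(\<And>F u. u \<in> T \<Longrightarrow> (\<And>v. v \<in> S \<Longrightarrow> E v \<le> F v) \<Longrightarrow> (\<And>v. v \<in> S \<Longrightarrow> F v \<le> E' v) \<Longrightarrow> F u < E' u \<Longrightarrow>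
        card (cosets (vbox S F) (vbox S (F(u := F u + 1)))) = resid_card u)
      \<Longrightarrow> card (cosets (vbox S E) (vbox S E')) = (\<Prod>v\<in>T. resid_card v ^ nat (E' v - E v))"
    unfolding step_def by blast+
qed

lemma box_index_finite_places:
  assumes "S \<subseteq> places" "finite S" "\<And>v. v \<in> S \<Longrightarrow> E v \<le> E' v"
  shows "card (cosets (vbox S E) (vbox S E')) = (\<Prod>v\<in>S. resid_card v ^ nat (E' v - E v))"
  using assms by (intro box_index(3)) (auto intro: box_step(5))

text \<open>For a finite set \<open>S\<close> of zeros of \<open>x\<close>, the elements integral at
  \<open>S\<close> have index at least \<open>2 ^ card S\<close> modulo \<open>x\<close>, while
  \<open>finite_index_scale\<close> bounds this index independently of \<open>S\<close>.\<close>

lemma finite_zeros: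
  assumes "x \<noteq> 0"
  shows "finite {v. place v \<and> v x > 0}"
proof -
  obtain M where M: "\<And>G. add_subgroup G \<Longrightarrow> (\<forall>a\<in>G. x * a \<in> G) \<Longrightarrow>
    finite (cosets G (x *o G)) \<and> card (cosets G (x *o G)) \<le> M"
    using finite_index_scale[OF assms] by blast
  have "card S \<le> M" if S: "finite S" "S \<subseteq> {v. place v \<and> v x > 0}" for S
  proof -
    have SP: "S \<subseteq> places" using S by blast
    have "x * a \<in> vbox S (\<lambda>_. 0)" if "a \<in> vbox S (\<lambda>_. 0)" for a
      using that S val_ge_mult[of _ 0 x 0 a] by (auto simp: vbox_def val_ge_def subset_iff)
    then have "card (cosets (vbox S (\<lambda>_. 0)) (x *o vbox S (\<lambda>_. 0))) \<le> M"
      using M box_subgroup[OF SP] by blast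
    moreover have "card (cosets (vbox S (\<lambda>_. 0)) (x *o vbox S (\<lambda>_. 0))) = (\<Prod>v\<in>S. resid_card v ^ nat (v x - 0))"
      unfolding box_scale[OF SP assms] using S
      by (subst box_index_finite_places[OF SP S(1)]) (auto simp: subset_iff less_imp_le)
    moreover have "(\<Prod>v\<in>S. 2) \<le> (\<Prod>v\<in>S. resid_card v ^ nat (v x - 0))"
    proof (rule prod_mono)
      fix v assume "v \<in> S"
      then have "place v" "nat (v x - 0) \<noteq> 0" using S by auto
      then show "0 \<le> (2::nat) \<and> 2 \<le> resid_card v ^ nat (v x - 0)"
        using resid_card_ge_2[of v] self_le_power[of "resid_card v" "nat (v x - 0)"] by linarith
    qed
    ultimately have "2 ^ card S \<le> M" by simp
    then show ?thesis using less_exp[of "card S"] by linarith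
  qed
  then show ?thesis by (intro finite_if_finite_subsets_card_bdd[THEN conjunct1]) blast
qed

lemma finite_support:
  assumes "x \<noteq> 0"
  shows "finite {v. place v \<and> v x \<noteq> 0}"
proof -
  have "{v. place v \<and> v x \<noteq> 0} \<subseteq> {v. place v \<and> v x > 0} \<union> {v. place v \<and> v (inverse x) > 0}"
  proof
    fix v assume "v \<in> {v. place v \<and> v x \<noteq> 0}"
    then show "v \<in> {v. place v \<and> v x > 0} \<union> {v. place v \<and> v (inverse x) > 0}"
      using place_inverse[of v x] assms by (cases "v x > 0") auto
  qed
  then show ?thesis using finite_zeros[OF assms] finite_zeros[of "inverse x"] assms
    by (auto intro: finite_subset)
qed

end

section \<open>Existence of places\<close>

text \<open>The situation that Zorn's lemma produces. As in Chevalley's extension theorem,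
  maximality with respect to avoiding the inverse of \<open>y\<close> yields a valuation
  ring.\<close>

locale maximal_subring = subring_set F for F :: "'a::field set" +
  fixes y :: 'a
  assumes y: "y \<in> F" "inverse y \<notin> F"
    and maximal: "\<And>G. subring_set G \<Longrightarrow> F \<subseteq> G \<Longrightarrow> inverse y \<notin> G \<Longrightarrow> G = F"
begin

lemma y_nonzero: "y \<noteq> 0"
  using y by auto

text \<open>The ring \<open>F[x]\<close> is strictly larger than \<open>F\<close>, so maximality
  forces the inverse of \<open>y\<close> into it.\<close>

lemma inverse_in_extension:
  assumes "x \<notin> F"
  shows "\<exists>p\<in>polys_over F. poly p x = inverse y"
proof (rule ccontr)
  assume c: "\<not> ?thesis"
  define G where "G = {poly p x | p. p \<in> polys_over F}"
  have G: "subring_set G"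
  proof unfold_locales
    show "0 \<in> G" "1 \<in> G" unfolding G_def
      using polys_over_ring(1,2) poly_0[of x, symmetric] poly_1[of x, symmetric] by blast+
    fix a b assume "a \<in> G" "b \<in> G"
    then obtain p r where pr: "a = poly p x" "b = poly r x" "p \<in> polys_over F" "r \<in> polys_over F"
      unfolding G_def by blast
    have "a - b = poly (p - r) x" "a * b = poly (p * r) x" using pr by simp_all
    then show "a - b \<in> G" "a * b \<in> G" unfolding G_def using polys_over_ring(4,5)[OF pr(3,4)] by blast+
  qed
  have FG: "F \<subseteq> G"
  proof
    fix a assume "a \<in> F"
    then have "monom a 0 \<in> polys_over F" "a = poly (monom a 0) x"
      using polys_over_ring(6) by (auto simp: poly_monom)
    then show "a \<in> G" unfolding G_def by blast
  qed
  have "monom 1 1 \<in> polys_over F" "x = poly (monom 1 1) x"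
    using polys_over_ring(6) F01 by (auto simp: poly_monom)
  then have "x \<in> G" unfolding G_def by blast
  moreover have "inverse y \<notin> G" using c unfolding G_def by force
  ultimately show False using maximal[OF G FG] assms by blast
qed

text \<open>If \<open>w = 1 + y * c\<close> were not invertible in \<open>F\<close>, the inverse of
  \<open>y\<close> would be a polynomial in the inverse of \<open>w\<close>. Clearing denominators
  by \<open>w ^ k\<close>, which is 1 modulo \<open>y\<close>, would bring the inverse of
  \<open>y\<close> into \<open>F\<close>.\<close>

lemma one_plus_unit:
  assumes c: "c \<in> F"
  shows "1 + y * c \<noteq> 0" "inverse (1 + y * c) \<in> F"
proof -
  define w where "w = 1 + y * c"
  have wF: "w \<in> F" unfolding w_def by (intro Fadd Fmult F01 y c)
  show w0: "1 + y * c \<noteq> 0"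
  proof
    assume "1 + y * c = 0"
    then have "y * c = - 1" by (simp add: add_eq_0_iff)
    then have "y * (- c) = 1" by simp
    then have "inverse y = - c" by (rule inverse_unique)
    then show False using Fminus[OF c] y by simp
  qed
  have pow: "\<exists>d\<in>F. w ^ k = 1 + y * d" for k
  proof (induction k)
    case 0 then show ?case using F01 by (intro bexI[of _ 0]) auto
  next
    case (Suc k)
    then obtain d where d: "d \<in> F" "w ^ k = 1 + y * d" by blast
    then have "w ^ Suc k = 1 + y * (c + d + y * c * d)" by (simp add: w_def algebra_simps)
    moreover have "c + d + y * c * d \<in> F" by (intro Fadd Fmult d c y)
    ultimately show ?case by blast
  qed
  have "inverse w \<in> F"
  proof (rule ccontr)
    assume "inverse w \<notin> F"
    then obtain p where p: "p \<in> polys_over F" "poly p (inverse w) = inverse y"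
      using inverse_in_extension by blast
    define k where "k = degree p"
    obtain d where d: "d \<in> F" "w ^ k = 1 + y * d" using pow by blast
    have w: "w \<noteq> 0" using w0 by (simp add: w_def)
    have "w ^ k * inverse y = (\<Sum>i\<le>k. coeff p i * w ^ (k - i))"
    proof -
      have "w ^ k * inverse w ^ i = w ^ (k - i)" if "i \<le> k" for i
        using w that by (simp add: power_inverse power_diff divide_inverse)
      then have "w ^ k * poly p (inverse w) = (\<Sum>i\<le>k. coeff p i * w ^ (k - i))"
        unfolding poly_altdef k_def[symmetric] sum_distrib_left by (intro sum.cong) (auto simp: ac_simps)
      then show ?thesis using p by simp
    qed
    moreover have "\<dots> \<in> F" using p(1) by (intro Fsum Fmult Fpower wF) (auto simp: polys_over_iff)
    ultimately have "w ^ k * inverse y \<in> F" by simp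
    moreover have "w ^ k * inverse y = inverse y + d" using d y_nonzero by (simp add: algebra_simps)
    ultimately have "inverse y + d \<in> F" by simp
    then have "(inverse y + d) - d \<in> F" using Fdiff d by blast
    then show False using y by simp
  qed
  then show "inverse (1 + y * c) \<in> F" by (simp add: w_def)
qed

text \<open>A polynomial over \<open>F\<close> with value \<open>1 / y\<close> at \<open>x\<close>,
  written without inverses; the bound \<open>m\<close> on its degree is the quantity for the
  descent.\<close>

definition relation :: "'a \<Rightarrow> nat \<Rightarrow> bool" where
  "relation x m \<longleftrightarrow> (\<exists>a. (\<forall>i. a i \<in> F) \<and> 1 = y * (\<Sum>i\<le>m. a i * x ^ i))"

lemma relation_exists:
  assumes "x \<notin> F"
  shows "\<exists>m. relation x m"
proof -
  obtain p where p: "p \<in> polys_over F" "poly p x = inverse y" using inverse_in_extension[OF assms] by blast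
  have "1 = y * poly p x" using p y_nonzero by simp
  then have "relation x (degree p)" unfolding relation_def poly_altdef
    using p(1) by (intro exI[of _ "coeff p"]) (auto simp: polys_over_iff)
  then show ?thesis by blast
qed

lemma not_relation_0: "\<not> relation x 0"
proof
  assume "relation x 0"
  then obtain a :: "nat \<Rightarrow> 'a" where "a 0 \<in> F" "1 = y * a 0" unfolding relation_def by auto
  then have "inverse y = a 0" by (intro inverse_unique) simp
  then show False using y \<open>a 0 \<in> F\<close> by simp
qed

text \<open>Chevalley's exchange: the relation for the inverse of \<open>x\<close> is solved for 1,
  its constant term being absorbed into the unit \<open>w\<close>, and multiplied by
  \<open>x ^ m\<close>. This expresses \<open>x ^ m\<close> through lower powers, which replace the
  top term of the first relation.\<close>

lemma relation_lower:
  assumes "x \<noteq> 0" "relation x m" "relation (inverse x) n" "n \<le> m"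
  shows "relation x (m - 1)"
proof -
  obtain a where a: "\<And>i. a i \<in> F" "1 = y * (\<Sum>i\<le>m. a i * x ^ i)" using assms(2) unfolding relation_def by blast
  obtain b where b: "\<And>i. b i \<in> F" "1 = y * (\<Sum>i\<le>n. b i * inverse x ^ i)"
    using assms(3) unfolding relation_def by blast
  obtain k where m: "m = Suc k" using assms(2) not_relation_0 by (cases m) auto
  define w where "w = 1 + y * (- b 0)"
  have w: "w \<noteq> 0" "inverse w \<in> F" using one_plus_unit[of "- b 0"] Fminus b(1) by (auto simp: w_def)
  \<comment> \<open>Padded by zeros up to \<open>m\<close>; since no index exceeds \<open>m\<close>,
    multiplication by \<open>x ^ m\<close> leaves only nonnegative exponents.\<close>
  define c where "c j = (if 1 \<le> j \<and> j \<le> n then b j * inverse w else 0)" for j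
  have cF: "c j \<in> F" for j unfolding c_def using F01 Fmult b(1) w(2) by simp
  have "1 - y * b 0 = y * (\<Sum>j\<in>{1..n}. b j * inverse x ^ j)"
  proof -
    have "(\<Sum>i\<le>n. b i * inverse x ^ i) = b 0 + (\<Sum>j\<in>{1..n}. b j * inverse x ^ j)"
      by (simp add: sum.atMost_shift sum.atLeast1_atMost_eq)
    then show ?thesis using b(2) by (simp add: algebra_simps)
  qed
  then have "w = y * (\<Sum>j\<in>{1..n}. b j * inverse x ^ j)" by (simp add: w_def)
  moreover have "1 = inverse w * w" using w(1) by simp
  ultimately have "1 = inverse w * (y * (\<Sum>j\<in>{1..n}. b j * inverse x ^ j))" by metis
  also have "\<dots> = y * (\<Sum>j\<in>{1..n}. c j * inverse x ^ j)"
    by (simp add: sum_distrib_left c_def ac_simps)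
  also have "(\<Sum>j\<in>{1..n}. c j * inverse x ^ j) = (\<Sum>j\<in>{1..m}. c j * inverse x ^ j)"
    using assms(4) by (intro sum.mono_neutral_left) (auto simp: c_def)
  finally have "x ^ m * 1 = x ^ m * (y * (\<Sum>j\<in>{1..m}. c j * inverse x ^ j))" by (rule arg_cong)
  also have "\<dots> = y * (\<Sum>j\<in>{1..m}. c j * (x ^ m * inverse x ^ j))"
    by (simp add: sum_distrib_left ac_simps)
  also have "(\<Sum>j\<in>{1..m}. c j * (x ^ m * inverse x ^ j)) = (\<Sum>i<m. c (m - i) * x ^ i)"
    by (rule sum.reindex_bij_witness[of _ "\<lambda>i. m - i" "\<lambda>j. m - j"])
       (use assms(1) in \<open>auto simp: power_diff power_inverse divide_inverse\<close>)
  finally have xm: "x ^ m = y * (\<Sum>i<m. c (m - i) * x ^ i)" by simp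
  have "1 = y * ((\<Sum>i<m. a i * x ^ i) + a m * x ^ m)"
    using a(2) by (simp add: lessThan_Suc_atMost[symmetric] del: sum.atMost_Suc)
  also have "\<dots> = y * (\<Sum>i<m. (a i + a m * y * c (m - i)) * x ^ i)"
    unfolding xm by (simp add: sum.distrib sum_distrib_left algebra_simps)
  finally show ?thesis unfolding relation_def m
    by (intro exI[of _ "\<lambda>i. a i + a m * y * c (m - i)"])
       (auto simp: m lessThan_Suc_atMost intro!: Fadd Fmult a y cF)
qed

text \<open>Descent on \<open>m + n\<close> by shortening the longer relation; a relation of degree
  0 would make \<open>y\<close> invertible in \<open>F\<close>.\<close>

lemma no_two_relations:
  assumes "x \<noteq> 0"
  shows "\<not> (relation x m \<and> relation (inverse x) n)"
  using assms
proof (induction "m + n" arbitrary: m n x)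
  case 0
  then show ?case using not_relation_0 by simp
next
  case (Suc k)
  show ?case
  proof
    assume r: "relation x m \<and> relation (inverse x) n"
    then have mn: "m \<noteq> 0" "n \<noteq> 0" using not_relation_0 by (metis)+
    show False
    proof (cases "n \<le> m")
      case True
      then have "relation x (m - 1)" using relation_lower r Suc.prems by blast
      moreover have "k = (m - 1) + n" using Suc.hyps(2) mn by simp
      ultimately show False using Suc.hyps(1)[of "m - 1" n x] Suc.prems r by blast
    next
      case False
      then have "relation (inverse x) (n - 1)" using relation_lower[of "inverse x" n m] r Suc.prems by simp
      moreover have "k = m + (n - 1)" using Suc.hyps(2) mn by simp
      ultimately show False using Suc.hyps(1)[of m "n - 1" x] Suc.prems r by blast
    qed
  qed
qed

lemma valuation_ring: "x \<in> F \<or> inverse x \<in> F"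
proof (cases "x = 0")
  case True then show ?thesis using F01 by simp
next
  case False
  then show ?thesis using no_two_relations relation_exists by blast
qed

end

context global_function_field
begin

interpretation Fq: subring_set Fq by (rule Fq_subring)

text \<open>Zorn's lemma gives a valuation ring \<open>V\<close> in which \<open>y\<close> is not a
  unit, but a priori its value group is arbitrary. It is discrete because the index of
  \<open>z V\<close> in \<open>V\<close> is finite, multiplicative, and at least 2 for nonunits: a
  nonunit \<open>p\<close> of least index is a uniformizer.\<close>

lemma place_exists:
  assumes "y \<notin> Fq"
  shows "\<exists>v. place v \<and> v y > 0"
proof -
  define S where "S = {V. subring_set V \<and> Fq \<subseteq> V \<and> y \<in> V \<and> inverse y \<notin> V}"
  have y0: "y \<noteq> 0" using assms Fq_subfield by auto
  have ne: "S \<noteq> {}"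
  proof -
    define G where "G = {poly p y | p. p \<in> polys_over Fq}"
    have "subring_set G"
    proof unfold_locales
      show "0 \<in> G" "1 \<in> G" unfolding G_def
        using Fq.polys_over_ring(1,2) poly_0[of y, symmetric] poly_1[of y, symmetric] by blast+
      fix a b assume "a \<in> G" "b \<in> G"
      then obtain p r where pr: "a = poly p y" "b = poly r y" "p \<in> polys_over Fq" "r \<in> polys_over Fq"
        unfolding G_def by blast
      have "a - b = poly (p - r) y" "a * b = poly (p * r) y" using pr by simp_all
      then show "a - b \<in> G" "a * b \<in> G" unfolding G_def using Fq.polys_over_ring(4,5)[OF pr(3,4)] by blast+
    qed
    moreover have "Fq \<subseteq> G"
    proof
      fix a assume "a \<in> Fq"
      then have "monom a 0 \<in> polys_over Fq" "a = poly (monom a 0) y"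
        using Fq.polys_over_ring(6) by (auto simp: poly_monom)
      then show "a \<in> G" unfolding G_def by blast
    qed
    moreover have "y \<in> G"
    proof -
      have "monom 1 1 \<in> polys_over Fq" "y = poly (monom 1 1) y"
        using Fq.polys_over_ring(6) Fq_subfield by (auto simp: poly_monom)
      then show ?thesis unfolding G_def by blast
    qed
    \<comment> \<open>Otherwise \<open>y\<close> would be a root of a polynomial over
      \<open>Fq\<close> with constant term \<open>- 1\<close>, hence an element of
      \<open>Fq\<close>.\<close>
    moreover have "inverse y \<notin> G"
    proof
      assume "inverse y \<in> G"
      then obtain p where p: "p \<in> polys_over Fq" "inverse y = poly p y" unfolding G_def by blast
      define r where "r = monom 1 1 * p - 1"
      have "r \<in> polys_over Fq" unfolding r_def
        by (intro Fq.polys_over_ring p Fq_subfield)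
      moreover have "poly r y = 0" unfolding r_def using p(2)[symmetric] y0 by (simp add: poly_monom)
      moreover have "r \<noteq> 0"
      proof
        assume "r = 0"
        then have "poly r 0 = 0" by simp
        then show False unfolding r_def by (simp add: poly_monom)
      qed
      ultimately have "algebraic_over Fq y" unfolding algebraic_over_def by blast
      then show False using Fq_alg_closed assms by blast
    qed
    ultimately show ?thesis unfolding S_def by blast
  qed
  have "\<exists>V\<in>S. \<forall>X\<in>S. V \<subseteq> X \<longrightarrow> X = V"
  proof (rule subset_Zorn_nonempty[OF ne])
    fix C assume C: "C \<noteq> {}" "subset.chain S C"
    then have CS: "\<And>V. V \<in> C \<Longrightarrow> V \<in> S" and tot: "\<And>V W. V \<in> C \<Longrightarrow> W \<in> C \<Longrightarrow> V \<subseteq> W \<or> W \<subseteq> V"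
      by (auto simp: subset.chain_def)
    obtain V0 where V0: "V0 \<in> C" using C by blast
    have "subring_set (\<Union>C)"
    proof unfold_locales
      show "0 \<in> \<Union>C" "1 \<in> \<Union>C" using V0 CS[OF V0] subring_set.F01 unfolding S_def by blast+
      fix a b assume "a \<in> \<Union>C" "b \<in> \<Union>C"
      then obtain V where V: "V \<in> C" "a \<in> V" "b \<in> V" using tot by blast
      then have "a - b \<in> V" "a * b \<in> V" using CS[OF V(1)] subring_set.Fdiff subring_set.Fmult
        unfolding S_def by blast+
      then show "a - b \<in> \<Union>C" "a * b \<in> \<Union>C" using V by blast+
    qed
    then show "\<Union>C \<in> S" using CS V0 unfolding S_def by blast
  qed
  then obtain V where V: "V \<in> S" "\<And>X. X \<in> S \<Longrightarrow> V \<subseteq> X \<Longrightarrow> X = V" by blast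
  have FqV: "Fq \<subseteq> V" and yV: "y \<in> V" using V(1) by (auto simp: S_def)
  interpret V: subring_set V using V(1) by (simp add: S_def)
  interpret V: maximal_subring V y
    by unfold_locales (use V FqV yV in \<open>auto simp: S_def\<close>)
  have fin: "finite (cosets V (z *o V))" if "z \<in> V" "z \<noteq> 0" for z
    using finite_index_scale[OF that(2)] V.add_subgroup V.Fmult that(1) by blast
  define ix where "ix z = card (cosets V (z *o V))" for z
  have sub: "z *o V \<subseteq> V" if "z \<in> V" for z using that V.Fmult by (auto simp: elt_set_times_def)
  have ix_mult: "ix (a * c) = ix a * ix c" if "a \<in> V" "c \<in> V" "a \<noteq> 0" for a c
  proof -
    have e: "(a * c) *o V = a *o (c *o V)" by (simp add: set_times_rearrange2)
    have "c *o V \<subseteq> V" using sub that by blast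
    then have "(a * c) *o V \<subseteq> a *o V" unfolding e by (auto simp: elt_set_times_def)
    from index_tower(1)[OF V.add_subgroup add_subgroup_scale[OF V.add_subgroup]
        add_subgroup_scale[OF V.add_subgroup] this sub[OF that(1)]]
    show ?thesis unfolding ix_def e index_scale(1)[OF that(3) add_subgroup_scale[OF V.add_subgroup]] .
  qed
  have ix_pos: "ix z > 0" if "z \<in> V" "z \<noteq> 0" for z
    unfolding ix_def by (rule index_pos[OF V.add_subgroup fin[OF that]])
  have ix_2: "ix z \<ge> 2" if z: "z \<in> V" "z \<noteq> 0" "inverse z \<notin> V" for z
  proof -
    have "incongruent (z *o V) {0, 1}"
    proof -
      have "1 \<notin> z *o V" using mem_scale_iff[OF z(2), of 1 V] z(3) by (simp add: divide_inverse)
      moreover then have "0 - 1 \<notin> z *o V" using add_subgroupD(3)[OF add_subgroup_scale[OF V.add_subgroup], of "- 1" z] by auto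
      ultimately show ?thesis by (auto simp: incongruent_def)
    qed
    then have "card {0, 1 :: 'k} \<le> ix z" unfolding ix_def
      by (intro incongruent_card_le(2)[OF add_subgroup_scale[OF V.add_subgroup]] fin z) (auto simp: V.F01)
    then show ?thesis by simp
  qed
  define nonunit where "nonunit z \<longleftrightarrow> z \<in> V \<and> z \<noteq> 0 \<and> inverse z \<notin> V" for z
  have "nonunit y" using V.y y0 by (simp add: nonunit_def)
  then obtain p where p: "nonunit p" "\<And>z. nonunit z \<Longrightarrow> ix p \<le> ix z"
    using ex_has_least_nat[of nonunit y ix] by blast
  have pV: "p \<in> V" "p \<noteq> 0" "inverse p \<notin> V" using p(1) by (auto simp: nonunit_def)
  \<comment> \<open>If \<open>p\<close> did not divide \<open>z\<close>, then \<open>z\<close> would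
    be a proper divisor of \<open>p\<close> and have smaller index.\<close>
  have pdiv: "z / p \<in> V" if z: "nonunit z" for z
  proof (rule ccontr)
    assume n: "z / p \<notin> V"
    have z': "z \<in> V" "z \<noteq> 0" using z by (auto simp: nonunit_def)
    have "inverse (z / p) \<in> V" using V.valuation_ring n by blast
    then have c: "p / z \<in> V" by (simp add: field_simps)
    have "inverse (p / z) = z / p" by (simp add: field_simps)
    then have "ix (p / z) \<ge> 2" using ix_2[OF c] z' pV n by simp
    moreover have "ix p = ix z * ix (p / z)" using ix_mult[OF z'(1) c z'(2)] z' by simp
    ultimately have "ix z < ix p" using ix_pos[OF z'] by simp
    then show False using p(2)[OF z] by simp
  qed
  define U where "U u \<longleftrightarrow> u \<noteq> 0 \<and> u \<in> V \<and> inverse u \<in> V" for u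
  have U_mult: "U (a * b)" if "U a" "U b" for a b using that V.Fmult by (simp add: U_def)
  have U_inv: "U (inverse a)" if "U a" for a using that by (simp add: U_def)
  \<comment> \<open>Each division of a nonunit by \<open>p\<close> at least halves the index, so the
    process ends at a unit.\<close>
  have dec: "\<exists>n. U (z / p ^ n)" if "z \<in> V" "z \<noteq> 0" for z
    using that
  proof (induction "ix z" arbitrary: z rule: less_induct)
    case less
    show ?case
    proof (cases "U z")
      case True then show ?thesis by (intro exI[of _ 0]) simp
    next
      case False
      then have "nonunit z" using less.prems by (simp add: U_def nonunit_def)
      then have zp: "z / p \<in> V" "z / p \<noteq> 0" using pdiv pV less.prems by auto
      have "ix z = ix p * ix (z / p)" using ix_mult[OF pV(1) zp(1) pV(2)] pV by simp
      then have "ix (z / p) < ix z" using ix_2[OF pV] ix_pos[OF zp] by simp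
      from less.hyps[OF this zp] obtain n where "U (z / p / p ^ n)" by blast
      then show ?thesis by (intro exI[of _ "Suc n"]) (simp add: field_simps)
    qed
  qed
  have ex: "\<exists>n::int. U (a / p powi n)" if a0: "a \<noteq> 0" for a
  proof (cases "a \<in> V")
    case True
    then obtain n where "U (a / p ^ n)" using dec a0 by blast
    then show ?thesis by (intro exI[of _ "int n"]) simp
  next
    case False
    then have "inverse a \<in> V" using V.valuation_ring by blast
    then obtain n where "U (inverse a / p ^ n)" using dec[of "inverse a"] a0 by auto
    then have "U (inverse (inverse a / p ^ n))" by (rule U_inv)
    then have "U (a / p powi (- int n))" by (simp add: power_int_minus field_simps)
    then show ?thesis by blast
  qed
  have not_U: "\<not> U (p powi k)" if "k > 0" for k
  proof
    assume "U (p powi k)"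
    then have "inverse (p ^ nat k) \<in> V" using that by (simp add: U_def power_int_def)
    then have "p ^ (nat k - 1) * inverse (p ^ nat k) \<in> V" using V.Fpower[OF pV(1)] V.Fmult by blast
    moreover have "p ^ nat k = p ^ (nat k - 1) * p" using that by (metis Suc_diff_1 power_Suc2 zero_less_nat_eq)
    then have "p ^ (nat k - 1) * inverse (p ^ nat k) = inverse p" using pV by simp
    ultimately show False using pV by simp
  qed
  have uniq: "n = m" if U: "U (a / p powi n)" "U (a / p powi m)" for a n m
  proof (rule ccontr)
    assume nm: "n \<noteq> m"
    have a: "a \<noteq> 0" using U by (auto simp: U_def)
    have "U ((a / p powi n) * inverse (a / p powi m))" "U ((a / p powi m) * inverse (a / p powi n))"
      using U_mult U_inv U by blast+
    moreover have "(a / p powi n) * inverse (a / p powi m) = p powi (m - n)"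
      "(a / p powi m) * inverse (a / p powi n) = p powi (n - m)"
      using a pV by (simp_all add: power_int_diff field_simps)
    ultimately show False using not_U[of "m - n"] not_U[of "n - m"] nm by (cases "m > n") auto
  qed
  define v where "v a = (if a = 0 then 0 else THE n. U (a / p powi n))" for a
  have vI: "v a = n" if "U (a / p powi n)" for a n
  proof -
    have "a \<noteq> 0" using that by (auto simp: U_def)
    then show ?thesis unfolding v_def using that uniq by (auto intro!: the_equality)
  qed
  have vU: "U (a / p powi v a)" if "a \<noteq> 0" for a using ex[OF that] vI by metis
  have vmult: "v (a * b) = v a + v b" if "a \<noteq> 0" "b \<noteq> 0" for a b
  proof (rule vI)
    have "U ((a / p powi v a) * (b / p powi v b))" using U_mult vU that by blast
    then show "U (a * b / p powi (v a + v b))" using pV by (simp add: power_int_add)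
  qed
  have vpos: "v c \<ge> 0" if cV: "c \<in> V" "c \<noteq> 0" for c
  proof -
    obtain n where "U (c / p ^ n)" using dec cV by blast
    then have "v c = int n" by (intro vI) simp
    then show ?thesis by simp
  qed
  have vp: "v (p powi n) = n" for n by (intro vI) (use pV V.F01 in \<open>simp add: U_def\<close>)
  have vadd1: "v a \<le> v (a + b)" if ab: "a \<noteq> 0" "b \<noteq> 0" "a + b \<noteq> 0" "v a \<le> v b" for a b
  proof -
    define c where "c = (a + b) / p powi v a"
    have "b / p powi v a = (b / p powi v b) * p ^ nat (v b - v a)"
      using ab(4) pV by (simp add: power_int_diff power_int_def[symmetric] flip: power_int_of_nat)
    moreover have "a / p powi v a \<in> V" "b / p powi v b \<in> V" using vU ab by (auto simp: U_def)
    ultimately have "c \<in> V" unfolding c_def add_divide_distrib using V.Fadd V.Fmult V.Fpower[OF pV(1)] by metis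
    moreover have c0: "c \<noteq> 0" "p powi v a \<noteq> 0" using ab pV by (auto simp: c_def)
    ultimately have "v c \<ge> 0" using vpos by blast
    moreover have "v (c * p powi v a) = v c + v a" using vmult[OF c0] vp by simp
    moreover have "c * p powi v a = a + b" using c0 by (simp add: c_def)
    ultimately show ?thesis by simp
  qed
  have "place v" unfolding is_place_def
  proof (intro conjI allI impI ballI)
    show "v 0 = 0" by (simp add: v_def)
    show "v (a * b) = v a + v b" if "a \<noteq> 0" "b \<noteq> 0" for a b using vmult that by blast
    show "min (v a) (v b) \<le> v (a + b)" if "a \<noteq> 0" "b \<noteq> 0" "a + b \<noteq> 0" for a b
      using vadd1[of a b] vadd1[of b a] that by (cases "v a \<le> v b") (auto simp: add.commute min_def)
    show "v ` (- {0}) = UNIV"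
    proof -
      have "n \<in> v ` (- {0})" for n using vp[of n] pV by (intro image_eqI[of _ _ "p powi n"]) auto
      then show ?thesis by blast
    qed
    show "v c = 0" if "c \<in> Fq" for c
    proof (cases "c = 0")
      case False
      have "c \<in> V" "inverse c \<in> V" using that Fq_subfield(5) FqV by blast+
      then show ?thesis using False by (intro vI) (simp add: U_def)
    qed (simp add: v_def)
  qed
  moreover have "v y > 0"
  proof (rule ccontr)
    assume "\<not> v y > 0"
    then have "v y = 0" using vpos[OF yV y0] by simp
    then have "U y" using vU[OF y0] by simp
    then show False using V.y by (simp add: U_def)
  qed
  ultimately show ?thesis by blast
qed

end

section \<open>Product formula and strong approximation\<close>

lemma card_by_index:
  assumes "add_subgroup G" "add_subgroup H" "H \<subseteq> G" "finite (cosets G H)" "finite H"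
  shows "finite G" "card G = card (cosets G H) * card H"
proof -
  have z: "add_subgroup {0::'a}" by (simp add: add_subgroup_def)
  have s: "{0} \<subseteq> H" using add_subgroupD(1)[OF assms(2)] by simp
  note t = index_tower[OF assms(1,2) z s assms(3), unfolded cosets_zero]
  show "finite G" "card G = card (cosets G H) * card H" using t(1) t(2)[OF assms(4,5)] by simp_all
qed

context global_function_field
begin

interpretation Fq: subring_set Fq by (rule Fq_subring)

text \<open>The inverse of a nonconstant element has a zero by \<open>place_exists\<close>, so the
  element itself has a pole.\<close>

lemma constants: "vbox places (\<lambda>_. 0) = Fq"
proof
  show "Fq \<subseteq> vbox places (\<lambda>_. 0)" unfolding vbox_def using val_ge_Fq by auto
  show "vbox places (\<lambda>_. 0) \<subseteq> Fq"
  proof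
    fix a assume a: "a \<in> vbox places (\<lambda>_. 0)"
    show "a \<in> Fq"
    proof (rule ccontr)
      assume n: "a \<notin> Fq"
      then have "inverse a \<notin> Fq" "a \<noteq> 0" using Fq_subfield(5)[of "inverse a"] Fq_subfield(1) by auto
      then obtain v where v: "place v" "v (inverse a) > 0" using place_exists by blast
      then have "v a < 0" using place_inverse[OF v(1) \<open>a \<noteq> 0\<close>] by simp
      then show False using a v \<open>a \<noteq> 0\<close> by (auto simp: vbox_def val_ge_def)
    qed
  qed
qed

text \<open>The upper half of Riemann-Roch: starting from the constants, each additional pole order
  multiplies the size by at most the cardinality of the residue field.\<close>

lemma finite_vbox:
  assumes T: "finite T" "T \<subseteq> places" and E: "\<And>v. place v \<Longrightarrow> v \<notin> T \<Longrightarrow> E v = 0"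
  shows "finite (vbox places E)" "card (vbox places E) \<le> (\<Prod>v\<in>T. resid_card v ^ nat (- E v)) * q"
proof -
  \<comment> \<open>The zeros demanded by \<open>E\<close> are dropped; this enlarges the space so
    that it contains the constants.\<close>
  define E0 where "E0 v = (if v \<in> T then min (E v) 0 else 0)" for v
  have sub: "vbox places E \<subseteq> vbox places E0" by (rule box_mono) (use E in \<open>auto simp: E0_def\<close>)
  have sub0: "vbox places (\<lambda>_. 0) \<subseteq> vbox places E0" by (rule box_mono) (auto simp: E0_def)
  note g = box_subgroup[OF subset_refl]
  have i: "finite (cosets (vbox places E0) (vbox places (\<lambda>_. 0)))"
    "card (cosets (vbox places E0) (vbox places (\<lambda>_. 0))) \<le> (\<Prod>v\<in>T. resid_card v ^ nat (0 - E0 v))"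
    by (rule box_index(1,2)[OF subset_refl T]; simp add: E0_def)+
  have "finite (vbox places (\<lambda>_. 0))" using constants Fq_finite by simp
  note c = card_by_index[OF g g sub0 i(1) this]
  show "finite (vbox places E)" using c(1) sub finite_subset by blast
  have "card (vbox places E) \<le> card (vbox places E0)" using sub c(1) card_mono by blast
  also have "\<dots> \<le> (\<Prod>v\<in>T. resid_card v ^ nat (0 - E0 v)) * q"
    unfolding c(2) using i(2) constants by (simp add: q_def)
  also have "(\<Prod>v\<in>T. resid_card v ^ nat (0 - E0 v)) = (\<Prod>v\<in>T. resid_card v ^ nat (- E v))"
    by (intro prod.cong) (auto simp: E0_def min_def)
  finally show "card (vbox places E) \<le> (\<Prod>v\<in>T. resid_card v ^ nat (- E v)) * q" .
qed

text \<open>This is \<open>q\<close> to the degree of the divisor of zeros of \<open>x\<close>; at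
  the inverse of \<open>x\<close> it measures the poles.\<close>

definition zero_norm :: "'k \<Rightarrow> nat" where
  "zero_norm x = (\<Prod>v | place v \<and> v x > 0. resid_card v ^ nat (v x))"

lemma zero_norm_superset:
  assumes "finite T" "{v. place v \<and> v x > 0} \<subseteq> T" "T \<subseteq> places"
  shows "zero_norm x = (\<Prod>v\<in>T. resid_card v ^ nat (v x))"
  unfolding zero_norm_def using assms by (intro prod.mono_neutral_left) auto

lemma zero_norm_inverse:
  assumes "finite T" "{v. place v \<and> v x < 0} \<subseteq> T" "T \<subseteq> places" "x \<noteq> 0"
  shows "zero_norm (inverse x) = (\<Prod>v\<in>T. resid_card v ^ nat (- v x))"
proof -
  have i: "v (inverse x) = - v x" if "place v" for v using place_inverse[OF that assms(4)] .
  have "{v. place v \<and> v (inverse x) > 0} \<subseteq> T"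
  proof
    fix v assume "v \<in> {v. place v \<and> v (inverse x) > 0}"
    then show "v \<in> T" using i[of v] assms(2) by auto
  qed
  then have "zero_norm (inverse x) = (\<Prod>v\<in>T. resid_card v ^ nat (v (inverse x)))"
    by (rule zero_norm_superset[OF assms(1) _ assms(3)])
  also have "\<dots> = (\<Prod>v\<in>T. resid_card v ^ nat (- v x))"
  proof (rule prod.cong[OF refl])
    fix v assume "v \<in> T"
    then show "resid_card v ^ nat (v (inverse x)) = resid_card v ^ nat (- v x)"
      using i[of v] assms(3) by auto
  qed
  finally show ?thesis .
qed

text \<open>Riemann's inequality in disguise: the base-\<open>x\<close> digit sums of length \<open>N\<close>, whose digits represent
  the residues modulo the zeros of \<open>x\<close>, have only the poles of \<open>x\<^bsup>N\<^esup>\<close> and those of the digits.\<close>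
lemma many_digit_sums:
  assumes x: "x \<noteq> 0"
  shows "\<exists>C. finite {v \<in> places. C v \<noteq> 0} \<and> (\<forall>v. C v \<ge> 0) \<and>
    (\<forall>N. zero_norm x ^ N \<le> card (vbox places (\<lambda>v. int N * min 0 (v x) - C v)))"
proof -
  define S where "S = {v. place v \<and> v x > 0}"
  have S: "finite S" "S \<subseteq> places" using finite_zeros[OF x] by (auto simp: S_def)
  define G where "G = vbox S (\<lambda>_. 0)"
  have G: "add_subgroup G" unfolding G_def by (rule box_subgroup[OF S(2)])
  have xG: "x *o G = vbox S (\<lambda>v. 0 + v x)" unfolding G_def by (rule box_scale[OF S(2) x])
  have xG': "x * a \<in> G" if "a \<in> G" for a
    using that val_ge_mult[of _ 0 x 0 a] unfolding G_def by (auto simp: vbox_def val_ge_def S_def)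
  have fi: "finite (cosets G (x *o G))" unfolding xG unfolding G_def
    by (rule box_index(1)[OF S(2) S(1)]) (auto simp: S_def)
  have ci: "card (cosets G (x *o G)) = zero_norm x"
  proof -
    have "card (cosets G (x *o G)) = (\<Prod>v\<in>S. resid_card v ^ nat (0 + v x - 0))" unfolding xG unfolding G_def
      by (rule box_index_finite_places[OF S(2) S(1)]) (auto simp: S_def)
    then show ?thesis by (simp add: zero_norm_def S_def)
  qed
  note xg = add_subgroup_scale[OF G, of x]
  obtain Y where Y: "transversal G (x *o G) Y" using transversal_exists[OF xg] by blast
  have Yc: "finite Y" "card Y = zero_norm x" using transversal_card[OF xg Y] fi ci by auto
  have YG: "Y \<subseteq> G" using Y by (simp add: transversal_def)
  \<comment> \<open>Bounds the pole order of every digit at \<open>v\<close>, and vanishes at almost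
    all places because there are finitely many digits.\<close>
  define C where "C v = (\<Sum>y\<in>Y. \<bar>v y\<bar>)" for v :: "'k place"
  have C0: "C v \<ge> 0" for v by (simp add: C_def sum_nonneg)
  have Cy: "\<bar>v y\<bar> \<le> C v" if "y \<in> Y" for y v
    using member_le_sum[OF that, of "\<lambda>y. \<bar>v y\<bar>"] Yc(1) by (simp add: C_def)
  have Cf: "finite {v \<in> places. C v \<noteq> 0}"
  proof -
    have "{v \<in> places. C v \<noteq> 0} \<subseteq> (\<Union>y\<in>Y - {0}. {v. place v \<and> v y \<noteq> 0})"
    proof
      fix v assume v: "v \<in> {v \<in> places. C v \<noteq> 0}"
      then have "(\<Sum>y\<in>Y. \<bar>v y\<bar>) \<noteq> 0" by (simp add: C_def)
      from sum.not_neutral_contains_not_neutral[OF this] obtain y where y: "y \<in> Y" "v y \<noteq> 0" by auto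
      then have "y \<noteq> 0" using place_0[of v] v by auto
      then show "v \<in> (\<Union>y\<in>Y - {0}. {v. place v \<and> v y \<noteq> 0})" using y v by blast
    qed
    moreover have "finite (\<Union>y\<in>Y - {0}. {v. place v \<and> v y \<noteq> 0})"
      using Yc(1) finite_support by blast
    ultimately show ?thesis using finite_subset by blast
  qed
  have "zero_norm x ^ N \<le> card (vbox places (\<lambda>v. int N * min 0 (v x) - C v))" for N
  proof -
    define D where "D v = int N * min 0 (v x) - C v" for v
    have xy: "val_ge v (D v) (x ^ i * y)" if v: "place v" and y: "y \<in> Y" and i: "i < N" for v y i
    proof (cases "y = 0")
      case False
      have "int i * v x \<ge> int N * min 0 (v x)"
      proof (cases "v x \<ge> 0")
        case True then show ?thesis by simp
      next
        case False then show ?thesis using i by (simp add: mult_right_mono_neg)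
      qed
      moreover have "v y \<ge> - C v" using Cy[OF y, of v] by simp
      ultimately show ?thesis
        using place_mult[OF v _ False, of "x ^ i"] x place_power[OF v x, of i] by (simp add: val_ge_def D_def)
    qed simp
    have im: "(\<lambda>y. \<Sum>i<N. x ^ i * y i) ` ({..<N} \<rightarrow>\<^sub>E Y) \<subseteq> vbox places D"
      unfolding vbox_def by (auto intro!: val_ge_sum xy)
    have inj: "inj_on (\<lambda>y. \<Sum>i<N. x ^ i * y i) ({..<N} \<rightarrow>\<^sub>E Y)"
      by (rule digit_sums_inj[OF x G xG' YG transversal_incongruent[OF xg Y]])
    have fin: "finite (vbox places D)"
    proof (rule finite_vbox(1))
      show "finite ({v. place v \<and> v x \<noteq> 0} \<union> {v \<in> places. C v \<noteq> 0})" using finite_support[OF x] Cf by simp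
    qed (auto simp: D_def)
    have "card ({..<N} \<rightarrow>\<^sub>E Y) \<le> card (vbox places D)" by (rule card_inj_on_le[OF inj im fin])
    moreover have "(\<lambda>v. int N * min 0 (v x) - C v) = D" by (simp add: D_def fun_eq_iff)
    ultimately show ?thesis using Yc by (simp add: card_PiE)
  qed
  then show ?thesis using Cf C0 by blast
qed

text \<open>The \<open>zero_norm x ^ N\<close> digit sums lie in a space whose size is at most a
  constant times the \<open>N\<close>-th power of the norm of the poles, and
  \<open>power_growth\<close> removes the constant. Together with the same estimate for the inverse
  this is the product formula.\<close>

lemma zero_norm_le:
  assumes x: "x \<noteq> 0"
  shows "zero_norm x \<le> zero_norm (inverse x)"
proof -
  obtain C where C: "finite {v \<in> places. C v \<noteq> 0}" "\<And>v. C v \<ge> 0"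
    "\<And>N. zero_norm x ^ N \<le> card (vbox places (\<lambda>v. int N * min 0 (v x) - C v))"
    using many_digit_sums[OF x] by blast
  define T where "T = {v. place v \<and> v x \<noteq> 0} \<union> {v \<in> places. C v \<noteq> 0}"
  have T: "finite T" "T \<subseteq> places" using C(1) finite_support[OF x] by (auto simp: T_def)
  have "zero_norm x ^ N \<le> ((\<Prod>v\<in>T. resid_card v ^ nat (C v)) * q) * zero_norm (inverse x) ^ N" for N
  proof -
    have "zero_norm x ^ N \<le> card (vbox places (\<lambda>v. int N * min 0 (v x) - C v))" by (rule C(3))
    also have "\<dots> \<le> (\<Prod>v\<in>T. resid_card v ^ nat (- (int N * min 0 (v x) - C v))) * q"
      by (rule finite_vbox(2)[OF T]) (auto simp: T_def)
    also have "(\<Prod>v\<in>T. resid_card v ^ nat (- (int N * min 0 (v x) - C v)))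
      = (\<Prod>v\<in>T. resid_card v ^ nat (C v) * (resid_card v ^ nat (- v x)) ^ N)"
    proof (rule prod.cong[OF refl])
      fix v
      have "nat (- (int N * min 0 (v x) - C v)) = nat (C v) + nat (- v x) * N"
      proof (cases "v x \<ge> 0")
        case False
        then have "int (nat (C v) + nat (- v x) * N) = - (int N * min 0 (v x) - C v)"
          using C(2)[of v] by (simp add: algebra_simps)
        then show ?thesis by linarith
      qed (use C(2)[of v] in simp)
      then show "resid_card v ^ nat (- (int N * min 0 (v x) - C v)) = resid_card v ^ nat (C v) * (resid_card v ^ nat (- v x)) ^ N"
        by (simp only: power_add power_mult)
    qed
    also have "\<dots> = (\<Prod>v\<in>T. resid_card v ^ nat (C v)) * zero_norm (inverse x) ^ N"
      using zero_norm_inverse[OF T(1) _ T(2) x] by (simp add: prod.distrib prod_power_distrib T_def subset_iff)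
    finally show ?thesis by (simp add: ac_simps)
  qed
  then show ?thesis by (rule power_growth)
qed

lemma product_formula: "x \<noteq> 0 \<Longrightarrow> zero_norm x = zero_norm (inverse x)"
  using zero_norm_le[of x] zero_norm_le[of "inverse x"] by simp

section \<open>Functions whose only pole is at infinity\<close>

definition pole_space :: "nat \<Rightarrow> 'k set" where
  "pole_space N = vbox places (\<lambda>v. if v = vinf then - int N else 0)"

lemma pole_space_subgroup: "add_subgroup (pole_space N)"
  unfolding pole_space_def by (rule box_subgroup) simp

lemma finite_pole_space: "finite (pole_space N)"
  unfolding pole_space_def by (rule finite_vbox(1)[of "{vinf}"]) (use vinf_place in auto)

lemma resid_pos: "place v \<Longrightarrow> resid_card v > 0"
  using resid_card_ge_2[of v] by simp

text \<open>Riemann's inequality for multiples of infinity. The base \<open>x\<close> has a simple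
  pole there, but possibly others, of norm \<open>W\<close>; by the product formula
  \<open>zero_norm x\<close> is \<open>W\<close> times the residue cardinality at infinity. Removing
  the other poles from the digit sums costs a factor of at most \<open>K * W ^ N\<close>, so the
  powers of \<open>W\<close> cancel.\<close>

lemma pole_space_growth: "\<exists>K. \<forall>N. resid_card vinf ^ N \<le> K * card (pole_space N)"
proof -
  obtain x where x: "x \<noteq> 0" "vinf x = - 1" using place_surj[OF vinf_place] by blast
  obtain C where C: "finite {v \<in> places. C v \<noteq> 0}" "\<And>v. C v \<ge> 0"
    "\<And>N. zero_norm x ^ N \<le> card (vbox places (\<lambda>v. int N * min 0 (v x) - C v))"
    using many_digit_sums[OF x(1)] by blast
  define T where "T = {v. place v \<and> v x \<noteq> 0} \<union> {v \<in> places. C v \<noteq> 0}"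
  have T: "finite T" "T \<subseteq> places" using C(1) finite_support[OF x(1)] by (auto simp: T_def)
  have vT: "vinf \<in> T" using vinf_place x by (simp add: T_def)
  define W where "W = (\<Prod>v\<in>T - {vinf}. resid_card v ^ nat (- v x))"
  define K where "K = (\<Prod>v\<in>T. resid_card v ^ nat (C v))"
  have W: "W > 0" unfolding W_def
  proof (rule prod_pos)
    fix v assume "v \<in> T - {vinf}"
    then show "0 < resid_card v ^ nat (- v x)" using T(2) resid_pos[of v] by auto
  qed
  have zn: "zero_norm x = resid_card vinf * W"
  proof -
    have "zero_norm x = (\<Prod>v\<in>T. resid_card v ^ nat (- v x))"
      unfolding product_formula[OF x(1)] by (rule zero_norm_inverse[OF T(1) _ T(2) x(1)]) (auto simp: T_def)
    then show ?thesis using prod.remove[OF T(1) vT, of "\<lambda>v. resid_card v ^ nat (- v x)"] x by (simp add: W_def)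
  qed
  have "resid_card vinf ^ N \<le> K * card (pole_space N)" for N
  proof -
    define D where "D v = int N * min 0 (v x) - C v" for v
    define F where "F v = (if v = vinf then - int N else 0)" for v :: "'k place"
    have DF: "D v \<le> F v" for v
    proof -
      have "int N * min 0 (v x) \<le> 0" by (simp add: mult_nonneg_nonpos)
      then show ?thesis using C(2)[of v] x by (auto simp: D_def F_def)
    qed
    have i: "finite (cosets (vbox places D) (vbox places F))"
      "card (cosets (vbox places D) (vbox places F)) \<le> (\<Prod>v\<in>T. resid_card v ^ nat (F v - D v))"
      by (rule box_index(1,2)[OF subset_refl T DF]; use vT in \<open>auto simp: D_def F_def T_def\<close>)+
    have Fp: "vbox places F = pole_space N" unfolding pole_space_def by (rule box_cong) (simp add: F_def)
    have sub: "vbox places F \<subseteq> vbox places D" by (rule box_mono) (rule DF)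
    note g = box_subgroup[OF subset_refl]
    have "(\<Prod>v\<in>T. resid_card v ^ nat (F v - D v)) = (\<Prod>v\<in>T. resid_card v ^ nat (C v) * (if v = vinf then 1 else resid_card v ^ nat (- v x)) ^ N)"
    proof (rule prod.cong[OF refl])
      fix v
      have "nat (F v - D v) = nat (C v) + (if v = vinf then 0 else nat (- v x)) * N"
      proof (cases "v = vinf")
        case True then show ?thesis using x C(2)[of v] by (simp add: F_def D_def)
      next
        case f: False
        show ?thesis
        proof (cases "v x \<ge> 0")
          case False
          then have "int (nat (C v) + nat (- v x) * N) = F v - D v"
            using C(2)[of v] f by (simp add: algebra_simps F_def D_def)
          then have "nat (F v - D v) = nat (C v) + nat (- v x) * N" by (metis nat_int)
          then show ?thesis using f by simp
        qed (use C(2)[of v] f in \<open>simp add: F_def D_def\<close>)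
      qed
      then show "resid_card v ^ nat (F v - D v) = resid_card v ^ nat (C v) * (if v = vinf then 1 else resid_card v ^ nat (- v x)) ^ N"
        by (simp add: power_add power_mult)
    qed
    also have "\<dots> = K * W ^ N"
    proof -
      have "(\<Prod>v\<in>T. (if v = vinf then 1 else resid_card v ^ nat (- v x))) = W"
        using prod.remove[OF T(1) vT, of "\<lambda>v. if v = vinf then 1 else resid_card v ^ nat (- v x)"]
        by (simp add: W_def)
      then show ?thesis by (simp add: prod.distrib K_def prod_power_distrib[symmetric])
    qed
    finally have P: "(\<Prod>v\<in>T. resid_card v ^ nat (F v - D v)) = K * W ^ N" .
    have "(\<lambda>v. int N * min 0 (v x) - C v) = D" by (simp add: D_def fun_eq_iff)
    then have "(resid_card vinf * W) ^ N \<le> card (vbox places D)" using C(3)[of N] zn by simp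
    also have "\<dots> \<le> K * W ^ N * card (pole_space N)"
      using card_by_index(2)[OF g g sub i(1)] finite_pole_space Fp i(2) P by (simp add: mult_le_mono1)
    finally have "resid_card vinf ^ N * W ^ N \<le> (K * card (pole_space N)) * W ^ N"
      by (simp add: power_mult_distrib ac_simps)
    then show ?thesis using W by simp
  qed
  then show ?thesis by blast
qed

lemma fin_places_subset: "fin_places \<subseteq> places"
  by (auto simp: fin_places_def)

lemma fin_placesD: "v \<in> fin_places \<Longrightarrow> place v"
  by (simp add: fin_places_def)

lemma places_split: "place v \<longleftrightarrow> v \<in> fin_places \<or> v = vinf"
  using vinf_place by (auto simp: fin_places_def)

lemma A_vbox: "A = vbox fin_places (\<lambda>_. 0)"
  by (simp add: A_def vbox_def)

lemma A_subgroup: "add_subgroup A"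
  unfolding A_vbox by (rule box_subgroup[OF fin_places_subset])

lemma A_subring: "subring_set A"
proof unfold_locales
  show "0 \<in> A" "1 \<in> A" using val_ge_one fin_placesD by (auto simp: A_def)
  fix a b assume ab: "a \<in> A" "b \<in> A"
  then show "a - b \<in> A" "a * b \<in> A"
    using val_ge_diff[of _ 0 a b] val_ge_mult[of _ 0 a 0 b] fin_placesD by (auto simp: A_def)
qed

lemma scale_A: "f \<noteq> 0 \<Longrightarrow> f *o A = vbox fin_places (\<lambda>v. v f)"
  unfolding A_vbox using box_scale[OF fin_places_subset, of f "\<lambda>_. 0"] by simp

lemma pole_space_A: "pole_space N \<subseteq> A"
  unfolding pole_space_def A_def vbox_def fin_places_def by auto

lemma finite_support_fin: "x \<noteq> 0 \<Longrightarrow> finite {v \<in> fin_places. v x \<noteq> 0}"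
  using finite_support[of x] by (rule finite_subset[rotated]) (auto simp: fin_places_def)

text \<open>The product formula for an element whose only possible pole is at infinity.\<close>

lemma A_element_norm:
  assumes f: "f \<in> A" "f \<noteq> 0"
  defines "P \<equiv> (\<Prod>v | v \<in> fin_places \<and> v f \<noteq> 0. resid_card v ^ nat (v f))"
  shows "vinf f \<le> 0" "P = resid_card vinf ^ nat (- vinf f)"
proof -
  have ge: "v f \<ge> 0" if "v \<in> fin_places" for v using f that by (auto simp: A_def val_ge_def)
  have inv: "zero_norm (inverse f) = resid_card vinf ^ nat (- vinf f)"
    using zero_norm_inverse[of "{vinf}" f] f vinf_place ge places_split by fastforce
  show le: "vinf f \<le> 0"
  proof (rule ccontr)
    assume n: "\<not> vinf f \<le> 0"
    then have "zero_norm f = 1" using inv product_formula[OF f(2)] by simp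
    moreover have "finite {v. place v \<and> v f > 0}" using finite_zeros f by blast
    then have "zero_norm f = resid_card vinf ^ nat (vinf f) * (\<Prod>v\<in>{v. place v \<and> v f > 0} - {vinf}. resid_card v ^ nat (v f))"
      unfolding zero_norm_def using n vinf_place by (intro prod.remove) auto
    ultimately have "resid_card vinf ^ nat (vinf f) = 1" by simp
    moreover have "2 ^ nat (vinf f) \<le> resid_card vinf ^ nat (vinf f)"
      using resid_card_ge_2[OF vinf_place] by (intro power_mono) auto
    moreover have "nat (vinf f) < 2 ^ nat (vinf f)" "nat (vinf f) > 0" using n by auto
    ultimately show False by linarith
  qed
  have "{v. place v \<and> v f > 0} \<subseteq> {v \<in> fin_places. v f \<noteq> 0}"
  proof
    fix v assume "v \<in> {v. place v \<and> v f > 0}"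
    then show "v \<in> {v \<in> fin_places. v f \<noteq> 0}" using places_split[of v] le by auto
  qed
  moreover have "{v \<in> fin_places. v f \<noteq> 0} \<subseteq> places" using fin_places_subset by blast
  ultimately have "zero_norm f = P" unfolding P_def
    by (rule zero_norm_superset[OF finite_support_fin[OF f(2)]])
  then show "P = resid_card vinf ^ nat (- vinf f)" using inv product_formula[OF f(2)] by simp
qed

text \<open>The upper bound is local. For the lower bound let \<open>n\<close> be the pole order of
  \<open>f\<close> at infinity: \<open>f\<close> times \<open>pole_space N\<close> has index at most
  that of \<open>f A\<close> in \<open>pole_space (N + n)\<close>. Iterating this and comparing with
  the growth of the pole spaces leaves no room.\<close>

lemma index_principal:
  assumes f: "f \<in> A" "f \<noteq> 0"
  shows "finite (cosets A (f *o A))"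
    "card (cosets A (f *o A)) = (\<Prod>v | v \<in> fin_places \<and> v f \<noteq> 0. resid_card v ^ nat (v f))"
proof -
  let ?P = "\<Prod>v | v \<in> fin_places \<and> v f \<noteq> 0. resid_card v ^ nat (v f)"
  have ge: "v f \<ge> 0" if "v \<in> fin_places" for v using f that by (auto simp: A_def val_ge_def)
  let ?T = "{v \<in> fin_places. v f \<noteq> 0}"
  have T: "finite ?T" "?T \<subseteq> fin_places" using finite_support_fin[OF f(2)] by auto
  have le: "finite (cosets A (f *o A))" "card (cosets A (f *o A)) \<le> (\<Prod>v\<in>?T. resid_card v ^ nat (v f - 0))"
    unfolding scale_A[OF f(2)] unfolding A_vbox
    by (rule box_index(1,2)[OF fin_places_subset T]; use ge in auto)+
  then show "finite (cosets A (f *o A))" by simp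
  define i where "i = card (cosets A (f *o A))"
  define n where "n = nat (- vinf f)"
  have vf: "vinf f = - int n" using A_element_norm(1)[OF f] by (simp add: n_def)
  have step: "card (pole_space (N + n)) \<le> i * card (pole_space N)" for N
  proof -
    have e: "f *o pole_space N = pole_space (N + n) \<inter> (f *o A)"
    proof (rule Set.set_eqI)
      fix a
      have "a \<in> f *o pole_space N \<longleftrightarrow> a / f \<in> A \<and> val_ge vinf (- int N) (a / f)"
        unfolding mem_scale_iff[OF f(2)] pole_space_def A_def vbox_def fin_places_def using vinf_place by auto
      also have "val_ge vinf (- int N) (a / f) \<longleftrightarrow> val_ge vinf (- int (N + n)) a"
        using val_ge_mult_iff[OF vinf_place f(2), of "- int (N + n)" "a / f"] vf f by simp
      also have "a / f \<in> A \<longleftrightarrow> a \<in> f *o A" using mem_scale_iff[OF f(2)] by blast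
      also have "a \<in> f *o A \<and> val_ge vinf (- int (N + n)) a \<longleftrightarrow> a \<in> pole_space (N + n) \<inter> (f *o A)"
      proof -
        have "a \<in> f *o A \<Longrightarrow> a \<in> A" using subring_set.Fmult[OF A_subring f(1)] by (auto simp: elt_set_times_def)
        then show ?thesis unfolding pole_space_def vbox_def A_def fin_places_def using vinf_place by auto
      qed
      finally show "a \<in> f *o pole_space N \<longleftrightarrow> a \<in> pole_space (N + n) \<inter> (f *o A)" .
    qed
    note fg = add_subgroup_scale[OF A_subgroup, of f]
    note ix = index_le[OF pole_space_subgroup fg pole_space_A e le(1)]
    have fin: "finite (f *o pole_space N)" using e finite_pole_space by simp
    have "f *o pole_space N = (*) f ` pole_space N" by (auto simp: elt_set_times_def)
    then have "card (f *o pole_space N) = card (pole_space N)" using f by (simp add: card_image inj_on_def)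
    then show ?thesis
      using card_by_index(2)[OF pole_space_subgroup add_subgroup_scale[OF pole_space_subgroup] _ ix(1) fin] e ix(2)
      by (simp add: i_def)
  qed
  have pw: "card (pole_space (k * n)) \<le> i ^ k * card (pole_space 0)" for k
  proof (induction k)
    case (Suc k)
    have "card (pole_space (Suc k * n)) \<le> i * card (pole_space (k * n))" using step[of "k * n"] by (simp add: add.commute)
    also have "\<dots> \<le> i * (i ^ k * card (pole_space 0))" using Suc by simp
    finally show ?case by (simp add: ac_simps)
  qed simp
  obtain K where K: "\<And>N. resid_card vinf ^ N \<le> K * card (pole_space N)" using pole_space_growth by blast
  have "(resid_card vinf ^ n) ^ k \<le> (K * card (pole_space 0)) * i ^ k" for k
  proof -
    have "(resid_card vinf ^ n) ^ k \<le> K * card (pole_space (k * n))"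
      using K[of "k * n"] by (simp add: power_mult[symmetric] mult.commute)
    also have "\<dots> \<le> K * (i ^ k * card (pole_space 0))" using pw by simp
    finally show ?thesis by (simp add: ac_simps)
  qed
  then have "resid_card vinf ^ n \<le> i" by (rule power_growth)
  then show "card (cosets A (f *o A)) = ?P"
    using A_element_norm(2)[OF f] le(2) by (simp add: i_def n_def)
qed

section \<open>Divisors on the finite places and strong approximation\<close>

definition fin_supp :: "('k place \<Rightarrow> int) \<Rightarrow> bool" where
  "fin_supp E \<longleftrightarrow> finite {v \<in> fin_places. E v \<noteq> 0}"

lemma fin_supp_place: "x \<noteq> 0 \<Longrightarrow> fin_supp (\<lambda>v. v x)"
  unfolding fin_supp_def by (rule finite_support_fin)

lemma fin_supp_combine:
  assumes "fin_supp E" "fin_supp F" "\<And>v. v \<in> fin_places \<Longrightarrow> E v = 0 \<Longrightarrow> F v = 0 \<Longrightarrow> G v = 0"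
  shows "fin_supp G"
proof -
  have "{v \<in> fin_places. G v \<noteq> 0} \<subseteq> {v \<in> fin_places. E v \<noteq> 0} \<union> {v \<in> fin_places. F v \<noteq> 0}" using assms(3) by auto
  then show ?thesis using assms(1,2) unfolding fin_supp_def by (meson finite_UnI finite_subset)
qed

lemma fin_supp_0 [simp]: "fin_supp (\<lambda>_. 0)" by (simp add: fin_supp_def)
lemma fin_supp_add: "fin_supp E \<Longrightarrow> fin_supp F \<Longrightarrow> fin_supp (\<lambda>v. E v + F v)"
  by (rule fin_supp_combine[of E F]) auto
lemma fin_supp_diff: "fin_supp E \<Longrightarrow> fin_supp F \<Longrightarrow> fin_supp (\<lambda>v. E v - F v)"
  by (rule fin_supp_combine[of E F]) auto
lemma fin_supp_minus: "fin_supp E \<Longrightarrow> fin_supp (\<lambda>v. - E v)"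
  by (rule fin_supp_combine[of E E]) auto
lemma fin_supp_upd: "fin_supp E \<Longrightarrow> fin_supp (E(u := n))"
proof -
  assume "fin_supp E"
  moreover have "fin_supp (\<lambda>v. if v = u then 1 else 0)" unfolding fin_supp_def
    by (rule finite_subset[of _ "{u}"]) auto
  ultimately show ?thesis by (rule fin_supp_combine) (auto split: if_splits)
qed

text \<open>Pigeonhole: the pole spaces grow exponentially, while the elements with the required
  zeros have finite index in \<open>A\<close>.\<close>

lemma exists_divisible:
  assumes "fin_supp E"
  shows "\<exists>f\<in>A. f \<noteq> 0 \<and> (\<forall>v\<in>fin_places. E v \<le> v f)"
proof -
  define E' where "E' v = max 0 (E v)" for v
  define X where "X = vbox fin_places E'"
  have X: "add_subgroup X" unfolding X_def by (rule box_subgroup[OF fin_places_subset])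
  have "finite (cosets A X)" unfolding A_vbox X_def
    by (rule box_index(1)[OF fin_places_subset, of "{v \<in> fin_places. E v \<noteq> 0}"])
       (use assms in \<open>auto simp: E'_def fin_supp_def\<close>)
  note ix = index_le[OF pole_space_subgroup X pole_space_A refl this]
  define M where "M = card (cosets A X)"
  obtain K where K: "\<And>N. resid_card vinf ^ N \<le> K * card (pole_space N)" using pole_space_growth by blast
  \<comment> \<open>With \<open>N = K * M\<close>, an injection of the pole space into the quotient
    would give \<open>2 ^ N \<le> K * M\<close>, that is \<open>2 ^ N \<le> N\<close>.\<close>
  have "\<exists>f\<in>pole_space (K * M) \<inter> X. f \<noteq> 0"
  proof (rule ccontr)
    assume "\<not> ?thesis"
    then have "pole_space (K * M) \<inter> X \<subseteq> {0}" by blast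
    moreover have "0 \<in> pole_space (K * M) \<inter> X"
      by (intro IntI add_subgroupD(1)[OF X] add_subgroupD(1)[OF pole_space_subgroup])
    ultimately have z: "pole_space (K * M) \<inter> X = {0}" by blast
    then have "card (pole_space (K * M)) \<le> M" using ix(2)[of "K * M"] unfolding M_def[symmetric] by (simp add: cosets_zero)
    then have "K * card (pole_space (K * M)) \<le> K * M" by (rule mult_le_mono2)
    then have "resid_card vinf ^ (K * M) \<le> K * M" using K[of "K * M"] by linarith
    moreover have "2 ^ (K * M) \<le> resid_card vinf ^ (K * M)"
      using resid_card_ge_2[OF vinf_place] by (intro power_mono) auto
    ultimately show False using less_exp[of "K * M"] by linarith
  qed
  then obtain f where f: "f \<in> pole_space (K * M)" "f \<in> X" "f \<noteq> 0" by blast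
  have "E v \<le> v f" if "v \<in> fin_places" for v
    using f that by (auto simp: X_def vbox_def val_ge_def E'_def)
  then show ?thesis using f pole_space_A by blast
qed

text \<open>A squeeze along the chain from \<open>A\<close> over the divisors \<open>E\<close> and
  \<open>E(u := E u + 1)\<close> to \<open>f A\<close>: the three indices have upper bounds whose
  product is the index of \<open>f A\<close>, so none of the bounds is strict. An arbitrary divisor
  becomes effective after multiplication by some \<open>g\<close>.\<close>

lemma fin_box_step:
  assumes E: "fin_supp E" and u: "u \<in> fin_places"
  shows "card (cosets (vbox fin_places E) (vbox fin_places (E(u := E u + 1)))) = resid_card u"
proof -
  have pos: "card (cosets (vbox fin_places E) (vbox fin_places (E(u := E u + 1)))) = resid_card u"
    if E: "fin_supp E" and E0: "\<And>v. v \<in> fin_places \<Longrightarrow> E v \<ge> 0" for E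
  proof -
    define E' where "E' = E(u := E u + 1)"
    have E'f: "fin_supp E'" unfolding E'_def using E fin_supp_upd by blast
    obtain f where f: "f \<in> A" "f \<noteq> 0" "\<And>v. v \<in> fin_places \<Longrightarrow> E' v \<le> v f" using exists_divisible[OF E'f] by blast
    define T where "T = {v \<in> fin_places. E v \<noteq> 0} \<union> {v \<in> fin_places. v f \<noteq> 0} \<union> {u}"
    have T: "finite T" "T \<subseteq> fin_places" "u \<in> T"
      using E finite_support_fin[OF f(2)] u by (auto simp: T_def fin_supp_def)
    have EE: "E v \<le> E' v" for v by (simp add: E'_def)
    have Ef: "E v \<le> v f" if "v \<in> fin_places" for v using EE f(3)[OF that] order_trans by blast
    note g = box_subgroup[OF fin_places_subset]
    define a where "a = card (cosets A (vbox fin_places E))"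
    define b where "b = card (cosets (vbox fin_places E) (vbox fin_places E'))"
    define c where "c = card (cosets (vbox fin_places E') (f *o A))"
    have s: "vbox fin_places (\<lambda>v. v f) \<subseteq> vbox fin_places E'" "vbox fin_places E' \<subseteq> vbox fin_places E"
      "vbox fin_places E \<subseteq> A" "vbox fin_places (\<lambda>v. v f) \<subseteq> vbox fin_places E"
      unfolding A_vbox using f(3) E0 EE Ef by (auto intro!: box_mono)
    have "card (cosets A (f *o A)) = a * (b * c)"
      unfolding a_def b_def c_def scale_A[OF f(2)]
      using index_tower(1)[OF A_subgroup g g s(4,3)] index_tower(1)[OF g g g s(1,2)] by simp
    moreover have a: "a \<le> (\<Prod>v\<in>T. resid_card v ^ nat (E v))"
    proof -
      have "a \<le> (\<Prod>v\<in>T. resid_card v ^ nat (E v - 0))" unfolding a_def A_vbox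
        by (rule box_index(2)[OF fin_places_subset T(1,2)]) (use E0 in \<open>auto simp: T_def\<close>)
      then show ?thesis by simp
    qed
    moreover have b: "b \<le> resid_card u" unfolding b_def E'_def by (rule box_step(4)[OF fin_places_subset u])
    moreover have c: "c \<le> (\<Prod>v\<in>T. resid_card v ^ nat (v f - E' v))"
      unfolding c_def scale_A[OF f(2)]
      by (rule box_index(2)[OF fin_places_subset T(1,2)]) (use f(3) in \<open>auto simp: T_def E'_def\<close>)
    moreover have "card (cosets A (f *o A)) = (\<Prod>v\<in>T. resid_card v ^ nat (E v)) * (resid_card u * (\<Prod>v\<in>T. resid_card v ^ nat (v f - E' v)))"
    proof -
      have "card (cosets A (f *o A)) = (\<Prod>v\<in>T. resid_card v ^ nat (v f))"
        unfolding index_principal(2)[OF f(1,2)] using T by (intro prod.mono_neutral_left) (auto simp: T_def)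
      also have "\<dots> = (\<Prod>v\<in>T. resid_card v ^ nat (E v) * ((if v = u then resid_card v else 1) * resid_card v ^ nat (v f - E' v)))"
      proof (rule prod.cong[OF refl])
        fix v assume v: "v \<in> T"
        then have vf: "v \<in> fin_places" using T by blast
        have "nat (v f) = nat (E v) + ((if v = u then 1 else 0) + nat (v f - E' v))"
          using E0[OF vf] f(3)[OF vf] by (auto simp: E'_def)
        then show "resid_card v ^ nat (v f) = resid_card v ^ nat (E v) * ((if v = u then resid_card v else 1) * resid_card v ^ nat (v f - E' v))"
          by (auto simp: power_add)
      qed
      also have "\<dots> = (\<Prod>v\<in>T. resid_card v ^ nat (E v)) * ((\<Prod>v\<in>T. if v = u then resid_card v else 1) * (\<Prod>v\<in>T. resid_card v ^ nat (v f - E' v)))"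
        by (simp add: prod.distrib)
      also have "(\<Prod>v\<in>T. if v = u then resid_card v else 1) = resid_card u"
        using T by (simp add: prod.delta)
      finally show ?thesis .
    qed
    moreover have "(\<Prod>v\<in>T. resid_card v ^ nat (E v)) > 0" "(\<Prod>v\<in>T. resid_card v ^ nat (v f - E' v)) > 0"
      by (intro prod_pos zero_less_power resid_pos fin_placesD; use T(2) in blast)+
    ultimately have "resid_card u \<le> b"
    proof -
      assume as: "card (cosets A (f *o A)) = a * (b * c)"
        "card (cosets A (f *o A)) = (\<Prod>v\<in>T. resid_card v ^ nat (E v)) * (resid_card u * (\<Prod>v\<in>T. resid_card v ^ nat (v f - E' v)))"
        "(\<Prod>v\<in>T. resid_card v ^ nat (E v)) > 0" "(\<Prod>v\<in>T. resid_card v ^ nat (v f - E' v)) > 0"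
      let ?a = "\<Prod>v\<in>T. resid_card v ^ nat (E v)" and ?c = "\<Prod>v\<in>T. resid_card v ^ nat (v f - E' v)"
      have "?a * (resid_card u * ?c) \<le> ?a * (b * ?c)"
        unfolding as(2)[symmetric] as(1) using a c by (intro mult_le_mono) auto
      then show ?thesis using as(3,4) by simp
    qed
    then show ?thesis using b by (simp add: b_def E'_def)
  qed
  obtain g where g: "g \<in> A" "g \<noteq> 0" "\<And>v. v \<in> fin_places \<Longrightarrow> - E v \<le> v g"
    using exists_divisible[OF fin_supp_minus[OF E]] by blast
  let ?E = "\<lambda>v. E v + v g"
  have "card (cosets (vbox fin_places ?E) (vbox fin_places (?E(u := ?E u + 1)))) = resid_card u"
  proof (rule pos)
    show "fin_supp ?E" using E fin_supp_place[OF g(2)] fin_supp_add by blast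
    show "?E v \<ge> 0" if "v \<in> fin_places" for v using g(3)[OF that] by simp
  qed
  moreover have "vbox fin_places ?E = g *o vbox fin_places E" by (rule box_scale[OF fin_places_subset g(2), symmetric])
  moreover have "vbox fin_places (?E(u := ?E u + 1)) = g *o vbox fin_places (E(u := E u + 1))"
    unfolding box_scale[OF fin_places_subset g(2)] by (rule box_cong) simp
  ultimately show ?thesis using index_scale(1)[OF g(2) box_subgroup[OF fin_places_subset]] by metis
qed

text \<open>Full index of a unit step means that the embedding into the residue quotient at
  \<open>u\<close> is onto, so the leading coefficient at \<open>u\<close> can be prescribed within
  the box.\<close>

lemma approximation_step:
  assumes "fin_supp E" "u \<in> fin_places" "val_ge u (E u) a"
  shows "\<exists>b\<in>vbox fin_places E. val_ge u (E u + 1) (a - b)"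
proof -
  have u: "place u" "{u} \<subseteq> places" using assms fin_placesD by auto
  note st = box_step[OF fin_places_subset assms(2), of E]
  have "\<exists>b\<in>vbox fin_places E. a - b \<in> vbox {u} (\<lambda>_. E u + 1)"
  proof (rule index_surj[OF box_subgroup[OF fin_places_subset] box_subgroup[OF u(2)] st(2) st(1)])
    show "finite (cosets (vbox {u} (\<lambda>_. E u)) (vbox {u} (\<lambda>_. E u + 1)))" by (rule resid_index(1)[OF u(1)])
    show "card (cosets (vbox {u} (\<lambda>_. E u)) (vbox {u} (\<lambda>_. E u + 1)))
        \<le> card (cosets (vbox fin_places E) (vbox fin_places (E(u := E u + 1))))"
      unfolding fin_box_step[OF assms(1,2)] resid_index(2)[OF u(1)] ..
    show "a \<in> vbox {u} (\<lambda>_. E u)" using assms by (simp add: vbox_def)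
  qed
  then show ?thesis by (simp add: vbox_def)
qed

text \<open>Successive approximation: one coefficient at one place is corrected, the targets are
  replaced by the remaining errors, and the process continues in the smaller box.\<close>

lemma approximation_box:
  assumes "finite T" "T \<subseteq> fin_places" "fin_supp E" "\<And>v. v \<in> T \<Longrightarrow> val_ge v (E v) (a v)"
    "\<And>v. v \<in> T \<Longrightarrow> E v \<le> E' v"
  shows "\<exists>b\<in>vbox fin_places E. \<forall>v\<in>T. val_ge v (E' v) (b - a v)"
  using assms(3-)
proof (induction "\<Sum>v\<in>T. nat (E' v - E v)" arbitrary: E a)
  case 0
  then have "\<forall>v\<in>T. nat (E' v - E v) = 0" using assms(1) by simp
  then have "E v = E' v" if "v \<in> T" for v using 0 that by (metis diff_gt_0_iff_gt nat_0_iff not_less antisym)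
  then have "\<forall>v\<in>T. val_ge v (E' v) (0 - a v)"
    using 0(3) val_ge_minus_iff fin_placesD assms(2) by auto
  moreover have "0 \<in> vbox fin_places E" by (simp add: vbox_def)
  ultimately show ?case by blast
next
  case (Suc n)
  have "(\<Sum>v\<in>T. nat (E' v - E v)) \<noteq> 0" using Suc.hyps(2) by simp
  from sum.not_neutral_contains_not_neutral[OF this]
  obtain u where u: "u \<in> T" "nat (E' u - E u) \<noteq> 0" by blast
  then have uf: "u \<in> fin_places" using assms by blast
  obtain b where b: "b \<in> vbox fin_places E" "val_ge u (E u + 1) (a u - b)"
    using approximation_step[OF Suc.prems(1) uf Suc.prems(2)[OF u(1)]] by blast
  define F where "F = E(u := E u + 1)"
  have "(\<Sum>v\<in>T. nat (E' v - E v)) = nat (E' u - E u) + (\<Sum>v\<in>T - {u}. nat (E' v - E v))"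
    "(\<Sum>v\<in>T. nat (E' v - F v)) = nat (E' u - F u) + (\<Sum>v\<in>T - {u}. nat (E' v - F v))"
    using u assms(1) by (simp_all add: sum.remove)
  moreover have "(\<Sum>v\<in>T - {u}. nat (E' v - F v)) = (\<Sum>v\<in>T - {u}. nat (E' v - E v))"
    by (auto simp: F_def intro!: sum.cong)
  moreover have "nat (E' u - E u) = Suc (nat (E' u - F u))" using u by (auto simp: F_def)
  ultimately have n: "n = (\<Sum>v\<in>T. nat (E' v - F v))" using Suc.hyps(2) by simp
  have "\<exists>c\<in>vbox fin_places F. \<forall>v\<in>T. val_ge v (E' v) (c - (a v - b))"
  proof (rule Suc.hyps(1)[OF n])
    show "fin_supp F" unfolding F_def using Suc.prems(1) fin_supp_upd by blast
    fix v assume v: "v \<in> T"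
    then have vf: "v \<in> fin_places" using assms by blast
    show "val_ge v (F v) (a v - b)"
    proof (cases "v = u")
      case False
      have "val_ge v (E v) b" using b(1) vf by (simp add: vbox_def)
      then show ?thesis using False Suc.prems(2)[OF v] val_ge_diff fin_placesD[OF vf] by (simp add: F_def)
    qed (use b in \<open>simp add: F_def\<close>)
    show "F v \<le> E' v" using Suc.prems(3)[OF v] u by (auto simp: F_def)
  qed
  then obtain c where c: "c \<in> vbox fin_places F" "\<forall>v\<in>T. val_ge v (E' v) (c - (a v - b))" by blast
  have "vbox fin_places F \<subseteq> vbox fin_places E" by (rule box_mono) (simp add: F_def)
  then have "c + b \<in> vbox fin_places E" using c b add_subgroupD(4)[OF box_subgroup[OF fin_places_subset]] by blast
  moreover have "\<forall>v\<in>T. val_ge v (E' v) (c + b - a v)" using c(2) by (simp add: algebra_simps)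
  ultimately show ?case by blast
qed

theorem strong_approximation:
  assumes "finite T" "T \<subseteq> fin_places"
  shows "\<exists>b. (\<forall>v\<in>T. val_ge v (n v) (b - a v)) \<and> (\<forall>v\<in>fin_places - T. val_ge v 0 b)"
proof -
  \<comment> \<open>The poles of the targets must be allowed, and the minimum keeps the starting
    bound below the required precision.\<close>
  define E where "E v = (if v \<in> T then min (v (a v)) (n v) else 0)" for v
  have "\<exists>b\<in>vbox fin_places E. \<forall>v\<in>T. val_ge v (n v) (b - a v)"
  proof (rule approximation_box[OF assms])
    have "{v \<in> fin_places. E v \<noteq> 0} \<subseteq> T" by (auto simp: E_def)
    then show "fin_supp E" unfolding fin_supp_def using assms(1) finite_subset by blast
  qed (auto simp: E_def val_ge_def)
  then obtain b where b: "b \<in> vbox fin_places E" "\<forall>v\<in>T. val_ge v (n v) (b - a v)" by blast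
  have "val_ge v 0 b" if "v \<in> fin_places - T" for v
  proof -
    have "val_ge v (E v) b" using b(1) that by (simp add: vbox_def)
    then show ?thesis using that by (simp add: E_def)
  qed
  then show ?thesis using b(2) by blast
qed

end

section \<open>Ideals and their degrees\<close>

lemma sum_lessThan_add: "(\<Sum>i<n + (m::nat). h i) = (\<Sum>i<n. h i) + (\<Sum>i<m. h (n + i))" for h :: "nat \<Rightarrow> 'a::comm_monoid_add"
  by (induction m) (auto simp: ac_simps)

context global_function_field
begin

interpretation Fq: subring_set Fq by (rule Fq_subring)
interpretation A: subring_set A by (rule A_subring)

abbreviation ideal_of :: "('k place \<Rightarrow> int) \<Rightarrow> 'k set" where
  "ideal_of E \<equiv> vbox fin_places E"

lemma ideal_of_subgroup: "add_subgroup (ideal_of E)"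
  by (rule box_subgroup[OF fin_places_subset])

lemma ideal_of_mult: "a \<in> ideal_of E \<Longrightarrow> b \<in> ideal_of F \<Longrightarrow> a * b \<in> ideal_of (\<lambda>v. E v + F v)"
  unfolding vbox_def using val_ge_mult fin_placesD by simp

lemma ideal_of_A: "c \<in> A \<Longrightarrow> a \<in> ideal_of E \<Longrightarrow> c * a \<in> ideal_of E"
  using ideal_of_mult[of c "\<lambda>_. 0" a E] by (simp add: A_vbox)

text \<open>Strong approximation moves an element of valuation \<open>E u\<close> into the ideal by
  an error of larger valuation, which leaves the valuation at \<open>u\<close> unchanged. Such
  elements recover the divisor from its ideal.\<close>

lemma exact_element:
  assumes "fin_supp E" "u \<in> fin_places"
  shows "\<exists>a\<in>ideal_of E. a \<noteq> 0 \<and> u a = E u"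
proof -
  have u: "place u" using assms fin_placesD by blast
  obtain a where a: "a \<noteq> 0" "u a = E u" using place_surj[OF u] by blast
  obtain b where b: "b \<in> ideal_of E" "val_ge u (E u + 1) (a - b)"
    using approximation_step[OF assms, of a] a val_ge_self[of u a] by auto
  have "val_ge u (u a + 1) (- (a - b))"
    unfolding val_ge_minus_iff[OF u] using b(2) a by simp
  then have "a + - (a - b) \<noteq> 0" "u (a + - (a - b)) = u a" using place_add_eq[OF u a(1)] by blast+
  then show ?thesis using a b by (intro bexI[of _ b]) auto
qed

lemma ideal_of_subset_iff:
  assumes "fin_supp E"
  shows "ideal_of E \<subseteq> ideal_of F \<longleftrightarrow> (\<forall>v\<in>fin_places. F v \<le> E v)"
proof
  assume s: "ideal_of E \<subseteq> ideal_of F"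
  show "\<forall>v\<in>fin_places. F v \<le> E v"
  proof
    fix v assume v: "v \<in> fin_places"
    obtain a where "a \<in> ideal_of E" "a \<noteq> 0" "v a = E v" using exact_element[OF assms v] by blast
    then have "a \<in> ideal_of F" "a \<noteq> 0" "v a = E v" using s by blast+
    then show "F v \<le> E v" using v by (auto simp: vbox_def val_ge_def)
  qed
next
  assume "\<forall>v\<in>fin_places. F v \<le> E v"
  then show "ideal_of E \<subseteq> ideal_of F" by (intro box_mono) (erule bspec)
qed

lemma ideal_of_eq_iff:
  assumes "fin_supp E" "fin_supp F"
  shows "ideal_of E = ideal_of F \<longleftrightarrow> (\<forall>v\<in>fin_places. E v = F v)"
proof
  assume "ideal_of E = ideal_of F"
  then have "\<forall>v\<in>fin_places. F v \<le> E v" "\<forall>v\<in>fin_places. E v \<le> F v"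
    using ideal_of_subset_iff[OF assms(1), of F] ideal_of_subset_iff[OF assms(2), of E] by blast+
  then show "\<forall>v\<in>fin_places. E v = F v" using order.antisym by blast
next
  assume "\<forall>v\<in>fin_places. E v = F v"
  then show "ideal_of E = ideal_of F" by (intro box_cong) (erule bspec)
qed

definition A_module :: "'k set \<Rightarrow> bool" where
  "A_module M \<longleftrightarrow> 0 \<in> M \<and> (\<forall>a\<in>M. \<forall>b\<in>M. a + b \<in> M) \<and> (\<forall>c\<in>A. \<forall>a\<in>M. c * a \<in> M)"

lemma A_moduleD:
  assumes "A_module M"
  shows "0 \<in> M" "a \<in> M \<Longrightarrow> b \<in> M \<Longrightarrow> a + b \<in> M" "c \<in> A \<Longrightarrow> a \<in> M \<Longrightarrow> c * a \<in> M"
  using assms by (auto simp: A_module_def)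

lemma A_module_sum: "A_module M \<Longrightarrow> (\<And>i. i \<in> I \<Longrightarrow> f i \<in> M) \<Longrightarrow> sum f I \<in> M"
  by (induction I rule: infinite_finite_induct) (auto intro: A_moduleD(1,2))

lemma ideal_of_module: "A_module (ideal_of E)"
  unfolding A_module_def
  by (intro conjI ballI add_subgroupD(1,4)[OF ideal_of_subgroup] ideal_of_A)

definition A_span :: "'k set \<Rightarrow> 'k set" where
  "A_span S = {\<Sum>s\<in>S. c s * s | c. \<forall>s\<in>S. c s \<in> A}"

text \<open>A module bounded by a divisor contains an element \<open>g\<close> of minimal valuation at the finitely
  many places where this matters, and together with any nonzero \<open>f\<close> it generates the module.\<close>
lemma bounded_module:
  assumes M: "A_module M" "M \<noteq> {0}" and F: "fin_supp F" "M \<subseteq> ideal_of F"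
  shows "\<exists>E. fin_supp E \<and> M = ideal_of E \<and> (\<forall>v\<in>fin_places. F v \<le> E v)"
    "\<exists>S. finite S \<and> M = A_span S"
proof -
  obtain f where f: "f \<in> M" "f \<noteq> 0" using M A_moduleD(1)[OF M(1)] by blast
  have lo: "F v \<le> v a" if "v \<in> fin_places" "a \<in> M" "a \<noteq> 0" for v a
    using that F(2) by (auto simp: vbox_def val_ge_def)
  \<comment> \<open>At a finite place the lower bound \<open>F\<close> makes the differences
    nonnegative, so minimizing natural numbers there minimizes the valuation.\<close>
  have "\<exists>a. (a \<in> M \<and> a \<noteq> 0) \<and> (\<forall>b. b \<in> M \<and> b \<noteq> 0 \<longrightarrow> nat (v a - F v) \<le> nat (v b - F v))" for v
    using ex_has_least_nat[of "\<lambda>a. a \<in> M \<and> a \<noteq> 0" f "\<lambda>a. nat (v a - F v)"] f by blast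
  then obtain j where j: "\<And>v. j v \<in> M \<and> j v \<noteq> 0"
    "\<And>v b. b \<in> M \<Longrightarrow> b \<noteq> 0 \<Longrightarrow> nat (v (j v) - F v) \<le> nat (v b - F v)" by metis
  define E where "E v = v (j v)" for v
  have E: "E v \<le> v a" if "v \<in> fin_places" "a \<in> M" "a \<noteq> 0" for v a
    using j(2)[OF that(2,3), of v] lo[OF that] by (simp add: E_def)
  have FE: "F v \<le> E v" if "v \<in> fin_places" for v using lo[OF that] j(1) by (simp add: E_def)
  have Ef: "fin_supp E"
  proof (rule fin_supp_combine[OF F(1) fin_supp_place[OF f(2)]])
    fix v assume "v \<in> fin_places" "F v = 0" "v f = 0"
    then show "E v = 0" using E[of v f] FE[of v] f by simp
  qed
  have ME: "M \<subseteq> ideal_of E" unfolding vbox_def val_ge_def using E by auto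
  \<comment> \<open>Outside \<open>T\<close> both \<open>f\<close> and the minimal valuation
    \<open>E\<close> are 0, so nothing has to be corrected there.\<close>
  define T where "T = {v \<in> fin_places. v f \<noteq> 0} \<union> {v \<in> fin_places. E v \<noteq> 0}"
  have T: "finite T" "T \<subseteq> fin_places" using finite_support_fin[OF f(2)] Ef by (auto simp: T_def fin_supp_def)
  \<comment> \<open>Approximate indicators in \<open>A\<close> of the places of \<open>T\<close>;
    they glue the local minimizers \<open>j v\<close> into one element that is minimal on all of
    \<open>T\<close>.\<close>
  have "\<forall>v. \<exists>c. (\<forall>w\<in>T. val_ge w 1 (c - (if w = v then 1 else 0))) \<and> (\<forall>w\<in>fin_places - T. val_ge w 0 c)"
    by (intro allI strong_approximation[OF T])
  then obtain c where c: "\<And>v w. w \<in> T \<Longrightarrow> val_ge w 1 (c v - (if w = v then 1 else 0))"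
    "\<And>v w. w \<in> fin_places - T \<Longrightarrow> val_ge w 0 (c v)" by metis
  have cA: "c v \<in> A" for v unfolding A_def
  proof (intro CollectI ballI)
    fix w assume w: "w \<in> fin_places"
    note pw = fin_placesD[OF w]
    show "val_ge w 0 (c v)"
    proof (cases "w \<in> T")
      case True
      have "val_ge w 0 (c v - (if w = v then 1 else 0))" using val_ge_mono[OF c(1)[OF True, of v]] by simp
      moreover have "val_ge w 0 (if w = v then 1 else 0)" using val_ge_one[OF pw] by (cases "w = v") auto
      ultimately have "val_ge w 0 (c v - (if w = v then 1 else 0) + (if w = v then 1 else 0))"
        by (rule val_ge_add[OF pw])
      then show ?thesis by simp
    next
      case False then show ?thesis using c(2)[of w v] w by blast
    qed
  qed
  define g where "g = (\<Sum>v\<in>T. c v * j v)"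
  have gM: "g \<in> M" unfolding g_def using j(1) cA A_moduleD(3)[OF M(1)] by (intro A_module_sum[OF M(1)]) blast
  have g: "g \<noteq> 0 \<and> v g = E v" if v: "v \<in> T" for v
  proof -
    have vf: "v \<in> fin_places" and pv: "place v" using v T fin_placesD by blast+
    have jj: "val_ge v (E v) (j w)" for w using E[OF vf] j(1) by (simp add: val_ge_def)
    have "g = c v * j v + (\<Sum>w\<in>T - {v}. c w * j w)" unfolding g_def using T v by (simp add: sum.remove)
    then have e: "g = j v + ((c v - 1) * j v + (\<Sum>w\<in>T - {v}. c w * j w))" by (simp add: algebra_simps)
    have "val_ge v (1 + E v) ((c v - 1) * j v)" using val_ge_mult[OF pv _ jj] c(1)[OF v, of v] by simp
    moreover have "val_ge v (1 + E v) (c w * j w)" if "w \<in> T - {v}" for w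
      using val_ge_mult[OF pv _ jj, of 1 "c w"] c(1)[OF v, of w] that by auto
    ultimately have "val_ge v (v (j v) + 1) ((c v - 1) * j v + (\<Sum>w\<in>T - {v}. c w * j w))"
      unfolding E_def add.commute[of 1] by (intro val_ge_add[OF pv] val_ge_sum[OF pv])
    then show ?thesis using place_add_eq[OF pv, of "j v"] j(1) e by (simp add: E_def)
  qed
  \<comment> \<open>If \<open>b\<close> is close to \<open>a / g\<close> on \<open>T\<close>, the
    remainder \<open>a - b * g\<close> is divisible by \<open>f\<close> everywhere.\<close>
  have gen: "\<exists>b\<in>A. \<exists>d\<in>A. a = b * g + d * f" if a: "a \<in> ideal_of E" for a
  proof -
    obtain b where b: "\<forall>v\<in>T. val_ge v (v f - E v) (b - a / g)" "\<forall>v\<in>fin_places - T. val_ge v 0 b"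
      using strong_approximation[OF T, of "\<lambda>v. v f - E v" "\<lambda>_. a / g"] by blast
    have ag: "val_ge v 0 (a / g)" if v: "v \<in> T" for v
    proof -
      have pv: "place v" "v \<in> fin_places" using v T fin_placesD by blast+
      have "val_ge v (E v) (g * (a / g))" using a pv g[OF v] by (simp add: vbox_def)
      then have "val_ge v (E v - v g) (a / g)" using val_ge_mult_iff[OF pv(1)] g[OF v] by blast
      then show ?thesis using g[OF v] by simp
    qed
    have bA: "b \<in> A" unfolding A_def
    proof (intro CollectI ballI)
      fix v assume v: "v \<in> fin_places"
      show "val_ge v 0 b"
      proof (cases "v \<in> T")
        case True
        have "val_ge v 0 (b - a / g)"
          by (rule val_ge_mono) (use b(1) True E[OF v f] in auto)
        then have "val_ge v 0 (b - a / g + a / g)" using val_ge_add[OF fin_placesD[OF v]] ag[OF True] by blast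
        then show ?thesis by simp
      qed (use b(2) v in blast)
    qed
    have "a - b * g \<in> ideal_of (\<lambda>v. v f)" unfolding vbox_def
    proof (intro CollectI ballI)
      fix v assume v: "v \<in> fin_places"
      note pv = fin_placesD[OF v]
      show "val_ge v (v f) (a - b * g)"
      proof (cases "v \<in> T")
        case True
        have "val_ge v (E v + (v f - E v)) (g * (b - a / g))"
          by (rule val_ge_mult[OF pv]) (use g[OF True] b(1) True val_ge_self[of v g] in auto)
        moreover have "g * (b - a / g) = - (a - b * g)" using g[OF True] by (simp add: algebra_simps)
        ultimately have "val_ge v (E v + (v f - E v)) (- (a - b * g))" by (simp only:)
        then show ?thesis unfolding val_ge_minus_iff[OF pv] by simp
      next
        case False
        then have "v f = 0" "E v = 0" using v by (auto simp: T_def)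
        moreover have "val_ge v (E v) a" "val_ge v (E v) (b * g)"
          using a gM ME bA ideal_of_A v unfolding vbox_def by blast+
        ultimately show ?thesis using val_ge_diff[OF pv] by simp
      qed
    qed
    then have "a - b * g \<in> f *o A" using scale_A[OF f(2)] by simp
    then obtain d where "d \<in> A" "a - b * g = f * d" by (auto simp: elt_set_times_def)
    then have "a = b * g + d * f" by (simp add: algebra_simps)
    then show ?thesis using bA \<open>d \<in> A\<close> by blast
  qed
  have eq: "M = ideal_of E"
  proof
    show "ideal_of E \<subseteq> M"
    proof
      fix a assume "a \<in> ideal_of E"
      then obtain b d where "b \<in> A" "d \<in> A" "a = b * g + d * f" using gen by blast
      then show "a \<in> M" using A_moduleD[OF M(1)] gM f by blast
    qed
  qed (rule ME)
  then show "\<exists>E. fin_supp E \<and> M = ideal_of E \<and> (\<forall>v\<in>fin_places. F v \<le> E v)" using Ef FE by blast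
  have "M = A_span {f, g}"
  proof
    show "A_span {f, g} \<subseteq> M" unfolding A_span_def
      using f gM by (auto intro!: A_module_sum[OF M(1)] A_moduleD(3)[OF M(1)])
    show "M \<subseteq> A_span {f, g}"
    proof
      fix a assume "a \<in> M"
      then obtain b d where bd: "b \<in> A" "d \<in> A" "a = b * g + d * f" using gen eq by blast
      show "a \<in> A_span {f, g}"
      \<comment> \<open>If the generators coincide, the sum over \<open>{f, g}\<close> has a single
        term, so the two coefficients must be added.\<close>
      proof (cases "f = g")
        case True
        then have "a = (\<Sum>s\<in>{f, g}. (b + d) * s)" using bd by (simp add: algebra_simps)
        then show ?thesis unfolding A_span_def using A.Fadd[OF bd(1,2)] by (intro CollectI exI[of _ "\<lambda>_. b + d"]) auto
      next
        case False
        then have "a = (\<Sum>s\<in>{f, g}. (if s = g then b else d) * s)" using bd by (simp add: algebra_simps)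
        then show ?thesis unfolding A_span_def using bd
          by (intro CollectI exI[of _ "\<lambda>s. if s = g then b else d"]) auto
      qed
    qed
  qed
  then show "\<exists>S. finite S \<and> M = A_span S" by (intro exI[of _ "{f, g}"] conjI finite.intros)
qed

lemma ideal_of_nonzero:
  assumes "fin_supp E"
  shows "ideal_of E \<noteq> {0}"
proof -
  obtain f where "f \<in> A" "f \<noteq> 0" "\<forall>v\<in>fin_places. E v \<le> v f" using exists_divisible[OF assms] by blast
  then have "f \<in> ideal_of E" "f \<noteq> 0" by (auto simp: vbox_def val_ge_def)
  then show ?thesis by blast
qed

definition effective :: "('k place \<Rightarrow> int) \<Rightarrow> bool" where
  "effective E \<longleftrightarrow> fin_supp E \<and> (\<forall>v\<in>fin_places. 0 \<le> E v)"

lemma nonzero_ideals_eq: "nonzero_ideals = {ideal_of E | E. effective E}"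
proof (intro Set.set_eqI iffI)
  fix J assume "J \<in> nonzero_ideals"
  then have J: "A_module J" "J \<noteq> {0}" "J \<subseteq> ideal_of (\<lambda>_. 0)"
    unfolding nonzero_ideals_def A_module_def A_vbox by auto
  show "J \<in> {ideal_of E | E. effective E}"
    using bounded_module(1)[OF J(1,2) fin_supp_0 J(3)] unfolding effective_def by auto
next
  fix J assume "J \<in> {ideal_of E | E. effective E}"
  then obtain E where E: "J = ideal_of E" "fin_supp E" "\<forall>v\<in>fin_places. 0 \<le> E v" unfolding effective_def by blast
  then have "J \<subseteq> A" unfolding A_vbox using box_mono[of fin_places "\<lambda>_. 0" E] by blast
  then show "J \<in> nonzero_ideals" using ideal_of_module[of E] ideal_of_nonzero[OF E(2)] E(1)
    unfolding nonzero_ideals_def A_module_def by blast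
qed

text \<open>Generators bound all poles, so \<open>bounded_module\<close> applies; conversely its
  second part supplies generators of \<open>ideal_of E\<close>. Together with
  \<open>ideal_of_eq_iff\<close> this is unique factorization of fractional ideals.\<close>

lemma frac_ideals_eq: "frac_ideals = {ideal_of E | E. fin_supp E}"
proof (intro Set.set_eqI iffI)
  fix M assume "M \<in> frac_ideals"
  then obtain S where M: "M \<noteq> {0}" "finite S" "M = A_span S" unfolding frac_ideals_def A_span_def by blast
  define F where "F v = - (\<Sum>s\<in>S - {0}. \<bar>v s\<bar>)" for v :: "'k place"
  have "fin_supp F"
  proof -
    have "{v \<in> fin_places. F v \<noteq> 0} \<subseteq> (\<Union>s\<in>S - {0}. {v \<in> fin_places. v s \<noteq> 0})"
    proof
      fix v assume v: "v \<in> {v \<in> fin_places. F v \<noteq> 0}"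
      then have "(\<Sum>s\<in>S - {0}. \<bar>v s\<bar>) \<noteq> 0" by (simp add: F_def)
      from sum.not_neutral_contains_not_neutral[OF this] obtain s where "s \<in> S - {0}" "v s \<noteq> 0" by auto
      then show "v \<in> (\<Union>s\<in>S - {0}. {v \<in> fin_places. v s \<noteq> 0})" using v by blast
    qed
    moreover have "finite (\<Union>s\<in>S - {0}. {v \<in> fin_places. v s \<noteq> 0})"
      using M(2) finite_support_fin by blast
    ultimately show ?thesis unfolding fin_supp_def using finite_subset by blast
  qed
  moreover have "A_module M" unfolding A_module_def
  proof (intro conjI ballI)
    show "0 \<in> M" unfolding M(3) A_span_def using A.F01(1) by (intro CollectI exI[of _ "\<lambda>_. 0"]) auto
    fix a b assume "a \<in> M" "b \<in> M"
    then obtain c d where cd: "a = (\<Sum>s\<in>S. c s * s)" "\<forall>s\<in>S. c s \<in> A" "b = (\<Sum>s\<in>S. d s * s)" "\<forall>s\<in>S. d s \<in> A"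
      unfolding M(3) A_span_def by blast
    have "a + b = (\<Sum>s\<in>S. (c s + d s) * s)" using cd by (simp add: sum.distrib algebra_simps)
    then show "a + b \<in> M" unfolding M(3) A_span_def using cd A.Fadd
      by (intro CollectI exI[of _ "\<lambda>s. c s + d s"]) auto
  next
    fix e a assume "e \<in> A" "a \<in> M"
    then obtain c where c: "a = (\<Sum>s\<in>S. c s * s)" "\<forall>s\<in>S. c s \<in> A" unfolding M(3) A_span_def by blast
    have "e * a = (\<Sum>s\<in>S. (e * c s) * s)" using c by (simp add: sum_distrib_left algebra_simps)
    then show "e * a \<in> M" unfolding M(3) A_span_def using c A.Fmult \<open>e \<in> A\<close>
      by (intro CollectI exI[of _ "\<lambda>s. e * c s"]) auto
  qed
  moreover have "M \<subseteq> ideal_of F"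
  proof
    fix a assume "a \<in> M"
    then obtain c where c: "a = (\<Sum>s\<in>S. c s * s)" "\<forall>s\<in>S. c s \<in> A" unfolding M(3) A_span_def by blast
    have "s \<in> ideal_of F" if s: "s \<in> S" for s unfolding vbox_def
    proof (intro CollectI ballI)
      fix v assume "v \<in> fin_places"
      show "val_ge v (F v) s"
      proof (cases "s = 0")
        case False
        then have "\<bar>v s\<bar> \<le> (\<Sum>s\<in>S - {0}. \<bar>v s\<bar>)" using s M(2) by (intro member_le_sum) auto
        then have "F v \<le> v s" unfolding F_def by linarith
        then show ?thesis by (simp add: val_ge_def)
      qed simp
    qed
    then show "a \<in> ideal_of F" unfolding c(1) using c(2) ideal_of_A
      by (intro add_subgroup_sum[OF ideal_of_subgroup]) auto
  qed
  ultimately show "M \<in> {ideal_of E | E. fin_supp E}" using bounded_module(1)[of M F] M(1) by auto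
next
  fix M assume "M \<in> {ideal_of E | E. fin_supp E}"
  then obtain E where E: "M = ideal_of E" "fin_supp E" by blast
  have "\<exists>S. finite S \<and> M = A_span S" unfolding E(1)
    by (rule bounded_module(2)[OF ideal_of_module ideal_of_nonzero[OF E(2)] E(2) subset_refl])
  moreover have "M \<noteq> {0}" using ideal_of_nonzero[OF E(2)] E(1) by simp
  ultimately show "M \<in> frac_ideals" unfolding frac_ideals_def A_span_def by (intro CollectI conjI)
qed

definition product_sum :: "'k set \<Rightarrow> 'k set \<Rightarrow> 'k \<Rightarrow> nat \<Rightarrow> (nat \<Rightarrow> 'k) \<Rightarrow> (nat \<Rightarrow> 'k) \<Rightarrow> bool" where
  "product_sum M N x n a b \<longleftrightarrow> x = (\<Sum>i<n. a i * b i) \<and> (\<forall>i<n. a i \<in> M \<and> b i \<in> N)"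

lemma ideal_mult_iff: "x \<in> ideal_mult M N \<longleftrightarrow> (\<exists>n a b. product_sum M N x n a b)"
  unfolding ideal_mult_def product_sum_def by (rule mem_Collect_eq)

text \<open>The product is a bounded module, hence some \<open>ideal_of G\<close> with
  \<open>G\<close> at least \<open>E + F\<close>; products of elements of exact valuation give the
  opposite inequality.\<close>

lemma ideal_mult_ideal_of:
  assumes "fin_supp E" "fin_supp F"
  shows "ideal_mult (ideal_of E) (ideal_of F) = ideal_of (\<lambda>v. E v + F v)"
proof -
  let ?M = "ideal_mult (ideal_of E) (ideal_of F)"
  have mem: "a * b \<in> ?M" if "a \<in> ideal_of E" "b \<in> ideal_of F" for a b unfolding ideal_mult_iff product_sum_def
    using that by (intro exI[of _ "Suc 0"] exI[of _ "\<lambda>_. a"] exI[of _ "\<lambda>_. b"]) auto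
  have mod: "A_module ?M" unfolding A_module_def
  proof (intro conjI ballI)
    show "0 \<in> ?M" using mem[of 0 0] add_subgroupD(1)[OF ideal_of_subgroup] by simp
    fix x y assume "x \<in> ?M" "y \<in> ?M"
    obtain n a b where "product_sum (ideal_of E) (ideal_of F) x n a b"
      using \<open>x \<in> ?M\<close> ideal_mult_iff by blast
    then have x: "x = (\<Sum>i<n. a i * b i)" "\<forall>i<n. a i \<in> ideal_of E \<and> b i \<in> ideal_of F"
      unfolding product_sum_def by blast+
    obtain m c d where "product_sum (ideal_of E) (ideal_of F) y m c d"
      using \<open>y \<in> ?M\<close> ideal_mult_iff by blast
    then have y: "y = (\<Sum>i<m. c i * d i)" "\<forall>i<m. c i \<in> ideal_of E \<and> d i \<in> ideal_of F"
      unfolding product_sum_def by blast+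
    define e where "e i = (if i < n then a i else c (i - n))" for i
    define h where "h i = (if i < n then b i else d (i - n))" for i
    have "x + y = (\<Sum>i<n + m. e i * h i)" unfolding sum_lessThan_add x y by (simp add: e_def h_def)
    moreover have "\<forall>i<n + m. e i \<in> ideal_of E \<and> h i \<in> ideal_of F" using x y by (auto simp: e_def h_def)
    ultimately show "x + y \<in> ?M" unfolding ideal_mult_iff product_sum_def by blast
  next
    fix e x assume e: "e \<in> A" and "x \<in> ?M"
    obtain n a b where "product_sum (ideal_of E) (ideal_of F) x n a b"
      using \<open>x \<in> ?M\<close> ideal_mult_iff by blast
    then have x: "x = (\<Sum>i<n. a i * b i)" "\<forall>i<n. a i \<in> ideal_of E \<and> b i \<in> ideal_of F"
      unfolding product_sum_def by blast+
    have "e * x = (\<Sum>i<n. (e * a i) * b i)" unfolding x by (simp add: sum_distrib_left mult.assoc)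
    moreover have "\<forall>i<n. e * a i \<in> ideal_of E \<and> b i \<in> ideal_of F" using x(2) ideal_of_A e by blast
    ultimately show "e * x \<in> ?M" unfolding ideal_mult_iff product_sum_def
      by (intro exI[of _ n] exI[of _ "\<lambda>i. e * a i"] exI[of _ b] conjI)
  qed
  have sub: "?M \<subseteq> ideal_of (\<lambda>v. E v + F v)"
    by (auto simp: ideal_mult_iff product_sum_def intro!: add_subgroup_sum[OF ideal_of_subgroup] ideal_of_mult)
  have "?M \<noteq> {0}"
  proof -
    obtain a b where "a \<in> ideal_of E" "a \<noteq> 0" "b \<in> ideal_of F" "b \<noteq> 0"
      using ideal_of_nonzero[OF assms(1)] ideal_of_nonzero[OF assms(2)] add_subgroupD(1)[OF ideal_of_subgroup] by blast
    then have "a * b \<in> ?M" "a * b \<noteq> 0" using mem by auto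
    then show ?thesis by blast
  qed
  from bounded_module(1)[OF mod this fin_supp_add[OF assms] sub]
  obtain G where G: "fin_supp G" "?M = ideal_of G" "\<forall>v\<in>fin_places. E v + F v \<le> G v" by blast
  have "G v = E v + F v" if v: "v \<in> fin_places" for v
  proof -
    obtain a b where ab: "a \<in> ideal_of E" "a \<noteq> 0" "v a = E v" "b \<in> ideal_of F" "b \<noteq> 0" "v b = F v"
      using exact_element[OF assms(1) v] exact_element[OF assms(2) v] by blast
    then have "a * b \<in> ideal_of G" using mem G by blast
    then have "val_ge v (G v) (a * b)" using v by (simp add: vbox_def)
    then have "G v \<le> E v + F v" using ab place_mult[OF fin_placesD[OF v] ab(2,5)] by (simp add: val_ge_def)
    then show ?thesis using G(3) v by force
  qed
  then show ?thesis unfolding G(2) by (rule box_cong)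
qed

section \<open>Degrees of ideals\<close>

lemma logq_power: "logq (q ^ k) = k"
proof -
  have "log (real q) (real (q ^ k)) = real k" using q_ge_2 by (simp add: log_nat_power)
  then show ?thesis by (simp add: logq_def)
qed

definition resid_deg :: "'k place \<Rightarrow> nat" where
  "resid_deg v = logq (resid_card v)"

lemma resid_deg:
  assumes "place v"
  shows "resid_card v = q ^ resid_deg v" "resid_deg v > 0"
proof -
  obtain k where k: "resid_card v = q ^ k" using resid_card_power[OF assms] by blast
  then show e: "resid_card v = q ^ resid_deg v" by (simp add: resid_deg_def logq_power)
  show "resid_deg v > 0"
  proof (rule ccontr)
    assume "\<not> resid_deg v > 0"
    then show False using e resid_card_ge_2[OF assms] by simp
  qed
qed

definition degree_of :: "('k place \<Rightarrow> int) \<Rightarrow> int" where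
  "degree_of E = (\<Sum>v | v \<in> fin_places \<and> E v \<noteq> 0. int (resid_deg v) * E v)"

lemma degree_of_superset:
  assumes "finite T" "{v \<in> fin_places. E v \<noteq> 0} \<subseteq> T" "T \<subseteq> fin_places"
  shows "degree_of E = (\<Sum>v\<in>T. int (resid_deg v) * E v)"
  unfolding degree_of_def using assms by (intro sum.mono_neutral_left) auto

lemma degree_of_add:
  assumes "fin_supp E" "fin_supp F"
  shows "degree_of (\<lambda>v. E v + F v) = degree_of E + degree_of F"
proof -
  define T where "T = {v \<in> fin_places. E v \<noteq> 0} \<union> {v \<in> fin_places. F v \<noteq> 0}"
  have T: "finite T" "T \<subseteq> fin_places" using assms by (auto simp: T_def fin_supp_def)
  have s: "{v \<in> fin_places. E v \<noteq> 0} \<subseteq> T" "{v \<in> fin_places. F v \<noteq> 0} \<subseteq> T"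
    "{v \<in> fin_places. E v + F v \<noteq> 0} \<subseteq> T" by (auto simp: T_def)
  show ?thesis unfolding degree_of_superset[OF T(1) s(1) T(2)] degree_of_superset[OF T(1) s(2) T(2)]
      degree_of_superset[OF T(1) s(3) T(2)] by (simp add: sum.distrib algebra_simps)
qed

lemma effective_fin_supp: "effective E \<Longrightarrow> fin_supp E"
  by (simp add: effective_def)

text \<open>The Chinese remainder theorem in counting form: \<open>fin_box_step\<close> provides the
  full index of every step that \<open>box_index\<close> asks for.\<close>

lemma index_ideal_of:
  assumes "effective E"
  shows "finite (cosets A (ideal_of E))" "int (deg_integral (ideal_of E)) = degree_of E"
proof -
  let ?T = "{v \<in> fin_places. E v \<noteq> 0}"
  have T: "finite ?T" "?T \<subseteq> fin_places" using assms by (auto simp: effective_def fin_supp_def)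
  have E0: "\<And>v. v \<in> fin_places \<Longrightarrow> 0 \<le> E v" using assms by (auto simp: effective_def)
  show "finite (cosets A (ideal_of E))" unfolding A_vbox
    by (rule box_index(1)[OF fin_places_subset T E0]) auto
  have "card (cosets A (ideal_of E)) = (\<Prod>v\<in>?T. resid_card v ^ nat (E v - 0))" unfolding A_vbox
  proof (rule box_index(3)[OF fin_places_subset T E0])
    fix F u assume u: "u \<in> ?T" and F: "\<And>v. v \<in> fin_places \<Longrightarrow> 0 \<le> F v" "\<And>v. v \<in> fin_places \<Longrightarrow> F v \<le> E v"
    have "fin_supp F"
    proof (rule fin_supp_combine[OF effective_fin_supp[OF assms] effective_fin_supp[OF assms]])
      fix v assume "v \<in> fin_places" "E v = 0"
      then show "F v = 0" using F[of v] by simp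
    qed
    then show "card (cosets (ideal_of F) (ideal_of (F(u := F u + 1)))) = resid_card u"
      using fin_box_step u by blast
  qed auto
  also have "\<dots> = (\<Prod>v\<in>?T. q ^ (resid_deg v * nat (E v)))"
  proof (rule prod.cong[OF refl])
    fix v assume "v \<in> ?T"
    then have "resid_card v = q ^ resid_deg v" using resid_deg(1)[of v] fin_placesD by blast
    then show "resid_card v ^ nat (E v - 0) = q ^ (resid_deg v * nat (E v))" by (simp add: power_mult)
  qed
  also have "\<dots> = q ^ (\<Sum>v\<in>?T. resid_deg v * nat (E v))" by (simp add: power_sum)
  finally have "deg_integral (ideal_of E) = (\<Sum>v\<in>?T. resid_deg v * nat (E v))"
    by (simp add: deg_integral_def logq_power)
  then show "int (deg_integral (ideal_of E)) = degree_of E"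
    unfolding degree_of_def using E0 by (auto intro!: sum.cong)
qed

lemma deg_ideal_of:
  assumes E: "fin_supp E"
  shows "deg (ideal_of E) = degree_of E"
proof -
  have eq: "degree_of E = int (deg_integral I) - int (deg_integral J)"
    if IJ: "I \<in> nonzero_ideals" "J \<in> nonzero_ideals" "ideal_mult (ideal_of E) J = I" for I J
  proof -
    obtain G F where GF: "I = ideal_of G" "effective G" "J = ideal_of F" "effective F"
      using IJ nonzero_ideals_eq by auto
    have "ideal_of G = ideal_of (\<lambda>v. E v + F v)"
      using IJ(3) ideal_mult_ideal_of[OF E, of F] GF effective_fin_supp by simp
    then have "\<forall>v\<in>fin_places. G v = E v + F v"
      using ideal_of_eq_iff[of G] GF effective_fin_supp fin_supp_add[OF E] by simp
    then have "degree_of G = degree_of (\<lambda>v. E v + F v)" unfolding degree_of_def by (auto intro!: sum.cong)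
    then show ?thesis using degree_of_add[OF E, of F] index_ideal_of(2) GF effective_fin_supp by simp
  qed
  \<comment> \<open>Multiplication by this effective divisor makes the product effective as well, so
    the condition in the definition of \<open>deg\<close> is not vacuous and has one
    solution.\<close>
  define F where "F v = \<bar>E v\<bar>" for v
  have "fin_supp F" by (rule fin_supp_combine[OF E E]) (simp add: F_def)
  moreover have "fin_supp (\<lambda>v. E v + F v)" using E calculation by (rule fin_supp_add)
  moreover have "ideal_mult (ideal_of E) (ideal_of F) = ideal_of (\<lambda>v. E v + F v)"
    by (rule ideal_mult_ideal_of[OF E \<open>fin_supp F\<close>])
  moreover have "\<forall>v. 0 \<le> F v" "\<forall>v. 0 \<le> E v + F v" by (auto simp: F_def)
  ultimately have ex: "ideal_of F \<in> nonzero_ideals" "ideal_of (\<lambda>v. E v + F v) \<in> nonzero_ideals"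
    "ideal_mult (ideal_of E) (ideal_of F) = ideal_of (\<lambda>v. E v + F v)"
    unfolding nonzero_ideals_eq effective_def by auto
  show ?thesis unfolding deg_def
  proof (rule the_equality)
    show "\<forall>I\<in>nonzero_ideals. \<forall>J\<in>nonzero_ideals.
      ideal_mult (ideal_of E) J = I \<longrightarrow> degree_of E = int (deg_integral I) - int (deg_integral J)" using eq by blast
    fix d assume "\<forall>I\<in>nonzero_ideals. \<forall>J\<in>nonzero_ideals.
      ideal_mult (ideal_of E) J = I \<longrightarrow> d = int (deg_integral I) - int (deg_integral J)"
    then show "d = degree_of E" using ex eq by metis
  qed
qed

lemma degree_of_ge:
  assumes "effective E" "v \<in> fin_places"
  shows "int (resid_deg v) * E v \<le> degree_of E" "0 \<le> degree_of E"
proof -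
  have E: "finite {v \<in> fin_places. E v \<noteq> 0}" "\<And>w. w \<in> fin_places \<Longrightarrow> 0 \<le> E w"
    using assms by (auto simp: effective_def fin_supp_def)
  show 0: "0 \<le> degree_of E" unfolding degree_of_def using E(2) by (auto intro!: sum_nonneg)
  show "int (resid_deg v) * E v \<le> degree_of E"
  proof (cases "E v = 0")
    case False
    then show ?thesis unfolding degree_of_def using E assms(2)
      by (intro member_le_sum[of v _ "\<lambda>v. int (resid_deg v) * E v"]) auto
  qed (use 0 in simp)
qed

text \<open>Among \<open>t ^ 0\<close> to \<open>t ^ m\<close>, for a nonconstant \<open>t\<close>
  in \<open>A\<close>, two powers agree in any residue field with at most \<open>m\<close> elements.
  Hence the place is a zero of one of finitely many nonzero differences.\<close>

lemma finite_small_places: "finite {v \<in> fin_places. resid_card v \<le> m}"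
proof -
  obtain K where K: "\<And>N. resid_card vinf ^ N \<le> K * card (pole_space N)" using pole_space_growth by blast
  \<comment> \<open>A space of constants has at most \<open>q\<close> elements; the exponent
    \<open>K * q\<close> makes the growth estimate exceed this.\<close>
  have "\<not> pole_space (K * q) \<subseteq> Fq"
  proof
    assume "pole_space (K * q) \<subseteq> Fq"
    then have "card (pole_space (K * q)) \<le> q" unfolding q_def using Fq_finite card_mono by blast
    then have "K * card (pole_space (K * q)) \<le> K * q" by (rule mult_le_mono2)
    moreover have "2 ^ (K * q) \<le> resid_card vinf ^ (K * q)"
      using resid_card_ge_2[OF vinf_place] by (intro power_mono) auto
    ultimately show False using K[of "K * q"] less_exp[of "K * q"] by linarith
  qed
  then obtain t where t: "t \<in> A" "t \<notin> Fq" using pole_space_A by blast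
  have diff: "t ^ j - t ^ i \<noteq> 0" if "i < j" for i j
  proof
    assume z: "t ^ j - t ^ i = 0"
    let ?P = "monom (1::'k) j - monom 1 i"
    have "?P \<in> polys_over Fq" by (intro Fq.polys_over_ring Fq_subfield)
    moreover have "poly ?P t = 0" using z by (simp add: poly_monom)
    moreover have "coeff ?P j \<noteq> 0" using that by simp
    then have "?P \<noteq> 0" by (metis coeff_0)
    ultimately have "algebraic_over Fq t" unfolding algebraic_over_def by blast
    then show False using Fq_alg_closed t by blast
  qed
  have inj: "inj_on (\<lambda>i. t ^ i) {..m}"
  proof (rule inj_onI)
    fix i j assume "t ^ i = t ^ j"
    then show "i = j" using diff[of i j] diff[of j i] by (cases i j rule: linorder_cases) auto
  qed
  have "{v \<in> fin_places. resid_card v \<le> m} \<subseteq> (\<Union>j\<in>{..m}. \<Union>i\<in>{..<j}. {v. place v \<and> v (t ^ j - t ^ i) > 0})"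
  proof
    fix v assume v: "v \<in> {v \<in> fin_places. resid_card v \<le> m}"
    then have pv: "place v" using fin_placesD by blast
    have tv: "val_ge v 0 t" using t(1) v by (auto simp: A_def)
    have g: "add_subgroup (vbox {v} (\<lambda>_. 1))" using box_subgroup pv by simp
    have "(\<lambda>i. t ^ i) ` {..m} \<subseteq> vbox {v} (\<lambda>_. 0)" using val_ge_power[OF pv tv] by (auto simp: vbox_def)
    moreover have "card ((\<lambda>i. t ^ i) ` {..m}) = m + 1" using inj by (simp add: card_image)
    ultimately have "\<not> incongruent (vbox {v} (\<lambda>_. 1)) ((\<lambda>i. t ^ i) ` {..m})"
      using incongruent_card_le(2)[OF g, of "(\<lambda>i. t ^ i) ` {..m}" "vbox {v} (\<lambda>_. 0)"]
        resid_index(1)[OF pv, of 0] v by (auto simp: resid_card_def)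
    then obtain i j where ij: "i \<le> m" "j \<le> m" "t ^ i - t ^ j \<in> vbox {v} (\<lambda>_. 1)" "t ^ i \<noteq> t ^ j"
      unfolding incongruent_def by auto
    have ge: "val_ge v 1 (t ^ i - t ^ j)" using ij by (simp add: vbox_def)
    then have ge': "val_ge v 1 (t ^ j - t ^ i)" using val_ge_minus_iff[OF pv, of 1 "t ^ i - t ^ j"] by simp
    show "v \<in> (\<Union>j\<in>{..m}. \<Union>i\<in>{..<j}. {v. place v \<and> v (t ^ j - t ^ i) > 0})"
    proof (cases "i < j")
      case True then show ?thesis using ge' diff[OF True] ij pv by (force simp: val_ge_def)
    next
      case False
      then have ji: "j < i" using ij by (cases i j rule: linorder_cases) auto
      then show ?thesis using ge diff[OF ji] ij pv by (force simp: val_ge_def)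
    qed
  qed
  moreover have "finite (\<Union>j\<in>{..m}. \<Union>i\<in>{..<j}. {v. place v \<and> v (t ^ j - t ^ i) > 0})"
    using finite_zeros[OF diff] by blast
  ultimately show ?thesis by (rule finite_subset)
qed

text \<open>Residue degrees are positive, so a bound on the degree bounds the multiplicities as well
  as the residue fields that can occur.\<close>

lemma finite_small_ideals: "finite {J \<in> nonzero_ideals. deg J \<le> int n}"
proof -
  define V where "V = {v \<in> fin_places. resid_card v \<le> q ^ n}"
  have V: "finite V" unfolding V_def by (rule finite_small_places)
  have "{J \<in> nonzero_ideals. deg J \<le> int n}
    \<subseteq> (\<lambda>e. ideal_of (\<lambda>v. if v \<in> V then e v else 0)) ` (V \<rightarrow>\<^sub>E {0..int n})"
  proof
    fix J assume "J \<in> {J \<in> nonzero_ideals. deg J \<le> int n}"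
    then obtain E where E: "J = ideal_of E" "effective E" "deg J \<le> int n" unfolding nonzero_ideals_eq by blast
    have d: "degree_of E \<le> int n" using E deg_ideal_of effective_fin_supp by simp
    have E0: "0 \<le> E v" if "v \<in> fin_places" for v using E(2) that by (simp add: effective_def)
    have b: "int (resid_deg v) * E v \<le> int n" if "v \<in> fin_places" for v using degree_of_ge(1)[OF E(2) that] d by simp
    have le: "E v \<le> int n" if v: "v \<in> fin_places" for v
    proof -
      have "1 * E v \<le> int (resid_deg v) * E v"
        using resid_deg(2)[OF fin_placesD[OF v]] E0[OF v] by (intro mult_right_mono) auto
      then show ?thesis using b[OF v] by simp
    qed
    have z: "E v = 0" if v: "v \<in> fin_places" "v \<notin> V" for v
    proof (rule ccontr)
      assume "E v \<noteq> 0"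
      then have "int (resid_deg v) * 1 \<le> int (resid_deg v) * E v" using E0[OF v(1)] by (intro mult_left_mono) auto
      then have "resid_deg v \<le> n" using b[OF v(1)] by simp
      then have "resid_card v \<le> q ^ n" using resid_deg(1)[OF fin_placesD[OF v(1)]] q_ge_2 by (simp add: power_increasing)
      then show False using v by (simp add: V_def)
    qed
    have "J = ideal_of (\<lambda>v. if v \<in> V then restrict E V v else 0)"
      unfolding E(1) by (rule box_cong) (use z in auto)
    moreover have "restrict E V \<in> V \<rightarrow>\<^sub>E {0..int n}" using E0 le by (auto simp: V_def)
    ultimately show "J \<in> (\<lambda>e. ideal_of (\<lambda>v. if v \<in> V then e v else 0)) ` (V \<rightarrow>\<^sub>E {0..int n})" by blast
  qed
  moreover have "finite (V \<rightarrow>\<^sub>E {0..int n})" using V by (simp add: finite_PiE)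
  ultimately show ?thesis using finite_surj by blast
qed

lemma deg_nonneg: "J \<in> nonzero_ideals \<Longrightarrow> 0 \<le> deg J"
proof -
  assume "J \<in> nonzero_ideals"
  then obtain E where E: "J = ideal_of E" "effective E" unfolding nonzero_ideals_eq by blast
  show ?thesis
    using deg_ideal_of[OF effective_fin_supp[OF E(2)]] E
    by (auto simp: degree_of_def effective_def intro!: sum_nonneg)
qed

lemma A_ideal: "A \<in> nonzero_ideals" "deg A = 0"
proof -
  show "A \<in> nonzero_ideals" unfolding nonzero_ideals_eq A_vbox effective_def
    by (intro CollectI exI[of _ "\<lambda>_. 0"]) simp
  show "deg A = 0" unfolding A_vbox deg_ideal_of[OF fin_supp_0] by (simp add: degree_of_def)
qed

lemma deg_pos:
  assumes "J \<in> nonzero_ideals" "J \<noteq> A"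
  shows "deg J > 0"
proof -
  obtain E where E: "J = ideal_of E" "effective E" using assms(1) unfolding nonzero_ideals_eq by blast
  have "\<exists>v\<in>fin_places. E v \<noteq> 0"
  proof (rule ccontr)
    assume "\<not> ?thesis"
    then have "J = A" unfolding E(1) A_vbox by (intro box_cong) auto
    then show False using assms by blast
  qed
  then obtain v where v: "v \<in> fin_places" "E v \<noteq> 0" by blast
  then have "E v > 0" using E(2) by (auto simp: effective_def less_le)
  then have "int (resid_deg v) * E v > 0" using resid_deg(2)[OF fin_placesD[OF v(1)]] by simp
  then show ?thesis using degree_of_ge(1)[OF E(2) v(1)] deg_ideal_of[OF effective_fin_supp[OF E(2)]] E(1) by simp
qed

end

section \<open>Completions\<close>

context global_function_field
begin

section \<open>Cauchy sequences modulo null sequences\<close>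

lemma cauchy_simps [simp]:
  "mult (cauchy_ring v) = (\<lambda>f g i. f i * g i)" "add (cauchy_ring v) = (\<lambda>f g i. f i + g i)"
  "one (cauchy_ring v) = (\<lambda>_. 1)" "zero (cauchy_ring v) = (\<lambda>_. 0)"
  by (simp_all add: cauchy_ring_def)

abbreviation cauchy :: "'k place \<Rightarrow> (nat \<Rightarrow> 'k) \<Rightarrow> bool" where
  "cauchy v f \<equiv> f \<in> carrier (cauchy_ring v)"

lemma cauchy_iff: "cauchy v f \<longleftrightarrow> (\<forall>n. \<exists>N. \<forall>i\<ge>N. \<forall>j\<ge>N. val_ge v n (f i - f j))"
  by (simp add: cauchy_ring_def)

lemma null_iff: "f \<in> null_seqs v \<longleftrightarrow> (\<forall>n. \<forall>\<^sub>F i in sequentially. val_ge v n (f i))"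
  by (simp add: null_seqs_def eventually_sequentially)

lemma cauchy_bounded:
  assumes "place v" "cauchy v f"
  shows "\<exists>m. \<forall>i. val_ge v m (f i)"
proof -
  obtain N where N: "\<forall>i\<ge>N. \<forall>j\<ge>N. val_ge v 0 (f i - f j)" using assms(2) cauchy_iff by blast
  define m where "m = - (\<Sum>i\<le>N. \<bar>v (f i)\<bar>)"
  have m: "m \<le> v (f i)" if "i \<le> N" for i
  proof -
    have "\<bar>v (f i)\<bar> \<le> (\<Sum>i\<le>N. \<bar>v (f i)\<bar>)" using that by (intro member_le_sum) auto
    then show ?thesis by (simp add: m_def)
  qed
  have m0: "m \<le> 0" by (simp add: m_def sum_nonneg)
  have "val_ge v m (f i)" for i
  proof (cases "i \<le> N")
    case True then show ?thesis using m by (simp add: val_ge_def)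
  next
    case False
    then have "val_ge v m (f i - f N)" using N by (intro val_ge_mono[OF _ m0]) auto
    moreover have "val_ge v m (f N)" using m by (simp add: val_ge_def)
    ultimately have "val_ge v m (f i - f N + f N)" by (rule val_ge_add[OF assms(1)])
    then show ?thesis by simp
  qed
  then show ?thesis by blast
qed

lemma cauchy_diff:
  assumes "place v" "cauchy v f" "cauchy v g"
  shows "cauchy v (\<lambda>i. f i - g i)"
  unfolding cauchy_iff
proof
  fix n
  obtain N M where N: "\<forall>i\<ge>N. \<forall>j\<ge>N. val_ge v n (f i - f j)" and M: "\<forall>i\<ge>M. \<forall>j\<ge>M. val_ge v n (g i - g j)"
    using assms(2,3) cauchy_iff by meson
  have "val_ge v n ((f i - g i) - (f j - g j))" if "i \<ge> max N M" "j \<ge> max N M" for i j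
  proof -
    have "val_ge v n (f i - f j)" "val_ge v n (g i - g j)" using that N M by auto
    then have "val_ge v n ((f i - f j) - (g i - g j))" by (rule val_ge_diff[OF assms(1)])
    then show ?thesis by (simp add: algebra_simps)
  qed
  then show "\<exists>N. \<forall>i\<ge>N. \<forall>j\<ge>N. val_ge v n ((f i - g i) - (f j - g j))" by blast
qed

lemma cauchy_const: "cauchy v (\<lambda>_. a)"
  unfolding cauchy_iff by simp

lemma cauchy_minus:
  assumes "place v" "cauchy v f"
  shows "cauchy v (\<lambda>i. - f i)"
proof -
  have "cauchy v (\<lambda>i. 0 - f i)" by (rule cauchy_diff[OF assms(1) cauchy_const assms(2)])
  then show ?thesis by (simp only: diff_0)
qed

lemma cauchy_add:
  assumes "place v" "cauchy v f" "cauchy v g"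
  shows "cauchy v (\<lambda>i. f i + g i)"
proof -
  have "cauchy v (\<lambda>i. f i - - g i)" by (rule cauchy_diff[OF assms(1,2) cauchy_minus[OF assms(1,3)]])
  then show ?thesis by (simp only: diff_minus_eq_add)
qed

lemma cauchy_mult:
  assumes v: "place v" and f: "cauchy v f" and g: "cauchy v g"
  shows "cauchy v (\<lambda>i. f i * g i)"
  unfolding cauchy_iff
proof
  fix n
  obtain a b where a: "\<And>i. val_ge v a (f i)" and b: "\<And>i. val_ge v b (g i)"
    using cauchy_bounded[OF v f] cauchy_bounded[OF v g] by blast
  obtain N M where N: "\<forall>i\<ge>N. \<forall>j\<ge>N. val_ge v (n - b) (f i - f j)" and M: "\<forall>i\<ge>M. \<forall>j\<ge>M. val_ge v (n - a) (g i - g j)"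
    using f g cauchy_iff by meson
  have "val_ge v n (f i * g i - f j * g j)" if "i \<ge> max N M" "j \<ge> max N M" for i j
  proof -
    have "val_ge v (a + (n - a)) (f i * (g i - g j))" "val_ge v ((n - b) + b) ((f i - f j) * g j)"
      using that N M by (intro val_ge_mult[OF v] a b; simp)+
    then have "val_ge v n (f i * (g i - g j) + (f i - f j) * g j)" using val_ge_add[OF v] by simp
    then show ?thesis by (simp add: algebra_simps)
  qed
  then show "\<exists>N. \<forall>i\<ge>N. \<forall>j\<ge>N. val_ge v n (f i * g i - f j * g j)" by blast
qed

lemma cauchy_cring:
  assumes "place v"
  shows "cring (cauchy_ring v)"
proof (rule cringI)
  show "abelian_group (cauchy_ring v)"
  proof (rule abelian_groupI)
    fix f assume f: "f \<in> carrier (cauchy_ring v)"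
    show "\<exists>g\<in>carrier (cauchy_ring v). g \<oplus>\<^bsub>cauchy_ring v\<^esub> f = \<zero>\<^bsub>cauchy_ring v\<^esub>"
      using cauchy_minus[OF assms f] by (intro bexI[of _ "\<lambda>i. - f i"]) auto
  qed (simp_all add: cauchy_add[OF assms] cauchy_const add.assoc add.commute add.left_commute)
  show "comm_monoid (cauchy_ring v)"
    by (rule comm_monoidI) (simp_all add: cauchy_mult[OF assms] cauchy_const mult.assoc mult.commute mult.left_commute)
qed (simp add: distrib_right)

lemma null_add:
  assumes v: "place v" and f: "f \<in> null_seqs v" and g: "g \<in> null_seqs v"
  shows "(\<lambda>i. f i + g i) \<in> null_seqs v"
  unfolding null_iff
proof
  fix n
  have "\<forall>\<^sub>F i in sequentially. val_ge v n (f i)" "\<forall>\<^sub>F i in sequentially. val_ge v n (g i)"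
    using f g null_iff by blast+
  then show "\<forall>\<^sub>F i in sequentially. val_ge v n (f i + g i)" by eventually_elim (rule val_ge_add[OF v])
qed

lemma null_minus: "place v \<Longrightarrow> f \<in> null_seqs v \<Longrightarrow> (\<lambda>i. - f i) \<in> null_seqs v"
  unfolding null_iff by (simp add: val_ge_minus_iff)

lemma null_cauchy:
  assumes v: "place v" and f: "f \<in> null_seqs v"
  shows "cauchy v f"
  unfolding cauchy_iff
proof
  fix n
  obtain N where "\<forall>i\<ge>N. val_ge v n (f i)" using f by (auto simp: null_iff eventually_sequentially)
  then show "\<exists>N. \<forall>i\<ge>N. \<forall>j\<ge>N. val_ge v n (f i - f j)" using val_ge_diff[OF v] by blast
qed

lemma null_mult:
  assumes v: "place v" and f: "f \<in> null_seqs v" and g: "cauchy v g"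
  shows "(\<lambda>i. g i * f i) \<in> null_seqs v"
  unfolding null_iff
proof
  fix n
  obtain b where b: "\<And>i. val_ge v b (g i)" using cauchy_bounded[OF v g] by blast
  have "\<forall>\<^sub>F i in sequentially. val_ge v (n - b) (f i)" using f by (simp add: null_iff)
  then show "\<forall>\<^sub>F i in sequentially. val_ge v n (g i * f i)"
  proof eventually_elim
    case (elim i)
    then show ?case using val_ge_mult[OF v b elim, of i] by simp
  qed
qed

lemma cauchy_a_inv:
  assumes "place v" "cauchy v f"
  shows "\<ominus>\<^bsub>cauchy_ring v\<^esub> f = (\<lambda>i. - f i)"
proof -
  interpret cring "cauchy_ring v" by (rule cauchy_cring[OF assms(1)])
  show ?thesis by (rule minus_equality) (use cauchy_minus assms in auto)
qed

lemma null_ideal: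
  assumes "place v"
  shows "ideal (null_seqs v) (cauchy_ring v)"
proof -
  interpret cring "cauchy_ring v" by (rule cauchy_cring[OF assms])
  show ?thesis
  proof (rule idealI[OF ring_axioms])
    show "subgroup (null_seqs v) (add_monoid (cauchy_ring v))"
    proof
      show "null_seqs v \<subseteq> carrier (add_monoid (cauchy_ring v))" using null_cauchy[OF assms] by auto
      show "\<one>\<^bsub>add_monoid (cauchy_ring v)\<^esub> \<in> null_seqs v" by (simp add: null_iff)
      fix f assume f: "f \<in> null_seqs v"
      show "inv\<^bsub>add_monoid (cauchy_ring v)\<^esub> f \<in> null_seqs v"
        using cauchy_a_inv[OF assms null_cauchy[OF assms f]] null_minus[OF assms f] by (simp add: a_inv_def)
    qed (auto intro: null_add[OF assms])
    fix f g assume fg: "f \<in> null_seqs v" "g \<in> carrier (cauchy_ring v)"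
    show "g \<otimes>\<^bsub>cauchy_ring v\<^esub> f \<in> null_seqs v" using null_mult[OF assms fg] by simp
    then show "f \<otimes>\<^bsub>cauchy_ring v\<^esub> g \<in> null_seqs v" by (simp add: mult.commute)
  qed
qed

lemma completion_cring: "place v \<Longrightarrow> cring (completion v)"
  unfolding completion_def by (intro ideal.quotient_is_cring null_ideal cauchy_cring)

definition lim_of :: "'k place \<Rightarrow> (nat \<Rightarrow> 'k) \<Rightarrow> (nat \<Rightarrow> 'k) set" where
  "lim_of v f = null_seqs v +>\<^bsub>cauchy_ring v\<^esub> f"

lemma lim_of_mem_iff: "g \<in> lim_of v f \<longleftrightarrow> (\<lambda>i. g i - f i) \<in> null_seqs v"
proof
  assume "g \<in> lim_of v f"
  then obtain h where "h \<in> null_seqs v" "g = (\<lambda>i. h i + f i)" by (auto simp: lim_of_def a_r_coset_def')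
  then show "(\<lambda>i. g i - f i) \<in> null_seqs v" by simp
next
  assume h: "(\<lambda>i. g i - f i) \<in> null_seqs v"
  have "g = (\<lambda>i. (g i - f i) + f i)" by simp
  then show "g \<in> lim_of v f" unfolding lim_of_def a_r_coset_def' cauchy_simps using h by blast
qed

lemma lim_of_eq_iff:
  assumes "place v"
  shows "lim_of v f = lim_of v g \<longleftrightarrow> (\<lambda>i. f i - g i) \<in> null_seqs v"
proof
  assume "lim_of v f = lim_of v g"
  moreover have "f \<in> lim_of v f" by (simp add: lim_of_mem_iff null_iff)
  ultimately show "(\<lambda>i. f i - g i) \<in> null_seqs v" using lim_of_mem_iff by blast
next
  have *: "lim_of v f \<subseteq> lim_of v g" if "(\<lambda>i. f i - g i) \<in> null_seqs v" for f g
  proof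
    fix h assume "h \<in> lim_of v f"
    then have "(\<lambda>i. (h i - f i) + (f i - g i)) \<in> null_seqs v"
      using null_add[OF assms _ that] lim_of_mem_iff by blast
    then show "h \<in> lim_of v g" by (simp add: lim_of_mem_iff)
  qed
  assume h: "(\<lambda>i. f i - g i) \<in> null_seqs v"
  then have "(\<lambda>i. g i - f i) \<in> null_seqs v" using null_minus[OF assms h] by simp
  then show "lim_of v f = lim_of v g" using *[OF h] *[of g f] by blast
qed

lemma completion_carrier: "carrier (completion v) = lim_of v ` carrier (cauchy_ring v)"
  unfolding completion_def FactRing_def lim_of_def by (auto simp: A_RCOSETS_def')

lemma completionD: "X \<in> carrier (completion v) \<Longrightarrow> \<exists>f. cauchy v f \<and> X = lim_of v f"
  unfolding completion_carrier by blast

lemma lim_of_carrier: "cauchy v f \<Longrightarrow> lim_of v f \<in> carrier (completion v)"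
  using completion_carrier by blast

lemma completion_ops:
  assumes "place v"
  shows "cauchy v f \<Longrightarrow> cauchy v g \<Longrightarrow> lim_of v f \<oplus>\<^bsub>completion v\<^esub> lim_of v g = lim_of v (\<lambda>i. f i + g i)"
    "cauchy v f \<Longrightarrow> cauchy v g \<Longrightarrow> lim_of v f \<otimes>\<^bsub>completion v\<^esub> lim_of v g = lim_of v (\<lambda>i. f i * g i)"
    "\<zero>\<^bsub>completion v\<^esub> = lim_of v (\<lambda>_. 0)" "\<one>\<^bsub>completion v\<^esub> = lim_of v (\<lambda>_. 1)"
    "cauchy v f \<Longrightarrow> \<ominus>\<^bsub>completion v\<^esub> lim_of v f = lim_of v (\<lambda>i. - f i)"
    "cauchy v f \<Longrightarrow> cauchy v g \<Longrightarrow> lim_of v f \<ominus>\<^bsub>completion v\<^esub> lim_of v g = lim_of v (\<lambda>i. f i - g i)"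
proof -
  interpret I: ideal "null_seqs v" "cauchy_ring v" by (rule null_ideal[OF assms])
  interpret C: cring "completion v" by (rule completion_cring[OF assms])
  show a: "lim_of v f \<oplus>\<^bsub>completion v\<^esub> lim_of v g = lim_of v (\<lambda>i. f i + g i)"
    if "cauchy v f" "cauchy v g" for f g
    using I.a_rcos_sum[OF that] by (simp add: completion_def FactRing_def lim_of_def)
  show "lim_of v f \<otimes>\<^bsub>completion v\<^esub> lim_of v g = lim_of v (\<lambda>i. f i * g i)" if "cauchy v f" "cauchy v g"
    using I.rcoset_mult_add[OF that] by (simp add: completion_def FactRing_def lim_of_def)
  have "lim_of v (\<lambda>_. 0) = null_seqs v" by (rule Set.set_eqI) (simp add: lim_of_mem_iff)
  then show z: "\<zero>\<^bsub>completion v\<^esub> = lim_of v (\<lambda>_. 0)" by (simp add: completion_def FactRing_def)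
  show "\<one>\<^bsub>completion v\<^esub> = lim_of v (\<lambda>_. 1)" by (simp add: completion_def FactRing_def lim_of_def)
  show m: "\<ominus>\<^bsub>completion v\<^esub> lim_of v f = lim_of v (\<lambda>i. - f i)" if f: "cauchy v f" for f
  proof (rule C.minus_equality)
    show "lim_of v (\<lambda>i. - f i) \<oplus>\<^bsub>completion v\<^esub> lim_of v f = \<zero>\<^bsub>completion v\<^esub>"
      using a[OF cauchy_minus[OF assms f] f] z by simp
  qed (use lim_of_carrier cauchy_minus[OF assms] f in blast)+
  show "lim_of v f \<ominus>\<^bsub>completion v\<^esub> lim_of v g = lim_of v (\<lambda>i. f i - g i)" if "cauchy v f" "cauchy v g"
    using that m a[OF that(1) cauchy_minus[OF assms that(2)]] by (simp add: a_minus_def)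
qed

text \<open>A ball asks for one representative that is good at every index. Finitely many terms may
  be replaced by 0, so for a given representative this is a condition on late indices only.\<close>

lemma lim_of_ball:
  assumes v: "place v" and f: "cauchy v f"
  shows "lim_of v f \<in> completion_ball v n \<longleftrightarrow> (\<forall>\<^sub>F i in sequentially. val_ge v n (f i))"
proof
  assume "lim_of v f \<in> completion_ball v n"
  then obtain g where g: "(\<lambda>i. g i - f i) \<in> null_seqs v" "\<forall>i. val_ge v n (g i)"
    by (auto simp: completion_ball_def lim_of_mem_iff)
  have "\<forall>\<^sub>F i in sequentially. val_ge v n (g i - f i)" using g(1) by (simp add: null_iff)
  then show "\<forall>\<^sub>F i in sequentially. val_ge v n (f i)"
  proof eventually_elim
    case (elim i)
    then show ?case using val_ge_diff[OF v g(2)[rule_format, of i] elim] by simp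
  qed
next
  assume "\<forall>\<^sub>F i in sequentially. val_ge v n (f i)"
  then obtain N where N: "\<forall>i\<ge>N. val_ge v n (f i)" by (auto simp: eventually_sequentially)
  define g where "g i = (if i \<ge> N then f i else 0)" for i
  have "\<forall>\<^sub>F i in sequentially. g i - f i = 0" unfolding eventually_sequentially g_def by auto
  then have "(\<lambda>i. g i - f i) \<in> null_seqs v" unfolding null_iff by (auto elim: eventually_mono)
  moreover have "\<forall>i. val_ge v n (g i)" using N by (simp add: g_def)
  ultimately show "lim_of v f \<in> completion_ball v n"
    unfolding completion_ball_def using lim_of_carrier[OF f] lim_of_mem_iff by blast
qed

lemma ball_carrier: "X \<in> completion_ball v n \<Longrightarrow> X \<in> carrier (completion v)"
  by (simp add: completion_ball_def)

lemma ball_mono: "X \<in> completion_ball v n \<Longrightarrow> m \<le> n \<Longrightarrow> X \<in> completion_ball v m"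
  unfolding completion_ball_def using val_ge_mono by blast

lemma ball_add:
  assumes v: "place v" and X: "X \<in> completion_ball v n" "Y \<in> completion_ball v n"
  shows "X \<oplus>\<^bsub>completion v\<^esub> Y \<in> completion_ball v n" "X \<ominus>\<^bsub>completion v\<^esub> Y \<in> completion_ball v n"
    "\<ominus>\<^bsub>completion v\<^esub> X \<in> completion_ball v n"
proof -
  obtain f g where f: "cauchy v f" "X = lim_of v f" and g: "cauchy v g" "Y = lim_of v g"
    using completionD[OF ball_carrier[OF X(1)]] completionD[OF ball_carrier[OF X(2)]] by blast
  have e: "\<forall>\<^sub>F i in sequentially. val_ge v n (f i)" "\<forall>\<^sub>F i in sequentially. val_ge v n (g i)"
    using X f g lim_of_ball[OF v] by auto
  show "X \<oplus>\<^bsub>completion v\<^esub> Y \<in> completion_ball v n"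
    unfolding f(2) g(2) completion_ops(1)[OF v f(1) g(1)] lim_of_ball[OF v cauchy_add[OF v f(1) g(1)]]
    using e by eventually_elim (rule val_ge_add[OF v])
  show "X \<ominus>\<^bsub>completion v\<^esub> Y \<in> completion_ball v n"
    unfolding f(2) g(2) completion_ops(6)[OF v f(1) g(1)] lim_of_ball[OF v cauchy_diff[OF v f(1) g(1)]]
    using e by eventually_elim (rule val_ge_diff[OF v])
  show "\<ominus>\<^bsub>completion v\<^esub> X \<in> completion_ball v n"
    unfolding f(2) completion_ops(5)[OF v f(1)] lim_of_ball[OF v cauchy_minus[OF v f(1)]]
    using e(1) by eventually_elim (simp add: val_ge_minus_iff[OF v])
qed

lemma ball_mult:
  assumes v: "place v" and X: "X \<in> completion_ball v n" "Y \<in> completion_ball v m"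
  shows "X \<otimes>\<^bsub>completion v\<^esub> Y \<in> completion_ball v (n + m)"
proof -
  obtain f g where f: "cauchy v f" "X = lim_of v f" and g: "cauchy v g" "Y = lim_of v g"
    using completionD[OF ball_carrier[OF X(1)]] completionD[OF ball_carrier[OF X(2)]] by blast
  have e: "\<forall>\<^sub>F i in sequentially. val_ge v n (f i)" "\<forall>\<^sub>F i in sequentially. val_ge v m (g i)"
    using X f g lim_of_ball[OF v] by auto
  show ?thesis
    unfolding f(2) g(2) completion_ops(2)[OF v f(1) g(1)] lim_of_ball[OF v cauchy_mult[OF v f(1) g(1)]]
    using e by eventually_elim (rule val_ge_mult[OF v])
qed

definition const :: "'k place \<Rightarrow> 'k \<Rightarrow> (nat \<Rightarrow> 'k) set" where
  "const v a = lim_of v (\<lambda>_. a)"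

lemma const_carrier: "const v a \<in> carrier (completion v)"
  unfolding const_def by (rule lim_of_carrier[OF cauchy_const])

lemma const_ball: "place v \<Longrightarrow> const v a \<in> completion_ball v n \<longleftrightarrow> val_ge v n a"
  unfolding const_def lim_of_ball[OF _ cauchy_const] by simp

lemma const_ops:
  assumes "place v"
  shows "const v a \<oplus>\<^bsub>completion v\<^esub> const v b = const v (a + b)"
    "const v a \<otimes>\<^bsub>completion v\<^esub> const v b = const v (a * b)"
    "const v a \<ominus>\<^bsub>completion v\<^esub> const v b = const v (a - b)"
    "\<zero>\<^bsub>completion v\<^esub> = const v 0" "\<one>\<^bsub>completion v\<^esub> = const v 1"
  unfolding const_def
  by (rule completion_ops(1,2,6)[OF assms cauchy_const cauchy_const] completion_ops(3,4)[OF assms])+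

lemma zero_ball: "place v \<Longrightarrow> \<zero>\<^bsub>completion v\<^esub> \<in> completion_ball v n"
  unfolding const_ops(4) const_ball by simp

lemma one_ball: "place v \<Longrightarrow> \<one>\<^bsub>completion v\<^esub> \<in> completion_ball v 0"
  unfolding const_ops(5) const_ball by (rule val_ge_one)

lemma const_dense:
  assumes v: "place v" and X: "X \<in> carrier (completion v)"
  shows "\<exists>a. const v a \<ominus>\<^bsub>completion v\<^esub> X \<in> completion_ball v n"
proof -
  obtain f where f: "cauchy v f" "X = lim_of v f" using completionD[OF X] by blast
  obtain N where N: "\<forall>i\<ge>N. \<forall>j\<ge>N. val_ge v n (f i - f j)" using f cauchy_iff by blast
  have "\<forall>\<^sub>F i in sequentially. val_ge v n (f N - f i)" unfolding eventually_sequentially using N by blast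
  then have "const v (f N) \<ominus>\<^bsub>completion v\<^esub> X \<in> completion_ball v n"
    unfolding f(2) const_def completion_ops(6)[OF v cauchy_const f(1)]
      lim_of_ball[OF v cauchy_diff[OF v cauchy_const f(1)]] .
  then show ?thesis by blast
qed

lemma ball_zero:
  assumes v: "place v" and X: "\<And>n. X \<in> completion_ball v n"
  shows "X = \<zero>\<^bsub>completion v\<^esub>"
proof -
  obtain f where f: "cauchy v f" "X = lim_of v f" using completionD[OF ball_carrier[OF X]] by blast
  have "f \<in> null_seqs v" using X f lim_of_ball[OF v f(1)] by (simp add: null_iff)
  then show ?thesis unfolding f(2) completion_ops(3)[OF v] lim_of_eq_iff[OF v] by simp
qed

text \<open>The valuation as a relation, since 0 has none; stated through balls it does not refer to
  representatives.\<close>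

definition has_ord :: "'k place \<Rightarrow> (nat \<Rightarrow> 'k) set \<Rightarrow> int \<Rightarrow> bool" where
  "has_ord v X n \<longleftrightarrow> X \<in> carrier (completion v) \<and> (\<forall>m. X \<in> completion_ball v m \<longleftrightarrow> m \<le> n)"

lemma has_ord_unique: "has_ord v X n \<Longrightarrow> has_ord v X m \<Longrightarrow> n = m"
  unfolding has_ord_def by (auto intro: order.antisym)

text \<open>A late term whose valuation lies below that of all further differences fixes the
  valuation of the remaining terms; such a term exists unless the sequence is null.\<close>

lemma cauchy_ord:
  assumes v: "place v" and f: "cauchy v f" and nn: "f \<notin> null_seqs v"
  shows "\<exists>n. \<forall>\<^sub>F i in sequentially. f i \<noteq> 0 \<and> v (f i) = n"
proof -
  obtain n where n: "\<not> (\<forall>\<^sub>F i in sequentially. val_ge v n (f i))" using nn null_iff by blast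
  obtain N where N: "\<forall>i\<ge>N. \<forall>j\<ge>N. val_ge v n (f i - f j)" using f cauchy_iff by blast
  obtain k where k: "k \<ge> N" "\<not> val_ge v n (f k)" using n by (auto simp: eventually_sequentially)
  have fk: "f k \<noteq> 0" "v (f k) < n" using k by (auto simp: val_ge_def)
  have "f i \<noteq> 0 \<and> v (f i) = v (f k)" if "i \<ge> N" for i
  proof -
    have "val_ge v (v (f k) + 1) (f i - f k)" by (rule val_ge_mono[of v n]) (use N k that fk in auto)
    then show ?thesis using place_add_eq[OF v fk(1)] by force
  qed
  then show ?thesis unfolding eventually_sequentially by blast
qed

lemma lim_of_has_ord:
  assumes v: "place v" and f: "cauchy v f" and e: "\<forall>\<^sub>F i in sequentially. f i \<noteq> 0 \<and> v (f i) = n"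
  shows "has_ord v (lim_of v f) n"
  unfolding has_ord_def
proof (intro conjI allI)
  show "lim_of v f \<in> carrier (completion v)" by (rule lim_of_carrier[OF f])
  fix m
  show "lim_of v f \<in> completion_ball v m \<longleftrightarrow> m \<le> n" unfolding lim_of_ball[OF v f]
  proof
    assume "\<forall>\<^sub>F i in sequentially. val_ge v m (f i)"
    then have "\<forall>\<^sub>F i in sequentially. m \<le> n" using e by eventually_elim (auto simp: val_ge_def)
    then show "m \<le> n" by simp
  next
    assume "m \<le> n"
    then show "\<forall>\<^sub>F i in sequentially. val_ge v m (f i)" using e by (auto simp: val_ge_def elim: eventually_mono)
  qed
qed

lemma has_ord_lim_of:
  assumes v: "place v" and f: "cauchy v f" and o: "has_ord v (lim_of v f) n"
  shows "\<forall>\<^sub>F i in sequentially. f i \<noteq> 0 \<and> v (f i) = n"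
proof -
  have "f \<notin> null_seqs v"
  proof
    assume "f \<in> null_seqs v"
    then have "lim_of v f \<in> completion_ball v (n + 1)" unfolding lim_of_ball[OF v f] by (simp add: null_iff)
    then show False using o by (simp add: has_ord_def)
  qed
  then obtain m where m: "\<forall>\<^sub>F i in sequentially. f i \<noteq> 0 \<and> v (f i) = m" using cauchy_ord[OF v f] by blast
  then have "n = m" using lim_of_has_ord[OF v f m] has_ord_unique[OF o] by blast
  then show ?thesis using m by simp
qed

lemma has_ord_exists:
  assumes v: "place v" and X: "X \<in> carrier (completion v)" "X \<noteq> \<zero>\<^bsub>completion v\<^esub>"
  shows "\<exists>n. has_ord v X n"
proof -
  obtain f where f: "cauchy v f" "X = lim_of v f" using completionD[OF X(1)] by blast
  have "f \<notin> null_seqs v" using X(2) unfolding f(2) completion_ops(3)[OF v] lim_of_eq_iff[OF v] by simp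
  then show ?thesis using cauchy_ord[OF v f(1)] lim_of_has_ord[OF v f(1)] f(2) by blast
qed

lemma has_ord_mult:
  assumes v: "place v" and X: "has_ord v X n" and Y: "has_ord v Y m"
  shows "has_ord v (X \<otimes>\<^bsub>completion v\<^esub> Y) (n + m)"
proof -
  obtain f g where f: "cauchy v f" "X = lim_of v f" and g: "cauchy v g" "Y = lim_of v g"
    using completionD[of X v] completionD[of Y v] X Y unfolding has_ord_def by blast
  have "\<forall>\<^sub>F i in sequentially. f i \<noteq> 0 \<and> v (f i) = n" "\<forall>\<^sub>F i in sequentially. g i \<noteq> 0 \<and> v (g i) = m"
    using has_ord_lim_of[OF v] f g X Y by blast+
  then have "\<forall>\<^sub>F i in sequentially. f i * g i \<noteq> 0 \<and> v (f i * g i) = n + m"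
    by eventually_elim (simp add: place_mult[OF v])
  then show ?thesis
    unfolding f(2) g(2) completion_ops(2)[OF v f(1) g(1)] by (rule lim_of_has_ord[OF v cauchy_mult[OF v f(1) g(1)]])
qed

lemma has_ord_const: "place v \<Longrightarrow> a \<noteq> 0 \<Longrightarrow> has_ord v (const v a) (v a)"
  unfolding has_ord_def by (simp add: const_carrier const_ball val_ge_def)

text \<open>The termwise inverses form a Cauchy sequence because the valuation is eventually
  constant: dividing a difference by \<open>f i * f j\<close> loses only the fixed amount
  \<open>n + n\<close>.\<close>

lemma has_ord_inverse:
  assumes v: "place v" and X: "has_ord v X n"
  shows "\<exists>Y. has_ord v Y (- n) \<and> X \<otimes>\<^bsub>completion v\<^esub> Y = \<one>\<^bsub>completion v\<^esub>"
proof -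
  obtain f where f: "cauchy v f" "X = lim_of v f" using completionD[of X v] X unfolding has_ord_def by blast
  have e: "\<forall>\<^sub>F i in sequentially. f i \<noteq> 0 \<and> v (f i) = n" using has_ord_lim_of[OF v f(1)] X f by blast
  then obtain M where M: "\<And>i. i \<ge> M \<Longrightarrow> f i \<noteq> 0 \<and> v (f i) = n" by (auto simp: eventually_sequentially)
  define g where "g i = inverse (f i)" for i
  have g: "cauchy v g" unfolding cauchy_iff
  proof
    fix m
    obtain N where N: "\<forall>i\<ge>N. \<forall>j\<ge>N. val_ge v (m + n + n) (f i - f j)" using f(1) cauchy_iff by blast
    have "val_ge v m (g i - g j)" if ij: "i \<ge> max M N" "j \<ge> max M N" for i j
    proof -
      have fi: "f i \<noteq> 0" "v (f i) = n" "f j \<noteq> 0" "v (f j) = n" using M ij by auto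
      have "(f i * f j) * (g i - g j) = f j - f i" using fi by (simp add: g_def field_simps)
      then have "val_ge v (m + n + n) ((f i * f j) * (g i - g j))" using N ij by simp
      then have "val_ge v (m + n + n - v (f i * f j)) (g i - g j)" using val_ge_mult_iff[OF v] fi by simp
      then show ?thesis using fi place_mult[OF v fi(1,3)] by simp
    qed
    then show "\<exists>N. \<forall>i\<ge>N. \<forall>j\<ge>N. val_ge v m (g i - g j)" by blast
  qed
  have "\<forall>\<^sub>F i in sequentially. g i \<noteq> 0 \<and> v (g i) = - n" using e
    by eventually_elim (simp add: g_def place_inverse[OF v])
  then have o: "has_ord v (lim_of v g) (- n)" by (rule lim_of_has_ord[OF v g])
  have "\<forall>\<^sub>F i in sequentially. f i * g i - 1 = 0" using e by eventually_elim (simp add: g_def)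
  then have "(\<lambda>i. f i * g i - 1) \<in> null_seqs v" unfolding null_iff by (auto elim: eventually_mono)
  then have "X \<otimes>\<^bsub>completion v\<^esub> lim_of v g = \<one>\<^bsub>completion v\<^esub>"
    unfolding f(2) completion_ops(2)[OF v f(1) g] completion_ops(4)[OF v] lim_of_eq_iff[OF v] .
  then show ?thesis using o by blast
qed

lemma has_ord_mult_ball:
  assumes v: "place v" and X: "has_ord v X n" and Y: "Y \<in> carrier (completion v)"
  shows "X \<otimes>\<^bsub>completion v\<^esub> Y \<in> completion_ball v m \<longleftrightarrow> Y \<in> completion_ball v (m - n)"
proof -
  interpret C: cring "completion v" by (rule completion_cring[OF v])
  obtain Z where Z: "has_ord v Z (- n)" "X \<otimes>\<^bsub>completion v\<^esub> Z = \<one>\<^bsub>completion v\<^esub>" using has_ord_inverse[OF v X] by blast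
  have XZ: "X \<in> carrier (completion v)" "Z \<in> carrier (completion v)" "X \<in> completion_ball v n" "Z \<in> completion_ball v (- n)"
    using X Z by (auto simp: has_ord_def)
  show ?thesis
  proof
    assume "X \<otimes>\<^bsub>completion v\<^esub> Y \<in> completion_ball v m"
    then have "Z \<otimes>\<^bsub>completion v\<^esub> (X \<otimes>\<^bsub>completion v\<^esub> Y) \<in> completion_ball v (- n + m)" using ball_mult[OF v XZ(4)] by blast
    moreover have "Z \<otimes>\<^bsub>completion v\<^esub> (X \<otimes>\<^bsub>completion v\<^esub> Y) = Y"
      using XZ(1,2) Y Z(2) by (metis C.l_one C.m_assoc C.m_comm)
    ultimately show "Y \<in> completion_ball v (m - n)" by simp
  next
    assume "Y \<in> completion_ball v (m - n)"
    then show "X \<otimes>\<^bsub>completion v\<^esub> Y \<in> completion_ball v m" using ball_mult[OF v XZ(3)] by fastforce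
  qed
qed

section \<open>Adeles and ideles\<close>

lemma adele_carrier: "a \<in> carrier adeles \<longleftrightarrow>
    a \<in> (\<Pi>\<^sub>E v\<in>fin_places. carrier (completion v)) \<and> finite {v \<in> fin_places. a v \<notin> completion_ball v 0}"
  by (simp add: adeles_def)

lemma adele_mem: "a \<in> carrier adeles \<Longrightarrow> v \<in> fin_places \<Longrightarrow> a v \<in> carrier (completion v)"
  by (auto simp: adele_carrier)

lemma adele_eqI:
  assumes "a \<in> carrier adeles" "b \<in> carrier adeles" "\<And>v. v \<in> fin_places \<Longrightarrow> a v = b v"
  shows "a = b"
  using assms unfolding adele_carrier by (blast intro: PiE_ext)

lemma adele_ops:
  shows "v \<in> fin_places \<Longrightarrow> (a \<otimes>\<^bsub>adeles\<^esub> b) v = a v \<otimes>\<^bsub>completion v\<^esub> b v"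
    "v \<in> fin_places \<Longrightarrow> (a \<oplus>\<^bsub>adeles\<^esub> b) v = a v \<oplus>\<^bsub>completion v\<^esub> b v"
    "v \<in> fin_places \<Longrightarrow> \<one>\<^bsub>adeles\<^esub> v = \<one>\<^bsub>completion v\<^esub>"
    "v \<in> fin_places \<Longrightarrow> \<zero>\<^bsub>adeles\<^esub> v = \<zero>\<^bsub>completion v\<^esub>"
  by (simp_all add: adeles_def)

lemma adele_restrict:
  assumes "\<And>v. v \<in> fin_places \<Longrightarrow> f v \<in> carrier (completion v)"
    "finite S" "\<And>v. v \<in> fin_places \<Longrightarrow> v \<notin> S \<Longrightarrow> f v \<in> completion_ball v 0"
  shows "restrict f fin_places \<in> carrier adeles"
proof -
  have "{v \<in> fin_places. restrict f fin_places v \<notin> completion_ball v 0} \<subseteq> S" using assms(3) by auto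
  then have "finite {v \<in> fin_places. restrict f fin_places v \<notin> completion_ball v 0}"
    using assms(2) by (rule finite_subset)
  moreover have "restrict f fin_places \<in> (\<Pi>\<^sub>E v\<in>fin_places. carrier (completion v))" using assms(1) by simp
  ultimately show ?thesis unfolding adele_carrier by (rule conjI[rotated])
qed

lemma adele_closed:
  assumes "a \<in> carrier adeles" "b \<in> carrier adeles"
  shows "a \<otimes>\<^bsub>adeles\<^esub> b \<in> carrier adeles" "a \<oplus>\<^bsub>adeles\<^esub> b \<in> carrier adeles"
    "restrict (\<lambda>v. \<ominus>\<^bsub>completion v\<^esub> a v) fin_places \<in> carrier adeles"
proof -
  let ?S = "{v \<in> fin_places. a v \<notin> completion_ball v 0} \<union> {v \<in> fin_places. b v \<notin> completion_ball v 0}"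
  have S: "finite ?S" using assms by (simp add: adele_carrier)
  have b: "a v \<in> completion_ball v 0 \<and> b v \<in> completion_ball v 0" if "v \<in> fin_places" "v \<notin> ?S" for v
    using that by blast
  have C: "cring (completion v)" if "v \<in> fin_places" for v using completion_cring fin_placesD that by blast
  have "restrict (\<lambda>v. a v \<otimes>\<^bsub>completion v\<^esub> b v) fin_places \<in> carrier adeles"
    "restrict (\<lambda>v. a v \<oplus>\<^bsub>completion v\<^esub> b v) fin_places \<in> carrier adeles"
    "restrict (\<lambda>v. \<ominus>\<^bsub>completion v\<^esub> a v) fin_places \<in> carrier adeles"
  proof -
    show "restrict (\<lambda>v. a v \<otimes>\<^bsub>completion v\<^esub> b v) fin_places \<in> carrier adeles"
    proof (rule adele_restrict[OF _ S])
      fix v assume v: "v \<in> fin_places"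
      interpret cring "completion v" by (rule C[OF v])
      show "a v \<otimes>\<^bsub>completion v\<^esub> b v \<in> carrier (completion v)" using adele_mem assms v by simp
      show "a v \<otimes>\<^bsub>completion v\<^esub> b v \<in> completion_ball v 0" if "v \<notin> ?S"
        using ball_mult[OF fin_placesD[OF v], of "a v" 0 "b v" 0] b[OF v that] by simp
    qed
    show "restrict (\<lambda>v. a v \<oplus>\<^bsub>completion v\<^esub> b v) fin_places \<in> carrier adeles"
    proof (rule adele_restrict[OF _ S])
      fix v assume v: "v \<in> fin_places"
      interpret cring "completion v" by (rule C[OF v])
      show "a v \<oplus>\<^bsub>completion v\<^esub> b v \<in> carrier (completion v)" using adele_mem assms v by simp
      show "a v \<oplus>\<^bsub>completion v\<^esub> b v \<in> completion_ball v 0" if "v \<notin> ?S"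
        using ball_add(1)[OF fin_placesD[OF v], of "a v" 0 "b v"] b[OF v that] by simp
    qed
    show "restrict (\<lambda>v. \<ominus>\<^bsub>completion v\<^esub> a v) fin_places \<in> carrier adeles"
    proof (rule adele_restrict[OF _ S])
      fix v assume v: "v \<in> fin_places"
      interpret cring "completion v" by (rule C[OF v])
      show "\<ominus>\<^bsub>completion v\<^esub> a v \<in> carrier (completion v)" using adele_mem assms v by simp
      show "\<ominus>\<^bsub>completion v\<^esub> a v \<in> completion_ball v 0" if "v \<notin> ?S"
        using ball_add(3)[OF fin_placesD[OF v], of "a v" 0 "b v"] b[OF v that] by simp
    qed
  qed
  then show "a \<otimes>\<^bsub>adeles\<^esub> b \<in> carrier adeles" "a \<oplus>\<^bsub>adeles\<^esub> b \<in> carrier adeles"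
    "restrict (\<lambda>v. \<ominus>\<^bsub>completion v\<^esub> a v) fin_places \<in> carrier adeles" by (simp_all add: adeles_def)
qed

lemma adele_zero_one: "\<zero>\<^bsub>adeles\<^esub> \<in> carrier adeles" "\<one>\<^bsub>adeles\<^esub> \<in> carrier adeles"
proof -
  have "restrict (\<lambda>v. \<zero>\<^bsub>completion v\<^esub>) fin_places \<in> carrier adeles"
    "restrict (\<lambda>v. \<one>\<^bsub>completion v\<^esub>) fin_places \<in> carrier adeles"
    by (rule adele_restrict[of _ "{}"]; use zero_ball one_ball ball_carrier fin_placesD in blast)+
  then show "\<zero>\<^bsub>adeles\<^esub> \<in> carrier adeles" "\<one>\<^bsub>adeles\<^esub> \<in> carrier adeles" by (simp_all add: adeles_def)
qed

lemma adeles_cring: "cring adeles"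
proof (rule cringI)
  have C: "cring (completion v)" if "v \<in> fin_places" for v using completion_cring fin_placesD that by blast
  show "abelian_group adeles"
  proof (rule abelian_groupI)
    fix a b c assume abc: "a \<in> carrier adeles" "b \<in> carrier adeles" "c \<in> carrier adeles"
    show "a \<oplus>\<^bsub>adeles\<^esub> b \<oplus>\<^bsub>adeles\<^esub> c = a \<oplus>\<^bsub>adeles\<^esub> (b \<oplus>\<^bsub>adeles\<^esub> c)"
    proof (rule adele_eqI)
      fix v assume v: "v \<in> fin_places"
      interpret cring "completion v" by (rule C[OF v])
      show "(a \<oplus>\<^bsub>adeles\<^esub> b \<oplus>\<^bsub>adeles\<^esub> c) v = (a \<oplus>\<^bsub>adeles\<^esub> (b \<oplus>\<^bsub>adeles\<^esub> c)) v"
        using adele_mem[OF _ v] abc by (simp add: adele_ops v a_assoc)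
    qed (intro adele_closed(1,2) abc)+
  next
    fix a b assume ab: "a \<in> carrier adeles" "b \<in> carrier adeles"
    show "a \<oplus>\<^bsub>adeles\<^esub> b = b \<oplus>\<^bsub>adeles\<^esub> a"
    proof (rule adele_eqI)
      fix v assume v: "v \<in> fin_places"
      interpret cring "completion v" by (rule C[OF v])
      show "(a \<oplus>\<^bsub>adeles\<^esub> b) v = (b \<oplus>\<^bsub>adeles\<^esub> a) v"
        using adele_mem[OF _ v] ab by (simp add: adele_ops v a_comm)
    qed (intro adele_closed(1,2) ab)+
  next
    fix a assume a: "a \<in> carrier adeles"
    show "\<zero>\<^bsub>adeles\<^esub> \<oplus>\<^bsub>adeles\<^esub> a = a"
    proof (rule adele_eqI)
      fix v assume v: "v \<in> fin_places"
      interpret cring "completion v" by (rule C[OF v])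
      show "(\<zero>\<^bsub>adeles\<^esub> \<oplus>\<^bsub>adeles\<^esub> a) v = a v" using adele_mem[OF a v] by (simp add: adele_ops v)
    qed (intro adele_closed(1,2) adele_closed(3)[OF a a] adele_zero_one a)+
    show "\<exists>b\<in>carrier adeles. b \<oplus>\<^bsub>adeles\<^esub> a = \<zero>\<^bsub>adeles\<^esub>"
    proof (intro bexI adele_eqI)
      fix v assume v: "v \<in> fin_places"
      interpret cring "completion v" by (rule C[OF v])
      show "(restrict (\<lambda>v. \<ominus>\<^bsub>completion v\<^esub> a v) fin_places \<oplus>\<^bsub>adeles\<^esub> a) v = \<zero>\<^bsub>adeles\<^esub> v"
        using adele_mem[OF a v] by (simp add: adele_ops v l_neg)
    qed (intro adele_closed(1,2) adele_closed(3)[OF a a] adele_zero_one a)+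
  qed (intro adele_closed(1,2) adele_zero_one; assumption)+
  show "comm_monoid adeles"
  proof (rule comm_monoidI)
    fix a b c assume abc: "a \<in> carrier adeles" "b \<in> carrier adeles" "c \<in> carrier adeles"
    show "a \<otimes>\<^bsub>adeles\<^esub> b \<otimes>\<^bsub>adeles\<^esub> c = a \<otimes>\<^bsub>adeles\<^esub> (b \<otimes>\<^bsub>adeles\<^esub> c)"
    proof (rule adele_eqI)
      fix v assume v: "v \<in> fin_places"
      interpret cring "completion v" by (rule C[OF v])
      show "(a \<otimes>\<^bsub>adeles\<^esub> b \<otimes>\<^bsub>adeles\<^esub> c) v = (a \<otimes>\<^bsub>adeles\<^esub> (b \<otimes>\<^bsub>adeles\<^esub> c)) v"
        using adele_mem[OF _ v] abc by (simp add: adele_ops v m_assoc)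
    qed (intro adele_closed(1,2) abc)+
  next
    fix a b assume ab: "a \<in> carrier adeles" "b \<in> carrier adeles"
    show "a \<otimes>\<^bsub>adeles\<^esub> b = b \<otimes>\<^bsub>adeles\<^esub> a"
    proof (rule adele_eqI)
      fix v assume v: "v \<in> fin_places"
      interpret cring "completion v" by (rule C[OF v])
      show "(a \<otimes>\<^bsub>adeles\<^esub> b) v = (b \<otimes>\<^bsub>adeles\<^esub> a) v"
        using adele_mem[OF _ v] ab by (simp add: adele_ops v m_comm)
    qed (intro adele_closed(1,2) ab)+
  next
    fix a assume a: "a \<in> carrier adeles"
    show "\<one>\<^bsub>adeles\<^esub> \<otimes>\<^bsub>adeles\<^esub> a = a"
    proof (rule adele_eqI)
      fix v assume v: "v \<in> fin_places"
      interpret cring "completion v" by (rule C[OF v])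
      show "(\<one>\<^bsub>adeles\<^esub> \<otimes>\<^bsub>adeles\<^esub> a) v = a v" using adele_mem[OF a v] by (simp add: adele_ops v)
    qed (intro adele_closed(1,2) adele_closed(3)[OF a a] adele_zero_one a)+
  qed (intro adele_closed(1,2) adele_zero_one; assumption)+
  fix a b c assume abc: "a \<in> carrier adeles" "b \<in> carrier adeles" "c \<in> carrier adeles"
  show "(a \<oplus>\<^bsub>adeles\<^esub> b) \<otimes>\<^bsub>adeles\<^esub> c = a \<otimes>\<^bsub>adeles\<^esub> c \<oplus>\<^bsub>adeles\<^esub> b \<otimes>\<^bsub>adeles\<^esub> c"
  proof (rule adele_eqI)
    fix v assume v: "v \<in> fin_places"
    interpret cring "completion v" by (rule C[OF v])
    show "((a \<oplus>\<^bsub>adeles\<^esub> b) \<otimes>\<^bsub>adeles\<^esub> c) v = (a \<otimes>\<^bsub>adeles\<^esub> c \<oplus>\<^bsub>adeles\<^esub> b \<otimes>\<^bsub>adeles\<^esub> c) v"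
      using adele_mem[OF _ v] abc by (simp add: adele_ops v l_distr)
  qed (intro adele_closed(1,2) abc)+
qed

lemma adele_minus:
  assumes a: "a \<in> carrier adeles" and b: "b \<in> carrier adeles" and v: "v \<in> fin_places"
  shows "(a \<ominus>\<^bsub>adeles\<^esub> b) v = a v \<ominus>\<^bsub>completion v\<^esub> b v"
proof -
  interpret Ad: cring adeles by (rule adeles_cring)
  interpret C: cring "completion v" by (rule completion_cring[OF fin_placesD[OF v]])
  have nb: "\<ominus>\<^bsub>adeles\<^esub> b \<in> carrier adeles" using b by simp
  have "\<ominus>\<^bsub>adeles\<^esub> b \<oplus>\<^bsub>adeles\<^esub> b = \<zero>\<^bsub>adeles\<^esub>" using b by (rule Ad.l_neg)
  then have "(\<ominus>\<^bsub>adeles\<^esub> b) v \<oplus>\<^bsub>completion v\<^esub> b v = \<zero>\<^bsub>completion v\<^esub>" using adele_ops(2,4)[OF v] by metis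
  then have "\<ominus>\<^bsub>completion v\<^esub> b v = (\<ominus>\<^bsub>adeles\<^esub> b) v"
    using C.minus_equality adele_mem[OF nb v] adele_mem[OF b v] by blast
  then show ?thesis by (simp add: a_minus_def adele_ops v)
qed

definition adele_box :: "('k place \<Rightarrow> int) \<Rightarrow> 'k adele set" where
  "adele_box E = {z \<in> carrier adeles. \<forall>v\<in>fin_places. z v \<in> completion_ball v (E v)}"

lemma R_box: "R = adele_box (\<lambda>_. 0)"
  by (simp add: R_def adele_box_def)

lemma adele_box_add:
  assumes "a \<in> adele_box E" "b \<in> adele_box E"
  shows "a \<oplus>\<^bsub>adeles\<^esub> b \<in> adele_box E" "a \<ominus>\<^bsub>adeles\<^esub> b \<in> adele_box E"
proof -
  interpret Ad: cring adeles by (rule adeles_cring)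
  have ab: "a \<in> carrier adeles" "b \<in> carrier adeles" using assms by (auto simp: adele_box_def)
  show "a \<oplus>\<^bsub>adeles\<^esub> b \<in> adele_box E" "a \<ominus>\<^bsub>adeles\<^esub> b \<in> adele_box E"
    using assms ab ball_add[OF fin_placesD] by (auto simp: adele_box_def adele_ops adele_minus)
qed

lemma adele_box_mult:
  assumes "a \<in> adele_box E" "b \<in> adele_box F"
  shows "a \<otimes>\<^bsub>adeles\<^esub> b \<in> adele_box (\<lambda>v. E v + F v)"
  using assms adele_closed(1) ball_mult[OF fin_placesD] by (auto simp: adele_box_def adele_ops)

lemma diag_apply: "v \<in> fin_places \<Longrightarrow> diag a v = const v a"
  by (simp add: diag_def const_def lim_of_def)

lemma diag_carrier: "diag a \<in> carrier adeles"
proof -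
  have "diag a = restrict (\<lambda>v. const v a) fin_places" by (auto simp: diag_def const_def lim_of_def)
  also have "\<dots> \<in> carrier adeles"
  proof (cases "a = 0")
    case True
    then show ?thesis using fin_placesD
      by (intro adele_restrict[of _ "{}"]) (auto simp: const_carrier const_ball)
  next
    case False
    show ?thesis by (rule adele_restrict[OF const_carrier finite_support_fin[OF False]])
        (use fin_placesD in \<open>auto simp: const_ball val_ge_def\<close>)
  qed
  finally show ?thesis .
qed

lemma diag_ops:
  "diag (a + b) = diag a \<oplus>\<^bsub>adeles\<^esub> diag b" "diag (a * b) = diag a \<otimes>\<^bsub>adeles\<^esub> diag b"
  "diag (a - b) = diag a \<ominus>\<^bsub>adeles\<^esub> diag b" "diag 1 = \<one>\<^bsub>adeles\<^esub>" "diag 0 = \<zero>\<^bsub>adeles\<^esub>"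
proof -
  interpret Ad: cring adeles by (rule adeles_cring)
  show "diag (a + b) = diag a \<oplus>\<^bsub>adeles\<^esub> diag b" "diag (a * b) = diag a \<otimes>\<^bsub>adeles\<^esub> diag b"
    "diag (a - b) = diag a \<ominus>\<^bsub>adeles\<^esub> diag b" "diag 1 = \<one>\<^bsub>adeles\<^esub>" "diag 0 = \<zero>\<^bsub>adeles\<^esub>"
    by (rule adele_eqI; simp add: diag_carrier adele_closed adele_zero_one diag_apply adele_ops adele_minus
        const_ops[OF fin_placesD])+
qed

lemma diag_box: "diag a \<in> adele_box E \<longleftrightarrow> a \<in> ideal_of E"
  using const_ball[OF fin_placesD] by (auto simp: adele_box_def diag_carrier diag_apply vbox_def)

text \<open>The field is dense modulo every box: the components are approximated by constants at the
  finitely many places that matter, and strong approximation merges these. This is the surjectivity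
  behind the identification of \<open>K\<close> modulo a lattice with an adelic quotient.\<close>

lemma adele_approximation:
  assumes z: "z \<in> carrier adeles" and E: "fin_supp E"
  shows "\<exists>b. diag b \<ominus>\<^bsub>adeles\<^esub> z \<in> adele_box E"
proof -
  interpret Ad: cring adeles by (rule adeles_cring)
  define T where "T = {v \<in> fin_places. z v \<notin> completion_ball v 0} \<union> {v \<in> fin_places. E v \<noteq> 0}"
  have T: "finite T" "T \<subseteq> fin_places" using z E by (auto simp: T_def adele_carrier fin_supp_def)
  have "\<forall>v\<in>T. \<exists>a. const v a \<ominus>\<^bsub>completion v\<^esub> z v \<in> completion_ball v (E v)"
    using const_dense adele_mem[OF z] T(2) fin_placesD by blast
  then obtain a where a: "\<And>v. v \<in> T \<Longrightarrow> const v (a v) \<ominus>\<^bsub>completion v\<^esub> z v \<in> completion_ball v (E v)" by metis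
  obtain b where b: "\<forall>v\<in>T. val_ge v (E v) (b - a v)" "\<forall>v\<in>fin_places - T. val_ge v 0 b"
    using strong_approximation[OF T, of E a] by blast
  have "diag b \<ominus>\<^bsub>adeles\<^esub> z \<in> adele_box E" unfolding adele_box_def
  proof (intro CollectI conjI ballI)
    show "diag b \<ominus>\<^bsub>adeles\<^esub> z \<in> carrier adeles" using z diag_carrier by simp
    fix v assume v: "v \<in> fin_places"
    note pv = fin_placesD[OF v]
    interpret C: cring "completion v" by (rule completion_cring[OF pv])
    have zv: "z v \<in> carrier (completion v)" by (rule adele_mem[OF z v])
    have e: "(diag b \<ominus>\<^bsub>adeles\<^esub> z) v = const v b \<ominus>\<^bsub>completion v\<^esub> z v"
      using adele_minus[OF diag_carrier z v] by (simp add: diag_apply v)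
    show "(diag b \<ominus>\<^bsub>adeles\<^esub> z) v \<in> completion_ball v (E v)" unfolding e
    proof (cases "v \<in> T")
      case True
      have "const v (b - a v) \<oplus>\<^bsub>completion v\<^esub> (const v (a v) \<ominus>\<^bsub>completion v\<^esub> z v) \<in> completion_ball v (E v)"
        using a[OF True] b(1) True by (intro ball_add(1)[OF pv]) (auto simp: const_ball[OF pv])
      moreover have "const v (b - a v) \<oplus>\<^bsub>completion v\<^esub> (const v (a v) \<ominus>\<^bsub>completion v\<^esub> z v) = const v b \<ominus>\<^bsub>completion v\<^esub> z v"
      proof -
        have "const v (b - a v) \<oplus>\<^bsub>completion v\<^esub> const v (a v) = const v b" by (simp add: const_ops[OF pv])
        then show ?thesis using const_carrier zv unfolding a_minus_def
          by (metis C.a_assoc C.a_inv_closed)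
      qed
      ultimately show "const v b \<ominus>\<^bsub>completion v\<^esub> z v \<in> completion_ball v (E v)" by simp
    next
      case False
      then have "E v = 0" "z v \<in> completion_ball v 0" "const v b \<in> completion_ball v 0"
        using v b(2) by (auto simp: T_def const_ball[OF pv])
      then show "const v b \<ominus>\<^bsub>completion v\<^esub> z v \<in> completion_ball v (E v)" using ball_add(2)[OF pv] by simp
    qed
  qed
  then show ?thesis by blast
qed

text \<open>An idele and its inverse are both integral almost everywhere, which confines the nonzero
  orders to a finite set; conversely the componentwise inverses form an adele.\<close>

lemma ideles_iff: "u \<in> ideles \<longleftrightarrow> u \<in> carrier adeles \<and>
    (\<exists>E. fin_supp E \<and> (\<forall>v\<in>fin_places. has_ord v (u v) (E v)))"
proof
  interpret Ad: cring adeles by (rule adeles_cring)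
  assume u: "u \<in> ideles"
  define w where "w = inv\<^bsub>adeles\<^esub> u"
  have c: "u \<in> carrier adeles" "w \<in> carrier adeles" "u \<otimes>\<^bsub>adeles\<^esub> w = \<one>\<^bsub>adeles\<^esub>" using u by (auto simp: w_def)
  have "\<exists>n. has_ord v (u v) n \<and> has_ord v (w v) (- n)" if v: "v \<in> fin_places" for v
  proof -
    note pv = fin_placesD[OF v]
    interpret C: cring "completion v" by (rule completion_cring[OF pv])
    have uw: "u v \<otimes>\<^bsub>completion v\<^esub> w v = \<one>\<^bsub>completion v\<^esub>" using c(3) adele_ops(1,3)[OF v] by metis
    have m: "u v \<in> carrier (completion v)" "w v \<in> carrier (completion v)" using c adele_mem v by auto
    have o1: "has_ord v \<one>\<^bsub>completion v\<^esub> 0" unfolding const_ops(5)[OF pv]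
      using has_ord_const[OF pv, of 1] place_one[OF pv] by simp
    then have "\<one>\<^bsub>completion v\<^esub> \<noteq> \<zero>\<^bsub>completion v\<^esub>" using zero_ball[OF pv, of 1] by (auto simp: has_ord_def)
    then have "u v \<noteq> \<zero>\<^bsub>completion v\<^esub>" "w v \<noteq> \<zero>\<^bsub>completion v\<^esub>" using uw m by auto
    then obtain n k where nk: "has_ord v (u v) n" "has_ord v (w v) k" using has_ord_exists[OF pv] m by blast
    have "n + k = 0" using has_ord_mult[OF pv nk] uw o1 has_ord_unique by metis
    then have "k = - n" by simp
    then show ?thesis using nk by blast
  qed
  then obtain E where E: "\<And>v. v \<in> fin_places \<Longrightarrow> has_ord v (u v) (E v) \<and> has_ord v (w v) (- E v)" by metis
  have "{v \<in> fin_places. E v \<noteq> 0} \<subseteq> {v \<in> fin_places. u v \<notin> completion_ball v 0} \<union> {v \<in> fin_places. w v \<notin> completion_ball v 0}"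
  proof
    fix v assume v: "v \<in> {v \<in> fin_places. E v \<noteq> 0}"
    then have "has_ord v (u v) (E v)" "has_ord v (w v) (- E v)" using E by auto
    then show "v \<in> {v \<in> fin_places. u v \<notin> completion_ball v 0} \<union> {v \<in> fin_places. w v \<notin> completion_ball v 0}"
      using v by (auto simp: has_ord_def)
  qed
  then have "fin_supp E" unfolding fin_supp_def using c(1,2) unfolding adele_carrier
    by (meson finite_UnI finite_subset)
  then show "u \<in> carrier adeles \<and> (\<exists>E. fin_supp E \<and> (\<forall>v\<in>fin_places. has_ord v (u v) (E v)))" using c E by blast
next
  interpret Ad: cring adeles by (rule adeles_cring)
  assume "u \<in> carrier adeles \<and> (\<exists>E. fin_supp E \<and> (\<forall>v\<in>fin_places. has_ord v (u v) (E v)))"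
  then obtain E where u: "u \<in> carrier adeles" and E: "fin_supp E" "\<And>v. v \<in> fin_places \<Longrightarrow> has_ord v (u v) (E v)" by blast
  have "\<forall>v\<in>fin_places. \<exists>Y. has_ord v Y (- E v) \<and> u v \<otimes>\<^bsub>completion v\<^esub> Y = \<one>\<^bsub>completion v\<^esub>"
    using has_ord_inverse E(2) fin_placesD by blast
  then obtain Y where Y: "\<And>v. v \<in> fin_places \<Longrightarrow> has_ord v (Y v) (- E v)"
    "\<And>v. v \<in> fin_places \<Longrightarrow> u v \<otimes>\<^bsub>completion v\<^esub> Y v = \<one>\<^bsub>completion v\<^esub>" by metis
  define w where "w = restrict Y fin_places"
  have w: "w \<in> carrier adeles" unfolding w_def
  proof (rule adele_restrict)
    show "finite {v \<in> fin_places. E v \<noteq> 0}" using E(1) by (simp add: fin_supp_def)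
  qed (use Y(1) in \<open>auto simp: has_ord_def\<close>)
  have "u \<otimes>\<^bsub>adeles\<^esub> w = \<one>\<^bsub>adeles\<^esub>"
    by (rule adele_eqI) (use u w Y(2) in \<open>auto simp: adele_closed adele_zero_one adele_ops w_def\<close>)
  then show "u \<in> ideles" using u w Ad.m_comm[OF u w] unfolding Units_def by auto
qed

text \<open>The value 0 off the finite places makes equality of divisors an equality of
  functions.\<close>

definition idele_ord :: "'k adele \<Rightarrow> 'k place \<Rightarrow> int" where
  "idele_ord u v = (if v \<in> fin_places then THE n. has_ord v (u v) n else 0)"

lemma idele_ordI: "v \<in> fin_places \<Longrightarrow> has_ord v (u v) n \<Longrightarrow> idele_ord u v = n"
  unfolding idele_ord_def using has_ord_unique by (auto intro!: the_equality)

lemma idele_ord: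
  assumes "u \<in> ideles"
  shows "v \<in> fin_places \<Longrightarrow> has_ord v (u v) (idele_ord u v)" "fin_supp (idele_ord u)" "u \<in> carrier adeles"
proof -
  obtain E where E: "fin_supp E" "\<And>v. v \<in> fin_places \<Longrightarrow> has_ord v (u v) (E v)" using assms ideles_iff by blast
  have e: "idele_ord u v = E v" if "v \<in> fin_places" for v using idele_ordI E(2) that by blast
  show "v \<in> fin_places \<Longrightarrow> has_ord v (u v) (idele_ord u v)" using E(2) e by simp
  show "fin_supp (idele_ord u)" by (rule fin_supp_combine[OF E(1) E(1)]) (simp add: e)
  show "u \<in> carrier adeles" using assms ideles_iff by blast
qed

lemma idele_ord_mult:
  assumes "u \<in> ideles" "w \<in> ideles"
  shows "idele_ord (u \<otimes>\<^bsub>adeles\<^esub> w) v = idele_ord u v + idele_ord w v"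
proof (cases "v \<in> fin_places")
  case True
  have "has_ord v ((u \<otimes>\<^bsub>adeles\<^esub> w) v) (idele_ord u v + idele_ord w v)"
    unfolding adele_ops(1)[OF True] by (intro has_ord_mult fin_placesD True idele_ord(1) assms)
  then show ?thesis by (rule idele_ordI[OF True])
qed (simp add: idele_ord_def)

lemma idele_ord_one: "idele_ord \<one>\<^bsub>adeles\<^esub> v = 0"
proof (cases "v \<in> fin_places")
  case True
  note pv = fin_placesD[OF True]
  show ?thesis by (rule idele_ordI[OF True])
    (use has_ord_const[OF pv, of 1] place_one[OF pv] in \<open>simp add: adele_ops True const_ops[OF pv]\<close>)
qed (simp add: idele_ord_def)

lemma idele_ord_inv:
  assumes "u \<in> ideles"
  shows "idele_ord (inv\<^bsub>adeles\<^esub> u) v = - idele_ord u v"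
proof -
  interpret Ad: cring adeles by (rule adeles_cring)
  have "idele_ord (u \<otimes>\<^bsub>adeles\<^esub> inv\<^bsub>adeles\<^esub> u) v = idele_ord u v + idele_ord (inv\<^bsub>adeles\<^esub> u) v"
    using assms by (intro idele_ord_mult) auto
  then show ?thesis using assms idele_ord_one[of v] by simp
qed

lemma idele_exists:
  assumes E: "fin_supp E"
  shows "\<exists>u\<in>ideles. \<forall>v\<in>fin_places. idele_ord u v = E v"
proof -
  have "\<forall>v\<in>fin_places. \<exists>a. a \<noteq> 0 \<and> v a = E v" using place_surj fin_placesD by metis
  then obtain a where a: "\<And>v. v \<in> fin_places \<Longrightarrow> a v \<noteq> 0 \<and> v (a v) = E v" by metis
  define u where "u = restrict (\<lambda>v. const v (a v)) fin_places"
  have o: "has_ord v (u v) (E v)" if v: "v \<in> fin_places" for v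
    using has_ord_const[OF fin_placesD[OF v], of "a v"] a[OF v] v by (simp add: u_def)
  have "u \<in> carrier adeles" unfolding u_def
  proof (rule adele_restrict)
    show "finite {v \<in> fin_places. E v \<noteq> 0}" using E by (simp add: fin_supp_def)
    fix v assume "v \<in> fin_places" "v \<notin> {v \<in> fin_places. E v \<noteq> 0}"
    then show "const v (a v) \<in> completion_ball v 0" using a[of v] const_ball[OF fin_placesD, of v] by (simp add: val_ge_def)
  qed (rule const_carrier)
  then have "u \<in> ideles" using o E ideles_iff by blast
  then show ?thesis using o idele_ordI by blast
qed

lemma idele_mult_box:
  assumes u: "u \<in> ideles" and z: "z \<in> carrier adeles"
  shows "u \<otimes>\<^bsub>adeles\<^esub> z \<in> adele_box E \<longleftrightarrow> z \<in> adele_box (\<lambda>v. E v - idele_ord u v)"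
proof -
  have "(u \<otimes>\<^bsub>adeles\<^esub> z) v \<in> completion_ball v (E v) \<longleftrightarrow> z v \<in> completion_ball v (E v - idele_ord u v)"
    if v: "v \<in> fin_places" for v
    unfolding adele_ops(1)[OF v]
    by (rule has_ord_mult_ball[OF fin_placesD[OF v] idele_ord(1)[OF u v] adele_mem[OF z v]])
  then show ?thesis using z adele_closed(1)[OF idele_ord(3)[OF u] z] by (auto simp: adele_box_def)
qed

lemma idele_mult_R:
  assumes u: "u \<in> ideles"
  shows "(\<lambda>r. r \<otimes>\<^bsub>adeles\<^esub> u) ` R = adele_box (idele_ord u)"
proof -
  interpret Ad: cring adeles by (rule adeles_cring)
  have uc: "u \<in> carrier adeles" by (rule idele_ord(3)[OF u])
  show ?thesis
  proof (intro equalityI subsetI)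
    fix z assume "z \<in> (\<lambda>r. r \<otimes>\<^bsub>adeles\<^esub> u) ` R"
    then obtain r where r: "r \<in> R" "z = r \<otimes>\<^bsub>adeles\<^esub> u" by blast
    then have rc: "r \<in> carrier adeles" by (simp add: R_def)
    have "u \<otimes>\<^bsub>adeles\<^esub> r \<in> adele_box (idele_ord u)"
      using idele_mult_box[OF u rc, of "idele_ord u"] r(1) by (simp add: R_box)
    then show "z \<in> adele_box (idele_ord u)" using r rc uc by (simp add: Ad.m_comm)
  next
    fix z assume z: "z \<in> adele_box (idele_ord u)"
    then have zc: "z \<in> carrier adeles" by (simp add: adele_box_def)
    define r where "r = inv\<^bsub>adeles\<^esub> u \<otimes>\<^bsub>adeles\<^esub> z"
    have iu: "inv\<^bsub>adeles\<^esub> u \<in> ideles" using u by simp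
    have "r \<in> R" unfolding r_def R_box idele_mult_box[OF iu zc] idele_ord_inv[OF u] using z by simp
    moreover have "z = r \<otimes>\<^bsub>adeles\<^esub> u" unfolding r_def
      using u uc zc by (metis Ad.Units_inv_closed Ad.Units_r_inv Ad.m_assoc Ad.m_comm Ad.r_one)
    ultimately show "z \<in> (\<lambda>r. r \<otimes>\<^bsub>adeles\<^esub> u) ` R" by blast
  qed
qed

lemma R_over_box:
  assumes "s \<in> ideles"
  shows "R_over s = adele_box (\<lambda>v. - idele_ord s v)"
proof -
  interpret Ad: cring adeles by (rule adeles_cring)
  have "R_over s = adele_box (idele_ord (inv\<^bsub>adeles\<^esub> s))"
    unfolding R_over_def by (rule idele_mult_R) (use assms in simp)
  then show ?thesis using idele_ord_inv[OF assms] by (simp add: adele_box_def)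
qed

lemma diag_idele:
  assumes "k \<noteq> 0"
  shows "diag k \<in> ideles" "v \<in> fin_places \<Longrightarrow> idele_ord (diag k) v = v k"
proof -
  have o: "has_ord v (diag k v) (v k)" if "v \<in> fin_places" for v
    using has_ord_const[OF fin_placesD[OF that] assms] that by (simp add: diag_apply)
  then show "diag k \<in> ideles" using ideles_iff diag_carrier fin_supp_place[OF assms] by blast
  show "v \<in> fin_places \<Longrightarrow> idele_ord (diag k) v = v k" using o idele_ordI by blast
qed

end

section \<open>Lattices\<close>

lemma coset_plus_coset:
  assumes "add_subgroup H"
  shows "(a +o H) + (b +o H) = (a + b) +o H"
proof (intro equalityI subsetI)
  fix x assume "x \<in> (a +o H) + (b +o H)"
  then obtain g h where "g - a \<in> H" "h - b \<in> H" "x = g + h" by (auto simp: set_plus_def mem_coset_iff)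
  then have "(g - a) + (h - b) \<in> H" using add_subgroupD(4)[OF assms] by blast
  then show "x \<in> (a + b) +o H" using \<open>x = g + h\<close> by (simp add: mem_coset_iff algebra_simps)
next
  fix x assume "x \<in> (a + b) +o H"
  then have "(x - a) - b \<in> H" by (simp add: mem_coset_iff algebra_simps)
  then have "x - a \<in> b +o H" by (simp add: mem_coset_iff)
  moreover have "a \<in> a +o H" by (rule coset_self[OF assms])
  moreover have "x = a + (x - a)" by simp
  ultimately show "x \<in> (a +o H) + (b +o H)" unfolding set_plus_def by blast
qed

lemma scale_coset_plus:
  assumes H: "add_subgroup H" and c: "\<And>h. h \<in> H \<Longrightarrow> (c::'a::field) * h \<in> H"
  shows "c *o (b +o H) + H = (c * b) +o H"
proof (intro equalityI subsetI)
  fix x assume "x \<in> c *o (b +o H) + H"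
  then obtain g h where g: "g - b \<in> H" "h \<in> H" "x = c * g + h"
    by (auto simp: set_plus_def elt_set_times_def mem_coset_iff)
  then have "c * (g - b) + h \<in> H" using add_subgroupD(4)[OF H] c by blast
  then show "x \<in> (c * b) +o H" using g(3) by (simp add: mem_coset_iff algebra_simps)
next
  fix x assume "x \<in> (c * b) +o H"
  then have h: "x - c * b \<in> H" by (simp add: mem_coset_iff)
  have "c * b \<in> c *o (b +o H)" using coset_self[OF H, of b] by (auto simp: elt_set_times_def)
  moreover have "x = c * b + (x - c * b)" by simp
  ultimately show "x \<in> c *o (b +o H) + H" unfolding set_plus_def using h by blast
qed

lemma (in cring) difference_identities:
  assumes "a \<in> carrier R" "b \<in> carrier R" "c \<in> carrier R" "d \<in> carrier R"
  shows "(a \<ominus> (b \<oplus> c)) \<oplus> c = a \<ominus> b" "(a \<ominus> c) \<ominus> (b \<ominus> c) = a \<ominus> b"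
    "(a \<ominus> b) \<oplus> (b \<ominus> c) = a \<ominus> c" "(a \<otimes> b) \<ominus> (c \<otimes> (a \<otimes> d)) = (b \<ominus> (c \<otimes> d)) \<otimes> a"
    "(b \<ominus> c) \<otimes> d = (a \<ominus> (c \<otimes> d)) \<ominus> (a \<ominus> (b \<otimes> d))"
    "a \<ominus> b = \<zero> \<longleftrightarrow> a = b"
proof -
  show "(a \<ominus> (b \<oplus> c)) \<oplus> c = a \<ominus> b" "(a \<ominus> c) \<ominus> (b \<ominus> c) = a \<ominus> b"
    "(a \<ominus> b) \<oplus> (b \<ominus> c) = a \<ominus> c" "(a \<otimes> b) \<ominus> (c \<otimes> (a \<otimes> d)) = (b \<ominus> (c \<otimes> d)) \<otimes> a"
    "(b \<ominus> c) \<otimes> d = (a \<ominus> (c \<otimes> d)) \<ominus> (a \<ominus> (b \<otimes> d))"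
    using assms by algebra+
  show "a \<ominus> b = \<zero> \<longleftrightarrow> a = b"
  proof
    assume "a \<ominus> b = \<zero>"
    moreover have "a = (a \<ominus> b) \<oplus> b" using assms by algebra
    ultimately show "a = b" using assms by simp
  qed (use assms in \<open>simp add: a_minus_def r_neg\<close>)
qed

context global_function_field
begin

interpretation A: subring_set A by (rule A_subring)
interpretation Ad: cring adeles by (rule adeles_cring)

text \<open>The lattice with \<open>\<Lambda> = ideal_of D\<close> and \<open>\<phi>\<close> the multiplication by \<open>y\<close>; in terms of the adelic data,
  \<open>D = - ord s\<close> and \<open>y = \<rho> s\<^sup>-\<^sup>1\<close>. Unlike the data \<open>(s, \<rho>)\<close>, the pair \<open>(D, y)\<close> is unique.\<close>
definition lattice_of :: "('k place \<Rightarrow> int) \<Rightarrow> 'k adele \<Rightarrow> 'k rlattice" where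
  "lattice_of D y = ({a. diag a \<in> adele_box D},
     \<lambda>X\<in>cosets UNIV A. {b. \<exists>a\<in>X. diag b \<ominus>\<^bsub>adeles\<^esub> (y \<otimes>\<^bsub>adeles\<^esub> diag a) \<in> adele_box D})"

definition lattice_data :: "('k place \<Rightarrow> int) \<Rightarrow> 'k adele \<Rightarrow> bool" where
  "lattice_data D y \<longleftrightarrow> fin_supp D \<and> y \<in> adele_box D"

lemma adele_box_cong: "(\<And>v. v \<in> fin_places \<Longrightarrow> D v = E v) \<Longrightarrow> adele_box D = adele_box E"
  by (auto simp: adele_box_def)

lemma lattice_of_cong: "(\<And>v. v \<in> fin_places \<Longrightarrow> D v = E v) \<Longrightarrow> lattice_of D y = lattice_of E y"
  unfolding lattice_of_def using adele_box_cong[of D E] by simp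

lemma adele_box_carrier: "z \<in> adele_box D \<Longrightarrow> z \<in> carrier adeles"
  by (simp add: adele_box_def)

lemma adelic_lattice_eq:
  assumes "s \<in> ideles"
  shows "adelic_lattice s \<rho> = lattice_of (\<lambda>v. - idele_ord s v) (\<rho> \<otimes>\<^bsub>adeles\<^esub> inv\<^bsub>adeles\<^esub> s)"
  unfolding adelic_lattice_def lattice_of_def R_over_box[OF assms] ..

lemma adelic_data:
  assumes "s \<in> ideles" "\<rho> \<in> R"
  shows "lattice_data (\<lambda>v. - idele_ord s v) (\<rho> \<otimes>\<^bsub>adeles\<^esub> inv\<^bsub>adeles\<^esub> s)"
proof -
  have "\<rho> \<otimes>\<^bsub>adeles\<^esub> inv\<^bsub>adeles\<^esub> s \<in> R_over s" unfolding R_over_def using assms(2) by blast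
  then show ?thesis unfolding lattice_data_def R_over_box[OF assms(1)]
    using fin_supp_minus[OF idele_ord(2)[OF assms(1)]] by simp
qed

lemma data_adelic:
  assumes "lattice_data D y"
  shows "\<exists>s\<in>ideles. \<exists>\<rho>\<in>R. (\<forall>v\<in>fin_places. idele_ord s v = - D v) \<and> \<rho> \<otimes>\<^bsub>adeles\<^esub> inv\<^bsub>adeles\<^esub> s = y
    \<and> adelic_lattice s \<rho> = lattice_of D y"
proof -
  have D: "fin_supp D" "y \<in> adele_box D" using assms by (auto simp: lattice_data_def)
  obtain s where s: "s \<in> ideles" "\<forall>v\<in>fin_places. idele_ord s v = - D v"
    using idele_exists[OF fin_supp_minus[OF D(1)]] by blast
  have "y \<in> R_over s" unfolding R_over_box[OF s(1)] using D(2) s(2) adele_box_cong[of "\<lambda>v. - idele_ord s v" D] by simp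
  then obtain \<rho> where \<rho>: "\<rho> \<in> R" "y = \<rho> \<otimes>\<^bsub>adeles\<^esub> inv\<^bsub>adeles\<^esub> s" unfolding R_over_def by blast
  have "adelic_lattice s \<rho> = lattice_of D y" unfolding adelic_lattice_eq[OF s(1)] \<rho>(2)
    by (rule lattice_of_cong) (use s(2) in simp)
  then show ?thesis using s \<rho> by blast
qed

lemma fst_lattice_of: "fst (lattice_of D y) = ideal_of D"
  by (auto simp: lattice_of_def diag_box)

lemma data_mult:
  assumes "y \<in> adele_box D" "c \<in> A"
  shows "y \<otimes>\<^bsub>adeles\<^esub> diag c \<in> adele_box D"
proof -
  have "diag c \<in> adele_box (\<lambda>_. 0)" using assms(2) by (simp add: diag_box A_vbox)
  then show ?thesis using adele_box_mult[OF assms(1)] by fastforce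
qed

text \<open>Two representatives of a coset differ by some \<open>c\<close> in \<open>A\<close>, and
  \<open>y\<close> times \<open>c\<close> stays in the box because \<open>y\<close> lies in it; so a
  single representative decides membership.\<close>

lemma snd_lattice_of_mem:
  assumes "lattice_data D y"
  shows "b \<in> snd (lattice_of D y) (a +o A) \<longleftrightarrow> diag b \<ominus>\<^bsub>adeles\<^esub> (y \<otimes>\<^bsub>adeles\<^esub> diag a) \<in> adele_box D"
proof -
  have y: "y \<in> adele_box D" "y \<in> carrier adeles" using assms adele_box_carrier by (auto simp: lattice_data_def)
  have X: "a +o A \<in> cosets UNIV A" by (auto simp: cosets_def)
  have shift: "diag b \<ominus>\<^bsub>adeles\<^esub> (y \<otimes>\<^bsub>adeles\<^esub> diag a) \<in> adele_box D"
    if a': "a' \<in> a +o A" "diag b \<ominus>\<^bsub>adeles\<^esub> (y \<otimes>\<^bsub>adeles\<^esub> diag a') \<in> adele_box D" for a'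
  proof -
    define c where "c = a' - a"
    have c: "c \<in> A" "diag a' = diag a \<oplus>\<^bsub>adeles\<^esub> diag c"
      using a'(1) by (simp_all add: c_def mem_coset_iff diag_ops(1)[symmetric])
    have "(diag b \<ominus>\<^bsub>adeles\<^esub> (y \<otimes>\<^bsub>adeles\<^esub> diag a')) \<oplus>\<^bsub>adeles\<^esub> (y \<otimes>\<^bsub>adeles\<^esub> diag c) \<in> adele_box D"
      by (rule adele_box_add(1)[OF a'(2) data_mult[OF y(1) c(1)]])
    moreover have "(diag b \<ominus>\<^bsub>adeles\<^esub> (y \<otimes>\<^bsub>adeles\<^esub> diag a')) \<oplus>\<^bsub>adeles\<^esub> (y \<otimes>\<^bsub>adeles\<^esub> diag c)
      = diag b \<ominus>\<^bsub>adeles\<^esub> (y \<otimes>\<^bsub>adeles\<^esub> diag a)"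
    proof -
      let ?p = "y \<otimes>\<^bsub>adeles\<^esub> diag a" and ?q = "y \<otimes>\<^bsub>adeles\<^esub> diag c"
      have pq: "?p \<in> carrier adeles" "?q \<in> carrier adeles" "diag b \<in> carrier adeles" using y diag_carrier by auto
      have "y \<otimes>\<^bsub>adeles\<^esub> diag a' = ?p \<oplus>\<^bsub>adeles\<^esub> ?q" unfolding c(2) using y diag_carrier by (simp add: Ad.r_distr)
      then show ?thesis using pq Ad.difference_identities(1) by simp
    qed
    ultimately show ?thesis by simp
  qed
  have "snd (lattice_of D y) (a +o A) = {b. \<exists>a'\<in>a +o A. diag b \<ominus>\<^bsub>adeles\<^esub> (y \<otimes>\<^bsub>adeles\<^esub> diag a') \<in> adele_box D}"
    using X by (simp add: lattice_of_def)
  then show ?thesis using shift coset_self[OF A_subgroup, of a] by blast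
qed

lemma diag_diff_box:
  assumes z: "z \<in> carrier adeles" and b: "diag b \<ominus>\<^bsub>adeles\<^esub> z \<in> adele_box D"
  shows "diag c \<ominus>\<^bsub>adeles\<^esub> z \<in> adele_box D \<longleftrightarrow> c - b \<in> ideal_of D"
proof -
  have e: "diag (c - b) = (diag c \<ominus>\<^bsub>adeles\<^esub> z) \<ominus>\<^bsub>adeles\<^esub> (diag b \<ominus>\<^bsub>adeles\<^esub> z)"
    unfolding diag_ops(3) by (rule Ad.difference_identities(2)[symmetric]) (use z diag_carrier in blast)+
  have e': "diag c \<ominus>\<^bsub>adeles\<^esub> z = diag (c - b) \<oplus>\<^bsub>adeles\<^esub> (diag b \<ominus>\<^bsub>adeles\<^esub> z)"
    unfolding diag_ops(3) by (rule Ad.difference_identities(3)[symmetric]) (use z diag_carrier in blast)+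
  show ?thesis using adele_box_add(2)[OF _ b] adele_box_add(1)[OF _ b] e e' diag_box by metis
qed

lemma snd_lattice_of:
  assumes d: "lattice_data D y" and b: "diag b \<ominus>\<^bsub>adeles\<^esub> (y \<otimes>\<^bsub>adeles\<^esub> diag a) \<in> adele_box D"
  shows "snd (lattice_of D y) (a +o A) = b +o ideal_of D"
proof (rule Set.set_eqI)
  fix c
  have "y \<otimes>\<^bsub>adeles\<^esub> diag a \<in> carrier adeles"
    using d diag_carrier adele_box_carrier by (auto simp: lattice_data_def)
  then show "c \<in> snd (lattice_of D y) (a +o A) \<longleftrightarrow> c \<in> b +o ideal_of D"
    unfolding snd_lattice_of_mem[OF d] mem_coset_iff using diag_diff_box b by blast
qed

lemma lattice_value_exists:
  assumes d: "lattice_data D y"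
  shows "\<exists>b. diag b \<ominus>\<^bsub>adeles\<^esub> (y \<otimes>\<^bsub>adeles\<^esub> diag a) \<in> adele_box D"
  using d diag_carrier adele_box_carrier by (intro adele_approximation) (auto simp: lattice_data_def)

lemma rational_lattice_of:
  assumes d: "lattice_data D y"
  shows "rational_lattice (lattice_of D y)"
proof -
  have y: "y \<in> carrier adeles" and D: "fin_supp D" using d adele_box_carrier by (auto simp: lattice_data_def)
  let ?\<phi> = "snd (lattice_of D y)"
  note g = ideal_of_subgroup[of D]
  obtain \<beta> where \<beta>: "\<And>a. diag (\<beta> a) \<ominus>\<^bsub>adeles\<^esub> (y \<otimes>\<^bsub>adeles\<^esub> diag a) \<in> adele_box D"
    using lattice_value_exists[OF d] by metis
  have val: "?\<phi> (a +o A) = \<beta> a +o ideal_of D" for a by (rule snd_lattice_of[OF d \<beta>])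
  have "?\<phi> \<in> cosets UNIV A \<rightarrow>\<^sub>E cosets UNIV (ideal_of D)"
  proof (rule PiE_I)
    fix X assume "X \<in> cosets UNIV A"
    then obtain a where "X = a +o A" by (auto simp: cosets_def)
    then show "?\<phi> X \<in> cosets UNIV (ideal_of D)" using val by (auto simp: cosets_def)
  qed (simp add: lattice_of_def)
  moreover have "?\<phi> ((a + b) +o A) = ?\<phi> (a +o A) + ?\<phi> (b +o A)" for a b
  proof -
    have "diag (\<beta> a + \<beta> b) \<ominus>\<^bsub>adeles\<^esub> (y \<otimes>\<^bsub>adeles\<^esub> diag (a + b))
      = (diag (\<beta> a) \<ominus>\<^bsub>adeles\<^esub> (y \<otimes>\<^bsub>adeles\<^esub> diag a)) \<oplus>\<^bsub>adeles\<^esub> (diag (\<beta> b) \<ominus>\<^bsub>adeles\<^esub> (y \<otimes>\<^bsub>adeles\<^esub> diag b))"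
      unfolding diag_ops(1) a_minus_def using y diag_carrier
      by (simp add: Ad.r_distr Ad.minus_add Ad.a_ac)
    then have "diag (\<beta> a + \<beta> b) \<ominus>\<^bsub>adeles\<^esub> (y \<otimes>\<^bsub>adeles\<^esub> diag (a + b)) \<in> adele_box D"
      using adele_box_add(1)[OF \<beta> \<beta>] by simp
    then show ?thesis using snd_lattice_of[OF d] val coset_plus_coset[OF g] by simp
  qed
  moreover have "?\<phi> ((c * a) +o A) = c *o ?\<phi> (a +o A) + ideal_of D" if c: "c \<in> A" for c a
  proof -
    have "diag (c * \<beta> a) \<ominus>\<^bsub>adeles\<^esub> (y \<otimes>\<^bsub>adeles\<^esub> diag (c * a))
      = (diag (\<beta> a) \<ominus>\<^bsub>adeles\<^esub> (y \<otimes>\<^bsub>adeles\<^esub> diag a)) \<otimes>\<^bsub>adeles\<^esub> diag c"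
      unfolding diag_ops(2) by (rule Ad.difference_identities(4)) (use y diag_carrier in blast)+
    then have "diag (c * \<beta> a) \<ominus>\<^bsub>adeles\<^esub> (y \<otimes>\<^bsub>adeles\<^esub> diag (c * a)) \<in> adele_box D"
      using data_mult[OF \<beta> c] by simp
    then have "?\<phi> ((c * a) +o A) = (c * \<beta> a) +o ideal_of D" by (rule snd_lattice_of[OF d])
    then show ?thesis using val scale_coset_plus[OF g, of c] ideal_of_A[OF c] by simp
  qed
  moreover have "ideal_of D \<in> frac_ideals" using D frac_ideals_eq by blast
  ultimately show ?thesis unfolding rational_lattice_def fst_lattice_of[symmetric, of D y] by (simp add: case_prod_beta)
qed

text \<open>Multiplication by elements with poles of any order at \<open>v\<close> shows that
  \<open>z v\<close> lies in every ball.\<close>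

lemma adele_ball_all_zero:
  assumes z: "z \<in> carrier adeles" and a: "\<And>a. z \<otimes>\<^bsub>adeles\<^esub> diag a \<in> adele_box D"
  shows "z = \<zero>\<^bsub>adeles\<^esub>"
proof (rule adele_eqI[OF z adele_zero_one(1)])
  fix v assume v: "v \<in> fin_places"
  note pv = fin_placesD[OF v]
  interpret C: cring "completion v" by (rule completion_cring[OF pv])
  have "z v \<in> completion_ball v n" for n
  proof -
    obtain a where a': "a \<noteq> 0" "v a = D v - n" using place_surj[OF pv] by blast
    have "(z \<otimes>\<^bsub>adeles\<^esub> diag a) v \<in> completion_ball v (D v)" using a v by (simp add: adele_box_def)
    then have "const v a \<otimes>\<^bsub>completion v\<^esub> z v \<in> completion_ball v (D v)"
      using C.m_comm[OF adele_mem[OF z v] const_carrier] by (simp add: adele_ops v diag_apply)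
    then show ?thesis using has_ord_mult_ball[OF pv has_ord_const[OF pv a'(1)] adele_mem[OF z v]] a'(2) by simp
  qed
  then show "z v = \<zero>\<^bsub>adeles\<^esub> v" using ball_zero[OF pv] by (simp add: adele_ops v)
qed

text \<open>If the two maps agree, the difference of the adeles carries the whole field into one
  box, hence vanishes. This removes the ambiguity of \<open>(s, \<rho>)\<close>.\<close>

lemma lattice_of_inj:
  assumes d: "lattice_data D y" and d': "lattice_data D' y'" and e: "lattice_of D y = lattice_of D' y'"
  shows "y = y'" "v \<in> fin_places \<Longrightarrow> D v = D' v"
proof -
  have f: "fin_supp D" "fin_supp D'" and y: "y \<in> carrier adeles" "y' \<in> carrier adeles"
    using d d' adele_box_carrier by (auto simp: lattice_data_def)
  have "ideal_of D = ideal_of D'" using e fst_lattice_of by metis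
  then have DD: "\<forall>v\<in>fin_places. D v = D' v" using ideal_of_eq_iff[OF f] by blast
  then show "v \<in> fin_places \<Longrightarrow> D v = D' v" by blast
  have bD: "adele_box D = adele_box D'" by (rule adele_box_cong) (use DD in blast)
  have "(y \<ominus>\<^bsub>adeles\<^esub> y') \<otimes>\<^bsub>adeles\<^esub> diag a \<in> adele_box D" for a
  proof -
    obtain b where b: "diag b \<ominus>\<^bsub>adeles\<^esub> (y \<otimes>\<^bsub>adeles\<^esub> diag a) \<in> adele_box D" using lattice_value_exists[OF d] by blast
    then have "b \<in> snd (lattice_of D' y') (a +o A)" using snd_lattice_of_mem[OF d, of b a] e by simp
    then have b': "diag b \<ominus>\<^bsub>adeles\<^esub> (y' \<otimes>\<^bsub>adeles\<^esub> diag a) \<in> adele_box D" using snd_lattice_of_mem[OF d'] bD by simp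
    have "(y \<ominus>\<^bsub>adeles\<^esub> y') \<otimes>\<^bsub>adeles\<^esub> diag a
      = (diag b \<ominus>\<^bsub>adeles\<^esub> (y' \<otimes>\<^bsub>adeles\<^esub> diag a)) \<ominus>\<^bsub>adeles\<^esub> (diag b \<ominus>\<^bsub>adeles\<^esub> (y \<otimes>\<^bsub>adeles\<^esub> diag a))"
      by (rule Ad.difference_identities(5)) (use y diag_carrier in blast)+
    then show ?thesis using adele_box_add(2)[OF b' b] by simp
  qed
  then have z: "y \<ominus>\<^bsub>adeles\<^esub> y' = \<zero>\<^bsub>adeles\<^esub>" using y by (intro adele_ball_all_zero) auto
  then show "y = y'" using y Ad.difference_identities(6)[OF y y] by blast
qed

lemma commensurable_iff:
  "commensurable L L' \<longleftrightarrow> (\<exists>D D' y. lattice_data D y \<and> lattice_data D' y \<and> L = lattice_of D y \<and> L' = lattice_of D' y)"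
proof
  assume "commensurable L L'"
  then obtain s s' \<rho> \<rho>' where s: "s \<in> ideles" "s' \<in> ideles" "\<rho> \<in> R" "\<rho>' \<in> R"
    "L = adelic_lattice s \<rho>" "L' = adelic_lattice s' \<rho>'"
    "\<rho> \<otimes>\<^bsub>adeles\<^esub> inv\<^bsub>adeles\<^esub> s = \<rho>' \<otimes>\<^bsub>adeles\<^esub> inv\<^bsub>adeles\<^esub> s'" unfolding commensurable_def by blast
  then show "\<exists>D D' y. lattice_data D y \<and> lattice_data D' y \<and> L = lattice_of D y \<and> L' = lattice_of D' y"
    using adelic_data[OF s(1,3)] adelic_data[OF s(2,4)] adelic_lattice_eq[OF s(1)] adelic_lattice_eq[OF s(2)] by metis
next
  assume "\<exists>D D' y. lattice_data D y \<and> lattice_data D' y \<and> L = lattice_of D y \<and> L' = lattice_of D' y"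
  then obtain D D' y where d: "lattice_data D y" "lattice_data D' y" "L = lattice_of D y" "L' = lattice_of D' y" by blast
  obtain s \<rho> where s: "s \<in> ideles" "\<rho> \<in> R" "\<rho> \<otimes>\<^bsub>adeles\<^esub> inv\<^bsub>adeles\<^esub> s = y" "adelic_lattice s \<rho> = L"
    using data_adelic[OF d(1)] d(3) by blast
  obtain s' \<rho>' where s': "s' \<in> ideles" "\<rho>' \<in> R" "\<rho>' \<otimes>\<^bsub>adeles\<^esub> inv\<^bsub>adeles\<^esub> s' = y" "adelic_lattice s' \<rho>' = L'"
    using data_adelic[OF d(2)] d(4) by blast
  show "commensurable L L'" unfolding commensurable_def
    using rational_lattice_of d s s' by (metis (no_types, lifting))
qed

lemma scale_lattice_of:
  assumes k: "k \<noteq> 0" and d: "lattice_data D y"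
  shows "scale k (lattice_of D y) = lattice_of (\<lambda>v. D v + v k) (diag k \<otimes>\<^bsub>adeles\<^esub> y)"
    "lattice_data (\<lambda>v. D v + v k) (diag k \<otimes>\<^bsub>adeles\<^esub> y)"
proof -
  have y: "y \<in> adele_box D" "y \<in> carrier adeles" "fin_supp D" using d adele_box_carrier by (auto simp: lattice_data_def)
  have kb: "diag k \<otimes>\<^bsub>adeles\<^esub> z \<in> adele_box (\<lambda>v. D v + v k) \<longleftrightarrow> z \<in> adele_box D" if "z \<in> carrier adeles" for z
  proof -
    have "adele_box (\<lambda>v. D v + v k - idele_ord (diag k) v) = adele_box D"
      by (rule adele_box_cong) (simp add: diag_idele(2)[OF k])
    then show ?thesis using idele_mult_box[OF diag_idele(1)[OF k] that] by simp
  qed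
  show d': "lattice_data (\<lambda>v. D v + v k) (diag k \<otimes>\<^bsub>adeles\<^esub> y)"
    unfolding lattice_data_def using kb[OF y(2)] y fin_supp_add[OF y(3) fin_supp_place[OF k]] by simp
  have "k *o snd (lattice_of D y) X = snd (lattice_of (\<lambda>v. D v + v k) (diag k \<otimes>\<^bsub>adeles\<^esub> y)) X"
    if X: "X \<in> cosets UNIV A" for X
  proof (rule Set.set_eqI)
    fix b
    obtain a where a: "X = a +o A" using X by (auto simp: cosets_def)
    have c: "y \<otimes>\<^bsub>adeles\<^esub> diag a \<in> carrier adeles" using y diag_carrier by simp
    have "diag k \<otimes>\<^bsub>adeles\<^esub> (diag (b / k) \<ominus>\<^bsub>adeles\<^esub> (y \<otimes>\<^bsub>adeles\<^esub> diag a))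
      = diag b \<ominus>\<^bsub>adeles\<^esub> ((diag k \<otimes>\<^bsub>adeles\<^esub> y) \<otimes>\<^bsub>adeles\<^esub> diag a)"
    proof -
      have "diag k \<otimes>\<^bsub>adeles\<^esub> diag (b / k) = diag b" using k by (simp add: diag_ops(2)[symmetric])
      then show ?thesis unfolding a_minus_def using y diag_carrier
        by (simp add: Ad.r_distr Ad.r_minus Ad.m_assoc)
    qed
    then show "b \<in> k *o snd (lattice_of D y) X \<longleftrightarrow> b \<in> snd (lattice_of (\<lambda>v. D v + v k) (diag k \<otimes>\<^bsub>adeles\<^esub> y)) X"
      unfolding mem_scale_iff[OF k] a snd_lattice_of_mem[OF d] snd_lattice_of_mem[OF d']
      using kb[of "diag (b / k) \<ominus>\<^bsub>adeles\<^esub> (y \<otimes>\<^bsub>adeles\<^esub> diag a)"] c diag_carrier by simp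
  qed
  then have "(\<lambda>X\<in>cosets UNIV A. k *o snd (lattice_of D y) X) = snd (lattice_of (\<lambda>v. D v + v k) (diag k \<otimes>\<^bsub>adeles\<^esub> y))"
    by (intro ext) (auto simp: lattice_of_def restrict_def)
  moreover have "k *o fst (lattice_of D y) = fst (lattice_of (\<lambda>v. D v + v k) (diag k \<otimes>\<^bsub>adeles\<^esub> y))"
    unfolding fst_lattice_of by (rule box_scale[OF fin_places_subset k])
  ultimately show "scale k (lattice_of D y) = lattice_of (\<lambda>v. D v + v k) (diag k \<otimes>\<^bsub>adeles\<^esub> y)"
    unfolding scale_def by (metis prod.collapse)
qed

lemma idele_mult_cancel:
  assumes "s \<in> ideles" "u \<in> ideles" "\<rho> \<in> carrier adeles"
  shows "(\<rho> \<otimes>\<^bsub>adeles\<^esub> u) \<otimes>\<^bsub>adeles\<^esub> inv\<^bsub>adeles\<^esub> (s \<otimes>\<^bsub>adeles\<^esub> u) = \<rho> \<otimes>\<^bsub>adeles\<^esub> inv\<^bsub>adeles\<^esub> s"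
proof -
  have c: "s \<in> carrier adeles" "u \<in> carrier adeles" "inv\<^bsub>adeles\<^esub> s \<in> carrier adeles" "inv\<^bsub>adeles\<^esub> u \<in> carrier adeles"
    using assms by auto
  have "inv\<^bsub>adeles\<^esub> (s \<otimes>\<^bsub>adeles\<^esub> u) = inv\<^bsub>adeles\<^esub> u \<otimes>\<^bsub>adeles\<^esub> inv\<^bsub>adeles\<^esub> s"
  proof (rule Ad.inv_char)
    have "(s \<otimes>\<^bsub>adeles\<^esub> u) \<otimes>\<^bsub>adeles\<^esub> (inv\<^bsub>adeles\<^esub> u \<otimes>\<^bsub>adeles\<^esub> inv\<^bsub>adeles\<^esub> s)
      = (s \<otimes>\<^bsub>adeles\<^esub> inv\<^bsub>adeles\<^esub> s) \<otimes>\<^bsub>adeles\<^esub> (u \<otimes>\<^bsub>adeles\<^esub> inv\<^bsub>adeles\<^esub> u)"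
      using c by (simp only: Ad.m_ac Ad.m_closed)
    then show e: "(s \<otimes>\<^bsub>adeles\<^esub> u) \<otimes>\<^bsub>adeles\<^esub> (inv\<^bsub>adeles\<^esub> u \<otimes>\<^bsub>adeles\<^esub> inv\<^bsub>adeles\<^esub> s) = \<one>\<^bsub>adeles\<^esub>"
      using assms by simp
    then show "(inv\<^bsub>adeles\<^esub> u \<otimes>\<^bsub>adeles\<^esub> inv\<^bsub>adeles\<^esub> s) \<otimes>\<^bsub>adeles\<^esub> (s \<otimes>\<^bsub>adeles\<^esub> u) = \<one>\<^bsub>adeles\<^esub>"
      using c Ad.m_comm by (metis Ad.m_closed)
  qed (use c in simp_all)
  moreover have "(\<rho> \<otimes>\<^bsub>adeles\<^esub> u) \<otimes>\<^bsub>adeles\<^esub> (inv\<^bsub>adeles\<^esub> u \<otimes>\<^bsub>adeles\<^esub> inv\<^bsub>adeles\<^esub> s)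
    = \<rho> \<otimes>\<^bsub>adeles\<^esub> ((u \<otimes>\<^bsub>adeles\<^esub> inv\<^bsub>adeles\<^esub> u) \<otimes>\<^bsub>adeles\<^esub> inv\<^bsub>adeles\<^esub> s)"
    using c assms by (simp only: Ad.m_assoc Ad.m_closed)
  ultimately show ?thesis using assms c by simp
qed

lemma adelic_pair:
  assumes "s \<in> ideles" "u \<in> ideles" "\<rho> \<in> R" "\<rho> \<otimes>\<^bsub>adeles\<^esub> u \<in> R"
  defines "D \<equiv> \<lambda>v. - idele_ord s v" and "y \<equiv> \<rho> \<otimes>\<^bsub>adeles\<^esub> inv\<^bsub>adeles\<^esub> s"
  shows "adelic_lattice s \<rho> = lattice_of D y"
    "adelic_lattice (s \<otimes>\<^bsub>adeles\<^esub> u) (\<rho> \<otimes>\<^bsub>adeles\<^esub> u) = lattice_of (\<lambda>v. D v - idele_ord u v) y"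
    "lattice_data D y" "lattice_data (\<lambda>v. D v - idele_ord u v) y"
proof -
  have su: "s \<otimes>\<^bsub>adeles\<^esub> u \<in> ideles" using assms by simp
  have o: "(\<lambda>v. - idele_ord (s \<otimes>\<^bsub>adeles\<^esub> u) v) = (\<lambda>v. D v - idele_ord u v)"
    using idele_ord_mult[OF assms(1,2)] by (simp add: D_def fun_eq_iff)
  have "\<rho> \<in> carrier adeles" using assms(3) by (simp add: R_def)
  note c = idele_mult_cancel[OF assms(1,2) this]
  show "adelic_lattice s \<rho> = lattice_of D y" "lattice_data D y"
    using adelic_lattice_eq[OF assms(1)] adelic_data[OF assms(1,3)] by (simp_all add: D_def y_def)
  show "adelic_lattice (s \<otimes>\<^bsub>adeles\<^esub> u) (\<rho> \<otimes>\<^bsub>adeles\<^esub> u) = lattice_of (\<lambda>v. D v - idele_ord u v) y"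
    using adelic_lattice_eq[OF su, of "\<rho> \<otimes>\<^bsub>adeles\<^esub> u"] unfolding o c y_def .
  show "lattice_data (\<lambda>v. D v - idele_ord u v) y"
    using adelic_data[OF su assms(4)] unfolding o c y_def .
qed

text \<open>Both \<open>s\<close> and \<open>\<rho>\<close> are multiplied by \<open>u\<close>, so
  their quotient \<open>y\<close> is unchanged and only the divisor moves. Injectivity of
  \<open>lattice_of\<close> makes the result independent of the data, as the definite description
  requires.\<close>

lemma ideal_inv_act_eq:
  assumes d: "lattice_data D y" and E: "effective E"
  shows "ideal_inv_act (ideal_of E) (lattice_of D y) = lattice_of (\<lambda>v. D v - E v) y"
    "lattice_data (\<lambda>v. D v - E v) y"
proof -
  have Ru: "{a. diag a \<in> (\<lambda>r. r \<otimes>\<^bsub>adeles\<^esub> u) ` R} = ideal_of (idele_ord u)" if "u \<in> ideles" for u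
    unfolding idele_mult_R[OF that] diag_box by simp
  have RR: "\<rho> \<otimes>\<^bsub>adeles\<^esub> u \<in> R" if "\<rho> \<in> R" "u \<in> R" for \<rho> u
    using adele_box_mult[of \<rho> "\<lambda>_. 0" u "\<lambda>_. 0"] that by (simp add: R_box)
  obtain s \<rho> where s: "s \<in> ideles" "\<rho> \<in> R" "\<forall>v\<in>fin_places. idele_ord s v = - D v"
    "\<rho> \<otimes>\<^bsub>adeles\<^esub> inv\<^bsub>adeles\<^esub> s = y" "adelic_lattice s \<rho> = lattice_of D y" using data_adelic[OF d] by blast
  obtain u where u: "u \<in> ideles" "\<forall>v\<in>fin_places. idele_ord u v = E v"
    using idele_exists[OF effective_fin_supp[OF E]] by blast
  have uR: "u \<in> R" unfolding R_box adele_box_def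
    using u E idele_ord[OF u(1)] by (auto simp: has_ord_def effective_def)
  note p = adelic_pair[OF s(1) u(1) s(2) RR[OF s(2) uR], unfolded s(4)]
  have c: "lattice_of (\<lambda>v. - idele_ord s v - idele_ord u v) y = lattice_of (\<lambda>v. D v - E v) y"
    by (rule lattice_of_cong) (use s(3) u(2) in simp)
  have m: "adelic_lattice (s \<otimes>\<^bsub>adeles\<^esub> u) (\<rho> \<otimes>\<^bsub>adeles\<^esub> u) = lattice_of (\<lambda>v. D v - E v) y"
    using p(2) c by simp
  have "adele_box (\<lambda>v. - idele_ord s v - idele_ord u v) = adele_box (\<lambda>v. D v - E v)"
    by (rule adele_box_cong) (use s(3) u(2) in simp)
  then show "lattice_data (\<lambda>v. D v - E v) y" using p(4) fin_supp_diff[of D E] d effective_fin_supp[OF E]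
    by (simp add: lattice_data_def)
  show "ideal_inv_act (ideal_of E) (lattice_of D y) = lattice_of (\<lambda>v. D v - E v) y"
    unfolding ideal_inv_act_def
  proof (rule the_equality)
    have "ideal_of E = {a. diag a \<in> (\<lambda>r. r \<otimes>\<^bsub>adeles\<^esub> u) ` R}"
      unfolding Ru[OF u(1)] by (rule box_cong) (use u(2) in simp)
    then show "\<exists>s\<in>ideles. \<exists>\<rho>\<in>R. \<exists>u\<in>R \<inter> ideles. lattice_of D y = adelic_lattice s \<rho> \<and>
       ideal_of E = {a. diag a \<in> (\<lambda>r. r \<otimes>\<^bsub>adeles\<^esub> u) ` R} \<and>
       lattice_of (\<lambda>v. D v - E v) y = adelic_lattice (s \<otimes>\<^bsub>adeles\<^esub> u) (\<rho> \<otimes>\<^bsub>adeles\<^esub> u)"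
      using s(1,2,5) u(1) uR m by (intro bexI[of _ s] bexI[of _ \<rho>] bexI[of _ u]) auto
    fix M
    assume "\<exists>s\<in>ideles. \<exists>\<rho>\<in>R. \<exists>u\<in>R \<inter> ideles. lattice_of D y = adelic_lattice s \<rho> \<and>
       ideal_of E = {a. diag a \<in> (\<lambda>r. r \<otimes>\<^bsub>adeles\<^esub> u) ` R} \<and>
       M = adelic_lattice (s \<otimes>\<^bsub>adeles\<^esub> u) (\<rho> \<otimes>\<^bsub>adeles\<^esub> u)"
    then obtain s' \<rho>' u' where s': "s' \<in> ideles" "\<rho>' \<in> R" "u' \<in> R" "u' \<in> ideles"
       "lattice_of D y = adelic_lattice s' \<rho>'" "ideal_of E = {a. diag a \<in> (\<lambda>r. r \<otimes>\<^bsub>adeles\<^esub> u') ` R}"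
       "M = adelic_lattice (s' \<otimes>\<^bsub>adeles\<^esub> u') (\<rho>' \<otimes>\<^bsub>adeles\<^esub> u')" by blast
    note p' = adelic_pair[OF s'(1,4,2) RR[OF s'(2,3)]]
    have "lattice_of D y = lattice_of (\<lambda>v. - idele_ord s' v) (\<rho>' \<otimes>\<^bsub>adeles\<^esub> inv\<^bsub>adeles\<^esub> s')" using s'(5) p'(1) by simp
    note inj = lattice_of_inj[OF d p'(3) this]
    have "\<forall>v\<in>fin_places. E v = idele_ord u' v"
      using s'(6) unfolding Ru[OF s'(4)] ideal_of_eq_iff[OF effective_fin_supp[OF E] idele_ord(2)[OF s'(4)]] .
    then show "M = lattice_of (\<lambda>v. D v - E v) y"
      unfolding s'(7) p'(2) inj(1)[symmetric] using inj(2) by (intro lattice_of_cong) simp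
  qed
qed

text \<open>An \<open>A\<close>-linear map \<open>K/A \<rightarrow> K/\<Lambda>\<close> is multiplication by an adele: if \<open>\<beta> a\<close> represents the image
  of \<open>a\<close>, the elements \<open>f \<beta> (1/f)\<close> converge to it as \<open>f\<close> becomes divisible.\<close>
lemma rational_lattice_data:
  assumes L: "rational_lattice L"
  shows "\<exists>D y. lattice_data D y \<and> L = lattice_of D y"
proof -
  obtain \<Lambda> \<phi> where L': "L = (\<Lambda>, \<phi>)" by (cases L)
  have r: "\<Lambda> \<in> frac_ideals" "\<phi> \<in> cosets UNIV A \<rightarrow>\<^sub>E cosets UNIV \<Lambda>"
    "\<And>a b. \<phi> ((a + b) +o A) = \<phi> (a +o A) + \<phi> (b +o A)"
    "\<And>c a. c \<in> A \<Longrightarrow> \<phi> ((c * a) +o A) = c *o \<phi> (a +o A) + \<Lambda>"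
    using L unfolding rational_lattice_def L' by auto
  obtain D where D: "\<Lambda> = ideal_of D" "fin_supp D" using r(1) frac_ideals_eq by blast
  note g = ideal_of_subgroup[of D]
  have "\<forall>a. \<exists>b. \<phi> (a +o A) = b +o \<Lambda>"
  proof
    fix a
    have "a +o A \<in> cosets UNIV A" by (auto simp: cosets_def)
    then have "\<phi> (a +o A) \<in> cosets UNIV \<Lambda>" using r(2) by blast
    then show "\<exists>b. \<phi> (a +o A) = b +o \<Lambda>" by (auto simp: cosets_def)
  qed
  then obtain \<beta> where \<beta>: "\<And>a. \<phi> (a +o A) = \<beta> a +o ideal_of D" unfolding D(1) by metis
  have sc: "\<beta> (c * a) - c * \<beta> a \<in> ideal_of D" if "c \<in> A" for c a
  proof -
    have "\<beta> (c * a) +o ideal_of D = (c * \<beta> a) +o ideal_of D"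
      using r(4)[OF that, of a] scale_coset_plus[OF g, of c] ideal_of_A[OF that] unfolding \<beta> D(1) by simp
    then show ?thesis using coset_eq_iff[OF g] by blast
  qed
  \<comment> \<open>The element 1 lies in \<open>A\<close>, so its coset is that of 0 and is mapped
    to the zero coset.\<close>
  have b1: "\<beta> 1 \<in> ideal_of D"
  proof -
    have "\<beta> (0 * 1) - 0 * \<beta> 1 \<in> ideal_of D" by (rule sc[OF A.F01(1)])
    then have "\<beta> 0 \<in> ideal_of D" by simp
    moreover have "(1::'k) +o A = 0 +o A" using coset_eq_iff[OF A_subgroup, of 1 0] A.F01(2) by simp
    then have "\<beta> 1 +o ideal_of D = \<beta> 0 +o ideal_of D" using \<beta>[of 1] \<beta>[of 0] by metis
    then have "\<beta> 1 - \<beta> 0 \<in> ideal_of D" using coset_eq_iff[OF g] by blast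
    ultimately show ?thesis using add_subgroupD(4)[OF g, of "\<beta> 1 - \<beta> 0" "\<beta> 0"] by simp
  qed
  define t where "t f = f * \<beta> (1 / f)" for f
  have tD: "t f \<in> ideal_of D" if "f \<in> A" "f \<noteq> 0" for f
  proof -
    have "\<beta> 1 - t f \<in> ideal_of D" using sc[OF that(1), of "1 / f"] that by (simp add: t_def)
    then have "\<beta> 1 - (\<beta> 1 - t f) \<in> ideal_of D" using add_subgroupD(2)[OF g b1] by blast
    then show ?thesis by simp
  qed
  \<comment> \<open>Linearity relates the values at \<open>1 / f\<close> and
    \<open>1 / (f * h)\<close> up to \<open>ideal_of D\<close>; multiplied by \<open>f\<close>, the
    error has valuation at least \<open>v f + D v\<close>, which is large when \<open>f\<close> is
    highly divisible.\<close>
  have tt1: "val_ge v (v f + D v) (t f - t (f * h))" if v: "v \<in> fin_places" and fh: "f \<in> A" "f \<noteq> 0" "h \<in> A" "h \<noteq> 0" for v f h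
  proof -
    have "\<beta> (1 / f) - h * \<beta> (1 / (f * h)) \<in> ideal_of D"
      using sc[OF fh(3), of "1 / (f * h)"] fh by (simp add: field_simps)
    then have "val_ge v (D v) (\<beta> (1 / f) - h * \<beta> (1 / (f * h)))" using v by (simp add: vbox_def)
    then have "val_ge v (v f + D v) (f * (\<beta> (1 / f) - h * \<beta> (1 / (f * h))))"
      by (rule val_ge_mult[OF fin_placesD[OF v] val_ge_self])
    then show ?thesis by (simp add: t_def algebra_simps)
  qed
  have tt: "val_ge v (min (v f) (v h) + D v) (t f - t h)" if v: "v \<in> fin_places" and fh: "f \<in> A" "f \<noteq> 0" "h \<in> A" "h \<noteq> 0" for v f h
  proof -
    have "val_ge v (min (v f) (v h) + D v) (t f - t (f * h))" "val_ge v (min (v f) (v h) + D v) (t h - t (h * f))"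
      by (rule val_ge_mono[OF tt1[OF v fh]], simp) (rule val_ge_mono[OF tt1[OF v fh(3,4,1,2)]], simp)
    then have "val_ge v (min (v f) (v h) + D v) ((t f - t (f * h)) - (t h - t (h * f)))"
      by (rule val_ge_diff[OF fin_placesD[OF v]])
    then show ?thesis by (simp add: mult.commute)
  qed
  have "\<exists>f\<in>A. f \<noteq> 0 \<and> int n \<le> v f" if v: "v \<in> fin_places" for v n
    using exists_divisible[OF fin_supp_upd[OF fin_supp_0], of v "int n"] v by fastforce
  then obtain f where f: "\<And>v n. v \<in> fin_places \<Longrightarrow> f v n \<in> A \<and> f v n \<noteq> 0 \<and> int n \<le> v (f v n)" by metis
  define y where "y = restrict (\<lambda>v. lim_of v (\<lambda>n. t (f v n))) fin_places"
  have cau: "cauchy v (\<lambda>n. t (f v n))" if v: "v \<in> fin_places" for v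
    unfolding cauchy_iff
  proof
    fix n
    have "val_ge v n (t (f v i) - t (f v j))" if "i \<ge> nat (n - D v)" "j \<ge> nat (n - D v)" for i j
    proof (rule val_ge_mono[OF tt[OF v]])
      have "int i \<le> v (f v i)" "int j \<le> v (f v j)" using f[OF v] by blast+
      then show "n \<le> min (v (f v i)) (v (f v j)) + D v" using that by linarith
    qed (use f[OF v] in blast)+
    then show "\<exists>N. \<forall>i\<ge>N. \<forall>j\<ge>N. val_ge v n (t (f v i) - t (f v j))" by blast
  qed
  have yv: "y v = lim_of v (\<lambda>n. t (f v n))" if "v \<in> fin_places" for v using that by (simp add: y_def)
  have yb: "y v \<in> completion_ball v (D v)" if v: "v \<in> fin_places" for v
    unfolding yv[OF v] lim_of_ball[OF fin_placesD[OF v] cau[OF v]]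
    using tD f[OF v] v by (auto simp: vbox_def)
  have "y \<in> carrier adeles" unfolding y_def
  proof (rule adele_restrict)
    show "finite {v \<in> fin_places. D v \<noteq> 0}" using D(2) by (simp add: fin_supp_def)
    show "lim_of v (\<lambda>n. t (f v n)) \<in> carrier (completion v)" if "v \<in> fin_places" for v
      using lim_of_carrier cau[OF that] by blast
    show "lim_of v (\<lambda>n. t (f v n)) \<in> completion_ball v 0"
      if "v \<in> fin_places" "v \<notin> {v \<in> fin_places. D v \<noteq> 0}" for v
      using yb[OF that(1)] yv[OF that(1)] that by simp
  qed
  then have d: "lattice_data D y" using D(2) yb by (simp add: lattice_data_def adele_box_def)
  then have yc: "y \<in> carrier adeles" using adele_box_carrier by (auto simp: lattice_data_def)
  have val: "diag (\<beta> a) \<ominus>\<^bsub>adeles\<^esub> (y \<otimes>\<^bsub>adeles\<^esub> diag a) \<in> adele_box D" for a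
  proof -
    have yac: "y \<otimes>\<^bsub>adeles\<^esub> diag a \<in> carrier adeles" using yc diag_carrier by simp
    \<comment> \<open>A denominator of \<open>a\<close>: once \<open>a\<close> is
      \<open>c / h\<close> with \<open>c\<close> in \<open>A\<close>, linearity reduces the value at
      \<open>a\<close> to the value at \<open>1 / h\<close>.\<close>
    have "\<exists>h\<in>A. h \<noteq> 0 \<and> h * a \<in> A"
    proof (cases "a = 0")
      case True then show ?thesis using A.F01 by (intro bexI[of _ 1]) auto
    next
      case False
      obtain h where h: "h \<in> A" "h \<noteq> 0" "\<forall>v\<in>fin_places. - v a \<le> v h"
        using exists_divisible[OF fin_supp_minus[OF fin_supp_place[OF False]]] by blast
      have "h * a \<in> A" unfolding A_def
      proof (intro CollectI ballI)
        fix v assume v: "v \<in> fin_places"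
        then show "val_ge v 0 (h * a)" using place_mult[OF fin_placesD[OF v] h(2) False] h(3) by (force simp: val_ge_def)
      qed
      then show ?thesis using h by blast
    qed
    then obtain h where h: "h \<in> A" "h \<noteq> 0" "h * a \<in> A" by blast
    define c where "c = h * a"
    have a: "a = c * (1 / h)" using h by (simp add: c_def)
    have cA: "c \<in> A" using h by (simp add: c_def)
    have b0: "\<beta> a - c * \<beta> (1 / h) \<in> ideal_of D" using sc[OF cA, of "1 / h"] a by simp
    show ?thesis unfolding adele_box_def
    proof (intro CollectI conjI ballI)
      show "diag (\<beta> a) \<ominus>\<^bsub>adeles\<^esub> (y \<otimes>\<^bsub>adeles\<^esub> diag a) \<in> carrier adeles" using yac diag_carrier by simp
      fix v assume v: "v \<in> fin_places"
      note pv = fin_placesD[OF v]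
      note cm = cauchy_mult[OF pv cau[OF v] cauchy_const[of a v]]
      have e: "(diag (\<beta> a) \<ominus>\<^bsub>adeles\<^esub> (y \<otimes>\<^bsub>adeles\<^esub> diag a)) v = lim_of v (\<lambda>n. \<beta> a - t (f v n) * a)"
        unfolding adele_minus[OF diag_carrier yac v] adele_ops(1)[OF v] diag_apply[OF v] yv[OF v] const_def
          completion_ops(2)[OF pv cau[OF v] cauchy_const] completion_ops(6)[OF pv cauchy_const cm] ..
      show "(diag (\<beta> a) \<ominus>\<^bsub>adeles\<^esub> (y \<otimes>\<^bsub>adeles\<^esub> diag a)) v \<in> completion_ball v (D v)"
        unfolding e lim_of_ball[OF pv cauchy_diff[OF pv cauchy_const cm]] eventually_sequentially
      proof (intro exI allI impI)
        fix n assume n: "n \<ge> nat (v h)"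
        have fn: "f v n \<in> A" "f v n \<noteq> 0" "int n \<le> v (f v n)" using f[OF v] by auto
        have "val_ge v (v h + D v) (t h - t (f v n))"
          by (rule val_ge_mono[OF tt[OF v h(1,2) fn(1,2)]]) (use fn(3) n in linarith)
        then have "val_ge v (v h + D v) (h * ((t h - t (f v n)) / h))" using h by simp
        then have 1: "val_ge v (D v) ((t h - t (f v n)) / h)" unfolding val_ge_mult_iff[OF pv h(2)] by simp
        have "val_ge v 0 c" using cA v by (simp add: A_def)
        from val_ge_mult[OF pv this 1] have 2: "val_ge v (D v) (c * ((t h - t (f v n)) / h))" by simp
        have "val_ge v (D v) (\<beta> a - c * \<beta> (1 / h))" using b0 v by (simp add: vbox_def)
        from val_ge_add[OF pv this 2]
        have "val_ge v (D v) (\<beta> a - c * \<beta> (1 / h) + c * ((t h - t (f v n)) / h))" .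
        moreover have "\<beta> a - c * \<beta> (1 / h) + c * ((t h - t (f v n)) / h) = \<beta> a - t (f v n) * a"
        proof -
          have "c * ((t h - t (f v n)) / h) = c * (t h / h) - t (f v n) * (c / h)"
            by (simp add: diff_divide_distrib algebra_simps)
          moreover have "t h / h = \<beta> (1 / h)" "c / h = a" using h by (simp_all add: t_def c_def)
          ultimately show ?thesis by simp
        qed
        ultimately show "val_ge v (D v) (\<beta> a - t (f v n) * a)" by (simp only:)
      qed
    qed
  qed
  have "\<phi> = snd (lattice_of D y)"
  proof (rule extensionalityI[of _ "cosets UNIV A"])
    show "\<phi> \<in> extensional (cosets UNIV A)" using r(2) by (simp add: PiE_def)
    show "snd (lattice_of D y) \<in> extensional (cosets UNIV A)" by (simp add: lattice_of_def)
    fix X assume "X \<in> cosets UNIV A"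
    then obtain a where "X = a +o A" by (auto simp: cosets_def)
    then show "\<phi> X = snd (lattice_of D y) X" using \<beta> snd_lattice_of[OF d val] by simp
  qed
  then have "L = lattice_of D y" unfolding L' D(1) using fst_lattice_of by (metis prod.collapse)
  then show ?thesis using d by blast
qed

text \<open>If \<open>y v\<close> were one step deeper in the box, an element with a simple pole at
  \<open>v\<close> and no other finite pole would be in the kernel of \<open>\<phi>\<close>, against
  injectivity.\<close>

lemma invertible_lattice_data:
  assumes "invertible_lattice L"
  shows "\<exists>D y. lattice_data D y \<and> L = lattice_of D y \<and> (\<forall>v\<in>fin_places. has_ord v (y v) (D v))"
proof -
  obtain D y where d: "lattice_data D y" "L = lattice_of D y"
    using rational_lattice_data[of L] assms unfolding invertible_lattice_def by blast
  have inj: "inj_on (snd L) (cosets UNIV A)" using assms by (auto simp: invertible_lattice_def bij_betw_def)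
  have y: "y \<in> adele_box D" "y \<in> carrier adeles" using d adele_box_carrier by (auto simp: lattice_data_def)
  have "has_ord v (y v) (D v)" if v: "v \<in> fin_places" for v
  proof -
    note pv = fin_placesD[OF v]
    have yb: "y v \<in> completion_ball v (D v)" using y v by (simp add: adele_box_def)
    have nb: "y v \<notin> completion_ball v (D v + 1)"
    proof
      assume yb1: "y v \<in> completion_ball v (D v + 1)"
      define E where "E = (\<lambda>_::'k place. 0::int)(v := - 1)"
      obtain a where a: "a \<in> ideal_of E" "a \<noteq> 0" "v a = - 1"
        using exact_element[OF fin_supp_upd[OF fin_supp_0] v, of v "- 1"] unfolding E_def by auto
      have "y \<otimes>\<^bsub>adeles\<^esub> diag a \<in> adele_box D" unfolding adele_box_def
      proof (intro CollectI conjI ballI)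
        show "y \<otimes>\<^bsub>adeles\<^esub> diag a \<in> carrier adeles" using y diag_carrier by simp
        fix w assume w: "w \<in> fin_places"
        note pw = fin_placesD[OF w]
        have ca: "const w a \<in> completion_ball w (E w)" using a(1) w const_ball[OF pw] by (simp add: vbox_def)
        have "y w \<in> completion_ball w (D w - E w)" using y(1) yb1 w by (auto simp: adele_box_def E_def)
        from ball_mult[OF pw this ca]
        show "(y \<otimes>\<^bsub>adeles\<^esub> diag a) w \<in> completion_ball w (D w)" by (simp add: adele_ops w diag_apply)
      qed
      moreover have "diag 0 \<in> adele_box D" unfolding diag_box by (rule add_subgroupD(1)[OF ideal_of_subgroup])
      ultimately have "diag 0 \<ominus>\<^bsub>adeles\<^esub> (y \<otimes>\<^bsub>adeles\<^esub> diag a) \<in> adele_box D" by (intro adele_box_add(2))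
      then have 1: "snd L (a +o A) = 0 +o ideal_of D" unfolding d(2) by (rule snd_lattice_of[OF d(1)])
      have "diag 0 \<ominus>\<^bsub>adeles\<^esub> (y \<otimes>\<^bsub>adeles\<^esub> diag 0) \<in> adele_box D"
        by (intro adele_box_add(2) \<open>diag 0 \<in> adele_box D\<close> data_mult y A.F01)
      then have 2: "snd L (0 +o A) = 0 +o ideal_of D" unfolding d(2) by (rule snd_lattice_of[OF d(1)])
      have "a +o A \<in> cosets UNIV A" "0 +o A \<in> cosets UNIV A" unfolding cosets_def by blast+
      then have "a +o A = 0 +o A" using inj 1 2 by (metis inj_onD)
      then have "a \<in> A" using coset_eq_iff[OF A_subgroup, of a 0] by simp
      then show False using a v by (auto simp: A_def val_ge_def)
    qed
    have "y v \<noteq> \<zero>\<^bsub>completion v\<^esub>" using nb zero_ball[OF pv] by metis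
    then obtain n where n: "has_ord v (y v) n" using has_ord_exists[OF pv adele_mem[OF y(2) v]] by blast
    then have "D v \<le> n" "\<not> D v + 1 \<le> n" using yb nb by (auto simp: has_ord_def)
    then have "n = D v" by simp
    then show ?thesis using n by simp
  qed
  then show ?thesis using d by blast
qed

text \<open>A commensurable lattice has the same \<open>y\<close>, which must lie in the box of its
  divisor; as the order of \<open>y\<close> is exactly \<open>D\<close>, that divisor is at most
  \<open>D\<close> everywhere.\<close>

lemma comm_class_eq:
  assumes d: "lattice_data D y" and o: "\<And>v. v \<in> fin_places \<Longrightarrow> has_ord v (y v) (D v)"
  shows "comm_class (lattice_of D y) = {lattice_of (\<lambda>v. D v - E v) y | E. effective E}"
proof (intro Set.set_eqI iffI)
  fix L' assume "L' \<in> comm_class (lattice_of D y)"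
  then obtain F D' z where F: "lattice_data F z" "lattice_data D' z" "L' = lattice_of F z" "lattice_of D y = lattice_of D' z"
    unfolding comm_class_def commensurable_iff by blast
  note inj = lattice_of_inj[OF d F(2,4)]
  have "effective (\<lambda>v. D v - F v)" unfolding effective_def
  proof (intro conjI ballI)
    show "fin_supp (\<lambda>v. D v - F v)" using d F by (intro fin_supp_diff) (auto simp: lattice_data_def)
    fix v assume v: "v \<in> fin_places"
    have "y v \<in> completion_ball v (F v)" using F(1) v inj(1) by (simp add: lattice_data_def adele_box_def)
    then show "0 \<le> D v - F v" using o[OF v] by (simp add: has_ord_def)
  qed
  moreover have "L' = lattice_of (\<lambda>v. D v - (D v - F v)) y" using F(3) inj(1) by simp
  ultimately show "L' \<in> {lattice_of (\<lambda>v. D v - E v) y | E. effective E}"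
    by (intro CollectI exI[of _ "\<lambda>v. D v - F v"] conjI)
next
  fix L' assume "L' \<in> {lattice_of (\<lambda>v. D v - E v) y | E. effective E}"
  then obtain E where "L' = lattice_of (\<lambda>v. D v - E v) y" "effective E" by blast
  then show "L' \<in> comm_class (lattice_of D y)"
    unfolding comm_class_def commensurable_iff using ideal_inv_act_eq(2)[OF d] d by blast
qed

end

section \<open>The space of commensurable pairs\<close>

context global_function_field
begin

interpretation A: subring_set A by (rule A_subring)
interpretation Ad: cring adeles by (rule adeles_cring)

section \<open>Topologies on adeles, ideles and parameters\<close>

definition adele_nbhd :: "'k adele \<Rightarrow> ('k place \<Rightarrow> nat) \<Rightarrow> 'k adele set" where
  "adele_nbhd a N = {b \<in> carrier adeles. \<forall>v\<in>fin_places. b v \<ominus>\<^bsub>completion v\<^esub> a v \<in> completion_ball v (int (N v))}"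

lemma adele_nbhd_iff:
  assumes "a \<in> carrier adeles"
  shows "b \<in> adele_nbhd a N \<longleftrightarrow> b \<in> carrier adeles \<and> b \<ominus>\<^bsub>adeles\<^esub> a \<in> adele_box (\<lambda>v. int (N v))"
  using assms by (auto simp: adele_nbhd_def adele_box_def adele_minus)

lemma adele_box_mono: "(\<And>v. v \<in> fin_places \<Longrightarrow> E v \<le> F v) \<Longrightarrow> adele_box F \<subseteq> adele_box E"
  unfolding adele_box_def using ball_mono by blast

lemma adele_box_zero: "\<zero>\<^bsub>adeles\<^esub> \<in> adele_box E"
  unfolding adele_box_def using adele_zero_one zero_ball fin_placesD by (auto simp: adele_ops)

lemma openin_adele_top:
  "openin adele_top U \<longleftrightarrow> U \<subseteq> carrier adeles \<and>
    (\<forall>a\<in>U. \<exists>N. finite {v \<in> fin_places. N v \<noteq> 0} \<and> adele_nbhd a N \<subseteq> U)"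
proof -
  let ?P = "\<lambda>U. U \<subseteq> carrier adeles \<and> (\<forall>a\<in>U. \<exists>N. finite {v \<in> fin_places. N v \<noteq> 0} \<and> adele_nbhd a N \<subseteq> U)"
  have "istopology ?P" unfolding istopology_def
  proof (intro conjI allI impI)
    fix S T assume S: "?P S" and T: "?P T"
    show "S \<inter> T \<subseteq> carrier adeles" using S by blast
    show "\<forall>a\<in>S \<inter> T. \<exists>N. finite {v \<in> fin_places. N v \<noteq> 0} \<and> adele_nbhd a N \<subseteq> S \<inter> T"
    proof
      fix a assume a: "a \<in> S \<inter> T"
      obtain N where N: "finite {v \<in> fin_places. N v \<noteq> 0}" "adele_nbhd a N \<subseteq> S" using S a by blast
      obtain M where M: "finite {v \<in> fin_places. M v \<noteq> 0}" "adele_nbhd a M \<subseteq> T" using T a by blast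
      define K where "K v = max (N v) (M v)" for v
      have "{v \<in> fin_places. K v \<noteq> 0} \<subseteq> {v \<in> fin_places. N v \<noteq> 0} \<union> {v \<in> fin_places. M v \<noteq> 0}"
        by (auto simp: K_def max_def)
      then have "finite {v \<in> fin_places. K v \<noteq> 0}" using N(1) M(1) by (meson finite_UnI finite_subset)
      moreover have "adele_nbhd a K \<subseteq> adele_nbhd a N" "adele_nbhd a K \<subseteq> adele_nbhd a M"
        unfolding adele_nbhd_def K_def by (auto elim!: ball_mono)
      ultimately show "\<exists>N. finite {v \<in> fin_places. N v \<noteq> 0} \<and> adele_nbhd a N \<subseteq> S \<inter> T" using N(2) M(2) by blast
    qed
  next
    fix \<U> assume U: "\<forall>S\<in>\<U>. ?P S"
    show "\<Union>\<U> \<subseteq> carrier adeles" using U by blast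
    show "\<forall>a\<in>\<Union>\<U>. \<exists>N. finite {v \<in> fin_places. N v \<noteq> 0} \<and> adele_nbhd a N \<subseteq> \<Union>\<U>"
    proof
      fix a assume "a \<in> \<Union>\<U>"
      then obtain S where S: "S \<in> \<U>" "a \<in> S" by blast
      then obtain N where "finite {v \<in> fin_places. N v \<noteq> 0}" "adele_nbhd a N \<subseteq> S" using U by blast
      then show "\<exists>N. finite {v \<in> fin_places. N v \<noteq> 0} \<and> adele_nbhd a N \<subseteq> \<Union>\<U>" using S by blast
    qed
  qed
  then show ?thesis unfolding adele_top_def adele_nbhd_def[symmetric] by (simp add: topology_inverse')
qed

lemma topspace_adele_top: "topspace adele_top = carrier adeles"
proof -
  have "openin adele_top (carrier adeles)" unfolding openin_adele_top
  proof (intro conjI ballI subset_refl)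
    fix a
    show "\<exists>N. finite {v \<in> fin_places. N v \<noteq> 0} \<and> adele_nbhd a N \<subseteq> carrier adeles"
      by (intro exI[of _ "\<lambda>_. 0"]) (auto simp: adele_nbhd_def)
  qed
  from openin_subset[OF this] openin_topspace[of adele_top, unfolded openin_adele_top, THEN conjunct1]
  show ?thesis by (intro equalityI)
qed

lemma adele_nbhd_self: "a \<in> carrier adeles \<Longrightarrow> a \<in> adele_nbhd a N"
  unfolding adele_nbhd_iff by (simp add: a_minus_def Ad.r_neg adele_box_zero)

lemma openin_adele_nbhd:
  assumes a: "a \<in> carrier adeles" and N: "finite {v \<in> fin_places. N v \<noteq> 0}"
  shows "openin adele_top (adele_nbhd a N)"
  unfolding openin_adele_top
proof (intro conjI ballI)
  show "adele_nbhd a N \<subseteq> carrier adeles" by (auto simp: adele_nbhd_def)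
  fix b assume b: "b \<in> adele_nbhd a N"
  then have bc: "b \<in> carrier adeles" by (simp add: adele_nbhd_def)
  have "adele_nbhd b N \<subseteq> adele_nbhd a N"
  proof
    fix c assume c: "c \<in> adele_nbhd b N"
    then have cc: "c \<in> carrier adeles" by (simp add: adele_nbhd_def)
    have "c \<ominus>\<^bsub>adeles\<^esub> b \<in> adele_box (\<lambda>v. int (N v))" "b \<ominus>\<^bsub>adeles\<^esub> a \<in> adele_box (\<lambda>v. int (N v))"
      using b c adele_nbhd_iff[OF bc] adele_nbhd_iff[OF a] by simp_all
    then have "(c \<ominus>\<^bsub>adeles\<^esub> b) \<oplus>\<^bsub>adeles\<^esub> (b \<ominus>\<^bsub>adeles\<^esub> a) \<in> adele_box (\<lambda>v. int (N v))"
      by (rule adele_box_add)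
    then show "c \<in> adele_nbhd a N"
      unfolding adele_nbhd_iff[OF a] using Ad.difference_identities(3)[OF cc bc a a] cc by simp
  qed
  then show "\<exists>M. finite {v \<in> fin_places. M v \<noteq> 0} \<and> adele_nbhd b M \<subseteq> adele_nbhd a N" using N by blast
qed

lemma openin_idele_top:
  "openin idele_top S \<longleftrightarrow> (\<exists>U. openin (prod_topology adele_top adele_top) U \<and> S = (\<lambda>u. (u, inv\<^bsub>adeles\<^esub> u)) -` U \<inter> ideles)"
  unfolding idele_top_def by (rule openin_pullback_topology)

lemma topspace_idele_top: "topspace idele_top = ideles"
  unfolding idele_top_def topspace_pullback_topology by (auto simp: topspace_adele_top)

text \<open>If \<open>u\<close> is close to \<open>u\<^sub>0\<close> then \<open>ord u \<ge> ord u\<^sub>0\<close>; the same for the inverses gives equality.\<close>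
lemma openin_idele_ord: "openin idele_top {u \<in> ideles. idele_ord u = E}"
proof (subst openin_subopen, intro ballI)
  fix u0 assume u0: "u0 \<in> {u \<in> ideles. idele_ord u = E}"
  define w0 where "w0 = inv\<^bsub>adeles\<^esub> u0"
  have u: "u0 \<in> ideles" "w0 \<in> ideles" "u0 \<in> carrier adeles" "w0 \<in> carrier adeles" using u0 by (auto simp: w0_def)
  have ow: "idele_ord w0 v = - E v" for v using idele_ord_inv[OF u(1)] u0 by (simp add: w0_def)
  have Ef: "fin_supp E" using idele_ord(2)[OF u(1)] u0 by simp
  \<comment> \<open>Radii of neighbourhoods are natural numbers, so negative orders are raised to 0;
    a finer neighbourhood does no harm.\<close>
  define N where "N v = nat (E v)" for v
  define M where "M v = nat (- E v)" for v
  have "{v \<in> fin_places. N v \<noteq> 0} \<subseteq> {v \<in> fin_places. E v \<noteq> 0}" "{v \<in> fin_places. M v \<noteq> 0} \<subseteq> {v \<in> fin_places. E v \<noteq> 0}"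
    by (auto simp: N_def M_def)
  then have fin: "finite {v \<in> fin_places. N v \<noteq> 0}" "finite {v \<in> fin_places. M v \<noteq> 0}"
    using Ef unfolding fin_supp_def by (blast intro: finite_subset)+
  define W where "W = (\<lambda>u. (u, inv\<^bsub>adeles\<^esub> u)) -` (adele_nbhd u0 N \<times> adele_nbhd w0 M) \<inter> ideles"
  have "openin (prod_topology adele_top adele_top) (adele_nbhd u0 N \<times> adele_nbhd w0 M)"
    using openin_adele_nbhd u fin by (simp add: openin_prod_Times_iff)
  then have 1: "openin idele_top W" unfolding openin_idele_top W_def by blast
  have 2: "u0 \<in> W" using u adele_nbhd_self by (simp add: W_def w0_def)
  have near: "E v \<le> idele_ord u v" if x: "x \<in> ideles" "\<And>v. v \<in> fin_places \<Longrightarrow> idele_ord x v = E v" and u: "u \<in> ideles" "u \<in> adele_nbhd x (\<lambda>v. nat (E v))" and v: "v \<in> fin_places" for x u E v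
  proof -
    note pv = fin_placesD[OF v]
    interpret C: cring "completion v" by (rule completion_cring[OF pv])
    have xc: "x v \<in> carrier (completion v)" "u v \<in> carrier (completion v)"
      using x(1) u(1) idele_ord(3) adele_mem v by blast+
    have "u v \<ominus>\<^bsub>completion v\<^esub> x v \<in> completion_ball v (int (nat (E v)))" using u(2) v by (simp add: adele_nbhd_def)
    then have "u v \<ominus>\<^bsub>completion v\<^esub> x v \<in> completion_ball v (E v)" by (rule ball_mono) simp
    moreover have "x v \<in> completion_ball v (E v)" using idele_ord(1)[OF x(1) v] x(2)[OF v] by (simp add: has_ord_def)
    ultimately have "(u v \<ominus>\<^bsub>completion v\<^esub> x v) \<oplus>\<^bsub>completion v\<^esub> x v \<in> completion_ball v (E v)" by (rule ball_add(1)[OF pv])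
    moreover have "(u v \<ominus>\<^bsub>completion v\<^esub> x v) \<oplus>\<^bsub>completion v\<^esub> x v = u v" using xc by algebra
    ultimately show ?thesis using idele_ord(1)[OF u(1) v] by (simp add: has_ord_def)
  qed
  have 3: "W \<subseteq> {u \<in> ideles. idele_ord u = E}"
  proof
    fix u assume uW: "u \<in> W"
    then have uu: "u \<in> ideles" "u \<in> adele_nbhd u0 N" "inv\<^bsub>adeles\<^esub> u \<in> adele_nbhd w0 M" "inv\<^bsub>adeles\<^esub> u \<in> ideles"
      by (auto simp: W_def)
    have "idele_ord u v = E v" for v
    proof (cases "v \<in> fin_places")
      case True
      have "E v \<le> idele_ord u v"
        by (rule near[OF u(1) _ uu(1) _ True]) (use u0 uu(2) in \<open>simp_all add: N_def[abs_def]\<close>)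
      moreover have "- E v \<le> idele_ord (inv\<^bsub>adeles\<^esub> u) v"
        by (rule near[OF u(2) _ uu(4) _ True, of "\<lambda>v. - E v"]) (use ow uu(3) in \<open>simp_all add: M_def[abs_def]\<close>)
      ultimately show ?thesis using idele_ord_inv[OF uu(1), of v] by simp
    next
      case False then show ?thesis using u0 by (auto simp: idele_ord_def)
    qed
    then show "u \<in> {u \<in> ideles. idele_ord u = E}" using uu(1) by auto
  qed
  show "\<exists>T. openin idele_top T \<and> u0 \<in> T \<and> T \<subseteq> {u \<in> ideles. idele_ord u = E}" using 1 2 3 by blast
qed

lemma topspace_param_top:
  "topspace param_top = {(s, \<rho>, u). s \<in> ideles \<and> \<rho> \<in> R \<and> u \<in> ideles \<and> \<rho> \<otimes>\<^bsub>adeles\<^esub> u \<in> R}"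
  unfolding param_top_def by (auto simp: topspace_idele_top topspace_adele_top R_def)

text \<open>The orders of \<open>s\<close> and \<open>u\<close> are locally constant, so any
  condition \<open>Q\<close> on them is open, and so is its negation. The open sets of
  \<open>pair_space\<close> that occur below are recognized in this way.\<close>

lemma openin_param_ord:
  "openin param_top {(s, \<rho>, u). (s, \<rho>, u) \<in> topspace param_top \<and> Q (idele_ord s) (idele_ord u)}"
proof (subst openin_subopen, intro ballI)
  fix p assume p: "p \<in> {(s, \<rho>, u). (s, \<rho>, u) \<in> topspace param_top \<and> Q (idele_ord s) (idele_ord u)}"
  obtain s \<rho> u where e: "p = (s, \<rho>, u)" by (cases p)
  have q: "(s, \<rho>, u) \<in> topspace param_top" "Q (idele_ord s) (idele_ord u)" using p e by auto
  define T where "T = {s' \<in> ideles. idele_ord s' = idele_ord s} \<times> (carrier adeles \<times> {u' \<in> ideles. idele_ord u' = idele_ord u})"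
  define W where "W = T \<inter> topspace param_top"
  have "openin (prod_topology idele_top (prod_topology adele_top idele_top)) T"
    unfolding T_def openin_prod_Times_iff using openin_idele_ord openin_topspace[of adele_top] topspace_adele_top by simp
  moreover have "param_top = subtopology (prod_topology idele_top (prod_topology adele_top idele_top)) (topspace param_top)"
    unfolding topspace_param_top by (simp add: param_top_def)
  ultimately have "openin param_top W" unfolding W_def by (metis openin_subtopology)
  moreover have "p \<in> W" using q e by (auto simp: W_def T_def topspace_param_top R_def)
  moreover have "W \<subseteq> {(s, \<rho>, u). (s, \<rho>, u) \<in> topspace param_top \<and> Q (idele_ord s) (idele_ord u)}"
    using q(2) by (auto simp: W_def T_def)
  ultimately show "\<exists>T. openin param_top T \<and> p \<in> T \<and> T \<subseteq> {(s, \<rho>, u). (s, \<rho>, u) \<in> topspace param_top \<and> Q (idele_ord s) (idele_ord u)}"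
    by blast
qed

section \<open>The quotient space of pairs\<close>

lemma openin_pair_space:
  "openin pair_space U \<longleftrightarrow> U \<subseteq> param_class ` topspace param_top \<and>
     openin param_top {p \<in> topspace param_top. param_class p \<in> U}"
proof -
  have "istopology (\<lambda>U. U \<subseteq> param_class ` topspace param_top \<and>
     openin param_top {p \<in> topspace param_top. param_class p \<in> U})" unfolding istopology_def
  proof (intro conjI allI impI)
    fix S T
    assume "S \<subseteq> param_class ` topspace param_top \<and> openin param_top {p \<in> topspace param_top. param_class p \<in> S}"
      "T \<subseteq> param_class ` topspace param_top \<and> openin param_top {p \<in> topspace param_top. param_class p \<in> T}"
    moreover have "{p \<in> topspace param_top. param_class p \<in> S \<inter> T}
      = {p \<in> topspace param_top. param_class p \<in> S} \<inter> {p \<in> topspace param_top. param_class p \<in> T}" by blast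
    ultimately show "S \<inter> T \<subseteq> param_class ` topspace param_top"
      "openin param_top {p \<in> topspace param_top. param_class p \<in> S \<inter> T}" by auto
  next
    fix \<U>
    assume U: "\<forall>S\<in>\<U>. S \<subseteq> param_class ` topspace param_top \<and> openin param_top {p \<in> topspace param_top. param_class p \<in> S}"
    then show "\<Union>\<U> \<subseteq> param_class ` topspace param_top" by blast
    have "{p \<in> topspace param_top. param_class p \<in> \<Union>\<U>} = \<Union>((\<lambda>S. {p \<in> topspace param_top. param_class p \<in> S}) ` \<U>)" by blast
    also have "openin param_top \<dots>" using U by (intro openin_Union) blast
    finally show "openin param_top {p \<in> topspace param_top. param_class p \<in> \<Union>\<U>}" .
  qed
  then show ?thesis unfolding pair_space_def by (simp add: topology_inverse')
qed

lemma topspace_pair_space: "topspace pair_space = param_class ` topspace param_top"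
proof -
  have "{p \<in> topspace param_top. param_class p \<in> param_class ` topspace param_top} = topspace param_top" by blast
  then have "openin pair_space (param_class ` topspace param_top)" unfolding openin_pair_space by simp
  from openin_subset[OF this] openin_topspace[of pair_space, unfolded openin_pair_space, THEN conjunct1]
  show ?thesis by (intro equalityI)
qed

lemma continuous_param_class: "continuous_map param_top pair_space param_class"
  unfolding continuous_map_def using openin_pair_space topspace_pair_space by auto

lemma scale_one: "lattice_data D y \<Longrightarrow> scale 1 (lattice_of D y) = lattice_of D y"
proof -
  assume d: "lattice_data D y"
  have "lattice_of (\<lambda>v. D v + v 1) (diag 1 \<otimes>\<^bsub>adeles\<^esub> y) = lattice_of D y"
  proof -
    have "diag 1 \<otimes>\<^bsub>adeles\<^esub> y = y" using d by (simp add: diag_ops lattice_data_def adele_box_def)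
    then show ?thesis using place_one fin_placesD by (auto intro: lattice_of_cong)
  qed
  then show ?thesis using scale_lattice_of(1)[OF _ d, of 1] by simp
qed

lemma param_class_data:
  assumes "(s, \<rho>, u) \<in> topspace param_top"
  shows "\<exists>y. param_class (s, \<rho>, u) = pair_class (lattice_of (\<lambda>v. - idele_ord s v) y) (lattice_of (\<lambda>v. - idele_ord s v - idele_ord u v) y)
    \<and> lattice_data (\<lambda>v. - idele_ord s v) y \<and> lattice_data (\<lambda>v. - idele_ord s v - idele_ord u v) y"
  using adelic_pair[of s u \<rho>] assms unfolding topspace_param_top param_class_def by auto

lemma data_param_class:
  assumes d: "lattice_data D y" and d': "lattice_data D' y"
  shows "pair_class (lattice_of D y) (lattice_of D' y) \<in> topspace pair_space"
proof -
  obtain s \<rho> where s: "s \<in> ideles" "\<rho> \<in> R" "\<forall>v\<in>fin_places. idele_ord s v = - D v"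
    "\<rho> \<otimes>\<^bsub>adeles\<^esub> inv\<^bsub>adeles\<^esub> s = y" "adelic_lattice s \<rho> = lattice_of D y" using data_adelic[OF d] by blast
  have "fin_supp (\<lambda>v. D v - D' v)" using d d' by (intro fin_supp_diff) (auto simp: lattice_data_def)
  then obtain u where u: "u \<in> ideles" "\<forall>v\<in>fin_places. idele_ord u v = D v - D' v" using idele_exists by blast
  have c: "s \<in> carrier adeles" "u \<in> carrier adeles" "\<rho> \<in> carrier adeles" "inv\<^bsub>adeles\<^esub> s \<in> carrier adeles" "y \<in> carrier adeles"
    using s u d by (auto simp: R_def lattice_data_def adele_box_def)
  have "\<rho> = y \<otimes>\<^bsub>adeles\<^esub> s" unfolding s(4)[symmetric] using c s(1) by (simp add: Ad.m_assoc)
  then have "\<rho> \<otimes>\<^bsub>adeles\<^esub> u = (s \<otimes>\<^bsub>adeles\<^esub> u) \<otimes>\<^bsub>adeles\<^esub> y" using c by (simp add: Ad.m_ac)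
  moreover have "(s \<otimes>\<^bsub>adeles\<^esub> u) \<otimes>\<^bsub>adeles\<^esub> y \<in> adele_box (\<lambda>_. 0)"
  proof -
    have "adele_box (\<lambda>v. 0 - idele_ord (s \<otimes>\<^bsub>adeles\<^esub> u) v) = adele_box D'"
      by (rule adele_box_cong) (simp add: idele_ord_mult[OF s(1) u(1)] s(3) u(2))
    then show ?thesis using idele_mult_box[of "s \<otimes>\<^bsub>adeles\<^esub> u" y "\<lambda>_. 0"] s(1) u(1) c d' by (simp add: lattice_data_def)
  qed
  ultimately have "\<rho> \<otimes>\<^bsub>adeles\<^esub> u \<in> R" by (simp add: R_box)
  then have t: "(s, \<rho>, u) \<in> topspace param_top" using s u by (simp add: topspace_param_top)
  have "adelic_lattice (s \<otimes>\<^bsub>adeles\<^esub> u) (\<rho> \<otimes>\<^bsub>adeles\<^esub> u) = lattice_of D' y"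
    unfolding adelic_pair(2)[OF s(1) u(1) s(2) \<open>\<rho> \<otimes>\<^bsub>adeles\<^esub> u \<in> R\<close>] s(4) by (rule lattice_of_cong) (simp add: s(3) u(2))
  then have "param_class (s, \<rho>, u) = pair_class (lattice_of D y) (lattice_of D' y)"
    by (simp add: param_class_def s(5))
  then show ?thesis using t topspace_pair_space by (metis imageI)
qed

lemma pair_class_mem:
  assumes "lattice_data D y" "lattice_data D' y"
  shows "(lattice_of D y, lattice_of D' y) \<in> pair_class (lattice_of D y) (lattice_of D' y)"
  unfolding pair_class_def using scale_one[OF assms(1)] scale_one[OF assms(2)]
  by (intro CollectI exI[of _ 1]) simp

text \<open>Scaling by \<open>k\<close> shifts both divisors by that of \<open>k\<close>; in
  particular their difference is an invariant of the class.\<close>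

lemma pair_class_memD:
  assumes d: "lattice_data D y" "lattice_data D' y" and e: "lattice_data E z" "lattice_data E' z'"
    and m: "(lattice_of E z, lattice_of E' z') \<in> pair_class (lattice_of D y) (lattice_of D' y)"
  shows "\<exists>k. k \<noteq> 0 \<and> (\<forall>v\<in>fin_places. E v = D v + v k \<and> E' v = D' v + v k)"
proof -
  obtain k where k: "k \<noteq> 0" "lattice_of E z = scale k (lattice_of D y)" "lattice_of E' z' = scale k (lattice_of D' y)"
    using m by (auto simp: pair_class_def)
  have "lattice_of E z = lattice_of (\<lambda>v. D v + v k) (diag k \<otimes>\<^bsub>adeles\<^esub> y)"
    "lattice_of E' z' = lattice_of (\<lambda>v. D' v + v k) (diag k \<otimes>\<^bsub>adeles\<^esub> y)"
    using k scale_lattice_of(1)[OF k(1)] d by simp_all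
  then show ?thesis using lattice_of_inj(2)[OF e(1) scale_lattice_of(2)[OF k(1) d(1)]]
      lattice_of_inj(2)[OF e(2) scale_lattice_of(2)[OF k(1) d(2)]] k(1) by blast
qed

text \<open>The order of \<open>u\<close> depends only on the class, so the sets \<open>U E\<close>
  form an open cover indexed by the possible differences of divisors; compactness leaves finitely
  many of them.\<close>

lemma compact_pairs_finite:
  assumes "compactin pair_space K"
  shows "\<exists>\<E>. finite \<E> \<and> (\<forall>D D' y. lattice_data D y \<longrightarrow> lattice_data D' y \<longrightarrow>
    pair_class (lattice_of D y) (lattice_of D' y) \<in> K \<longrightarrow> (\<exists>E\<in>\<E>. \<forall>v\<in>fin_places. D' v = D v - E v))"
proof -
  define U where "U E = param_class ` {(s, \<rho>, u). (s, \<rho>, u) \<in> topspace param_top \<and> idele_ord u = E}" for E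
  have same: "idele_ord u = idele_ord u'"
    if p: "(s, \<rho>, u) \<in> topspace param_top" "(s', \<rho>', u') \<in> topspace param_top"
      "param_class (s, \<rho>, u) = param_class (s', \<rho>', u')" for s \<rho> u s' \<rho>' u'
  proof
    fix v
    obtain y where y: "param_class (s, \<rho>, u) = pair_class (lattice_of (\<lambda>v. - idele_ord s v) y) (lattice_of (\<lambda>v. - idele_ord s v - idele_ord u v) y)"
      "lattice_data (\<lambda>v. - idele_ord s v) y" "lattice_data (\<lambda>v. - idele_ord s v - idele_ord u v) y"
      using param_class_data[OF p(1)] by blast
    obtain y' where y': "param_class (s', \<rho>', u') = pair_class (lattice_of (\<lambda>v. - idele_ord s' v) y') (lattice_of (\<lambda>v. - idele_ord s' v - idele_ord u' v) y')"
      "lattice_data (\<lambda>v. - idele_ord s' v) y'" "lattice_data (\<lambda>v. - idele_ord s' v - idele_ord u' v) y'"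
      using param_class_data[OF p(2)] by blast
    have "(lattice_of (\<lambda>v. - idele_ord s v) y, lattice_of (\<lambda>v. - idele_ord s v - idele_ord u v) y)
      \<in> pair_class (lattice_of (\<lambda>v. - idele_ord s' v) y') (lattice_of (\<lambda>v. - idele_ord s' v - idele_ord u' v) y')"
      using pair_class_mem[OF y(2,3)] y(1) y'(1) p(3) by simp
    from pair_class_memD[OF y'(2,3) y(2,3) this] obtain k where k: "\<forall>v\<in>fin_places. - idele_ord s v = - idele_ord s' v + v k \<and>
        - idele_ord s v - idele_ord u v = - idele_ord s' v - idele_ord u' v + v k" by blast
    show "idele_ord u v = idele_ord u' v"
    proof (cases "v \<in> fin_places")
      case True then show ?thesis using k by force
    qed (simp add: idele_ord_def)
  qed
  have "openin pair_space (U E)" for E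
  proof -
    have "{p \<in> topspace param_top. param_class p \<in> U E} = {(s, \<rho>, u). (s, \<rho>, u) \<in> topspace param_top \<and> idele_ord u = E}"
    proof (intro equalityI subsetI)
      fix p assume p: "p \<in> {p \<in> topspace param_top. param_class p \<in> U E}"
      obtain s \<rho> u where e: "p = (s, \<rho>, u)" by (cases p)
      have t: "(s, \<rho>, u) \<in> topspace param_top" and "param_class (s, \<rho>, u) \<in> U E" using p e by auto
      then obtain s' \<rho>' u' where "(s', \<rho>', u') \<in> topspace param_top" "idele_ord u' = E"
        "param_class (s, \<rho>, u) = param_class (s', \<rho>', u')" unfolding U_def by blast
      then show "p \<in> {(s, \<rho>, u). (s, \<rho>, u) \<in> topspace param_top \<and> idele_ord u = E}"
        using same[OF t] t e by simp
    qed (auto simp: U_def)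
    then show ?thesis unfolding openin_pair_space using openin_param_ord[of "\<lambda>_ F. F = E"] by (auto simp: U_def)
  qed
  moreover have "K \<subseteq> \<Union>(range U)"
  proof
    fix P assume "P \<in> K"
    then have "P \<in> param_class ` topspace param_top" using compactin_subset_topspace[OF assms] topspace_pair_space by blast
    then obtain s \<rho> u where "(s, \<rho>, u) \<in> topspace param_top" "P = param_class (s, \<rho>, u)" by auto
    then have "P \<in> U (idele_ord u)" unfolding U_def by blast
    then show "P \<in> \<Union>(range U)" by blast
  qed
  ultimately obtain F where F: "finite F" "F \<subseteq> range U" "K \<subseteq> \<Union>F"
    using compactinD[OF assms, of "range U"] by (metis rangeE)
  obtain \<E> where E: "finite \<E>" "F = U ` \<E>" using F by (metis finite_subset_image)
  have "\<exists>E\<in>\<E>. \<forall>v\<in>fin_places. D' v = D v - E v"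
    if d: "lattice_data D y" "lattice_data D' y" and P: "pair_class (lattice_of D y) (lattice_of D' y) \<in> K" for D D' y
  proof -
    obtain E where EE: "E \<in> \<E>" "pair_class (lattice_of D y) (lattice_of D' y) \<in> U E" using P F E by blast
    then obtain s \<rho> u where p: "(s, \<rho>, u) \<in> topspace param_top" "idele_ord u = E"
      "pair_class (lattice_of D y) (lattice_of D' y) = param_class (s, \<rho>, u)" unfolding U_def by blast
    obtain z where z: "param_class (s, \<rho>, u) = pair_class (lattice_of (\<lambda>v. - idele_ord s v) z) (lattice_of (\<lambda>v. - idele_ord s v - idele_ord u v) z)"
      "lattice_data (\<lambda>v. - idele_ord s v) z" "lattice_data (\<lambda>v. - idele_ord s v - idele_ord u v) z"
      using param_class_data[OF p(1)] by blast
    have "(lattice_of D y, lattice_of D' y) \<in> pair_class (lattice_of (\<lambda>v. - idele_ord s v) z) (lattice_of (\<lambda>v. - idele_ord s v - idele_ord u v) z)"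
      using pair_class_mem[OF d] p(3) z(1) by simp
    from pair_class_memD[OF z(2,3) d this] have "\<forall>v\<in>fin_places. D' v = D v - E v" using p(2) by force
    then show ?thesis using EE(1) by blast
  qed
  then show ?thesis using E(1) by blast
qed

text \<open>Koenig's lemma: if finitely many members of the cover never suffice, then there is a nested
  sequence of boxes with the same property; it shrinks to an adele because only finitely many places
  have a residue field of a given size.\<close>
lemma compact_R: "compactin adele_top R"
  unfolding compactin_def
proof (intro conjI allI impI)
  show "R \<subseteq> topspace adele_top" by (auto simp: topspace_adele_top R_def)
  fix \<U> assume U: "Ball \<U> (openin adele_top) \<and> R \<subseteq> \<Union>\<U>"
  define covered where "covered X \<longleftrightarrow> (\<exists>\<F>. finite \<F> \<and> \<F> \<subseteq> \<U> \<and> X \<subseteq> \<Union>\<F>)" for X :: "'k adele set"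
  have cov_sub: "covered X" if "covered Y" "X \<subseteq> Y" for X Y using that unfolding covered_def by blast
  have cov_Un: "covered (\<Union>t\<in>T. X t)" if T: "finite T" "\<And>t. t \<in> T \<Longrightarrow> covered (X t)" for T :: "'k set" and X
  proof -
    have "\<forall>t\<in>T. \<exists>\<F>. finite \<F> \<and> \<F> \<subseteq> \<U> \<and> X t \<subseteq> \<Union>\<F>" using T(2) unfolding covered_def by blast
    then obtain F where F: "\<And>t. t \<in> T \<Longrightarrow> finite (F t) \<and> F t \<subseteq> \<U> \<and> X t \<subseteq> \<Union>(F t)" by metis
    show ?thesis unfolding covered_def 
    proof (intro exI conjI)
      show "finite (\<Union>t\<in>T. F t)" using F T(1) by blast
      show "(\<Union>t\<in>T. F t) \<subseteq> \<U>" using F by blast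
      show "(\<Union>t\<in>T. X t) \<subseteq> \<Union>(\<Union>t\<in>T. F t)"
      proof
        fix z assume "z \<in> (\<Union>t\<in>T. X t)"
        then obtain t where t: "t \<in> T" "z \<in> X t" by blast
        then have "z \<in> \<Union>(F t)" using F[OF t(1)] by blast
        then show "z \<in> \<Union>(\<Union>t\<in>T. F t)" using t(1) by blast
      qed
    qed
  qed
  \<comment> \<open>Level \<open>i\<close> asks for precision \<open>i\<close> at the finitely many
    places with at most \<open>i\<close> residues, and for integrality elsewhere; every place is
    eventually included with growing precision.\<close>
  define N where "N i v = (if v \<in> fin_places \<and> resid_card v \<le> i then i else 0)" for i :: nat and v :: "'k place"
  have Nf: "fin_supp (\<lambda>v. int (N i v))" for i unfolding fin_supp_def
    by (rule finite_subset[OF _ finite_small_places[of i]]) (auto simp: N_def)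
  have Nm: "int (N i v) \<le> int (N (Suc i) v)" for i v by (simp add: N_def)
  define B where "B a i = {z \<in> carrier adeles. diag a \<ominus>\<^bsub>adeles\<^esub> z \<in> adele_box (\<lambda>v. int (N i v))}" for a i
  \<comment> \<open>The box \<open>B a i\<close> is a union of finitely many boxes of the next
    level, centred at representatives of a finite quotient; if all of these were covered, so would
    be \<open>B a i\<close>.\<close>
  have step: "\<exists>b. \<not> covered (B b (Suc i)) \<and> b - a \<in> ideal_of (\<lambda>v. int (N i v))" if nb: "\<not> covered (B a i)" for a i
  proof (rule ccontr)
    assume n: "\<not> ?thesis"
    let ?G = "ideal_of (\<lambda>v. int (N i v))" and ?H = "ideal_of (\<lambda>v. int (N (Suc i) v))"
    have "finite {v \<in> fin_places. int (N (Suc i) v) \<noteq> 0}" using Nf[of "Suc i"] by (simp add: fin_supp_def)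
    then have fi: "finite (cosets ?G ?H)"
      by (rule box_index(1)[OF fin_places_subset]) (use Nm in \<open>auto simp: N_def split: if_splits\<close>)
    obtain T where T: "transversal ?G ?H T" using transversal_exists[OF ideal_of_subgroup] by blast
    have Tf: "finite T" using transversal_card(2)[OF ideal_of_subgroup T] fi by simp
    have "B a i \<subseteq> (\<Union>t\<in>T. B (a + t) (Suc i))"
    proof
      fix z assume z: "z \<in> B a i"
      then have zc: "z \<in> carrier adeles" and za: "diag a \<ominus>\<^bsub>adeles\<^esub> z \<in> adele_box (\<lambda>v. int (N i v))" by (auto simp: B_def)
      obtain b where b: "diag b \<ominus>\<^bsub>adeles\<^esub> z \<in> adele_box (\<lambda>v. int (N (Suc i) v))" using adele_approximation[OF zc Nf] by blast
      then have b': "diag b \<ominus>\<^bsub>adeles\<^esub> z \<in> adele_box (\<lambda>v. int (N i v))"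
        using adele_box_mono[of "\<lambda>v. int (N i v)" "\<lambda>v. int (N (Suc i) v)"] Nm by blast
      have "b - a \<in> ?G" using diag_diff_box[OF zc za, of b] b' by blast
      then obtain t where t: "t \<in> T" "(b - a) - t \<in> ?H" using T unfolding transversal_def by blast
      have "(a + t) - b \<in> ?H" using add_subgroupD(3)[OF ideal_of_subgroup t(2)] by (simp add: algebra_simps)
      then have "diag (a + t) \<ominus>\<^bsub>adeles\<^esub> z \<in> adele_box (\<lambda>v. int (N (Suc i) v))" using diag_diff_box[OF zc b, of "a + t"] by blast
      then show "z \<in> (\<Union>t\<in>T. B (a + t) (Suc i))" using t zc by (auto simp: B_def)
    qed
    moreover have "covered (B (a + t) (Suc i))" if "t \<in> T" for t
    proof -
      have "(a + t) - a \<in> ?G" using T that by (auto simp: transversal_def)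
      then show ?thesis using n by blast
    qed
    then have "covered (\<Union>t\<in>T. B (a + t) (Suc i))" by (rule cov_Un[OF Tf])
    ultimately have "covered (B a i)" by (rule cov_sub[rotated])
    then show False using nb by blast
  qed
  have "covered R"
  proof (rule ccontr)
    assume nR: "\<not> covered R"
    have "R \<subseteq> B 0 0"
    proof
      fix z assume "z \<in> R"
      then have z: "z \<in> adele_box (\<lambda>_. 0)" by (simp add: R_box)
      then have "diag 0 \<ominus>\<^bsub>adeles\<^esub> z \<in> adele_box (\<lambda>_. 0)" "z \<in> carrier adeles"
        unfolding diag_ops(5) by (rule adele_box_add(2)[OF adele_box_zero], rule adele_box_carrier)
      moreover have "N 0 v = 0" for v by (simp add: N_def)
      ultimately show "z \<in> B 0 0" by (simp add: B_def)
    qed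
    then have "\<not> covered (B 0 0)" using nR cov_sub by blast
    \<comment> \<open>The clause for \<open>i = 0\<close> pins the sequence to start at 0, from
      which integrality of its limit follows.\<close>
    then have "\<exists>\<alpha>. \<forall>i. (\<not> covered (B (\<alpha> i) i) \<and> (i = 0 \<longrightarrow> \<alpha> i = 0)) \<and> \<alpha> (Suc i) - \<alpha> i \<in> ideal_of (\<lambda>v. int (N i v))"
    proof (intro dependent_nat_choice)
      fix a i assume "\<not> covered (B a i) \<and> (i = 0 \<longrightarrow> a = 0)"
      then show "\<exists>b. (\<not> covered (B b (Suc i)) \<and> (Suc i = 0 \<longrightarrow> b = 0)) \<and> b - a \<in> ideal_of (\<lambda>v. int (N i v))"
        using step[of a i] by simp
    qed (rule exI[of _ 0], simp)
    then obtain \<alpha> where \<alpha>: "\<And>i. \<not> covered (B (\<alpha> i) i)" "\<alpha> 0 = 0" "\<And>i. \<alpha> (Suc i) - \<alpha> i \<in> ideal_of (\<lambda>v. int (N i v))"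
      by blast
    have diff: "\<alpha> (i + j) - \<alpha> i \<in> ideal_of (\<lambda>v. int (N i v))" for i j
    proof (induction j)
      case 0 then show ?case using add_subgroupD(1)[OF ideal_of_subgroup] by simp
    next
      case (Suc j)
      have "N i v \<le> N (i + j) v" for v by (simp add: N_def)
      then have "\<alpha> (Suc (i + j)) - \<alpha> (i + j) \<in> ideal_of (\<lambda>v. int (N i v))"
        using \<alpha>(3)[of "i + j"] box_mono[of fin_places "\<lambda>v. int (N i v)" "\<lambda>v. int (N (i + j) v)"] by auto
      from add_subgroupD(4)[OF ideal_of_subgroup this Suc] show ?case by simp
    qed
    have diff': "val_ge v (int (N i v)) (\<alpha> j - \<alpha> i)" if "i \<le> j" "v \<in> fin_places" for i j v
      using diff[of i "j - i"] that by (simp add: vbox_def)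
    have cau: "cauchy v \<alpha>" if v: "v \<in> fin_places" for v unfolding cauchy_iff
    proof
      fix n
      define M where "M = max (nat n) (resid_card v)"
      have M: "n \<le> int (N M v)" using v by (simp add: N_def M_def)
      have "val_ge v n (\<alpha> i - \<alpha> j)" if "i \<ge> M" "j \<ge> M" for i j
      proof -
        have "val_ge v n (\<alpha> i - \<alpha> M)" "val_ge v n (\<alpha> j - \<alpha> M)"
          using val_ge_mono[OF diff'[OF _ v] M] that by blast+
        then have "val_ge v n ((\<alpha> i - \<alpha> M) - (\<alpha> j - \<alpha> M))" by (rule val_ge_diff[OF fin_placesD[OF v]])
        then show ?thesis by simp
      qed
      then show "\<exists>N. \<forall>i\<ge>N. \<forall>j\<ge>N. val_ge v n (\<alpha> i - \<alpha> j)" by blast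
    qed
    define z where "z = restrict (\<lambda>v. lim_of v \<alpha>) fin_places"
    have zb: "lim_of v \<alpha> \<in> completion_ball v 0" if v: "v \<in> fin_places" for v
    proof -
      have "val_ge v 0 (\<alpha> j)" for j using val_ge_mono[OF diff'[of 0 j, OF _ v], of 0] \<alpha>(2) by simp
      then show ?thesis unfolding lim_of_ball[OF fin_placesD[OF v] cau[OF v]] by simp
    qed
    have zc: "z \<in> carrier adeles" unfolding z_def
      by (rule adele_restrict[of _ "{}"]) (use zb ball_carrier in blast)+
    then have zR: "z \<in> R" using zb by (simp add: R_def z_def)
    have zB: "diag (\<alpha> i) \<ominus>\<^bsub>adeles\<^esub> z \<in> adele_box (\<lambda>v. int (N i v))" for i unfolding adele_box_def
    proof (intro CollectI conjI ballI)
      show "diag (\<alpha> i) \<ominus>\<^bsub>adeles\<^esub> z \<in> carrier adeles" using zc diag_carrier by simp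
      fix v assume v: "v \<in> fin_places"
      note pv = fin_placesD[OF v]
      have e: "(diag (\<alpha> i) \<ominus>\<^bsub>adeles\<^esub> z) v = lim_of v (\<lambda>j. \<alpha> i - \<alpha> j)"
        unfolding adele_minus[OF diag_carrier zc v] diag_apply[OF v] const_def
        using completion_ops(6)[OF pv cauchy_const cau[OF v]] v by (simp add: z_def)
      have "val_ge v (int (N i v)) (\<alpha> i - \<alpha> j)" if "j \<ge> i" for j
      proof -
        have "val_ge v (int (N i v)) (- (\<alpha> j - \<alpha> i))" unfolding val_ge_minus_iff[OF pv] by (rule diff'[OF that v])
        then show ?thesis by simp
      qed
      then show "(diag (\<alpha> i) \<ominus>\<^bsub>adeles\<^esub> z) v \<in> completion_ball v (int (N i v))"
        unfolding e lim_of_ball[OF pv cauchy_diff[OF pv cauchy_const cau[OF v]]] eventually_sequentially by blast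
    qed
    obtain V where V: "V \<in> \<U>" "z \<in> V" using U zR by blast
    then obtain M where M: "finite {v \<in> fin_places. M v \<noteq> 0}" "adele_nbhd z M \<subseteq> V"
      using U openin_adele_top by meson
    \<comment> \<open>A level that includes every place constrained by \<open>M\<close> and refines
      all its radii.\<close>
    define i where "i = (\<Sum>v | v \<in> fin_places \<and> M v \<noteq> 0. M v + resid_card v)"
    have MN: "M v \<le> N i v" if v: "v \<in> fin_places" for v
    proof (cases "M v = 0")
      case False
      then have "M v + resid_card v \<le> i" unfolding i_def using M(1) v
        by (intro member_le_sum[of v _ "\<lambda>v. M v + resid_card v"]) auto
      then show ?thesis using v by (simp add: N_def)
    qed simp
    have "B (\<alpha> i) i \<subseteq> V"
    proof
      fix w assume w: "w \<in> B (\<alpha> i) i"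
      then have wc: "w \<in> carrier adeles" by (simp add: B_def)
      have "(diag (\<alpha> i) \<ominus>\<^bsub>adeles\<^esub> z) \<ominus>\<^bsub>adeles\<^esub> (diag (\<alpha> i) \<ominus>\<^bsub>adeles\<^esub> w) \<in> adele_box (\<lambda>v. int (N i v))"
        by (rule adele_box_add(2)[OF zB]) (use w in \<open>simp add: B_def\<close>)
      moreover have "(diag (\<alpha> i) \<ominus>\<^bsub>adeles\<^esub> z) \<ominus>\<^bsub>adeles\<^esub> (diag (\<alpha> i) \<ominus>\<^bsub>adeles\<^esub> w) = w \<ominus>\<^bsub>adeles\<^esub> z"
        using diag_carrier[of "\<alpha> i"] zc wc by algebra
      ultimately have "w \<ominus>\<^bsub>adeles\<^esub> z \<in> adele_box (\<lambda>v. int (M v))"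
        using adele_box_mono[of "\<lambda>v. int (M v)" "\<lambda>v. int (N i v)"] MN by auto
      then show "w \<in> V" using M(2) adele_nbhd_iff[OF zc] wc by blast
    qed
    then have "covered (B (\<alpha> i) i)" unfolding covered_def using V by (intro exI[of _ "{V}"]) auto
    then show False using \<alpha>(1) by blast
  qed
  then show "\<exists>\<F>. finite \<F> \<and> \<F> \<subseteq> \<U> \<and> R \<subseteq> \<Union>\<F>" by (simp add: covered_def)
qed

section \<open>Diagonal pairs over one ideal class\<close>

definition equivalent_divisor :: "('k place \<Rightarrow> int) \<Rightarrow> ('k place \<Rightarrow> int) \<Rightarrow> bool" where
  "equivalent_divisor D E \<longleftrightarrow> (\<exists>k. k \<noteq> 0 \<and> (\<forall>v\<in>fin_places. D v = E v + v k))"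

lemma equivalent_divisor_trans:
  assumes "equivalent_divisor D E" "equivalent_divisor E F"
  shows "equivalent_divisor D F"
proof -
  obtain k l where k: "k \<noteq> 0" "\<forall>v\<in>fin_places. D v = E v + v k" and l: "l \<noteq> 0" "\<forall>v\<in>fin_places. E v = F v + v l"
    using assms unfolding equivalent_divisor_def by blast
  have "D v = F v + v (k * l)" if "v \<in> fin_places" for v
    using k l place_mult[OF fin_placesD[OF that] k(1) l(1)] that by simp
  then show ?thesis unfolding equivalent_divisor_def using k l by (intro exI[of _ "k * l"]) simp
qed

lemma equivalent_divisor_sym:
  assumes "equivalent_divisor D E"
  shows "equivalent_divisor E D"
proof -
  obtain k where k: "k \<noteq> 0" "\<forall>v\<in>fin_places. D v = E v + v k" using assms unfolding equivalent_divisor_def by blast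
  have "E v = D v + v (inverse k)" if "v \<in> fin_places" for v
    using k place_inverse[OF fin_placesD[OF that] k(1)] that by simp
  then show ?thesis unfolding equivalent_divisor_def using k by (intro exI[of _ "inverse k"]) simp
qed

lemma equivalent_divisor_cong:
  "(\<And>v. v \<in> fin_places \<Longrightarrow> D v = E v) \<Longrightarrow> equivalent_divisor D E"
  unfolding equivalent_divisor_def by (intro exI[of _ 1]) (simp add: place_one fin_placesD)

text \<open>The condition on the divisor is invariant under scaling. One ideal class is fixed so
  that, after scaling, a single idele \<open>s\<close> serves for all these pairs.\<close>

definition diagonal_classes :: "('k place \<Rightarrow> int) \<Rightarrow> ('k rlattice \<times> 'k rlattice) set set" where
  "diagonal_classes D = {pair_class (lattice_of E y) (lattice_of E y) | E y. lattice_data E y \<and> equivalent_divisor E D}"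

text \<open>Membership depends on the parameters only through their orders, which makes the set both
  open and closed.\<close>

lemma diagonal_classes_param:
  assumes p: "(s, \<rho>, u) \<in> topspace param_top"
  shows "param_class (s, \<rho>, u) \<in> diagonal_classes D \<longleftrightarrow>
    equivalent_divisor (\<lambda>v. - idele_ord s v) D \<and> idele_ord u = (\<lambda>_. 0)"
proof -
  obtain z where z: "param_class (s, \<rho>, u) = pair_class (lattice_of (\<lambda>v. - idele_ord s v) z) (lattice_of (\<lambda>v. - idele_ord s v - idele_ord u v) z)"
    "lattice_data (\<lambda>v. - idele_ord s v) z" "lattice_data (\<lambda>v. - idele_ord s v - idele_ord u v) z"
    using param_class_data[OF p] by blast
  show ?thesis
  proof
    assume "param_class (s, \<rho>, u) \<in> diagonal_classes D"
    then obtain E y where E: "param_class (s, \<rho>, u) = pair_class (lattice_of E y) (lattice_of E y)"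
      "lattice_data E y" "equivalent_divisor E D" unfolding diagonal_classes_def by blast
    have "(lattice_of (\<lambda>v. - idele_ord s v) z, lattice_of (\<lambda>v. - idele_ord s v - idele_ord u v) z)
      \<in> pair_class (lattice_of E y) (lattice_of E y)" using pair_class_mem[OF z(2,3)] z(1) E(1) by simp
    from pair_class_memD[OF E(2,2) z(2,3) this] obtain k where k: "k \<noteq> 0"
      "\<forall>v\<in>fin_places. - idele_ord s v = E v + v k \<and> - idele_ord s v - idele_ord u v = E v + v k" by blast
    have "idele_ord u v = 0" for v
    proof (cases "v \<in> fin_places")
      case True then show ?thesis using k by force
    qed (simp add: idele_ord_def)
    moreover have "equivalent_divisor (\<lambda>v. - idele_ord s v) E" unfolding equivalent_divisor_def using k by blast
    ultimately show "equivalent_divisor (\<lambda>v. - idele_ord s v) D \<and> idele_ord u = (\<lambda>_. 0)"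
      using E(3) equivalent_divisor_trans by blast
  next
    assume a: "equivalent_divisor (\<lambda>v. - idele_ord s v) D \<and> idele_ord u = (\<lambda>_. 0)"
    then have "param_class (s, \<rho>, u) = pair_class (lattice_of (\<lambda>v. - idele_ord s v) z) (lattice_of (\<lambda>v. - idele_ord s v) z)"
      using z(1) by simp
    then show "param_class (s, \<rho>, u) \<in> diagonal_classes D" unfolding diagonal_classes_def using z(2) a by blast
  qed
qed

lemma diagonal_classes_subset: "diagonal_classes D \<subseteq> topspace pair_space"
  unfolding diagonal_classes_def using data_param_class by auto

lemma openin_ord_classes:
  assumes "U \<subseteq> topspace pair_space"
    and "\<And>s \<rho> u. (s, \<rho>, u) \<in> topspace param_top \<Longrightarrow> param_class (s, \<rho>, u) \<in> U \<longleftrightarrow> Q (idele_ord s) (idele_ord u)"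
  shows "openin pair_space U"
proof -
  have "{p \<in> topspace param_top. param_class p \<in> U} = {(s, \<rho>, u). (s, \<rho>, u) \<in> topspace param_top \<and> Q (idele_ord s) (idele_ord u)}"
    using assms(2) by auto
  then show ?thesis unfolding openin_pair_space using assms(1) topspace_pair_space openin_param_ord[of Q] by simp
qed

lemma diagonal_classes_clopen: "openin pair_space (diagonal_classes D)" "closedin pair_space (diagonal_classes D)"
proof -
  show "openin pair_space (diagonal_classes D)"
    by (rule openin_ord_classes[where Q = "\<lambda>s u. equivalent_divisor (\<lambda>v. - s v) D \<and> u = (\<lambda>_. 0)"])
       (auto simp: diagonal_classes_param diagonal_classes_subset)
  have "openin pair_space (topspace pair_space - diagonal_classes D)"
    by (rule openin_ord_classes[where Q = "\<lambda>s u. \<not> (equivalent_divisor (\<lambda>v. - s v) D \<and> u = (\<lambda>_. 0))"])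
       (use diagonal_classes_param topspace_pair_space in \<open>auto simp del: topspace_param_top\<close>)
  then show "closedin pair_space (diagonal_classes D)" unfolding closedin_def using diagonal_classes_subset by blast
qed

text \<open>Scaling moves every pair to the divisor \<open>D\<close> itself, so the set lies in the
  image of \<open>{s}\<close> times \<open>R\<close> times the unit idele. That image is compact by
  \<open>compact_R\<close>, and the set is closed.\<close>

lemma diagonal_classes_compact:
  assumes D: "fin_supp D"
  shows "compactin pair_space (diagonal_classes D)"
proof -
  obtain s where s: "s \<in> ideles" "\<forall>v\<in>fin_places. idele_ord s v = - D v"
    using idele_exists[OF fin_supp_minus[OF D]] by blast
  let ?K = "{s} \<times> (R \<times> {\<one>\<^bsub>adeles\<^esub>})"
  have sub: "?K \<subseteq> topspace param_top" using s(1) by (auto simp: topspace_param_top R_def)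
  have "compactin (prod_topology idele_top (prod_topology adele_top idele_top)) ?K"
    unfolding compactin_Times using compact_R s(1) by (simp add: topspace_idele_top)
  then have "compactin param_top ?K" unfolding param_top_def compactin_subtopology
    using sub unfolding topspace_param_top by blast
  then have "compactin pair_space (param_class ` ?K)" by (rule image_compactin[OF _ continuous_param_class])
  moreover have "diagonal_classes D \<subseteq> param_class ` ?K"
  proof
    fix P assume "P \<in> diagonal_classes D"
    then obtain E y where E: "P = pair_class (lattice_of E y) (lattice_of E y)" "lattice_data E y" "equivalent_divisor D E"
      unfolding diagonal_classes_def using equivalent_divisor_sym by blast
    obtain k where k: "k \<noteq> 0" "\<forall>v\<in>fin_places. D v = E v + v k" using E(3) unfolding equivalent_divisor_def by blast
    define y' where "y' = diag k \<otimes>\<^bsub>adeles\<^esub> y"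
    have b: "adele_box (\<lambda>v. E v + v k) = adele_box D" "adele_box (\<lambda>v. - idele_ord s v) = adele_box D"
      by (rule adele_box_cong; use k(2) s(2) in simp)+
    have sc: "scale k (lattice_of E y) = lattice_of D y'"
      unfolding scale_lattice_of(1)[OF k(1) E(2)] y'_def by (rule lattice_of_cong) (use k(2) in simp)
    have "y' \<in> adele_box D" using scale_lattice_of(2)[OF k(1) E(2)] b by (simp add: lattice_data_def y'_def)
    then have "y' \<in> R_over s" unfolding R_over_box[OF s(1)] b .
    then obtain \<rho> where \<rho>: "\<rho> \<in> R" "y' = \<rho> \<otimes>\<^bsub>adeles\<^esub> inv\<^bsub>adeles\<^esub> s" unfolding R_over_def by blast
    have al: "adelic_lattice s \<rho> = lattice_of D y'" unfolding adelic_lattice_eq[OF s(1)] \<rho>(2)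
      by (rule lattice_of_cong) (use s(2) in simp)
    have "param_class (s, \<rho>, \<one>\<^bsub>adeles\<^esub>) = pair_class (lattice_of D y') (lattice_of D y')"
      using s(1) \<rho>(1) al idele_ord(3)[OF s(1)] by (simp add: param_class_def R_def)
    also have "\<dots> = P"
    proof -
      have ss: "scale l (scale k (lattice_of E y)) = scale (l * k) (lattice_of E y)" if l: "l \<noteq> 0" for l
      proof -
        have "scale l (scale k (lattice_of E y)) = lattice_of (\<lambda>v. E v + v k + v l) (diag l \<otimes>\<^bsub>adeles\<^esub> (diag k \<otimes>\<^bsub>adeles\<^esub> y))"
          unfolding scale_lattice_of(1)[OF k(1) E(2)] scale_lattice_of(1)[OF l scale_lattice_of(2)[OF k(1) E(2)]] ..
        also have "diag l \<otimes>\<^bsub>adeles\<^esub> (diag k \<otimes>\<^bsub>adeles\<^esub> y) = diag (l * k) \<otimes>\<^bsub>adeles\<^esub> y"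
          using diag_carrier E(2) by (simp add: diag_ops(2) Ad.m_assoc lattice_data_def adele_box_def)
        also have "lattice_of (\<lambda>v. E v + v k + v l) (diag (l * k) \<otimes>\<^bsub>adeles\<^esub> y) = scale (l * k) (lattice_of E y)"
          unfolding scale_lattice_of(1)[OF no_zero_divisors[OF l k(1)] E(2)]
        proof (rule lattice_of_cong)
          fix v assume "v \<in> fin_places"
          then show "E v + v k + v l = E v + v (l * k)" using place_mult[OF fin_placesD l k(1), of v] by simp
        qed
        finally show ?thesis .
      qed
      show ?thesis unfolding E(1) sc[symmetric] pair_class_def
      proof (intro equalityI subsetI)
        fix p assume "p \<in> {(scale l (scale k (lattice_of E y)), scale l (scale k (lattice_of E y))) | l. l \<noteq> 0}"
        then obtain l where "l \<noteq> 0" "p = (scale (l * k) (lattice_of E y), scale (l * k) (lattice_of E y))" using ss by auto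
        then show "p \<in> {(scale l (lattice_of E y), scale l (lattice_of E y)) | l. l \<noteq> 0}" using k(1)
          by (intro CollectI exI[of _ "l * k"]) simp
      next
        fix p assume "p \<in> {(scale l (lattice_of E y), scale l (lattice_of E y)) | l. l \<noteq> 0}"
        then obtain l where l: "l \<noteq> 0" "p = (scale l (lattice_of E y), scale l (lattice_of E y))" by blast
        then show "p \<in> {(scale l (scale k (lattice_of E y)), scale l (scale k (lattice_of E y))) | l. l \<noteq> 0}"
          using k(1) ss[of "l / k"] by (intro CollectI exI[of _ "l / k"]) simp
      qed
    qed
    finally show "P \<in> param_class ` ?K" using \<rho>(1) by (intro image_eqI[of _ _ "(s, \<rho>, \<one>\<^bsub>adeles\<^esub>)"]) auto
  qed
  ultimately show ?thesis using closed_compactin diagonal_classes_clopen(2) by blast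
qed

end

section \<open>Sums in non-archimedean fields\<close>

context drinfeld_setting
begin

lemma absC_nonneg [simp]: "0 \<le> absC (z::'c)"
  by (simp add: absC_def)

lemma absC_eq_0_iff [simp]: "absC (z::'c) = 0 \<longleftrightarrow> z = 0"
  by (simp add: absC_def)

lemma absC_zero [simp]: "absC (0::'c) = 0"
  by (simp add: absC_def)

lemma absC_one [simp]: "absC (1::'c) = 1"
proof -
  have "absC (1::'c) * absC (1::'c) = absC (1::'c)" using absC_mult[of "1::'c" 1] by simp
  moreover have "absC (1::'c) \<noteq> 0" by simp
  ultimately show ?thesis by (simp del: absC_eq_0_iff)
qed

lemma absC_minus: "absC (- (z::'c)) = absC z"
  using dist_absC[of 0 z] by (simp add: absC_def dist_commute)

lemma absC_diff: "absC ((z::'c) - w) \<le> max (absC z) (absC w)"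
  using absC_add[of z "- w"] absC_minus[of w] by simp

lemma absC_inverse: "absC (inverse (z::'c)) = inverse (absC z)"
proof (cases "z = 0")
  case False
  then have "absC z * absC (inverse z) = 1" using absC_mult[of z "inverse z"] by simp
  then show ?thesis by (simp add: inverse_unique)
qed simp

lemma absC_power: "absC ((z::'c) ^ n) = absC z ^ n"
  by (induction n) (auto simp: absC_mult)

lemma absC_sum:
  assumes "0 \<le> c" "\<And>j. j \<in> J \<Longrightarrow> absC (f j :: 'c) \<le> c"
  shows "absC (sum f J) \<le> c"
  using assms(2)
proof (induction J rule: infinite_finite_induct)
  case (insert j J)
  then have "absC (f j) \<le> c" "absC (sum f J) \<le> c" by auto
  then show ?case using insert.hyps absC_add[of "f j" "sum f J"] by simp
qed (use assms(1) in auto)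

text \<open>In a complete ultrametric field a family that tends to 0 is summable: outside the finite
  set \<open>S n\<close> no finite partial sum exceeds \<open>d n\<close>.\<close>

lemma summable_nonarch:
  fixes f :: "'b \<Rightarrow> 'c"
  assumes "\<And>e. e > 0 \<Longrightarrow> finite {j \<in> J. e \<le> absC (f j)}"
  shows "f summable_on J"
proof -
  define d where "d n = inverse (real (Suc n))" for n
  define S where "S n = {j \<in> J. d n \<le> absC (f j)}" for n
  have d: "d n > 0" for n by (simp add: d_def)
  have S: "finite (S n)" for n unfolding S_def by (rule assms[OF d])
  have close: "absC (sum f F - sum f (S n)) \<le> d n" if F: "finite F" "S n \<subseteq> F" "F \<subseteq> J" for F n
  proof -
    have "sum f F - sum f (S n) = sum f (F - S n)" using F sum_diff[of F "S n" f] by simp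
    moreover have "absC (sum f (F - S n)) \<le> d n"
      using F(3) d[of n] by (intro absC_sum) (auto simp: S_def)
    ultimately show ?thesis by simp
  qed
  have dm: "d m \<le> d n" if "n \<le> m" for n m using that by (simp add: d_def)
  have Sm: "S n \<subseteq> S m" if "n \<le> m" for n m using dm[OF that] by (auto simp: S_def)
  have d0: "\<exists>n. d n < e" if "e > 0" for e using reals_Archimedean[OF that] by (simp add: d_def)
  have "Cauchy (\<lambda>n. sum f (S n))"
  proof (rule metric_CauchyI)
    fix e :: real assume "e > 0"
    then obtain N where N: "d N < e" using d0 by blast
    have "dist (sum f (S m)) (sum f (S n)) < e" if "m \<ge> N" "n \<ge> N" for m n
    proof -
      have 1: "absC (sum f (S m) - sum f (S N)) \<le> d N" "absC (sum f (S n) - sum f (S N)) \<le> d N"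
        using close[OF S Sm] that by (auto simp: S_def)
      have "absC ((sum f (S m) - sum f (S N)) - (sum f (S n) - sum f (S N))) \<le> d N"
        using absC_diff[of "sum f (S m) - sum f (S N)" "sum f (S n) - sum f (S N)"] 1 by linarith
      then show ?thesis using N dist_absC by simp
    qed
    then show "\<exists>M. \<forall>m\<ge>M. \<forall>n\<ge>M. dist (sum f (S m)) (sum f (S n)) < e" by blast
  qed
  then obtain l where l: "(\<lambda>n. sum f (S n)) \<longlonglongrightarrow> l" using Cauchy_convergent_iff convergent_def by blast
  have "(f has_sum l) J" unfolding has_sum_def tendsto_iff
  proof (intro allI impI)
    fix e :: real assume e: "e > 0"
    obtain N where N: "d N < e / 2" using d0[of "e / 2"] e by auto
    obtain M where M: "\<And>n. n \<ge> M \<Longrightarrow> dist (sum f (S n)) l < e / 2"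
      using l e by (metis half_gt_zero lim_sequentially)
    define n where "n = max N M"
    have n: "d n < e / 2" "dist (sum f (S n)) l < e / 2" using N M[of n] dm[of N n] by (auto simp: n_def)
    show "\<forall>\<^sub>F F in finite_subsets_at_top J. dist (sum f F) l < e" unfolding eventually_finite_subsets_at_top
    proof (intro exI[of _ "S n"] conjI allI impI)
      show "finite (S n)" "S n \<subseteq> J" using S by (auto simp: S_def)
      fix F assume F: "finite F \<and> S n \<subseteq> F \<and> F \<subseteq> J"
      have "dist (sum f F) (sum f (S n)) < e / 2" using close[of F n] F n dist_absC by force
      then show "dist (sum f F) l < e" using n(2) dist_triangle[of "sum f F" l "sum f (S n)"] by linarith
    qed
  qed
  then show ?thesis by (rule has_sum_imp_summable)
qed

text \<open>The ultrametric bound passes from finite sums to the limit; for a family without a sum,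
  \<open>infsum\<close> is 0 and the bound holds as well.\<close>

lemma absC_infsum:
  fixes f :: "'b \<Rightarrow> 'c"
  assumes "0 \<le> c" "\<And>j. j \<in> J \<Longrightarrow> absC (f j) \<le> c"
  shows "absC (infsum f J) \<le> c"
proof (cases "f summable_on J")
  case True
  then have "(sum f \<longlongrightarrow> infsum f J) (finite_subsets_at_top J)" using infsum_tendsto by blast
  then have "((\<lambda>F. dist (sum f F) 0) \<longlongrightarrow> dist (infsum f J) 0) (finite_subsets_at_top J)"
    by (intro tendsto_dist tendsto_const)
  moreover have "\<forall>\<^sub>F F in finite_subsets_at_top J. dist (sum f F) 0 \<le> c"
  proof (rule eventually_finite_subsets_at_top_weakI)
    fix F assume "finite F" "F \<subseteq> J"
    then have "absC (sum f F) \<le> c" using assms by (intro absC_sum) auto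
    then show "dist (sum f F) 0 \<le> c" by (simp add: absC_def)
  qed
  ultimately have "dist (infsum f J) 0 \<le> c" using tendsto_upperbound finite_subsets_at_top_neq_bot by blast
  then show ?thesis by (simp add: absC_def)
next
  case False
  then show ?thesis using assms(1) by (simp add: infsum_not_exists)
qed

lemma infsum_single:
  fixes f :: "'b \<Rightarrow> 'c"
  assumes "a \<in> J" "\<And>j. j \<in> J \<Longrightarrow> j \<noteq> a \<Longrightarrow> f j = 0"
  shows "infsum f J = f a"
proof -
  have "infsum f J = infsum f {a}" by (rule infsum_cong_neutral) (use assms in auto)
  then show ?thesis by simp
qed

text \<open>For the zero sequence as exponent, \<open>0 choose j\<close> leaves only the term
  \<open>j = 0\<close>, so the one-unit factor is 1.\<close>

lemma ideal_pow_exponent: "ideal_pow I (exponent x) = x powi deg I"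
proof -
  have "one_unit_pow w (\<lambda>_. 0) = 1" for w :: 'c
  proof -
    have "(\<Sum>j. of_nat (0 choose j) * (w - 1) ^ j) = (\<Sum>j\<in>{0}. of_nat (0 choose j) * (w - 1) ^ j)"
      by (rule suminf_finite) (auto simp: binomial_eq_0)
    then show ?thesis by (simp add: one_unit_pow_def)
  qed
  then show ?thesis by (simp add: ideal_pow_def exponent_def)
qed

section \<open>The algebra\<close>

lemma on_classes_pair_class:
  assumes "\<And>k. k \<noteq> 0 \<Longrightarrow> f (scale k M) (scale k M') = f M M'"
  shows "on_classes f (pair_class M M') = f M M'"
proof -
  have "(scale 1 M, scale 1 M') \<in> pair_class M M'" unfolding pair_class_def by (intro CollectI exI[of _ 1]) simp
  then have "(SOME p. p \<in> pair_class M M') \<in> pair_class M M'" by (rule someI)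
  then obtain k where "k \<noteq> 0" "(SOME p. p \<in> pair_class M M') = (scale k M, scale k M')"
    unfolding pair_class_def by blast
  then show ?thesis using assms by (simp add: on_classes_def)
qed

lemma algD:
  assumes "f \<in> alg"
  shows "\<not> commensurable M M' \<Longrightarrow> f M M' = 0"
    "commensurable M M' \<Longrightarrow> k \<noteq> 0 \<Longrightarrow> f (scale k M) (scale k M') = f M M'"
    "continuous_map pair_space euclidean (on_classes f)"
    "compactin pair_space (pair_space closure_of {P \<in> topspace pair_space. on_classes f P \<noteq> 0})"
  using assms unfolding alg_def by blast+

lemma alg_support:
  assumes f: "f \<in> alg" and nz: "f M M' \<noteq> 0"
  shows "commensurable M M'" "on_classes f (pair_class M M') = f M M'"
    "pair_class M M' \<in> pair_space closure_of {P \<in> topspace pair_space. on_classes f P \<noteq> 0}"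
proof -
  show c: "commensurable M M'" using algD(1)[OF f] nz by blast
  show o: "on_classes f (pair_class M M') = f M M'" by (rule on_classes_pair_class) (rule algD(2)[OF f c])
  obtain D D' y where d: "lattice_data D y" "lattice_data D' y" "M = lattice_of D y" "M' = lattice_of D' y"
    using c commensurable_iff by blast
  have "pair_class M M' \<in> topspace pair_space" unfolding d(3,4) by (rule data_param_class[OF d(1,2)])
  then have "pair_class M M' \<in> {P \<in> topspace pair_space. on_classes f P \<noteq> 0}" using o nz by simp
  then show "pair_class M M' \<in> pair_space closure_of {P \<in> topspace pair_space. on_classes f P \<noteq> 0}"
    using closure_of_subset[of "{P \<in> topspace pair_space. on_classes f P \<noteq> 0}" pair_space] by blast
qed

text \<open>The continuous image of the compact support is bounded, and the function is 0 off the
  support.\<close>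

lemma alg_bounded:
  assumes f: "f \<in> alg"
  shows "\<exists>c\<ge>0. \<forall>M M'. absC (f M M') \<le> c"
proof -
  let ?K = "pair_space closure_of {P \<in> topspace pair_space. on_classes f P \<noteq> 0}"
  have "compactin euclidean (on_classes f ` ?K)" by (rule image_compactin[OF algD(4,3)[OF f]])
  then have "compact (on_classes f ` ?K)" by simp
  then have "bounded (on_classes f ` ?K)" by (rule compact_imp_bounded)
  then obtain b where b: "\<And>z. z \<in> on_classes f ` ?K \<Longrightarrow> dist 0 z \<le> b" unfolding bounded_any_center[of _ 0] by blast
  have "absC (f M M') \<le> max b 0" for M M'
  proof (cases "f M M' = 0")
    case False
    have "on_classes f (pair_class M M') \<in> on_classes f ` ?K" by (rule imageI[OF alg_support(3)[OF f False]])
    then have "f M M' \<in> on_classes f ` ?K" unfolding alg_support(2)[OF f False] .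
    then have "dist 0 (f M M') \<le> b" by (rule b)
    then show ?thesis by (simp add: absC_def dist_commute)
  qed simp
  then show ?thesis by (intro exI[of _ "max b 0"]) simp
qed

text \<open>A test element: it realizes the norm of the functional, and it isolates a diagonal entry
  in a convolution.\<close>

definition diagonal_indicator :: "('k place \<Rightarrow> int) \<Rightarrow> 'k rlattice \<Rightarrow> 'k rlattice \<Rightarrow> 'c" where
  "diagonal_indicator D M M' =
    (if \<exists>E y. lattice_data E y \<and> equivalent_divisor E D \<and> M = lattice_of E y \<and> M' = M then 1 else 0)"

text \<open>On classes it induces the indicator of \<open>diagonal_classes D\<close>, which is
  continuous because that set is open and closed, and has this compact set as its support.\<close>

lemma diagonal_indicator_alg:
  assumes D: "fin_supp D"
  shows "diagonal_indicator D \<in> alg"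
proof -
  let ?f = "diagonal_indicator D"
  have zero: "?f M M' = 0" if "\<not> commensurable M M'" for M M'
    using that unfolding diagonal_indicator_def commensurable_iff by auto
  have inv: "?f (scale k M) (scale k M') = ?f M M'" if c: "commensurable M M'" and k: "k \<noteq> 0" for M M' k
  proof -
    obtain F F' z where d: "lattice_data F z" "lattice_data F' z" "M = lattice_of F z" "M' = lattice_of F' z"
      using c commensurable_iff by blast
    note s = scale_lattice_of[OF k d(1)] scale_lattice_of[OF k d(2)]
    have "(\<exists>E y. lattice_data E y \<and> equivalent_divisor E D \<and> scale k M = lattice_of E y \<and> scale k M' = scale k M)
      \<longleftrightarrow> (\<exists>E y. lattice_data E y \<and> equivalent_divisor E D \<and> M = lattice_of E y \<and> M' = M)"
    proof
      assume "\<exists>E y. lattice_data E y \<and> equivalent_divisor E D \<and> scale k M = lattice_of E y \<and> scale k M' = scale k M"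
      then obtain E y where E: "lattice_data E y" "equivalent_divisor E D" "scale k M = lattice_of E y" "scale k M' = scale k M" by blast
      have e1: "lattice_of (\<lambda>v. F v + v k) (diag k \<otimes>\<^bsub>adeles\<^esub> z) = lattice_of E y" using E(3) s(1) d(3) by simp
      have e2: "lattice_of (\<lambda>v. F' v + v k) (diag k \<otimes>\<^bsub>adeles\<^esub> z) = lattice_of (\<lambda>v. F v + v k) (diag k \<otimes>\<^bsub>adeles\<^esub> z)"
        using E(4) s(1,3) d(3,4) by simp
      have "M' = M" unfolding d(3,4)
      proof (rule lattice_of_cong)
        fix v assume "v \<in> fin_places"
        from lattice_of_inj(2)[OF s(4,2) e2 this] show "F' v = F v" by simp
      qed
      moreover have "equivalent_divisor F D"
      proof (rule equivalent_divisor_trans[OF equivalent_divisor_sym E(2)])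
        have "E v = F v + v k" if "v \<in> fin_places" for v using lattice_of_inj(2)[OF s(2) E(1) e1 that] by simp
        then show "equivalent_divisor E F" unfolding equivalent_divisor_def using k by blast
      qed
      ultimately show "\<exists>E y. lattice_data E y \<and> equivalent_divisor E D \<and> M = lattice_of E y \<and> M' = M" using d by blast
    next
      assume "\<exists>E y. lattice_data E y \<and> equivalent_divisor E D \<and> M = lattice_of E y \<and> M' = M"
      then obtain E y where E: "lattice_data E y" "equivalent_divisor E D" "M = lattice_of E y" "M' = M" by blast
      have "equivalent_divisor (\<lambda>v. E v + v k) E" unfolding equivalent_divisor_def using k by blast
      then have "equivalent_divisor (\<lambda>v. E v + v k) D" using E(2) by (rule equivalent_divisor_trans)
      then show "\<exists>E y. lattice_data E y \<and> equivalent_divisor E D \<and> scale k M = lattice_of E y \<and> scale k M' = scale k M"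
        using scale_lattice_of[OF k E(1)] E(3,4) by blast
    qed
    then show ?thesis unfolding diagonal_indicator_def by simp
  qed
  have oc: "on_classes ?f P = (if P \<in> diagonal_classes D then 1 else 0)" if P: "P \<in> topspace pair_space" for P
  proof -
    obtain s \<rho> u where "(s, \<rho>, u) \<in> topspace param_top" "P = param_class (s, \<rho>, u)"
      using P topspace_pair_space by auto
    then obtain F F' z where d: "P = pair_class (lattice_of F z) (lattice_of F' z)" "lattice_data F z" "lattice_data F' z"
      using param_class_data by blast
    have c: "commensurable (lattice_of F z) (lattice_of F' z)" unfolding commensurable_iff using d by blast
    have o: "on_classes ?f P = ?f (lattice_of F z) (lattice_of F' z)"
      unfolding d(1) by (rule on_classes_pair_class) (rule inv[OF c])
    have "P \<in> diagonal_classes D \<longleftrightarrow> (\<exists>E y. lattice_data E y \<and> equivalent_divisor E D \<and>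
      lattice_of F z = lattice_of E y \<and> lattice_of F' z = lattice_of F z)"
    proof
      assume "P \<in> diagonal_classes D"
      then obtain E y where E: "P = pair_class (lattice_of E y) (lattice_of E y)" "lattice_data E y" "equivalent_divisor E D"
        unfolding diagonal_classes_def by blast
      have m: "(lattice_of F z, lattice_of F' z) \<in> pair_class (lattice_of E y) (lattice_of E y)"
        using pair_class_mem[OF d(2,3)] d(1) E(1) by simp
      then have "lattice_of F' z = lattice_of F z" by (auto simp: pair_class_def)
      moreover have "equivalent_divisor F E" using pair_class_memD[OF E(2,2) d(2,3) m] unfolding equivalent_divisor_def by blast
      then have "equivalent_divisor F D" using E(3) by (rule equivalent_divisor_trans)
      ultimately show "\<exists>E y. lattice_data E y \<and> equivalent_divisor E D \<and>
        lattice_of F z = lattice_of E y \<and> lattice_of F' z = lattice_of F z" using d(2) by blast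
    next
      assume "\<exists>E y. lattice_data E y \<and> equivalent_divisor E D \<and>
        lattice_of F z = lattice_of E y \<and> lattice_of F' z = lattice_of F z"
      then obtain E y where "lattice_data E y" "equivalent_divisor E D" "lattice_of F z = lattice_of E y" "lattice_of F' z = lattice_of F z" by blast
      then show "P \<in> diagonal_classes D" unfolding diagonal_classes_def d(1) by auto
    qed
    then show ?thesis unfolding o diagonal_indicator_def by simp
  qed
  have cont: "continuous_map pair_space euclidean (on_classes ?f)"
    unfolding continuous_map_def
  proof (intro conjI allI impI)
    fix U :: "'c set"
    have "{P \<in> topspace pair_space. on_classes ?f P \<in> U}
      = (if 1 \<in> U then diagonal_classes D else {}) \<union> (if 0 \<in> U then topspace pair_space - diagonal_classes D else {})"
    proof (rule Set.set_eqI)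
      fix P
      show "P \<in> {P \<in> topspace pair_space. on_classes ?f P \<in> U} \<longleftrightarrow> P \<in> (if 1 \<in> U then diagonal_classes D else {})
        \<union> (if 0 \<in> U then topspace pair_space - diagonal_classes D else {})"
      proof (cases "P \<in> topspace pair_space")
        case True
        then show ?thesis using oc[OF True] by simp
      next
        case False
        then have "P \<notin> diagonal_classes D" using diagonal_classes_subset by (rule contra_subsetD[rotated])
        then show ?thesis using False by simp
      qed
    qed
    moreover have "openin pair_space (topspace pair_space - diagonal_classes D)"
      using diagonal_classes_clopen(2) by (simp add: closedin_def)
    ultimately show "openin pair_space {P \<in> topspace pair_space. on_classes ?f P \<in> U}"
      using diagonal_classes_clopen(1) by (auto intro!: openin_Un)
  qed simp
  have "{P \<in> topspace pair_space. on_classes ?f P \<noteq> 0} = diagonal_classes D"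
  proof (rule Set.set_eqI)
    fix P
    show "P \<in> {P \<in> topspace pair_space. on_classes ?f P \<noteq> 0} \<longleftrightarrow> P \<in> diagonal_classes D"
    proof (cases "P \<in> topspace pair_space")
      case True
      then show ?thesis using oc[OF True] by simp
    next
      case False
      then have "P \<notin> diagonal_classes D" using diagonal_classes_subset by (rule contra_subsetD[rotated])
      then show ?thesis using False by simp
    qed
  qed
  then have "pair_space closure_of {P \<in> topspace pair_space. on_classes ?f P \<noteq> 0} = diagonal_classes D"
    using diagonal_classes_clopen(2) by (simp add: closure_of_closedin)
  then show ?thesis unfolding alg_def using zero inv cont diagonal_classes_compact[OF D] by auto
qed

end

section \<open>The KMS functional\<close>

text \<open>An invertible lattice in the coordinates \<open>(D, y)\<close>; the assumption
  \<open>ord\<close> is the form in which invertibility is used.\<close>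

locale invertible_kms = drinfeld_setting Fq vinf \<iota> uinf
  for Fq :: "'k::field set" and vinf :: "'k place"
    and \<iota> :: "'k \<Rightarrow> 'c::{field, complete_space, topological_ab_group_add,
      uniform_topological_group_add, topological_semigroup_mult}" and uinf :: 'c +
  fixes x :: 'c and L :: "'k rlattice" and D :: "'k place \<Rightarrow> int" and y :: "'k adele"
  assumes x_gt: "absC x > 1" and data: "lattice_data D y" and L: "L = lattice_of D y"
    and ord: "\<And>v. v \<in> fin_places \<Longrightarrow> has_ord v (y v) (D v)"
begin

abbreviation lat :: "'k set \<Rightarrow> 'k rlattice" where
  "lat J \<equiv> ideal_inv_act J L"

definition weight :: "'k set \<Rightarrow> 'c" where
  "weight J = inverse (x powi deg J)"

lemma x_nonzero: "x \<noteq> 0"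
  using x_gt by auto

lemma weight_eq: "inverse (ideal_pow J (exponent x)) = weight J"
  by (simp add: weight_def ideal_pow_exponent)

lemma absC_weight: "J \<in> nonzero_ideals \<Longrightarrow> absC (weight J) = inverse (absC x ^ nat (deg J))"
  using deg_nonneg[of J] by (simp add: weight_def absC_inverse absC_power power_int_def)

lemma absC_weight_le: "J \<in> nonzero_ideals \<Longrightarrow> absC (weight J) \<le> 1"
  using x_gt by (simp add: absC_weight inverse_le_1_iff)

lemma absC_weight_less:
  assumes "J \<in> nonzero_ideals" "J \<noteq> A"
  shows "absC (weight J) \<le> inverse (absC x)"
proof -
  have "absC x ^ 1 \<le> absC x ^ nat (deg J)"
    using x_gt deg_pos[OF assms] by (intro power_increasing) auto
  then show ?thesis unfolding absC_weight[OF assms(1)] using x_gt by (intro le_imp_inverse_le) auto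
qed

lemma weight_A: "weight A = 1"
  by (simp add: weight_def A_ideal)

lemma finite_large_weight:
  assumes "e > 0"
  shows "finite {J \<in> nonzero_ideals. e \<le> absC (weight J)}"
proof -
  obtain n where n: "inverse e < absC x ^ n" using real_arch_pow[OF x_gt] by blast
  have "{J \<in> nonzero_ideals. e \<le> absC (weight J)} \<subseteq> {J \<in> nonzero_ideals. deg J \<le> int n}"
  proof
    fix J assume J: "J \<in> {J \<in> nonzero_ideals. e \<le> absC (weight J)}"
    have "deg J \<le> int n"
    proof (rule ccontr)
      assume "\<not> deg J \<le> int n"
      then have "absC x ^ n \<le> absC x ^ nat (deg J)" using x_gt by (intro power_increasing) auto
      then have "inverse (absC x ^ nat (deg J)) \<le> inverse (absC x ^ n)" using x_gt by (intro le_imp_inverse_le) auto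
      also have "\<dots> < e" using n assms x_gt by (simp add: inverse_less_iff_less[of "absC x ^ n" "inverse e", simplified] field_simps)
      finally show False using J absC_weight[of J] by simp
    qed
    then show "J \<in> {J \<in> nonzero_ideals. deg J \<le> int n}" using J by blast
  qed
  then show ?thesis using finite_small_ideals finite_subset by blast
qed

lemma finite_bounded_weight:
  assumes "\<And>J. J \<in> nonzero_ideals \<Longrightarrow> absC (f J) \<le> c" "e > 0"
  shows "finite {J \<in> nonzero_ideals. e \<le> absC (f J * weight J)}"
proof -
  \<comment> \<open>A positive bound, by which the threshold \<open>e\<close> can be
    divided.\<close>
  define c' where "c' = max c 1"
  have c': "c' > 0" by (simp add: c'_def)
  have "{J \<in> nonzero_ideals. e \<le> absC (f J * weight J)} \<subseteq> {J \<in> nonzero_ideals. e / c' \<le> absC (weight J)}"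
  proof
    fix J assume J: "J \<in> {J \<in> nonzero_ideals. e \<le> absC (f J * weight J)}"
    have "absC (f J) \<le> c'" using assms(1)[of J] J by (simp add: c'_def)
    then have "e \<le> c' * absC (weight J)" using J absC_mult[of "f J" "weight J"] mult_right_mono[of "absC (f J)" c' "absC (weight J)"] by simp
    then show "J \<in> {J \<in> nonzero_ideals. e / c' \<le> absC (weight J)}" using J c' by (simp add: divide_le_eq mult.commute)
  qed
  then show ?thesis using finite_large_weight[of "e / c'"] assms(2) c' finite_subset by simp
qed

lemma weighted_summable:
  assumes "\<And>J. J \<in> nonzero_ideals \<Longrightarrow> absC (f J) \<le> c"
  shows "(\<lambda>J. f J * weight J) summable_on nonzero_ideals"
  by (rule summable_nonarch) (rule finite_bounded_weight[OF assms])

lemma weight_summable: "weight summable_on nonzero_ideals"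
  using weighted_summable[of "\<lambda>_. 1" 1] by simp

text \<open>The term of \<open>J = A\<close> dominates all others.\<close>
lemma absC_dominant_sum:
  assumes f: "\<And>J. J \<in> nonzero_ideals \<Longrightarrow> absC (f J) \<le> 1" and A: "f A = 1"
  shows "absC (\<Sum>\<^sub>\<infinity>J\<in>nonzero_ideals. f J * weight J) = 1"
proof -
  let ?g = "\<lambda>J. f J * weight J"
  have sm: "?g summable_on nonzero_ideals" by (rule weighted_summable[OF f])
  have "nonzero_ideals = {A} \<union> (nonzero_ideals - {A})" using A_ideal(1) by blast
  then have "infsum ?g nonzero_ideals = infsum ?g ({A} \<union> (nonzero_ideals - {A}))" by simp
  also have "\<dots> = infsum ?g {A} + infsum ?g (nonzero_ideals - {A})"
    by (rule infsum_Un_disjoint) (auto intro: summable_nonarch finite_subset[OF _ finite_bounded_weight[OF f]])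
  finally have e: "infsum ?g nonzero_ideals = 1 + infsum ?g (nonzero_ideals - {A})" using A weight_A by simp
  have r: "absC (infsum ?g (nonzero_ideals - {A})) \<le> inverse (absC x)"
  proof (rule absC_infsum)
    show "0 \<le> inverse (absC x)" by simp
    fix J assume J: "J \<in> nonzero_ideals - {A}"
    have "absC (f J) * absC (weight J) \<le> 1 * inverse (absC x)"
      using f[of J] absC_weight_less[of J] J by (intro mult_mono) auto
    then show "absC (f J * weight J) \<le> inverse (absC x)" by (simp add: absC_mult)
  qed
  have lt: "inverse (absC x) < 1" using x_gt by (simp add: inverse_less_1_iff)
  let ?r = "infsum ?g (nonzero_ideals - {A})"
  have "absC (1 + ?r) \<le> 1" using absC_add[of 1 ?r] r lt by simp
  \<comment> \<open>Otherwise 1 would be a difference of two elements of absolute value below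
    1.\<close>
  moreover have "1 \<le> absC (1 + ?r)"
  proof (rule ccontr)
    assume "\<not> ?thesis"
    then have "absC ((1 + ?r) - ?r) < 1" using absC_diff[of "1 + ?r" ?r] r lt by simp
    then show False by simp
  qed
  ultimately show ?thesis using e by simp
qed

lemma absC_zeta: "absC (zeta x) = 1"
  using absC_dominant_sum[of "\<lambda>_. 1"] by (simp add: zeta_def weight_eq)

lemma zeta_nonzero: "zeta x \<noteq> 0"
  using absC_zeta by auto

lemma lat_eq:
  assumes "effective E"
  shows "lat (ideal_of E) = lattice_of (\<lambda>v. D v - E v) y" "lattice_data (\<lambda>v. D v - E v) y"
  unfolding L using ideal_inv_act_eq[OF data assms] by blast+

lemma comm_class_L: "comm_class L = lat ` nonzero_ideals"
proof -
  have "comm_class L = {lattice_of (\<lambda>v. D v - E v) y | E. effective E}"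
    unfolding L by (rule comm_class_eq[OF data ord])
  then show ?thesis unfolding nonzero_ideals_eq using lat_eq(1) by force
qed

lemma lat_inj: "inj_on lat nonzero_ideals"
proof (rule inj_onI)
  fix J J' assume J: "J \<in> nonzero_ideals" "J' \<in> nonzero_ideals" "lat J = lat J'"
  obtain E E' where E: "J = ideal_of E" "effective E" "J' = ideal_of E'" "effective E'"
    using J unfolding nonzero_ideals_eq by auto
  have e: "lattice_of (\<lambda>v. D v - E v) y = lattice_of (\<lambda>v. D v - E' v) y" using J(3) E lat_eq(1) by simp
  have "E v = E' v" if "v \<in> fin_places" for v
    using lattice_of_inj(2)[OF lat_eq(2)[OF E(2)] lat_eq(2)[OF E(4)] e that] by simp
  then show "J = J'" unfolding E by (rule box_cong)
qed

text \<open>The class consists of all lattices with the adele \<open>y\<close>, whichever member it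
  is formed from.\<close>

lemma comm_class_lat:
  assumes "J \<in> nonzero_ideals"
  shows "comm_class (lat J) = comm_class L"
proof -
  have *: "comm_class (lattice_of E y) = {lattice_of F y | F. lattice_data F y}" if E: "lattice_data E y" for E
  proof (intro equalityI subsetI)
    fix M assume "M \<in> comm_class (lattice_of E y)"
    then obtain F E' z where F: "lattice_data F z" "lattice_data E' z" "M = lattice_of F z" "lattice_of E y = lattice_of E' z"
      unfolding comm_class_def commensurable_iff by blast
    then have "y = z" using lattice_of_inj(1)[OF E F(2,4)] by blast
    then show "M \<in> {lattice_of F y | F. lattice_data F y}" using F by blast
  next
    fix M assume "M \<in> {lattice_of F y | F. lattice_data F y}"
    then show "M \<in> comm_class (lattice_of E y)" unfolding comm_class_def commensurable_iff using E by blast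
  qed
  obtain E where E: "J = ideal_of E" "effective E" using assms unfolding nonzero_ideals_eq by auto
  show ?thesis unfolding E(1) lat_eq(1)[OF E(2)] *[OF lat_eq(2)[OF E(2)]] unfolding L *[OF data] ..
qed

text \<open>Rewrites the sums over lattices in a convolution as sums over ideals, the index set of
  the functional.\<close>

lemma infsum_comm_class:
  assumes "J \<in> nonzero_ideals"
  shows "(\<Sum>\<^sub>\<infinity>M\<in>comm_class (lat J). h M) = (\<Sum>\<^sub>\<infinity>J'\<in>nonzero_ideals. h (lat J') :: 'c)"
  unfolding comm_class_lat[OF assms] comm_class_L using infsum_reindex[OF lat_inj, of h] by (simp add: o_def)

text \<open>The constant \<open>degree_of D\<close> cancels in a quotient of ideal powers, so the
  time evolution acts by a ratio of weights.\<close>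

lemma deg_lat:
  assumes "J \<in> nonzero_ideals"
  shows "deg (fst (lat J)) = degree_of D - deg J"
proof -
  obtain E where E: "J = ideal_of E" "effective E" using assms unfolding nonzero_ideals_eq by auto
  note Ef = effective_fin_supp[OF E(2)]
  have Df: "fin_supp (\<lambda>v. D v - E v)" "fin_supp D"
    using lat_eq(2)[OF E(2)] data by (auto simp: lattice_data_def)
  have "degree_of D = degree_of (\<lambda>v. (D v - E v) + E v)" by simp
  also have "\<dots> = degree_of (\<lambda>v. D v - E v) + degree_of E" by (rule degree_of_add[OF Df(1) Ef])
  finally show ?thesis
    unfolding E(1) lat_eq(1)[OF E(2)] fst_lattice_of deg_ideal_of[OF Df(1)] deg_ideal_of[OF Ef] by simp
qed

text \<open>Where \<open>f\<close> does not vanish, the divisors of the two ideals differ by one of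
  finitely many, so either ideal determines the other up to finitely many choices.\<close>

lemma alg_finite_neighbours:
  assumes f: "f \<in> alg" and J: "J \<in> nonzero_ideals"
  shows "finite {J' \<in> nonzero_ideals. f (lat J) (lat J') \<noteq> 0}" "finite {J' \<in> nonzero_ideals. f (lat J') (lat J) \<noteq> 0}"
proof -
  obtain E where E: "J = ideal_of E" "effective E" using J unfolding nonzero_ideals_eq by auto
  obtain \<E> where \<E>: "finite \<E>" "\<And>D D' y. lattice_data D y \<Longrightarrow> lattice_data D' y \<Longrightarrow>
    pair_class (lattice_of D y) (lattice_of D' y) \<in> pair_space closure_of {P \<in> topspace pair_space. on_classes f P \<noteq> 0} \<Longrightarrow>
    \<exists>E\<in>\<E>. \<forall>v\<in>fin_places. D' v = D v - E v"
    using compact_pairs_finite[OF algD(4)[OF f]] by meson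
  have key: "\<exists>F\<in>\<E>. \<forall>v\<in>fin_places. E2 v = E1 v + F v"
    if e: "effective E1" "effective E2" "f (lat (ideal_of E1)) (lat (ideal_of E2)) \<noteq> 0" for E1 E2
  proof -
    have "pair_class (lattice_of (\<lambda>v. D v - E1 v) y) (lattice_of (\<lambda>v. D v - E2 v) y)
      \<in> pair_space closure_of {P \<in> topspace pair_space. on_classes f P \<noteq> 0}"
      using alg_support(3)[OF f e(3)] unfolding lat_eq(1)[OF e(1)] lat_eq(1)[OF e(2)] .
    from \<E>(2)[OF lat_eq(2)[OF e(1)] lat_eq(2)[OF e(2)] this]
    obtain F where "F \<in> \<E>" "\<forall>v\<in>fin_places. D v - E2 v = D v - E1 v - F v" by blast
    then show ?thesis by (intro bexI[of _ F]) (auto simp: algebra_simps)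
  qed
  have "{J' \<in> nonzero_ideals. f (lat J) (lat J') \<noteq> 0} \<subseteq> (\<lambda>F. ideal_of (\<lambda>v. E v + F v)) ` \<E>"
  proof
    fix J' assume J': "J' \<in> {J' \<in> nonzero_ideals. f (lat J) (lat J') \<noteq> 0}"
    then obtain E' where E': "J' = ideal_of E'" "effective E'" unfolding nonzero_ideals_eq by auto
    obtain F where F: "F \<in> \<E>" "\<forall>v\<in>fin_places. E' v = E v + F v" using key[OF E(2) E'(2)] J' E E' by auto
    have "J' = ideal_of (\<lambda>v. E v + F v)" unfolding E'(1) by (rule box_cong) (use F(2) in simp)
    then show "J' \<in> (\<lambda>F. ideal_of (\<lambda>v. E v + F v)) ` \<E>" using F(1) by blast
  qed
  then show "finite {J' \<in> nonzero_ideals. f (lat J) (lat J') \<noteq> 0}" using \<E>(1) finite_surj by blast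
  have "{J' \<in> nonzero_ideals. f (lat J') (lat J) \<noteq> 0} \<subseteq> (\<lambda>F. ideal_of (\<lambda>v. E v - F v)) ` \<E>"
  proof
    fix J' assume J': "J' \<in> {J' \<in> nonzero_ideals. f (lat J') (lat J) \<noteq> 0}"
    then obtain E' where E': "J' = ideal_of E'" "effective E'" unfolding nonzero_ideals_eq by auto
    obtain F where F: "F \<in> \<E>" "\<forall>v\<in>fin_places. E v = E' v + F v" using key[OF E'(2) E(2)] J' E E' by auto
    have "J' = ideal_of (\<lambda>v. E v - F v)" unfolding E'(1) by (rule box_cong) (use F(2) in simp)
    then show "J' \<in> (\<lambda>F. ideal_of (\<lambda>v. E v - F v)) ` \<E>" using F(1) by blast
  qed
  then show "finite {J' \<in> nonzero_ideals. f (lat J') (lat J) \<noteq> 0}" using \<E>(1) finite_surj by blast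
qed

lemma phi_eq: "phi_functional x L f = inverse (zeta x) * (\<Sum>\<^sub>\<infinity>J\<in>nonzero_ideals. f (lat J) (lat J) * weight J)"
  by (simp add: phi_functional_def weight_eq)

lemma phi_add:
  assumes "\<And>M M'. absC (f M M') \<le> c" "\<And>M M'. absC (g M M') \<le> c'"
  shows "phi_functional x L (\<lambda>M M'. f M M' + g M M') = phi_functional x L f + phi_functional x L g"
    "phi_functional x L (\<lambda>M M'. f M M' - g M M') = phi_functional x L f - phi_functional x L g"
proof -
  have s: "(\<lambda>J. f (lat J) (lat J) * weight J) summable_on nonzero_ideals"
    "(\<lambda>J. g (lat J) (lat J) * weight J) summable_on nonzero_ideals"
    "(\<lambda>J. - g (lat J) (lat J) * weight J) summable_on nonzero_ideals"
    using weighted_summable[of "\<lambda>J. f (lat J) (lat J)" c] weighted_summable[of "\<lambda>J. g (lat J) (lat J)" c']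
      weighted_summable[of "\<lambda>J. - g (lat J) (lat J)" c'] assms by (simp_all only: absC_minus)
  show p: "phi_functional x L (\<lambda>M M'. f M M' + g M M') = phi_functional x L f + phi_functional x L g"
    unfolding phi_eq using infsum_add[OF s(1,2)] by (simp add: algebra_simps)
  have "(\<Sum>\<^sub>\<infinity>J\<in>nonzero_ideals. - g (lat J) (lat J) * weight J) = - (\<Sum>\<^sub>\<infinity>J\<in>nonzero_ideals. g (lat J) (lat J) * weight J)"
    using infsum_uminus[of "\<lambda>J. g (lat J) (lat J) * weight J" nonzero_ideals] by simp
  moreover have "(\<Sum>\<^sub>\<infinity>J\<in>nonzero_ideals. (f (lat J) (lat J) - g (lat J) (lat J)) * weight J)
    = (\<Sum>\<^sub>\<infinity>J\<in>nonzero_ideals. f (lat J) (lat J) * weight J + - g (lat J) (lat J) * weight J)"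
    by (rule infsum_cong) (simp add: left_diff_distrib)
  ultimately show "phi_functional x L (\<lambda>M M'. f M M' - g M M') = phi_functional x L f - phi_functional x L g"
    unfolding phi_eq using infsum_add[OF s(1,3)] by (simp add: right_diff_distrib)
qed

section \<open>Operator norm and norm of the functional\<close>

lemma sup_norm_rep:
  assumes h: "0 \<le> c" "\<And>M M'. absC (h M M') \<le> c" and b: "bdd_above ((\<lambda>M. absC (\<xi> M)) ` comm_class L)"
  shows "absC (rep h L \<xi> M) \<le> c * sup_norm L \<xi>" "sup_norm L (rep h L \<xi>) \<le> c * sup_norm L \<xi>"
proof -
  have ne: "comm_class L \<noteq> {}" using comm_class_L A_ideal(1) by blast
  have le: "absC (\<xi> M) \<le> sup_norm L \<xi>" if "M \<in> comm_class L" for M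
    unfolding sup_norm_def by (rule cSUP_upper[OF that b])
  obtain M0 where M0: "M0 \<in> comm_class L" using ne by blast
  have s0: "0 \<le> sup_norm L \<xi>" by (rule order_trans[OF absC_nonneg le[OF M0]])
  show r: "absC (rep h L \<xi> M) \<le> c * sup_norm L \<xi>" for M unfolding rep_def
  proof (rule absC_infsum)
    show "0 \<le> c * sup_norm L \<xi>" using h(1) s0 by simp
    fix M' assume "M' \<in> comm_class L"
    then show "absC (h M M' * \<xi> M') \<le> c * sup_norm L \<xi>"
      unfolding absC_mult using h le by (intro mult_mono) auto
  qed
  show "sup_norm L (rep h L \<xi>) \<le> c * sup_norm L \<xi>"
    unfolding sup_norm_def[of L "rep h L \<xi>"] by (rule cSUP_least[OF ne r])
qed

text \<open>The upper bound is the ultrametric estimate of \<open>rep\<close>. For the lower bound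
  the operator is applied to the function that is 1 at one lattice and 0 elsewhere, and evaluated at
  that lattice; the upper bound also shows that the supremum is a genuine one.\<close>

lemma op_norm_bounds:
  assumes h: "0 \<le> c" "\<And>M M'. absC (h M M') \<le> c"
  shows "op_norm L h \<le> c" "J \<in> nonzero_ideals \<Longrightarrow> absC (h (lat J) (lat J)) \<le> op_norm L h"
proof -
  let ?X = "{\<xi> :: 'k rlattice \<Rightarrow> 'c. bdd_above ((\<lambda>L'. absC (\<xi> L')) ` comm_class L) \<and> (\<exists>L'\<in>comm_class L. \<xi> L' \<noteq> 0)}"
  let ?ratio = "\<lambda>\<xi>. sup_norm L (rep h L \<xi>) / sup_norm L \<xi>"
  define \<delta> :: "'k rlattice \<Rightarrow> 'k rlattice \<Rightarrow> 'c" where "\<delta> M M' = (if M' = M then 1 else 0)" for M M'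
  have \<delta>b: "bdd_above ((\<lambda>L'. absC (\<delta> M L')) ` comm_class L)" for M
    by (rule bdd_aboveI[of _ 1]) (auto simp: \<delta>_def)
  have \<delta>X: "\<delta> M \<in> ?X" if "M \<in> comm_class L" for M
    using \<delta>b[of M] that by (auto simp: \<delta>_def intro!: bexI[of _ M])
  have le: "?ratio \<xi> \<le> c" if X: "\<xi> \<in> ?X" for \<xi>
  proof -
    obtain M where M: "M \<in> comm_class L" "\<xi> M \<noteq> 0" using X by blast
    have "absC (\<xi> M) \<le> sup_norm L \<xi>" unfolding sup_norm_def using X M(1) by (intro cSUP_upper) auto
    moreover have "absC (\<xi> M) > 0" using M(2) absC_nonneg[of "\<xi> M"] absC_eq_0_iff[of "\<xi> M"] by linarith
    ultimately have "sup_norm L \<xi> > 0" by linarith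
    then show ?thesis using sup_norm_rep(2)[where h = h and c = c and \<xi> = \<xi>] h X by (simp add: divide_le_eq)
  qed
  have AC: "lat J \<in> comm_class L" if "J \<in> nonzero_ideals" for J using comm_class_L that by blast
  have bdd: "bdd_above (?ratio ` ?X)" by (rule bdd_aboveI2[OF le])
  show "op_norm L h \<le> c" unfolding op_norm_def
  proof (rule cSUP_least[OF _ le])
    show "?X \<noteq> {}" using \<delta>X[OF AC[OF A_ideal(1)]] by blast
  qed
  assume J: "J \<in> nonzero_ideals"
  let ?M = "lat J"
  have "rep h L (\<delta> ?M) ?M = h ?M ?M * \<delta> ?M ?M" unfolding rep_def
    by (rule infsum_single[OF AC[OF J]]) (simp add: \<delta>_def)
  then have r: "rep h L (\<delta> ?M) ?M = h ?M ?M" by (simp add: \<delta>_def)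
  have sn: "sup_norm L (\<delta> ?M) = 1" unfolding sup_norm_def
  proof (rule cSup_eq_maximum)
    show "1 \<in> (\<lambda>L'. absC (\<delta> ?M L')) ` comm_class L" using AC[OF J] by (auto simp: \<delta>_def intro!: image_eqI[of _ _ ?M])
  qed (auto simp: \<delta>_def)
  have "absC (h ?M ?M) \<le> sup_norm L (rep h L (\<delta> ?M))" unfolding sup_norm_def r[symmetric]
  proof (rule cSUP_upper[OF AC[OF J]])
    show "bdd_above ((\<lambda>L'. absC (rep h L (\<delta> ?M) L')) ` comm_class L)"
      by (rule bdd_aboveI2) (rule sup_norm_rep(1)[OF h \<delta>b])
  qed
  also have "\<dots> = ?ratio (\<delta> ?M)" by (simp add: sn)
  also have "\<dots> \<le> op_norm L h" unfolding op_norm_def by (rule cSUP_upper[OF \<delta>X[OF AC[OF J]] bdd])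
  finally show "absC (h ?M ?M) \<le> op_norm L h" .
qed

text \<open>Weights have absolute value at most 1 and \<open>zeta x\<close> has absolute value 1, so
  the sum is bounded by any bound for the diagonal coefficients.\<close>

lemma absC_phi_le:
  assumes h: "0 \<le> c" "\<And>M M'. absC (h M M') \<le> c"
  shows "absC (phi_functional x L h) \<le> op_norm L h"
proof -
  note ob = op_norm_bounds[OF h]
  have o0: "0 \<le> op_norm L h" by (rule order_trans[OF absC_nonneg ob(2)[OF A_ideal(1)]])
  have "absC (\<Sum>\<^sub>\<infinity>J\<in>nonzero_ideals. h (lat J) (lat J) * weight J) \<le> op_norm L h"
  proof (rule absC_infsum[OF o0])
    fix J assume J: "J \<in> nonzero_ideals"
    have "absC (h (lat J) (lat J)) * absC (weight J) \<le> op_norm L h * 1"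
      using ob(2)[OF J] absC_weight_le[OF J] o0 by (intro mult_mono) auto
    then show "absC (h (lat J) (lat J) * weight J) \<le> op_norm L h" by (simp add: absC_mult)
  qed
  then show ?thesis unfolding phi_eq absC_mult absC_inverse absC_zeta by simp
qed

text \<open>The double family \<open>F\<close> is summable over pairs, which justifies the
  interchange: a lower bound for its terms leaves finitely many \<open>J'\<close> because of the
  weight, and for each of them finitely many \<open>J\<close> because of the support of
  \<open>f1\<close>.\<close>

lemma kms_condition:
  assumes f1: "f1 \<in> alg" and f2: "f2 \<in> alg"
  shows "phi_functional x L (conv f1 (sigma (exponent x) f2)) = phi_functional x L (conv f2 f1)"
proof -
  obtain c1 c2 where c1: "0 \<le> c1" "\<And>M M'. absC (f1 M M') \<le> c1" and c2: "0 \<le> c2" "\<And>M M'. absC (f2 M M') \<le> c2"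
    using alg_bounded[OF f1] alg_bounded[OF f2] by blast
  define a where "a J J' = f1 (lat J) (lat J') * f2 (lat J') (lat J)" for J J'
  have ab: "absC (a J J') \<le> c1 * c2" for J J' unfolding a_def absC_mult using c1 c2 by (intro mult_mono) auto
  define F where "F J J' = a J J' * weight J'" for J J'
  let ?I = nonzero_ideals
  have fin: "finite {(J, J') \<in> ?I \<times> ?I. e \<le> absC (F J J')}" if e: "e > 0" for e
  proof -
    have ab1: "finite {J' \<in> ?I. e \<le> absC (of_nat 1 * weight J') * max (c1 * c2) 1}"
    proof -
      have "{J' \<in> ?I. e \<le> absC (of_nat 1 * weight J') * max (c1 * c2) 1}
        = {J' \<in> ?I. e / max (c1 * c2) 1 \<le> absC (weight J')}" by (auto simp: divide_le_eq)
      then show ?thesis using finite_large_weight[of "e / max (c1 * c2) 1"] e by simp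
    qed
    let ?S = "{J' \<in> ?I. e \<le> absC (of_nat 1 * weight J') * max (c1 * c2) 1}"
    have "{(J, J') \<in> ?I \<times> ?I. e \<le> absC (F J J')} \<subseteq> (\<Union>J'\<in>?S. {J \<in> ?I. f1 (lat J) (lat J') \<noteq> 0} \<times> {J'})"
    proof
      fix p assume "p \<in> {(J, J') \<in> ?I \<times> ?I. e \<le> absC (F J J')}"
      then obtain J J' where p: "p = (J, J')" "J \<in> ?I" "J' \<in> ?I" "e \<le> absC (F J J')" by blast
      have "absC (a J J') * absC (weight J') \<le> max (c1 * c2) 1 * absC (weight J')"
        using ab[of J J'] by (intro mult_right_mono) auto
      then have "J' \<in> ?S" using p by (simp add: F_def absC_mult mult.commute)
      moreover have "f1 (lat J) (lat J') \<noteq> 0" using p(4) e by (auto simp: F_def a_def)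
      ultimately show "p \<in> (\<Union>J'\<in>?S. {J \<in> ?I. f1 (lat J) (lat J') \<noteq> 0} \<times> {J'})" using p by blast
    qed
    moreover have "finite (\<Union>J'\<in>?S. {J \<in> ?I. f1 (lat J) (lat J') \<noteq> 0} \<times> {J'})"
      using ab1 alg_finite_neighbours(2)[OF f1] by blast
    ultimately show ?thesis by (rule finite_subset)
  qed
  have sum2: "(\<lambda>(J, J'). F J J') summable_on ?I \<times> ?I"
  proof (rule summable_nonarch)
    fix e :: real assume "e > 0"
    have "{p \<in> ?I \<times> ?I. e \<le> absC (case p of (J, J') \<Rightarrow> F J J')} = {(J, J') \<in> ?I \<times> ?I. e \<le> absC (F J J')}" by auto
    then show "finite {p \<in> ?I \<times> ?I. e \<le> absC (case p of (J, J') \<Rightarrow> F J J')}" using fin[OF \<open>e > 0\<close>] by simp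
  qed
  have row: "F J summable_on ?I" if J: "J \<in> ?I" for J
  proof (rule summable_nonarch)
    fix e :: real assume "e > 0"
    have "{J' \<in> ?I. e \<le> absC (F J J')} \<subseteq> snd ` {(J, J') \<in> ?I \<times> ?I. e \<le> absC (F J J')}" using J by force
    then show "finite {J' \<in> ?I. e \<le> absC (F J J')}" using fin[OF \<open>e > 0\<close>] finite_surj by blast
  qed
  have col: "(\<lambda>J. F J J') summable_on ?I" if J: "J' \<in> ?I" for J'
  proof (rule summable_nonarch)
    fix e :: real assume "e > 0"
    have "{J \<in> ?I. e \<le> absC (F J J')} \<subseteq> fst ` {(J, J') \<in> ?I \<times> ?I. e \<le> absC (F J J')}" using J by force
    then show "finite {J \<in> ?I. e \<le> absC (F J J')}" using fin[OF \<open>e > 0\<close>] finite_surj by blast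
  qed
  have swap: "(\<Sum>\<^sub>\<infinity>J\<in>?I. \<Sum>\<^sub>\<infinity>J'\<in>?I. F J J') = (\<Sum>\<^sub>\<infinity>J'\<in>?I. \<Sum>\<^sub>\<infinity>J\<in>?I. F J J')"
    by (rule infsum_swap[OF uniformly_continuous_add sum2 row col])
  have l: "conv f1 (sigma (exponent x) f2) (lat J) (lat J) * weight J = (\<Sum>\<^sub>\<infinity>J'\<in>?I. F J J')" if J: "J \<in> ?I" for J
  proof -
    have "conv f1 (sigma (exponent x) f2) (lat J) (lat J) * weight J
      = (\<Sum>\<^sub>\<infinity>J'\<in>?I. f1 (lat J) (lat J') * sigma (exponent x) f2 (lat J') (lat J)) * weight J"
      unfolding conv_def infsum_comm_class[OF J] ..
    also have "\<dots> = (\<Sum>\<^sub>\<infinity>J'\<in>?I. (f1 (lat J) (lat J') * sigma (exponent x) f2 (lat J') (lat J)) * weight J)"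
      by (rule infsum_cmult_left'[symmetric])
    also have "\<dots> = (\<Sum>\<^sub>\<infinity>J'\<in>?I. F J J')"
    proof (rule infsum_cong)
      fix J' assume J': "J' \<in> ?I"
      have "x powi (degree_of D - deg J') / x powi (degree_of D - deg J) * weight J = weight J'"
        using x_nonzero by (simp add: weight_def power_int_diff field_simps)
      then show "(f1 (lat J) (lat J') * sigma (exponent x) f2 (lat J') (lat J)) * weight J = F J J'"
        unfolding sigma_def ideal_pow_exponent deg_lat[OF J] deg_lat[OF J'] F_def a_def
        by (metis (no_types, opaque_lifting) mult.assoc mult.commute)
    qed
    finally show ?thesis .
  qed
  have r: "conv f2 f1 (lat J') (lat J') * weight J' = (\<Sum>\<^sub>\<infinity>J\<in>?I. F J J')" if J': "J' \<in> ?I" for J'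
  proof -
    have "conv f2 f1 (lat J') (lat J') * weight J' = (\<Sum>\<^sub>\<infinity>J\<in>?I. f2 (lat J') (lat J) * f1 (lat J) (lat J')) * weight J'"
      unfolding conv_def infsum_comm_class[OF J'] ..
    also have "\<dots> = (\<Sum>\<^sub>\<infinity>J\<in>?I. (f2 (lat J') (lat J) * f1 (lat J) (lat J')) * weight J')"
      by (rule infsum_cmult_left'[symmetric])
    also have "\<dots> = (\<Sum>\<^sub>\<infinity>J\<in>?I. F J J')" by (rule infsum_cong) (simp add: F_def a_def mult.commute)
    finally show ?thesis .
  qed
  show ?thesis unfolding phi_eq using swap l r by (simp cong: infsum_cong)
qed

lemma diagonal_indicator_lat:
  assumes J: "J \<in> nonzero_ideals" and e: "J = ideal_of E" "effective E"
  shows "diagonal_indicator (\<lambda>v. D v - E v) (lat J) (lat J) = 1"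
proof -
  have "\<exists>F z. lattice_data F z \<and> equivalent_divisor F (\<lambda>v. D v - E v) \<and> lat J = lattice_of F z \<and> lat J = lat J"
    using lat_eq[OF e(2)] e(1)
    by (intro exI[of _ "\<lambda>v. D v - E v"] exI[of _ y] conjI equivalent_divisor_cong) simp_all
  then show ?thesis unfolding diagonal_indicator_def by (rule if_P)
qed

text \<open>The unit is known only through its products. Its product with the indicator for the
  ideal class of \<open>lat J\<close>, evaluated at the pair of \<open>lat J\<close> with itself,
  reduces to the single term of \<open>lat J\<close>.\<close>

lemma unit_diagonal:
  assumes e: "alg_unit e" and J: "J \<in> nonzero_ideals"
  shows "e (lat J) (lat J) = 1"
proof -
  obtain E where E: "J = ideal_of E" "effective E" using J unfolding nonzero_ideals_eq by auto
  let ?g = "diagonal_indicator (\<lambda>v. D v - E v)"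
  have g1: "?g (lat J) (lat J) = 1" by (rule diagonal_indicator_lat[OF J E])
  have "fin_supp (\<lambda>v. D v - E v)" using lat_eq(2)[OF E(2)] by (simp add: lattice_data_def)
  then have "?g \<in> alg" by (rule diagonal_indicator_alg)
  then have "conv e ?g = ?g" using e by (simp add: alg_unit_def)
  then have "conv e ?g (lat J) (lat J) = 1" using g1 by simp
  moreover have "conv e ?g (lat J) (lat J) = e (lat J) (lat J) * ?g (lat J) (lat J)" unfolding conv_def
  proof (rule infsum_single)
    show "lat J \<in> comm_class (lat J)" unfolding comm_class_lat[OF J] comm_class_L using J by blast
    fix M assume "M \<noteq> lat J"
    then show "e (lat J) M * ?g M (lat J) = 0" by (auto simp: diagonal_indicator_def)
  qed
  ultimately show ?thesis using g1 by simp
qed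

theorem KMS: "KMS_functional L x (phi_functional x L)"
proof -
  let ?\<phi> = "phi_functional x L"
  have add: "?\<phi> (\<lambda>M M'. f M M' + g M M') = ?\<phi> f + ?\<phi> g" if fg: "f \<in> alg" "g \<in> alg" for f g
  proof -
    obtain c c' where "\<And>M M'. absC (f M M') \<le> c" "\<And>M M'. absC (g M M') \<le> c'"
      using alg_bounded[OF fg(1)] alg_bounded[OF fg(2)] by blast
    then show ?thesis by (rule phi_add(1))
  qed
  have mult: "?\<phi> (\<lambda>M M'. c * f M M') = c * ?\<phi> f" for f c
    unfolding phi_eq using infsum_cmult_right'[of c "\<lambda>J. f (lat J) (lat J) * weight J" nonzero_ideals]
    by (simp add: mult.assoc mult.left_commute)
  have cont: "\<exists>\<delta>>0. \<forall>g\<in>alg. op_norm L (\<lambda>M M'. g M M' - f M M') < \<delta> \<longrightarrow> absC (?\<phi> g - ?\<phi> f) < \<epsilon>"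
    if f: "f \<in> alg" and \<epsilon>: "\<epsilon> > 0" for f \<epsilon>
  proof (intro exI[of _ \<epsilon>] conjI ballI impI \<epsilon>)
    fix g assume g: "g \<in> alg" and o: "op_norm L (\<lambda>M M'. g M M' - f M M') < \<epsilon>"
    obtain c c' where c: "0 \<le> c" "\<And>M M'. absC (g M M') \<le> c" "\<And>M M'. absC (f M M') \<le> c'"
      using alg_bounded[OF f] alg_bounded[OF g] by blast
    have "absC (g M M' - f M M') \<le> max c c'" for M M'
      using absC_diff[of "g M M'" "f M M'"] c(2)[of M M'] c(3)[of M M'] by linarith
    then have "absC (?\<phi> (\<lambda>M M'. g M M' - f M M')) \<le> op_norm L (\<lambda>M M'. g M M' - f M M')"
      using c(1) by (intro absC_phi_le[of "max c c'"]) auto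
    then show "absC (?\<phi> g - ?\<phi> f) < \<epsilon>" using o phi_add(2)[OF c(2,3)] by simp
  qed
  have unit: "?\<phi> e = 1" if "alg_unit e" for e
  proof -
    have "(\<Sum>\<^sub>\<infinity>J\<in>nonzero_ideals. e (lat J) (lat J) * weight J) = zeta x"
      unfolding zeta_def weight_eq by (rule infsum_cong) (simp add: unit_diagonal[OF that])
    then show ?thesis unfolding phi_eq using zeta_nonzero by simp
  qed
  \<comment> \<open>The quotients are at most 1, and the indicator for the divisor of
    \<open>L\<close> itself attains 1, its coefficient at \<open>J = A\<close> being 1.\<close>
  have norm: "(SUP f\<in>alg - {\<lambda>_ _. 0}. absC (?\<phi> f) / op_norm L f) = 1"
  proof (rule cSup_eq_maximum)
    let ?g = "diagonal_indicator D"
    have b: "absC (?g M M') \<le> 1" for M M' by (simp add: diagonal_indicator_def)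
    have gA: "?g (lat A) (lat A) = 1"
      using diagonal_indicator_lat[OF A_ideal(1) A_vbox] by (simp add: effective_def)
    have "absC (\<Sum>\<^sub>\<infinity>J\<in>nonzero_ideals. ?g (lat J) (lat J) * weight J) = 1"
      by (rule absC_dominant_sum[where f = "\<lambda>J. ?g (lat J) (lat J)", OF b gA])
    then have p: "absC (?\<phi> ?g) = 1" unfolding phi_eq absC_mult absC_inverse absC_zeta by simp
    have "op_norm L ?g \<le> 1" by (rule op_norm_bounds(1)[OF zero_le_one b])
    moreover have "1 \<le> op_norm L ?g" using absC_phi_le[of 1 ?g, OF zero_le_one b] p by simp
    ultimately have "op_norm L ?g = 1" by (rule order_antisym)
    moreover have "?g \<in> alg - {\<lambda>_ _. 0}"
    proof -
      have "fin_supp D" using data by (simp add: lattice_data_def)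
      moreover have "?g \<noteq> (\<lambda>_ _. 0)" using gA by (metis zero_neq_one)
      ultimately show ?thesis using diagonal_indicator_alg by blast
    qed
    ultimately show "1 \<in> (\<lambda>f. absC (?\<phi> f) / op_norm L f) ` (alg - {\<lambda>_ _. 0})"
      using p by (intro image_eqI[of _ _ ?g]) auto
    fix r assume "r \<in> (\<lambda>f. absC (?\<phi> f) / op_norm L f) ` (alg - {\<lambda>_ _. 0})"
    then obtain f where f: "f \<in> alg" "r = absC (?\<phi> f) / op_norm L f" by blast
    obtain c where c: "0 \<le> c" "\<And>M M'. absC (f M M') \<le> c" using alg_bounded[OF f(1)] by blast
    have le: "absC (?\<phi> f) \<le> op_norm L f" by (rule absC_phi_le[OF c])
    show "r \<le> 1"
    \<comment> \<open>A quotient by a vanishing norm is 0 by convention.\<close>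
    proof (cases "op_norm L f = 0")
      case False
      have "0 \<le> op_norm L f" by (rule order_trans[OF absC_nonneg le])
      then show ?thesis using False le f(2) by (simp add: divide_le_eq)
    qed (use f in simp)
  qed
  show ?thesis unfolding KMS_functional_def using add mult cont kms_condition unit norm by simp
qed

end

text \<open>An infinite sum without a limit has the value 0, and so has the inverse of 0.
  Convergence of both series and nonvanishing of \<open>Z(x)\<close> therefore belong to the
  conclusion, so that the formula for the functional has its intended meaning.\<close>

theorem theorem4p10:
  fixes Fq :: "'k::field set" and vinf :: "'k place"
    and \<iota> :: "'k \<Rightarrow> 'c::{field, complete_space, topological_ab_group_add,
      uniform_topological_group_add, topological_semigroup_mult}"
    and uinf x :: 'c
    and L :: "'k rlattice"
  assumes "drinfeld_setting Fq vinf \<iota> uinf"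
    and "global_function_field.invertible_lattice Fq vinf L"
    and "x \<noteq> 0"
    and "absC x > real (global_function_field.q Fq)"
  shows "(\<lambda>J. inverse (drinfeld_setting.ideal_pow Fq vinf \<iota> uinf J (drinfeld_setting.exponent x)))
           summable_on global_function_field.nonzero_ideals Fq vinf \<and>
    drinfeld_setting.zeta Fq vinf \<iota> uinf x \<noteq> 0 \<and>
    (\<forall>f\<in>drinfeld_setting.alg Fq vinf.
           (\<lambda>J. f (global_function_field.ideal_inv_act Fq vinf J L)
                  (global_function_field.ideal_inv_act Fq vinf J L)
                * inverse (drinfeld_setting.ideal_pow Fq vinf \<iota> uinf J (drinfeld_setting.exponent x)))
           summable_on global_function_field.nonzero_ideals Fq vinf) \<and>
    drinfeld_setting.KMS_functional Fq vinf \<iota> uinf L x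
           (drinfeld_setting.phi_functional Fq vinf \<iota> uinf x L)"
proof -
  interpret drinfeld_setting Fq vinf \<iota> uinf by (rule assms(1))
  obtain D y where d: "lattice_data D y" "L = lattice_of D y" "\<forall>v\<in>fin_places. has_ord v (y v) (D v)"
    using invertible_lattice_data[OF assms(2)] by blast
  have x: "absC x > 1" using assms(4) q_ge_2 by linarith
  interpret invertible_kms Fq vinf \<iota> uinf x L D y
    by unfold_locales (use x d in auto)
  have "(\<lambda>J. f (lat J) (lat J) * weight J) summable_on nonzero_ideals" if f: "f \<in> alg" for f
  proof -
    obtain c where "\<And>M M'. absC (f M M') \<le> c" using alg_bounded[OF f] by blast
    then show ?thesis by (rule weighted_summable)
  qed
  then show ?thesis unfolding weight_eq using weight_summable zeta_nonzero KMS by blast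
qed

end
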